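(* Assume the setting described in the context, with all coefficients satisfying the stated positivity and boundedness assumptions, with $\omega^2\notin\{\kappa_n\}_{n\ge0}$, and with $0<\omega<\omega_{\rm crit}:=\dfrac{1}{\rho_w k_{\max}}$. Assume further: 1. $\lambda>\dfrac{\alpha^2}{c_0}\max\left\{\dfrac12,\dfrac8{\gamma_{\min}}\right\}$, 2. $\gamma_{\min}-\dfrac{2\omega^3\rho_f^2}{\rho(k_{\max}^{-1}-\omega\rho_w)}>0$, 3. $\tau<\dfrac1\omega$, 4. $a_0>\dfrac{2b_0^2}{c_0}$, 5. $\lambda>\dfrac{8}{\gamma_{\min}}\max\left\{\dfrac{2\alpha^2}{c_0},\dfrac{\beta^2}{a_0-2b_0^2/c_0}\right\}$. Then for every $\mathcal{F}\in\mathbf{U}^*$ there is a unique $\vec{\mathbf{u}}\in\mathbf{U}$ such that $\langle\mathcal{A}\vec{\mathbf{u}},\vec{\mathbf{v}}\rangle=\mathcal{F}(\vec{\mathbf{v}})$ for all $\vec{\mathbf{v}}\in\mathbf{U}$. Moreover, there is a constant $C>0$ with $\|\vec{\mathbf{u}}\|_{\mathbf{U}}\le C\|\mathcal{F}\|_{\mathbf{U}^*}$.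
   Context: **Domain and spaces.** $\Omega\subset\mathbb{R}^d$ is a bounded Lipschitz domain. The spaces are complex-valued: $\mathbf{V}=H^1_0(\Omega)^d$, $\mathbf{Z}=H_0(\mathrm{div},\Omega)$, $Q=L^2(\Omega)$, $S=H^1_0(\Omega)$, and $\mathbf{U}=\mathbf{V}\times\mathbf{Z}\times Q\times S$ with the product norm. $(\cdot,\cdot)$ is the $L^2$ inner product, linear in the first argument and antilinear in the second. $\mathbf{U}^*$ is the antidual of $\mathbf{U}$. **Coefficients.** $\rho,\rho_f,\rho_w,\mu,\lambda,\alpha,c_0,\beta,b_0,a_0>0$ and $\tau\ge0$ are constants, and $\omega>0$ is the frequency. $\mathbf{K}$ and $\mathbf{\Theta}$ are symmetric tensor fields with $k_{\min}|\xi|^2\le\xi^T\mathbf{K}\xi\le k_{\max}|\xi|^2$ and $\theta_{\min}|\xi|^2\le\xi^T\mathbf{\Theta}\xi\le\theta_{\max}|\xi|^2$, where all bounds are positive. **Forms.** - $a_1(\mathbf{u},\mathbf{v})=2\mu(\varepsilon(\mathbf{u}),\varepsilon(\mathbf{v}))+\lambda(\mathrm{div}\,\mathbf{u},\mathrm{div}\,\mathbf{v})-\omega^2\rho(\mathbf{u},\mathbf{v})$. - $a_2(\mathbf{w},\mathbf{z})=-\omega^2\rho_w(\mathbf{w},\mathbf{z})+i\omega(\mathbf{K}^{-1}\mathbf{w},\mathbf{z})$. - $b_1(\mathbf{w},\mathbf{v})=-\omega^2\rho_f(\mathbf{w},\mathbf{v})$. - $b_2(p,\mathbf{v})=-\alpha(p,\mathrm{div}\,\mathbf{v})$.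 - $b_3(p,\mathbf{z})=-(p,\mathrm{div}\,\mathbf{z})$. - $d(p,q)=c_0(p,q)$. - $c_1(T,\mathbf{v})=-\beta(T,\mathrm{div}\,\mathbf{v})$. - $c_2(T,q)=-b_0(T,q)$. - $a_3(T,s)=i a_0(T,s)+\dfrac{1}{\omega(1+i\omega\tau)}(\mathbf{\Theta}\nabla T,\nabla s)$. For a form $b(x,y)$, its adjoint is $b^*(y,x):=\overline{b(x,y)}$. **Operator.** For $\vec{\mathbf{u}}=(\mathbf{u},\mathbf{w},p,T)$ and $\vec{\mathbf{v}}=(\mathbf{v},\mathbf{z},q,s)$, $$\langle\mathcal{A}\vec{\mathbf{u}},\vec{\mathbf{v}}\rangle=a_1(\mathbf{u},\mathbf{v})+a_2(\mathbf{w},\mathbf{z})+b_1(\mathbf{w},\mathbf{v})+b_1^*(\mathbf{u},\mathbf{z})+b_2(p,\mathbf{v})+b_3(p,\mathbf{z})-b_2^*(\mathbf{u},q)-b_3^*(\mathbf{w},q)+d(p,q)+c_1(T,\mathbf{v})+c_2(T,q)-ic_1^*(\mathbf{u},s)+ic_2^*(p,s)+a_3(T,s).$$ **Eigenvalues and $\gamma_{\min}$.** $\kappa_n>0$ are the eigenvalues with eigenvectors $\boldsymbol{\psi}_n\in\mathbf{V}$, forming a Hilbert basis, such that $2\mu(\varepsilon(\boldsymbol{\psi}_n),\varepsilon(\mathbf{v}))+\lambda(\mathrm{div}\,\boldsymbol{\psi}_n,\mathrm{div}\,\mathbf{v})=\kappa_n\rho(\boldsymbol{\psi}_n,\mathbf{v})$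 for all $\mathbf{v}\in\mathbf{V}$, with $\kappa_n\to\infty$. Define $\gamma_{\min}=\min_{n\ge0}\left|\dfrac{\omega^2-\kappa_n}{1+\kappa_n}\right|$. *)

theory Defs
  imports "HOL-Analysis.Analysis"
begin

text \<open>Points of R^d are of type real^'n (d = CARD('n)).
  Bounded Lipschitz domain: nonempty bounded open set whose boundary is locally
  the graph of a Lipschitz function (in some rotated coordinate frame, with
  direction e playing the role of the last coordinate axis).\<close>

definition lipschitz_domain :: "(real^'n::finite) set \<Rightarrow> bool" where
  "lipschitz_domain \<Omega> \<longleftrightarrow> open \<Omega> \<and> bounded \<Omega> \<and> \<Omega> \<noteq> {} \<and>
     (\<forall>x\<in>frontier \<Omega>. \<exists>U e h L. open U \<and> x \<in> U \<and> norm e = 1 \<and>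
        (\<forall>y t. h (y + t *\<^sub>R e) = h y) \<and> L-lipschitz_on UNIV h \<and>
        \<Omega> \<inter> U = {y \<in> U. y \<bullet> e < h y})"

definition partial :: "'n::finite \<Rightarrow> (real^'n \<Rightarrow> real) \<Rightarrow> real^'n \<Rightarrow> real" where
  "partial i f x = frechet_derivative f (at x) (axis i 1)"

fun iter_partial :: "'n::finite list \<Rightarrow> (real^'n \<Rightarrow> real) \<Rightarrow> real^'n \<Rightarrow> real" where
  "iter_partial [] f = f"
| "iter_partial (i # is) f = partial i (iter_partial is f)"

definition smooth_fun :: "(real^'n::finite \<Rightarrow> real) \<Rightarrow> bool" where
  "smooth_fun f \<longleftrightarrow> (\<forall>is x. iter_partial is f differentiable (at x))"

definition tsupport :: "(real^'n::finite \<Rightarrow> real) \<Rightarrow> (real^'n) set" where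
  "tsupport f = closure {x. f x \<noteq> 0}"

definition test_fun :: "(real^'n::finite) set \<Rightarrow> (real^'n \<Rightarrow> real) \<Rightarrow> bool" where
  "test_fun \<Omega> \<phi> \<longleftrightarrow> smooth_fun \<phi> \<and> compact (tsupport \<phi>) \<and> tsupport \<phi> \<subseteq> \<Omega>"

definition ctest_fun :: "(real^'n::finite) set \<Rightarrow> (real^'n \<Rightarrow> complex) \<Rightarrow> bool" where
  "ctest_fun \<Omega> \<psi> \<longleftrightarrow> test_fun \<Omega> (\<lambda>x. Re (\<psi> x)) \<and> test_fun \<Omega> (\<lambda>x. Im (\<psi> x))"

definition vtest_fun :: "(real^'n::finite) set \<Rightarrow> (real^'n \<Rightarrow> complex^'n) \<Rightarrow> bool" where
  "vtest_fun \<Omega> \<psi> \<longleftrightarrow> (\<forall>i. ctest_fun \<Omega> (\<lambda>x. \<psi> x $ i))"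

definition L2 :: "(real^'n::finite) set \<Rightarrow> (real^'n \<Rightarrow> complex) \<Rightarrow> bool" where
  "L2 \<Omega> f \<longleftrightarrow> f \<in> borel_measurable (lebesgue_on \<Omega>) \<and>
                integrable (lebesgue_on \<Omega>) (\<lambda>x. (cmod (f x))\<^sup>2)"

definition inner_L2 :: "(real^'n::finite) set \<Rightarrow> (real^'n \<Rightarrow> complex) \<Rightarrow> (real^'n \<Rightarrow> complex) \<Rightarrow> complex" where
  "inner_L2 \<Omega> f g = (LINT x|lebesgue_on \<Omega>. f x * cnj (g x))"

definition vinner_L2 :: "(real^'n::finite) set \<Rightarrow> (real^'n \<Rightarrow> complex^'n) \<Rightarrow> (real^'n \<Rightarrow> complex^'n) \<Rightarrow> complex" where
  "vinner_L2 \<Omega> u v = (LINT x|lebesgue_on \<Omega>. (\<Sum>i\<in>UNIV. u x $ i * cnj (v x $ i)))"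

definition norm_L2 :: "(real^'n::finite) set \<Rightarrow> (real^'n \<Rightarrow> complex) \<Rightarrow> real" where
  "norm_L2 \<Omega> f = sqrt (LINT x|lebesgue_on \<Omega>. (cmod (f x))\<^sup>2)"

definition is_wgrad :: "(real^'n::finite) set \<Rightarrow> (real^'n \<Rightarrow> complex) \<Rightarrow> (real^'n \<Rightarrow> complex^'n) \<Rightarrow> bool" where
  "is_wgrad \<Omega> f g \<longleftrightarrow> (\<forall>i. L2 \<Omega> (\<lambda>x. g x $ i)) \<and>
     (\<forall>\<phi> i. test_fun \<Omega> \<phi> \<longrightarrow>
        (LINT x|lebesgue_on \<Omega>. f x * of_real (partial i \<phi> x))
          = - (LINT x|lebesgue_on \<Omega>. g x $ i * of_real (\<phi> x)))"

definition wgrad :: "(real^'n::finite) set \<Rightarrow> (real^'n \<Rightarrow> complex) \<Rightarrow> real^'n \<Rightarrow> complex^'n" where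
  "wgrad \<Omega> f = (SOME g. is_wgrad \<Omega> f g)"

definition H1 :: "(real^'n::finite) set \<Rightarrow> (real^'n \<Rightarrow> complex) \<Rightarrow> bool" where
  "H1 \<Omega> f \<longleftrightarrow> L2 \<Omega> f \<and> (\<exists>g. is_wgrad \<Omega> f g)"

definition norm_H1 :: "(real^'n::finite) set \<Rightarrow> (real^'n \<Rightarrow> complex) \<Rightarrow> real" where
  "norm_H1 \<Omega> f = sqrt ((norm_L2 \<Omega> f)\<^sup>2 + (\<Sum>i\<in>UNIV. (norm_L2 \<Omega> (\<lambda>x. wgrad \<Omega> f x $ i))\<^sup>2))"

definition H10 :: "(real^'n::finite) set \<Rightarrow> (real^'n \<Rightarrow> complex) \<Rightarrow> bool" where
  "H10 \<Omega> f \<longleftrightarrow> H1 \<Omega> f \<and>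
     (\<exists>\<psi>. (\<forall>k. ctest_fun \<Omega> (\<psi> k)) \<and> (\<lambda>k. norm_H1 \<Omega> (\<lambda>x. f x - \<psi> k x)) \<longlonglongrightarrow> 0)"

definition is_wdiv :: "(real^'n::finite) set \<Rightarrow> (real^'n \<Rightarrow> complex^'n) \<Rightarrow> (real^'n \<Rightarrow> complex) \<Rightarrow> bool" where
  "is_wdiv \<Omega> w h \<longleftrightarrow> L2 \<Omega> h \<and>
     (\<forall>\<phi>. test_fun \<Omega> \<phi> \<longrightarrow>
        (LINT x|lebesgue_on \<Omega>. (\<Sum>i\<in>UNIV. w x $ i * of_real (partial i \<phi> x)))
          = - (LINT x|lebesgue_on \<Omega>. h x * of_real (\<phi> x)))"

definition wdiv :: "(real^'n::finite) set \<Rightarrow> (real^'n \<Rightarrow> complex^'n) \<Rightarrow> real^'n \<Rightarrow> complex" where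
  "wdiv \<Omega> w = (SOME h. is_wdiv \<Omega> w h)"

definition Hdiv :: "(real^'n::finite) set \<Rightarrow> (real^'n \<Rightarrow> complex^'n) \<Rightarrow> bool" where
  "Hdiv \<Omega> w \<longleftrightarrow> (\<forall>i. L2 \<Omega> (\<lambda>x. w x $ i)) \<and> (\<exists>h. is_wdiv \<Omega> w h)"

definition vnorm_L2 :: "(real^'n::finite) set \<Rightarrow> (real^'n \<Rightarrow> complex^'n) \<Rightarrow> real" where
  "vnorm_L2 \<Omega> w = sqrt (\<Sum>i\<in>UNIV. (norm_L2 \<Omega> (\<lambda>x. w x $ i))\<^sup>2)"

definition norm_Hdiv :: "(real^'n::finite) set \<Rightarrow> (real^'n \<Rightarrow> complex^'n) \<Rightarrow> real" where
  "norm_Hdiv \<Omega> w = sqrt ((vnorm_L2 \<Omega> w)\<^sup>2 + (norm_L2 \<Omega> (wdiv \<Omega> w))\<^sup>2)"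

definition H0div :: "(real^'n::finite) set \<Rightarrow> (real^'n \<Rightarrow> complex^'n) \<Rightarrow> bool" where
  "H0div \<Omega> w \<longleftrightarrow> Hdiv \<Omega> w \<and>
     (\<exists>\<psi>. (\<forall>k. vtest_fun \<Omega> (\<psi> k)) \<and> (\<lambda>k. norm_Hdiv \<Omega> (\<lambda>x. w x - \<psi> k x)) \<longlonglongrightarrow> 0)"

definition Vsp :: "(real^'n::finite) set \<Rightarrow> (real^'n \<Rightarrow> complex^'n) \<Rightarrow> bool" where
  "Vsp \<Omega> u \<longleftrightarrow> (\<forall>i. H10 \<Omega> (\<lambda>x. u x $ i))"

definition norm_V :: "(real^'n::finite) set \<Rightarrow> (real^'n \<Rightarrow> complex^'n) \<Rightarrow> real" where
  "norm_V \<Omega> u = sqrt (\<Sum>i\<in>UNIV. (norm_H1 \<Omega> (\<lambda>x. u x $ i))\<^sup>2)"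

type_synonym 'n Uelt =
  "(real^'n \<Rightarrow> complex^'n) \<times> (real^'n \<Rightarrow> complex^'n) \<times> (real^'n \<Rightarrow> complex) \<times> (real^'n \<Rightarrow> complex)"

definition Usp :: "(real^'n::finite) set \<Rightarrow> 'n Uelt \<Rightarrow> bool" where
  "Usp \<Omega> U \<longleftrightarrow> (case U of (u, w, p, T) \<Rightarrow>
      Vsp \<Omega> u \<and> H0div \<Omega> w \<and> L2 \<Omega> p \<and> H10 \<Omega> T)"

definition norm_U :: "(real^'n::finite) set \<Rightarrow> 'n Uelt \<Rightarrow> real" where
  "norm_U \<Omega> U = (case U of (u, w, p, T) \<Rightarrow>
      sqrt ((norm_V \<Omega> u)\<^sup>2 + (norm_Hdiv \<Omega> w)\<^sup>2 + (norm_L2 \<Omega> p)\<^sup>2 + (norm_H1 \<Omega> T)\<^sup>2))"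

definition add_U :: "'n::finite Uelt \<Rightarrow> 'n Uelt \<Rightarrow> 'n Uelt" where
  "add_U U V = (case U of (u, w, p, T) \<Rightarrow> case V of (u', w', p', T') \<Rightarrow>
      (\<lambda>x. u x + u' x, \<lambda>x. w x + w' x, \<lambda>x. p x + p' x, \<lambda>x. T x + T' x))"

definition scale_U :: "complex \<Rightarrow> 'n::finite Uelt \<Rightarrow> 'n Uelt" where
  "scale_U c U = (case U of (u, w, p, T) \<Rightarrow>
      (\<lambda>x. c *s u x, \<lambda>x. c *s w x, \<lambda>x. c * p x, \<lambda>x. c * T x))"

definition diff_U :: "'n::finite Uelt \<Rightarrow> 'n Uelt \<Rightarrow> 'n Uelt" where
  "diff_U U V = add_U U (scale_U (-1) V)"

definition antidual_U :: "(real^'n::finite) set \<Rightarrow> ('n Uelt \<Rightarrow> complex) \<Rightarrow> bool" where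
  "antidual_U \<Omega> F \<longleftrightarrow>
     (\<forall>U V. Usp \<Omega> U \<longrightarrow> Usp \<Omega> V \<longrightarrow> F (add_U U V) = F U + F V) \<and>
     (\<forall>c U. Usp \<Omega> U \<longrightarrow> F (scale_U c U) = cnj c * F U) \<and>
     (\<exists>M. \<forall>U. Usp \<Omega> U \<longrightarrow> cmod (F U) \<le> M * norm_U \<Omega> U)"

definition norm_antidual :: "(real^'n::finite) set \<Rightarrow> ('n Uelt \<Rightarrow> complex) \<Rightarrow> real" where
  "norm_antidual \<Omega> F = Sup {cmod (F U) |U. Usp \<Omega> U \<and> norm_U \<Omega> U \<le> 1}"

definition sym_tensor_field ::
  "(real^'n::finite) set \<Rightarrow> (real^'n \<Rightarrow> real^'n^'n) \<Rightarrow> real \<Rightarrow> real \<Rightarrow> bool" where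
  "sym_tensor_field \<Omega> K kmin kmax \<longleftrightarrow>
     (\<forall>i j. (\<lambda>x. K x $ i $ j) \<in> borel_measurable (lebesgue_on \<Omega>)) \<and>
     (\<forall>x\<in>\<Omega>. transpose (K x) = K x \<and>
        (\<forall>\<xi>. kmin * (norm \<xi>)\<^sup>2 \<le> \<xi> \<bullet> (K x *v \<xi>) \<and> \<xi> \<bullet> (K x *v \<xi>) \<le> kmax * (norm \<xi>)\<^sup>2))"

definition rmat_cvec :: "real^'n^'n \<Rightarrow> complex^'n \<Rightarrow> complex^'n::finite" where
  "rmat_cvec A w = (\<chi> i. \<Sum>j\<in>UNIV. complex_of_real (A $ i $ j) * w $ j)"

definition wpart :: "(real^'n::finite) set \<Rightarrow> (real^'n \<Rightarrow> complex^'n) \<Rightarrow> 'n \<Rightarrow> 'n \<Rightarrow> real^'n \<Rightarrow> complex" where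
  "wpart \<Omega> u i j x = wgrad \<Omega> (\<lambda>y. u y $ i) x $ j"

definition eps :: "(real^'n::finite) set \<Rightarrow> (real^'n \<Rightarrow> complex^'n) \<Rightarrow> 'n \<Rightarrow> 'n \<Rightarrow> real^'n \<Rightarrow> complex" where
  "eps \<Omega> u i j x = (wpart \<Omega> u i j x + wpart \<Omega> u j i x) / 2"

definition inner_eps :: "(real^'n::finite) set \<Rightarrow> (real^'n \<Rightarrow> complex^'n) \<Rightarrow> (real^'n \<Rightarrow> complex^'n) \<Rightarrow> complex" where
  "inner_eps \<Omega> u v = (LINT x|lebesgue_on \<Omega>. (\<Sum>i\<in>UNIV. \<Sum>j\<in>UNIV. eps \<Omega> u i j x * cnj (eps \<Omega> v i j x)))"

definition divV :: "(real^'n::finite) set \<Rightarrow> (real^'n \<Rightarrow> complex^'n) \<Rightarrow> real^'n \<Rightarrow> complex" where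
  "divV \<Omega> u x = (\<Sum>i\<in>UNIV. wpart \<Omega> u i i x)"

definition adj :: "('a \<Rightarrow> 'b \<Rightarrow> complex) \<Rightarrow> 'b \<Rightarrow> 'a \<Rightarrow> complex" where
  "adj b y x = cnj (b x y)"

definition form_a1 where
  "form_a1 \<Omega> (\<mu>::real) (lam::real) (\<rho>::real) (\<omega>::real) u v =
     of_real (2 * \<mu>) * inner_eps \<Omega> u v + of_real lam * inner_L2 \<Omega> (divV \<Omega> u) (divV \<Omega> v)
     - of_real (\<omega>\<^sup>2 * \<rho>) * vinner_L2 \<Omega> u v"

definition form_a2 where
  "form_a2 \<Omega> (\<rho>w::real) (\<omega>::real) K w z =
     - of_real (\<omega>\<^sup>2 * \<rho>w) * vinner_L2 \<Omega> w z
     + \<i> * of_real \<omega> * vinner_L2 \<Omega> (\<lambda>x. rmat_cvec (matrix_inv (K x)) (w x)) z"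

definition form_b1 where
  "form_b1 \<Omega> (\<rho>f::real) (\<omega>::real) w v = - of_real (\<omega>\<^sup>2 * \<rho>f) * vinner_L2 \<Omega> w v"

definition form_b2 where
  "form_b2 \<Omega> (\<alpha>::real) p v = - of_real \<alpha> * inner_L2 \<Omega> p (divV \<Omega> v)"

definition form_b3 where
  "form_b3 \<Omega> p z = - inner_L2 \<Omega> p (wdiv \<Omega> z)"

definition form_d where
  "form_d \<Omega> (c0::real) p q = of_real c0 * inner_L2 \<Omega> p q"

definition form_c1 where
  "form_c1 \<Omega> (\<beta>::real) T v = - of_real \<beta> * inner_L2 \<Omega> T (divV \<Omega> v)"

definition form_c2 where
  "form_c2 \<Omega> (b0::real) T q = - of_real b0 * inner_L2 \<Omega> T q"

definition form_a3 where
  "form_a3 \<Omega> (a0::real) (\<omega>::real) (\<tau>::real) \<Theta> T s =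
     \<i> * of_real a0 * inner_L2 \<Omega> T s
     + 1 / (of_real \<omega> * (1 + \<i> * of_real \<omega> * of_real \<tau>)) *
       vinner_L2 \<Omega> (\<lambda>x. rmat_cvec (\<Theta> x) (wgrad \<Omega> T x)) (wgrad \<Omega> s)"

definition form_A where
  "form_A \<Omega> \<rho> \<rho>f \<rho>w \<mu> lam \<alpha> c0 \<beta> b0 a0 \<tau> \<omega> K \<Theta> U V =
    (case U of (u, w, p, T) \<Rightarrow> case V of (v, z, q, s) \<Rightarrow>
       form_a1 \<Omega> \<mu> lam \<rho> \<omega> u v + form_a2 \<Omega> \<rho>w \<omega> K w z
     + form_b1 \<Omega> \<rho>f \<omega> w v + adj (form_b1 \<Omega> \<rho>f \<omega>) u z
     + form_b2 \<Omega> \<alpha> p v + form_b3 \<Omega> p z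
     - adj (form_b2 \<Omega> \<alpha>) u q - adj (form_b3 \<Omega>) w q
     + form_d \<Omega> c0 p q + form_c1 \<Omega> \<beta> T v + form_c2 \<Omega> b0 T q
     - \<i> * adj (form_c1 \<Omega> \<beta>) u s + \<i> * adj (form_c2 \<Omega> b0) p s
     + form_a3 \<Omega> a0 \<omega> \<tau> \<Theta> T s)"

definition elast_eigenvalues :: "(real^'n::finite) set \<Rightarrow> real \<Rightarrow> real \<Rightarrow> real \<Rightarrow> real set" where
  "elast_eigenvalues \<Omega> \<mu> lam \<rho> = {\<kappa>. \<exists>\<psi>. Vsp \<Omega> \<psi> \<and> vnorm_L2 \<Omega> \<psi> \<noteq> 0 \<and>
      (\<forall>v. Vsp \<Omega> v \<longrightarrow>
        of_real (2 * \<mu>) * inner_eps \<Omega> \<psi> v + of_real lam * inner_L2 \<Omega> (divV \<Omega> \<psi>) (divV \<Omega> v)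
          = of_real (\<kappa> * \<rho>) * vinner_L2 \<Omega> \<psi> v)}"

definition gamma_min :: "(real^'n::finite) set \<Rightarrow> real \<Rightarrow> real \<Rightarrow> real \<Rightarrow> real \<Rightarrow> real" where
  "gamma_min \<Omega> \<mu> lam \<rho> \<omega> = (INF \<kappa>\<in>elast_eigenvalues \<Omega> \<mu> lam \<rho>. \<bar>(\<omega>\<^sup>2 - \<kappa>) / (1 + \<kappa>)\<bar>)"

end

theory Submission
  imports Defs "HOL-Library.Function_Algebras" "HOL-Computational_Algebra.Polynomial" "HOL-Library.Diagonal_Subsequence"
begin

text \<open>
  The proof is by T-coercivity: for a suitable bijective test operator \<open>\<T>\<close> on \<open>U\<close>, the form
  \<open>\<langle>A U, \<T> U\<rangle>\<close> has real part bounded below by a multiple of the squared norm, and Lax-Milgram applies.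

  On the displacement, \<open>\<T>\<close> is the reflection that changes sign on the finitely many eigenmodes with
  \<open>\<kappa>\<^sub>n < \<omega>\<^sup>2\<close>; the spectral gap \<open>\<gamma>\<^sub>m\<^sub>i\<^sub>n\<close> makes \<open>a\<^sub>1\<close> coercive against it. Only this reflection is
  constructed, by successive Rayleigh minimization; the compactness it needs comes from Rellich's theorem,
  proved with Poincare inequalities on small cubes. Flux, pressure and temperature are multiplied by
  \<open>1 + i\<close>, \<open>1 - i\<close>, \<open>1 + i\<close>, which turns \<open>i\<omega>K\<^sup>-\<^sup>1\<close>, \<open>c\<^sub>0\<close>, \<open>i a\<^sub>0\<close> and the heat flux into positive terms and
  cancels the coupling of \<open>p\<close> with \<open>div w\<close>. Adding a small multiple of \<open>div w\<close> to the pressure test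
  function controls the divergence part of the norm of \<open>w\<close>.

  All function spaces consist of honest functions, so their norms are only seminorms; weak derivatives are
  chosen by SOME and are linear only almost everywhere. The Hilbert space arguments are therefore
  carried out for seminorms given by positive semidefinite sesquilinear forms on subspaces.
\<close>

subsection \<open>Hilbert space theory for seminorms\<close>

text \<open>The obstacle is the displacement: it is tested with its reflection, while the other
  unknowns are only rotated by a complex factor. Rotated couplings can cancel:
  \<open>-(1 - i) (p, div w)\<close> and \<open>(1 + i) (div w, p)\<close> have opposite real parts.
  Reflection and divergence do not commute, so the couplings of \<open>p\<close> and
  \<open>T\<close> with the divergence of the displacement cannot cancel and have to be absorbed.
  The reflection preserves the elastic energy, which contains \<open>lam ||div u||^2\<close>, so a
  large \<open>lam\<close> makes them small. Each such coupling occurs twice, once with modulus 1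
  and once with modulus \<open>|1 + i|\<close>; this is the origin of \<open>1 + sqrt 2\<close>. The
  coupling of displacement and flux is absorbed likewise, through \<open>h2\<close>. On the flux the
  rotation leaves the lower bound \<open>\<omega> (1/kmax - \<omega> \<rho>w)\<close>, positive
  exactly below the critical frequency; on the heat term it leaves a positive multiple of
  \<open>1 - \<omega> \<tau>\<close>. Scalar functions, vector fields and quadruples are different
  types carrying the same arguments, so the abstract theory is a locale over complex vector
  spaces.\<close>

locale complex_vector_space = vector_space scale
  for scale :: "complex \<Rightarrow> 'a::ab_group_add \<Rightarrow> 'a" (infixr "\<odot>" 75)
begin

text \<open>The laws are demanded on \<open>S\<close> only: a weak derivative chosen by SOME obeys
  no law off the Sobolev space.\<close>

definition sesq :: "'a set \<Rightarrow> ('a \<Rightarrow> 'a \<Rightarrow> complex) \<Rightarrow> bool" where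
  "sesq S f \<longleftrightarrow>
     (\<forall>x\<in>S. \<forall>y\<in>S. \<forall>z\<in>S. f (x + y) z = f x z + f y z \<and> f z (x + y) = f z x + f z y) \<and>
     (\<forall>c. \<forall>x\<in>S. \<forall>y\<in>S. f (c \<odot> x) y = c * f x y \<and> f x (c \<odot> y) = cnj c * f x y)"

definition antilinear :: "'a set \<Rightarrow> ('a \<Rightarrow> complex) \<Rightarrow> bool" where
  "antilinear S G \<longleftrightarrow> (\<forall>x\<in>S. \<forall>y\<in>S. G (x + y) = G x + G y) \<and> (\<forall>c. \<forall>x\<in>S. G (c \<odot> x) = cnj c * G x)"

definition psd :: "'a set \<Rightarrow> ('a \<Rightarrow> 'a \<Rightarrow> complex) \<Rightarrow> bool" where
  "psd S f \<longleftrightarrow> sesq S f \<and> (\<forall>x\<in>S. \<forall>y\<in>S. f y x = cnj (f x y)) \<and> (\<forall>x\<in>S. 0 \<le> Re (f x x))"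

definition qn :: "('a \<Rightarrow> 'a \<Rightarrow> complex) \<Rightarrow> 'a \<Rightarrow> real" where
  "qn f x = sqrt (Re (f x x))"

text \<open>Limits exist but are not unique, because a vector of seminorm zero need not
  vanish.\<close>

definition qcomplete :: "'a set \<Rightarrow> ('a \<Rightarrow> 'a \<Rightarrow> complex) \<Rightarrow> bool" where
  "qcomplete S f \<longleftrightarrow> (\<forall>X. (\<forall>n. X n \<in> S) \<longrightarrow>
      (\<forall>\<epsilon>>0. \<exists>N. \<forall>m\<ge>N. \<forall>n\<ge>N. qn f (X m - X n) < \<epsilon>) \<longrightarrow>
      (\<exists>x\<in>S. (\<lambda>n. qn f (X n - x)) \<longlonglongrightarrow> 0))"

lemma minus_eq_scale: "- x = (-1) \<odot> x"
  by simp

lemma diff_eq_scale: "x - y = x + (-1) \<odot> y"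
  by simp

lemma sesqD:
  assumes "sesq S f" "x \<in> S" "y \<in> S"
  shows "\<And>z. z \<in> S \<Longrightarrow> f (x + y) z = f x z + f y z"
    "\<And>z. z \<in> S \<Longrightarrow> f z (x + y) = f z x + f z y"
    "f (c \<odot> x) y = c * f x y" "f x (c \<odot> y) = cnj c * f x y"
  using assms unfolding sesq_def by blast+

lemma sesq_diff:
  assumes "sesq S f" "subspace S" "x \<in> S" "y \<in> S" "z \<in> S"
  shows "f (x - y) z = f x z - f y z" "f z (x - y) = f z x - f z y"
proof -
  have "(-1) \<odot> y \<in> S" using assms subspace_scale by blast
  then show "f (x - y) z = f x z - f y z" "f z (x - y) = f z x - f z y"
    unfolding diff_eq_scale using sesqD[OF assms(1)] assms by (simp_all del: scale_minus_left)
qed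

lemma sesq_mono: "sesq S f \<Longrightarrow> T \<subseteq> S \<Longrightarrow> sesq T f"
  unfolding sesq_def by (meson subsetD)

lemma psd_mono: "psd S f \<Longrightarrow> T \<subseteq> S \<Longrightarrow> psd T f"
  unfolding psd_def using sesq_mono by blast

lemma sesq_add: "sesq S f \<Longrightarrow> sesq S g \<Longrightarrow> sesq S (\<lambda>x y. f x y + g x y)"
  unfolding sesq_def by (simp add: algebra_simps)

lemma sesq_cmult: "sesq S f \<Longrightarrow> sesq S (\<lambda>x y. c * f x y)"
  unfolding sesq_def by (simp add: algebra_simps)

lemma sesq_sum: "(\<And>i. i \<in> I \<Longrightarrow> sesq S (f i)) \<Longrightarrow> sesq S (\<lambda>x y. \<Sum>i\<in>I. f i x y)"
  unfolding sesq_def by (auto simp: sum.distrib sum_distrib_left intro!: sum.cong)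

lemma psdI:
  assumes "sesq S f" "\<And>x y. x \<in> S \<Longrightarrow> y \<in> S \<Longrightarrow> f y x = cnj (f x y)"
    "\<And>x. x \<in> S \<Longrightarrow> 0 \<le> Re (f x x)"
  shows "psd S f"
  using assms unfolding psd_def by blast

lemma psdD:
  assumes "psd S f"
  shows "sesq S f" "\<And>x y. x \<in> S \<Longrightarrow> y \<in> S \<Longrightarrow> f y x = cnj (f x y)"
    "\<And>x. x \<in> S \<Longrightarrow> 0 \<le> Re (f x x)"
  using assms unfolding psd_def by blast+

lemma psd_add:
  assumes "psd S f" "psd S g"
  shows "psd S (\<lambda>x y. f x y + g x y)"
proof (rule psdI)
  show "f y x + g y x = cnj (f x y + g x y)" if "x \<in> S" "y \<in> S" for x y
    using psdD(2)[OF assms(1) that] psdD(2)[OF assms(2) that] by (metis complex_cnj_add)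
qed (use psdD(1,3)[OF assms(1)] psdD(1,3)[OF assms(2)] sesq_add in simp_all)

lemma psd_cmult:
  assumes "psd S f" "0 \<le> c"
  shows "psd S (\<lambda>x y. of_real c * f x y)"
proof (rule psdI)
  show "of_real c * f y x = cnj (of_real c * f x y)" if "x \<in> S" "y \<in> S" for x y
    using psdD(2)[OF assms(1) that] by (metis complex_cnj_complex_of_real complex_cnj_mult)
qed (use psdD(1,3)[OF assms(1)] assms(2) sesq_cmult in simp_all)

lemma psd_sum:
  assumes "\<And>i. i \<in> I \<Longrightarrow> psd S (f i)"
  shows "psd S (\<lambda>x y. \<Sum>i\<in>I. f i x y)"
proof (rule psdI)
  show "(\<Sum>i\<in>I. f i y x) = cnj (\<Sum>i\<in>I. f i x y)" if "x \<in> S" "y \<in> S" for x y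
    unfolding cnj_sum by (rule sum.cong[OF refl]) (rule psdD(2)[OF assms that])
  show "sesq S (\<lambda>x y. \<Sum>i\<in>I. f i x y)" using sesq_sum psdD(1)[OF assms] by blast
  show "0 \<le> Re (\<Sum>i\<in>I. f i x x)" if "x \<in> S" for x
    using psdD(3)[OF assms that] by (simp add: sum_nonneg)
qed

lemma psd_Im_zero:
  assumes "psd S f" "x \<in> S"
  shows "Im (f x x) = 0"
  using psdD(2)[OF assms assms(2)] by (metis Reals_cnj_iff complex_is_Real_iff)

lemma psd_of_real:
  assumes "psd S f" "x \<in> S"
  shows "f x x = of_real ((qn f x)\<^sup>2)"
  using psd_Im_zero[OF assms] psdD(3)[OF assms] unfolding qn_def by (auto simp: complex_eq_iff)

lemma qn_sq:
  assumes "psd S f" "x \<in> S"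
  shows "(qn f x)\<^sup>2 = Re (f x x)"
  using psdD(3)[OF assms] unfolding qn_def by simp

lemma qn_nonneg:
  assumes "psd S f" "x \<in> S"
  shows "0 \<le> qn f x"
  using psdD(3)[OF assms] unfolding qn_def by simp

lemma qn_scale:
  assumes "psd S f" "subspace S" "x \<in> S"
  shows "qn f (c \<odot> x) = cmod c * qn f x"
proof -
  have s: "sesq S f" using assms psdD by blast
  have "c \<odot> x \<in> S" using assms subspace_scale by blast
  have "f (c \<odot> x) (c \<odot> x) = c * cnj c * f x x"
    using sesqD(3,4)[OF s] assms \<open>c \<odot> x \<in> S\<close> by simp
  also have "\<dots> = of_real ((cmod c)\<^sup>2) * f x x"
    by (metis complex_norm_square)
  finally have "Re (f (c \<odot> x) (c \<odot> x)) = (cmod c)\<^sup>2 * Re (f x x)" by simp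
  then show ?thesis unfolding qn_def by (simp add: real_sqrt_mult)
qed

lemma qn_uminus:
  assumes "psd S f" "subspace S" "x \<in> S"
  shows "qn f (- x) = qn f x"
  unfolding minus_eq_scale using qn_scale[OF assms, of "-1"] by (simp del: scale_minus_left)

lemma qn_diff_commute:
  assumes "psd S f" "subspace S" "x \<in> S" "y \<in> S"
  shows "qn f (x - y) = qn f (y - x)"
  using qn_uminus[OF assms(1,2), of "x - y"] assms(2-) by (simp add: subspace_diff)

lemma qn_sq_add_scale:
  assumes "psd S f" "subspace S" "x \<in> S" "y \<in> S"
  shows "(qn f (x + c \<odot> y))\<^sup>2 = (qn f x)\<^sup>2 + 2 * Re (cnj c * f x y) + (cmod c)\<^sup>2 * (qn f y)\<^sup>2"
proof -
  have s: "sesq S f" using assms psdD by blast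
  have m: "c \<odot> y \<in> S" "x + c \<odot> y \<in> S" using assms subspace_scale subspace_add by blast+
  have h: "f y x = cnj (f x y)" using assms psdD by blast
  have "f (x + c \<odot> y) (x + c \<odot> y) = f x x + cnj c * f x y + (c * f y x + f (c \<odot> y) (c \<odot> y))"
    using sesqD[OF s] assms m by (simp add: algebra_simps)
  moreover have "Re (f (c \<odot> y) (c \<odot> y)) = (cmod c)\<^sup>2 * (qn f y)\<^sup>2"
    using qn_scale[OF assms(1,2,4)] qn_sq[OF assms(1) m(1)] by (metis power_mult_distrib)
  moreover have "Re (c * f y x) = Re (cnj c * f x y)" unfolding h by simp
  ultimately show ?thesis
    using qn_sq[OF assms(1) m(2)] qn_sq[OF assms(1,3)] by simp
qed

lemma qn_sq_add:
  assumes "psd S f" "subspace S" "x \<in> S" "y \<in> S"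
  shows "(qn f (x + y))\<^sup>2 = (qn f x)\<^sup>2 + 2 * Re (f x y) + (qn f y)\<^sup>2"
  using qn_sq_add_scale[OF assms, of 1] by simp

lemma qn_sq_diff:
  assumes "psd S f" "subspace S" "x \<in> S" "y \<in> S"
  shows "(qn f (x - y))\<^sup>2 = (qn f x)\<^sup>2 - 2 * Re (f x y) + (qn f y)\<^sup>2"
  using qn_sq_add_scale[OF assms, of "-1"] by simp

text \<open>Nonnegativity of \<open>f\<close> along \<open>x - t f(x,y) y\<close> for real
  \<open>t\<close> gives a polynomial in \<open>t\<close> that is never negative; the phase of
  \<open>f(x,y)\<close> in the direction produces the modulus. As \<open>f\<close> is only
  semidefinite, the seminorm of \<open>y\<close> may be zero without \<open>y\<close> being zero,
  and that case is treated separately.\<close>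

lemma cauchy_schwarz:
  assumes "psd S f" "subspace S" "x \<in> S" "y \<in> S"
  shows "cmod (f x y) \<le> qn f x * qn f y"
proof -
  let ?a = "qn f x" and ?b = "qn f y" and ?z = "f x y"
  have pos: "0 \<le> ?a\<^sup>2 - 2 * t * (cmod ?z)\<^sup>2 + t\<^sup>2 * (cmod ?z)\<^sup>2 * ?b\<^sup>2" for t :: real
  proof -
    let ?c = "- of_real t * ?z"
    have z: "cnj ?z * ?z = of_real ((cmod ?z)\<^sup>2)"
      by (metis complex_norm_square mult.commute)
    have "Re (cnj ?c * ?z) = - t * (cmod ?z)\<^sup>2"
    proof -
      have "cnj ?c * ?z = - of_real t * (cnj ?z * ?z)" by simp
      also have "\<dots> = of_real (- t * (cmod ?z)\<^sup>2)" unfolding z by simp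
      finally show ?thesis using Re_complex_of_real by metis
    qed
    moreover have "(cmod ?c)\<^sup>2 = t\<^sup>2 * (cmod ?z)\<^sup>2" by (simp add: norm_mult power_mult_distrib)
    ultimately show ?thesis using qn_sq_add_scale[OF assms, of ?c]
      by (metis (no_types, opaque_lifting) add_uminus_conv_diff mult.assoc mult_minus_left mult_minus_right zero_le_power2)
  qed
  have "(cmod ?z)\<^sup>2 \<le> ?a\<^sup>2 * ?b\<^sup>2"
  proof (cases "?b = 0")
    case True
    have "(cmod ?z)\<^sup>2 = 0"
    proof (rule ccontr)
      assume n: "(cmod ?z)\<^sup>2 \<noteq> 0"
      \<comment> \<open>For \<open>?b = 0\<close> the polynomial is affine in \<open>t\<close>, and
        this \<open>t\<close> makes its value -1.\<close>
      show False using pos[of "(?a\<^sup>2 + 1) / (2 * (cmod ?z)\<^sup>2)"] n True by simp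
    qed
    then show ?thesis by simp
  next
    case False
    \<comment> \<open>The minimum of the parabola is at \<open>t = 1 / ?b\<^sup>2\<close>.\<close>
    have "0 \<le> ?a\<^sup>2 - (cmod ?z)\<^sup>2 / ?b\<^sup>2"
      using pos[of "1 / ?b\<^sup>2"] False by (simp add: power2_eq_square field_simps)
    then show ?thesis using False by (simp add: field_simps)
  qed
  then have "(cmod ?z)\<^sup>2 \<le> (?a * ?b)\<^sup>2" by (simp add: power_mult_distrib)
  then show ?thesis using power2_le_imp_le qn_nonneg assms by (metis mult_nonneg_nonneg)
qed

lemma qn_triangle:
  assumes "psd S f" "subspace S" "x \<in> S" "y \<in> S"
  shows "qn f (x + y) \<le> qn f x + qn f y"
proof (rule power2_le_imp_le)
  have "Re (f x y) \<le> qn f x * qn f y"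
    using cauchy_schwarz[OF assms] complex_Re_le_cmod order_trans by blast
  then show "(qn f (x + y))\<^sup>2 \<le> (qn f x + qn f y)\<^sup>2"
    using qn_sq_add[OF assms] by (simp add: power2_sum)
qed (use assms qn_nonneg in auto)

lemma qn_triangle_diff:
  assumes "psd S f" "subspace S" "x \<in> S" "y \<in> S" "z \<in> S"
  shows "qn f (x - z) \<le> qn f (x - y) + qn f (y - z)"
  using qn_triangle[OF assms(1,2), of "x - y" "y - z"] assms by (simp add: subspace_diff)

lemma qn_parallelogram:
  assumes "psd S f" "subspace S" "x \<in> S" "y \<in> S"
  shows "(qn f (x - y))\<^sup>2 = 2 * (qn f x)\<^sup>2 + 2 * (qn f y)\<^sup>2 - (qn f (x + y))\<^sup>2"
  using qn_sq_diff[OF assms] qn_sq_add[OF assms] by simp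

lemma psd_eq_zero_if_qn_zero:
  assumes "psd S f" "subspace S" "x \<in> S" "y \<in> S" "qn f x = 0"
  shows "f x y = 0" "f y x = 0"
  using cauchy_schwarz[OF assms(1,2,3,4)] cauchy_schwarz[OF assms(1,2,4,3)] assms(5) by auto

lemma sesq_bounded_tendsto:
  assumes f: "psd S f" "subspace S" and B: "sesq S B"
    and bd: "\<And>x y. x \<in> S \<Longrightarrow> y \<in> S \<Longrightarrow> cmod (B x y) \<le> M * qn f x * qn f y"
    and X: "\<And>n. X n \<in> S" "x \<in> S" "(\<lambda>n. qn f (X n - x)) \<longlonglongrightarrow> 0" and v: "v \<in> S"
  shows "(\<lambda>n. B (X n) v) \<longlonglongrightarrow> B x v"
proof -
  have "(\<lambda>n. B (X n) v - B x v) \<longlonglongrightarrow> 0"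
  proof (rule tendsto_rabs_zero_cancel[THEN tendsto_norm_zero_cancel], simp)
    show "(\<lambda>n. cmod (B (X n) v - B x v)) \<longlonglongrightarrow> 0"
    proof (rule Lim_null_comparison)
      show "\<forall>\<^sub>F n in sequentially. norm (cmod (B (X n) v - B x v)) \<le> qn f (X n - x) * (M * qn f v)"
      proof (rule eventuallyI)
        fix n
        have "B (X n) v - B x v = B (X n - x) v" using sesq_diff[OF B f(2) X(1) X(2) v] by simp
        then show "norm (cmod (B (X n) v - B x v)) \<le> qn f (X n - x) * (M * qn f v)"
          using bd[of "X n - x" v] X v f(2) by (simp add: subspace_diff mult.commute mult.left_commute)
      qed
      show "(\<lambda>n. qn f (X n - x) * (M * qn f v)) \<longlonglongrightarrow> 0"
        using tendsto_mult_left_zero[OF X(3)] .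
    qed
  qed
  then show ?thesis using LIM_zero_iff by blast
qed

lemma qn_tendsto:
  assumes f: "psd S f" "subspace S"
    and X: "\<And>n. X n \<in> S" "x \<in> S" "(\<lambda>n. qn f (X n - x)) \<longlonglongrightarrow> 0"
  shows "(\<lambda>n. qn f (X n)) \<longlonglongrightarrow> qn f x"
proof -
  have "(\<lambda>n. qn f (X n) - qn f x) \<longlonglongrightarrow> 0"
  proof (rule Lim_null_comparison)
    show "\<forall>\<^sub>F n in sequentially. norm (qn f (X n) - qn f x) \<le> qn f (X n - x)"
    proof (rule eventuallyI)
      fix n
      show "norm (qn f (X n) - qn f x) \<le> qn f (X n - x)"
        using qn_triangle[OF f, of "X n - x" x] qn_triangle[OF f, of "x - X n" "X n"]
          qn_diff_commute[OF f X(1) X(2), of n] X f(2) by (simp add: subspace_diff)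
    qed
  qed (fact X(3))
  then show ?thesis using LIM_zero_iff by blast
qed

text \<open>Inequalities between quadratic forms extend from dense subspaces in this way.\<close>

lemma sesq_bounded_nonneg_limit:
  assumes f: "psd S f" "subspace S" and B: "sesq S B"
    and bd: "\<And>x y. x \<in> S \<Longrightarrow> y \<in> S \<Longrightarrow> cmod (B x y) \<le> M * qn f x * qn f y" and M: "0 \<le> M"
    and X: "\<And>n. X n \<in> S" "x \<in> S" "(\<lambda>n. qn f (X n - x)) \<longlonglongrightarrow> 0"
    and nn: "\<And>n. 0 \<le> Re (B (X n) (X n))"
  shows "0 \<le> Re (B x x)"
proof -
  have "(\<lambda>n. B (X n) (X n) - B (X n) x) \<longlonglongrightarrow> 0"
  proof (rule Lim_null_comparison)
    show "\<forall>\<^sub>F n in sequentially. norm (B (X n) (X n) - B (X n) x) \<le> M * qn f (X n) * qn f (X n - x)"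
    proof (rule eventuallyI)
      fix n
      show "norm (B (X n) (X n) - B (X n) x) \<le> M * qn f (X n) * qn f (X n - x)"
        using bd[of "X n" "X n - x"] sesq_diff(2)[OF B f(2) X(1) X(2) X(1), of n n] X f(2)
        by (simp add: subspace_diff)
    qed
    show "(\<lambda>n. M * qn f (X n) * qn f (X n - x)) \<longlonglongrightarrow> 0"
      using tendsto_mult[OF tendsto_mult[OF tendsto_const[of M] qn_tendsto[OF f X]] X(3)] by simp
  qed
  moreover have "(\<lambda>n. B (X n) x) \<longlonglongrightarrow> B x x"
    by (rule sesq_bounded_tendsto[OF f B bd X X(2)])
  ultimately have "(\<lambda>n. B (X n) (X n)) \<longlonglongrightarrow> B x x"
    using Lim_transform[of "\<lambda>n. B (X n) x" "B x x" sequentially "\<lambda>n. B (X n) (X n)"] by simp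
  then have "(\<lambda>n. Re (B (X n) (X n))) \<longlonglongrightarrow> Re (B x x)" by (rule tendsto_Re)
  then show ?thesis using nn LIMSEQ_le_const by blast
qed

lemma qcomplete_sq_criterion:
  assumes "qcomplete S f" "psd S f" "subspace S" "\<And>n. X n \<in> S"
    and "\<And>\<epsilon>. \<epsilon> > 0 \<Longrightarrow> \<exists>N. \<forall>m\<ge>N. \<forall>n\<ge>N. (qn f (X m - X n))\<^sup>2 < \<epsilon>"
  shows "\<exists>x\<in>S. (\<lambda>n. qn f (X n - x)) \<longlonglongrightarrow> 0"
proof -
  have "\<exists>N. \<forall>m\<ge>N. \<forall>n\<ge>N. qn f (X m - X n) < \<epsilon>" if e0: "\<epsilon> > 0" for \<epsilon>
  proof -
    obtain N where N: "\<forall>m\<ge>N. \<forall>n\<ge>N. (qn f (X m - X n))\<^sup>2 < \<epsilon>\<^sup>2"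
      using assms(5)[OF zero_less_power[OF e0, of 2]] by auto
    have "qn f (X m - X n) < \<epsilon>" if "m \<ge> N" "n \<ge> N" for m n
      using N that \<open>\<epsilon> > 0\<close> by (intro power_less_imp_less_base[of _ 2 \<epsilon>]) auto
    then show ?thesis by blast
  qed
  then show ?thesis using assms(1,4) unfolding qcomplete_def by blast
qed

section \<open>Riesz representation, Lax-Milgram and T-coercivity for seminorms\<close>

lemma minimizing_sequence:
  fixes J :: "'b \<Rightarrow> real"
  assumes "A \<noteq> {}" "bdd_below (J ` A)"
  obtains X where "\<And>n. X n \<in> A" "\<And>n. J (X n) < Inf (J ` A) + 1 / real (Suc n)"
proof -
  have "\<exists>x\<in>A. J x < Inf (J ` A) + 1 / real (Suc n)" for n
    using cInf_lessD[of "J ` A" "Inf (J ` A) + 1 / real (Suc n)"] assms by auto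
  then show ?thesis using that by metis
qed

text \<open>The representer minimizes \<open>||x||^2 - 2 Re G x\<close>. The parallelogram identity
  makes minimizing sequences Cauchy, and the first variation at the limit is the representation.
  \<open>G\<close> is antilinear, so it is represented through the second argument of
  \<open>f\<close>.\<close>

lemma riesz_representation:
  assumes f: "psd S f" "subspace S" "qcomplete S f"
    and G: "antilinear S G" and bd: "\<And>x. x \<in> S \<Longrightarrow> cmod (G x) \<le> M * qn f x"
  shows "\<exists>r\<in>S. \<forall>v\<in>S. f r v = G v"
proof -
  define J where "J x = (qn f x)\<^sup>2 - 2 * Re (G x)" for x
  have Gadd: "G (x + y) = G x + G y" "G (c \<odot> x) = cnj c * G x" if "x \<in> S" "y \<in> S" for x y c
    using G that unfolding antilinear_def by blast+
  have s: "sesq S f" using f psdD by blast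
  have lb: "- (M\<^sup>2) \<le> J x" if "x \<in> S" for x
  proof -
    have "Re (G x) \<le> M * qn f x" using bd[OF that] complex_Re_le_cmod order_trans by blast
    moreover have "0 \<le> (qn f x - M)\<^sup>2" by simp
    ultimately show ?thesis unfolding J_def by (simp add: power2_diff algebra_simps)
  qed
  have bb: "bdd_below (J ` S)" using lb by (auto simp: bdd_below_def)
  have ne: "S \<noteq> {}" using f(2) subspace_0 by blast
  define d where "d = Inf (J ` S)"
  obtain X where X: "\<And>n. X n \<in> S" "\<And>n. J (X n) < d + 1 / real (Suc n)"
    using minimizing_sequence[OF ne bb] unfolding d_def by blast
  have dle: "d \<le> J x" if "x \<in> S" for x unfolding d_def using bb that by (intro cInf_lower) auto
  \<comment> \<open>The midpoint \<open>?y\<close> is an admissible competitor, so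
    \<open>J ?y\<close> is at least the infimum; the parallelogram identity turns this into a bound
    on the distance of two almost minimizers.\<close>
  have par: "(qn f (X m - X n))\<^sup>2 \<le> 2 / real (Suc m) + 2 / real (Suc n)" for m n
  proof -
    let ?y = "(1/2) \<odot> (X m + X n)"
    have yS: "X m + X n \<in> S" "?y \<in> S" using X(1) f(2) subspace_add subspace_scale by blast+
    have "qn f ?y = qn f (X m + X n) / 2" using qn_scale[OF f(1,2) yS(1), of "1/2"] by simp
    moreover have "G ?y = (1/2) * (G (X m) + G (X n))"
      using Gadd(2)[OF yS(1) yS(1), of "1/2"] Gadd(1)[OF X(1) X(1), of m n] by simp
    then have "Re (G ?y) = (Re (G (X m)) + Re (G (X n))) / 2" by (simp only:) simp
    ultimately have "4 * J ?y = (qn f (X m + X n))\<^sup>2 - 4 * Re (G (X m)) - 4 * Re (G (X n))"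
      unfolding J_def by (simp only:) (simp add: power_divide field_simps)
    moreover have "(qn f (X m - X n))\<^sup>2 = 2 * (qn f (X m))\<^sup>2 + 2 * (qn f (X n))\<^sup>2 - (qn f (X m + X n))\<^sup>2"
      using qn_parallelogram[OF f(1,2) X(1) X(1)] .
    ultimately have "(qn f (X m - X n))\<^sup>2 = 2 * J (X m) + 2 * J (X n) - 4 * J ?y"
      unfolding J_def by simp
    then show ?thesis using X(2)[of m] X(2)[of n] dle[OF yS(2)] by simp
  qed
  have "\<exists>N. \<forall>m\<ge>N. \<forall>n\<ge>N. (qn f (X m - X n))\<^sup>2 < \<epsilon>" if e0: "\<epsilon> > 0" for \<epsilon>
  proof -
    obtain N where N: "1 / real (Suc N) < \<epsilon> / 4" using e0 nat_approx_posE[of "\<epsilon>/4"] by auto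
    have "(qn f (X m - X n))\<^sup>2 < \<epsilon>" if "m \<ge> N" "n \<ge> N" for m n
    proof -
      have "1 / real (Suc m) \<le> 1 / real (Suc N)" "1 / real (Suc n) \<le> 1 / real (Suc N)"
        using that by (simp_all add: frac_le)
      then show ?thesis using par[of m n] N by simp
    qed
    then show ?thesis by blast
  qed
  then obtain x where x: "x \<in> S" "(\<lambda>n. qn f (X n - x)) \<longlonglongrightarrow> 0"
    using qcomplete_sq_criterion[OF f(3,1,2), of X] X(1) by blast
  have Re0: "Re (f x v - G v) = 0" if v: "v \<in> S" for v
  proof -
    have ineq: "0 \<le> t\<^sup>2 * (qn f v)\<^sup>2 + 2 * t * Re (f x v - G v)" for t :: real
    proof -
      have "- (1 / real (Suc n)) \<le> t\<^sup>2 * (qn f v)\<^sup>2 + 2 * t * Re (f (X n) v - G v)" for n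
      proof -
        have m: "X n + of_real t \<odot> v \<in> S" using X(1) v f(2) subspace_add subspace_scale by blast
        have "J (X n + of_real t \<odot> v) = J (X n) + t\<^sup>2 * (qn f v)\<^sup>2 + 2 * t * Re (f (X n) v - G v)"
          unfolding J_def qn_sq_add_scale[OF f(1,2) X(1) v]
          using Gadd(1)[OF X(1), of "of_real t \<odot> v"] Gadd(2)[OF v v] v f(2)
          by (simp add: subspace_scale algebra_simps)
        then show ?thesis using dle[OF m] X(2)[of n] by simp
      qed
      moreover have "(\<lambda>n. t\<^sup>2 * (qn f v)\<^sup>2 + 2 * t * Re (f (X n) v - G v))
          \<longlonglongrightarrow> t\<^sup>2 * (qn f v)\<^sup>2 + 2 * t * Re (f x v - G v)"
        using sesq_bounded_tendsto[OF f(1,2) s _ X(1) x v, of 1] cauchy_schwarz[OF f(1,2)]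
        by (intro tendsto_intros) auto
      moreover have "(\<lambda>n. - (1 / real (Suc n))) \<longlonglongrightarrow> 0"
        using tendsto_minus[OF LIMSEQ_inverse_real_of_nat] by (simp add: inverse_eq_divide)
      ultimately show ?thesis using LIMSEQ_le by blast
    qed
    show ?thesis
    proof (rule ccontr)
      define b where "b = Re (f x v - G v)"
      assume "Re (f x v - G v) \<noteq> 0"
      then have b: "b \<noteq> 0" unfolding b_def .
      \<comment> \<open>The natural step would divide by the squared seminorm of \<open>v\<close>,
        which may be zero; adding 1 keeps the step finite and still makes the quadratic
        negative.\<close>
      define a where "a = (qn f v)\<^sup>2 + 1"
      have a: "a > 0" "(qn f v)\<^sup>2 < a" unfolding a_def by (simp_all add: add_nonneg_pos)
      have "0 \<le> (b/a)\<^sup>2 * (qn f v)\<^sup>2 - 2 * b\<^sup>2 / a"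
        using ineq[of "- b / a"] unfolding b_def[symmetric] by (simp add: power2_eq_square)
      also have "\<dots> \<le> (b/a)\<^sup>2 * a - 2 * b\<^sup>2 / a"
        using a by (simp add: mult_left_mono)
      also have "\<dots> = - (b\<^sup>2 / a)" using a by (simp add: power2_eq_square field_simps)
      finally show False using a b by (simp add: divide_le_0_iff)
    qed
  qed
  \<comment> \<open>So far only real parts agree; testing with \<open>\<i> \<odot> v\<close>
    supplies the imaginary parts.\<close>
  have "f x v = G v" if v: "v \<in> S" for v
  proof -
    have iv: "\<i> \<odot> v \<in> S" using v f(2) subspace_scale by blast
    have "f x (\<i> \<odot> v) = - \<i> * f x v" "G (\<i> \<odot> v) = - \<i> * G v"
      using sesqD(4)[OF s x(1) v] Gadd(2)[OF v v] by simp_all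
    then show ?thesis using Re0[OF v] Re0[OF iv] by (simp add: complex_eq_iff)
  qed
  then show ?thesis using x by blast
qed

text \<open>The steps are bounded by a geometric sequence and summed. A seminorm is not a metric, so
  the contraction principle enters through this estimate rather than as a fixed point
  theorem.\<close>

lemma geometric_Cauchy:
  assumes f: "psd S f" "subspace S" and X: "\<And>n. X n \<in> S" and q: "0 \<le> q" "q < 1"
    and step: "\<And>n. qn f (X (Suc (Suc n)) - X (Suc n)) \<le> q * qn f (X (Suc n) - X n)"
    and \<epsilon>: "\<epsilon> > 0"
  shows "\<exists>N. \<forall>m\<ge>N. \<forall>n\<ge>N. qn f (X m - X n) < \<epsilon>"
proof -
  define a where "a = qn f (X 1 - X 0)"
  have dS: "X m - X n \<in> S" for m n using X f(2) subspace_diff by blast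
  have a0: "0 \<le> a" unfolding a_def using qn_nonneg[OF f(1) dS] .
  have st: "qn f (X (Suc n) - X n) \<le> q ^ n * a" for n
  proof (induction n)
    case (Suc n)
    show ?case using step[of n] mult_left_mono[OF Suc q(1)] by (simp add: mult.assoc)
  qed (simp add: a_def)
  have up: "qn f (X (n + k) - X n) \<le> q ^ n * a * (\<Sum>i<k. q ^ i)" for n k
  proof (induction k)
    case 0
    have "qn f (X n - X n) = 0" using qn_scale[OF f X[of n], of 0] by simp
    then show ?case by simp
  next
    case (Suc k)
    have "qn f (X (n + Suc k) - X n) \<le> qn f (X (Suc (n + k)) - X (n + k)) + qn f (X (n + k) - X n)"
      using qn_triangle_diff[OF f X[of "n + Suc k"] X[of "n + k"] X[of n]] by simp
    then show ?case using Suc st[of "n + k"] by (simp add: power_add algebra_simps)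
  qed
  have geo: "(\<Sum>i<k. q ^ i) \<le> 1 / (1 - q)" for k
    using q sum_gp_strict[of q k] by (simp add: divide_right_mono)
  have bd: "qn f (X m - X n) \<le> q ^ n * a / (1 - q)" if "n \<le> m" for m n
    using up[of n "m - n"] mult_left_mono[OF geo[of "m - n"], of "q ^ n * a"] that q a0 by simp
  have "(\<lambda>n. q ^ n * a / (1 - q)) \<longlonglongrightarrow> 0 * a / (1 - q)"
    using q by (intro tendsto_intros LIMSEQ_realpow_zero) auto
  then have "\<forall>\<^sub>F n in sequentially. q ^ n * a / (1 - q) < \<epsilon>"
    using \<epsilon> order_tendstoD(2) by fastforce
  then obtain N where N: "\<And>n. n \<ge> N \<Longrightarrow> q ^ n * a / (1 - q) < \<epsilon>"
    unfolding eventually_sequentially by blast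
  have "qn f (X m - X n) < \<epsilon>" if "m \<ge> N" "n \<ge> N" for m n
    using bd[of n m] bd[of m n] N that qn_diff_commute[OF f X X, of m n]
    by (metis le_cases order_le_less_trans)
  then show ?thesis by blast
qed

text \<open>Riesz represents the residual \<open>B x v - G v\<close> by a vector \<open>R x\<close>.
  The map \<open>x - t R x\<close> contracts for small \<open>t\<close>, and its iterates converge
  in the seminorm. \<open>R x\<close> is fixed only up to vectors of seminorm zero, but differences
  of its values are controlled by \<open>B\<close> alone.\<close>

lemma lax_milgram:
  assumes f: "psd S f" "subspace S" "qcomplete S f" and B: "sesq S B"
    and bd: "\<And>x y. x \<in> S \<Longrightarrow> y \<in> S \<Longrightarrow> cmod (B x y) \<le> M * qn f x * qn f y"
    and co: "\<And>x. x \<in> S \<Longrightarrow> c * (qn f x)\<^sup>2 \<le> Re (B x x)" and c: "c > 0"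
    and G: "antilinear S G" and Gb: "\<And>x. x \<in> S \<Longrightarrow> cmod (G x) \<le> L * qn f x"
  shows "\<exists>x\<in>S. \<forall>v\<in>S. B x v = G v"
proof -
  have s: "sesq S f" using f psdD by blast
  \<comment> \<open>Enlarging the bound to at least \<open>c\<close> makes \<open>K\<close> positive
    and keeps \<open>1 - c\<^sup>2 / K\<^sup>2\<close>, the square of the contraction factor,
    nonnegative.\<close>
  define K where "K = max M c"
  have K: "c \<le> K" "0 < K" unfolding K_def using c by auto
  have bdK: "cmod (B x y) \<le> K * qn f x * qn f y" if "x \<in> S" "y \<in> S" for x y
  proof -
    have "M * (qn f x * qn f y) \<le> K * (qn f x * qn f y)"
      unfolding K_def using qn_nonneg f that by (intro mult_right_mono) auto
    then show ?thesis using bd[OF that] by (simp add: mult.assoc)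
  qed
  have "\<exists>r\<in>S. \<forall>v\<in>S. f r v = B x v - G v" if x: "x \<in> S" for x
  proof (rule riesz_representation[OF f])
    show "antilinear S (\<lambda>v. B x v - G v)"
      using B G x unfolding antilinear_def sesq_def by (simp add: algebra_simps)
    fix v assume v: "v \<in> S"
    show "cmod (B x v - G v) \<le> (K * qn f x + L) * qn f v"
      using norm_triangle_ineq4[of "B x v" "G v"] bdK[OF x v] Gb[OF v] by (simp add: algebra_simps)
  qed
  then obtain R where R: "\<And>x. x \<in> S \<Longrightarrow> R x \<in> S" "\<And>x v. x \<in> S \<Longrightarrow> v \<in> S \<Longrightarrow> f (R x) v = B x v - G v"
    by metis
  \<comment> \<open>This is the minimizer of \<open>1 - 2 t c + t\<^sup>2 K\<^sup>2\<close>, the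
    bound for the squared contraction factor.\<close>
  define t where "t = c / K\<^sup>2"
  define \<Phi> where "\<Phi> x = x - of_real t \<odot> R x" for x
  have \<Phi>S: "\<Phi> x \<in> S" if "x \<in> S" for x
    unfolding \<Phi>_def using that R f(2) subspace_scale subspace_diff by blast
  define q where "q = sqrt (1 - c\<^sup>2 / K\<^sup>2)"
  have ck: "0 < c\<^sup>2 / K\<^sup>2" "c\<^sup>2 / K\<^sup>2 \<le> 1" using c K by (simp_all add: power_mono)
  have q: "0 \<le> q" "q < 1" unfolding q_def using ck by (auto simp: real_sqrt_lt_1_iff)
  have contr: "qn f (\<Phi> x - \<Phi> y) \<le> q * qn f (x - y)" if xy: "x \<in> S" "y \<in> S" for x y
  proof -
    let ?z = "x - y" and ?D = "R x - R y"
    have m: "?z \<in> S" "?D \<in> S" using xy R f(2) subspace_diff by blast+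
    have fD: "f ?D v = B ?z v" if "v \<in> S" for v
      using sesq_diff(1)[OF s f(2) R(1) R(1) that] sesq_diff(1)[OF B f(2) xy that] R(2) xy that by simp
    have "\<Phi> x - \<Phi> y = ?z + of_real (- t) \<odot> ?D"
      unfolding \<Phi>_def by (simp add: algebra_simps)
    then have exp: "(qn f (\<Phi> x - \<Phi> y))\<^sup>2 = (qn f ?z)\<^sup>2 - 2 * t * Re (f ?z ?D) + t\<^sup>2 * (qn f ?D)\<^sup>2"
      using qn_sq_add_scale[OF f(1,2) m, of "of_real (-t)"] by simp
    have "f ?z ?D = cnj (f ?D ?z)" by (rule psdD(2)[OF f(1) m(2) m(1)])
    then have Re_eq: "Re (f ?z ?D) = Re (B ?z ?z)" using fD[OF m(1)] by simp
    have "(qn f ?D)\<^sup>2 \<le> K * qn f ?z * qn f ?D"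
      using qn_sq[OF f(1) m(2)] fD[OF m(2)] bdK[OF m] complex_Re_le_cmod order_trans by metis
    then have "qn f ?D \<le> K * qn f ?z"
      using qn_nonneg[OF f(1) m(2)] qn_nonneg[OF f(1) m(1)] K
      by (cases "qn f ?D = 0") (auto simp: power2_eq_square)
    from power_mono[OF this qn_nonneg[OF f(1) m(2)], of 2]
    have D2: "(qn f ?D)\<^sup>2 \<le> K\<^sup>2 * (qn f ?z)\<^sup>2" by (simp add: power_mult_distrib)
    have "0 \<le> t" unfolding t_def using c by simp
    then have "t * (c * (qn f ?z)\<^sup>2) \<le> t * Re (B ?z ?z)" "t\<^sup>2 * (qn f ?D)\<^sup>2 \<le> t\<^sup>2 * (K\<^sup>2 * (qn f ?z)\<^sup>2)"
      using mult_left_mono[OF co[OF m(1)]] mult_left_mono[OF D2] by simp_all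
    then have "(qn f (\<Phi> x - \<Phi> y))\<^sup>2 \<le> (qn f ?z)\<^sup>2 - 2 * t * (c * (qn f ?z)\<^sup>2) + t\<^sup>2 * (K\<^sup>2 * (qn f ?z)\<^sup>2)"
      unfolding exp Re_eq by linarith
    also have "\<dots> = (1 - c\<^sup>2 / K\<^sup>2) * (qn f ?z)\<^sup>2"
      unfolding t_def using K by (simp add: power2_eq_square field_simps)
    also have "\<dots> = (q * qn f ?z)\<^sup>2"
      unfolding q_def using ck by (simp add: power_mult_distrib)
    finally show ?thesis using q qn_nonneg[OF f(1) m(1)] power2_le_imp_le by (metis mult_nonneg_nonneg)
  qed
  define X where "X n = (\<Phi> ^^ n) 0" for n
  have XS: "X n \<in> S" for n
    by (induction n) (auto simp: X_def \<Phi>S f(2) subspace_0)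
  have XSuc: "X (Suc n) = \<Phi> (X n)" for n unfolding X_def by simp
  have cau: "\<exists>N. \<forall>m\<ge>N. \<forall>n\<ge>N. qn f (X m - X n) < \<epsilon>" if "\<epsilon> > 0" for \<epsilon>
  proof (rule geometric_Cauchy[OF f(1,2) XS q _ that])
    show "qn f (X (Suc (Suc n)) - X (Suc n)) \<le> q * qn f (X (Suc n) - X n)" for n
      using contr[OF XS[of "Suc n"] XS[of n]] by (simp only: XSuc)
  qed
  then obtain x where x: "x \<in> S" "(\<lambda>n. qn f (X n - x)) \<longlonglongrightarrow> 0"
    using f(3) XS unfolding qcomplete_def by blast
  have tp: "t > 0" unfolding t_def using c K by simp
  \<comment> \<open>No fixed point equation is used. Two consecutive iterates have the same limit
    when tested with \<open>v\<close>, and their difference is \<open>t\<close> times the residual,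
    so the residual tends to zero.\<close>
  have "B x v = G v" if v: "v \<in> S" for v
  proof -
    have l1: "(\<lambda>n. f (X n) v) \<longlonglongrightarrow> f x v"
      using sesq_bounded_tendsto[OF f(1,2) s _ XS x v, of 1] cauchy_schwarz[OF f(1,2)] by simp
    have l2: "(\<lambda>n. f (X (Suc n)) v) \<longlonglongrightarrow> f x v" using l1 by (rule LIMSEQ_Suc)
    have "f (X n) v - f (X (Suc n)) v = of_real t * (B (X n) v - G v)" for n
    proof -
      have m: "of_real t \<odot> R (X n) \<in> S" using R XS f(2) subspace_scale by blast
      have "f (X (Suc n)) v = f (X n) v - f (of_real t \<odot> R (X n)) v"
        unfolding XSuc \<Phi>_def using sesq_diff(1)[OF s f(2) XS m v] .
      then show ?thesis using sesqD(3)[OF s R(1)[OF XS] v] R(2)[OF XS v] by simp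
    qed
    then have "(\<lambda>n. of_real t * (B (X n) v - G v)) \<longlonglongrightarrow> 0"
      using tendsto_diff[OF l1 l2] by simp
    moreover have "(\<lambda>n. of_real t * (B (X n) v - G v)) \<longlonglongrightarrow> of_real t * (B x v - G v)"
      using sesq_bounded_tendsto[OF f(1,2) B bd XS x v] by (intro tendsto_intros)
    ultimately have "of_real t * (B x v - G v) = 0" using LIMSEQ_unique by blast
    then show ?thesis using tp by simp
  qed
  then show ?thesis using x by blast
qed

text \<open>The test operator need only be linear up to vectors of seminorm zero: it involves weak
  derivatives, which are functions determined almost everywhere.\<close>

lemma T_coercive_solvable:
  assumes f: "psd S f" "subspace S" "qcomplete S f" and A: "sesq S A"
    and bd: "\<And>x y. x \<in> S \<Longrightarrow> y \<in> S \<Longrightarrow> cmod (A x y) \<le> M * qn f x * qn f y" and M: "0 \<le> M"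
    and T: "\<And>x. x \<in> S \<Longrightarrow> T x \<in> S" "\<And>x. x \<in> S \<Longrightarrow> qn f (T x) \<le> K * qn f x"
      "\<And>x y. x \<in> S \<Longrightarrow> y \<in> S \<Longrightarrow> qn f (T (x + y) - (T x + T y)) = 0"
      "\<And>a x. x \<in> S \<Longrightarrow> qn f (T (a \<odot> x) - a \<odot> T x) = 0"
      "\<And>y. y \<in> S \<Longrightarrow> \<exists>x\<in>S. T x = y"
    and co: "\<And>x. x \<in> S \<Longrightarrow> c * (qn f x)\<^sup>2 \<le> Re (A x (T x))" and c: "c > 0"
    and G: "antilinear S G" and Gb: "\<And>x. x \<in> S \<Longrightarrow> cmod (G x) \<le> L * qn f x"
  shows "\<exists>x\<in>S. \<forall>v\<in>S. A x v = G v"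
proof -
  \<comment> \<open>A bounded antilinear functional does not see vectors of seminorm zero; this
    turns the approximate linearity of \<open>T\<close> into exact linearity of its composition with
    such functionals.\<close>
  have bdd_eq: "H u = H w" if H: "antilinear S H" "\<And>x. x \<in> S \<Longrightarrow> cmod (H x) \<le> N * qn f x"
    and u: "u \<in> S" "w \<in> S" "qn f (u - w) = 0" for H N u w
  proof -
    have "u - w \<in> S" using u f(2) subspace_diff by blast
    then have "H (u - w) = 0" using H(2)[of "u - w"] u by simp
    moreover have "H u = H w + H (u - w)"
      using H(1) u \<open>u - w \<in> S\<close> unfolding antilinear_def by (metis add.commute diff_add_cancel)
    ultimately show ?thesis by simp
  qed
  have lin: "antilinear S (\<lambda>x. H (T x))" if H: "antilinear S H" "\<And>x. x \<in> S \<Longrightarrow> cmod (H x) \<le> N * qn f x" for H N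
    unfolding antilinear_def
  proof (intro conjI ballI allI)
    fix x y assume xy: "x \<in> S" "y \<in> S"
    then have "H (T (x + y)) = H (T x + T y)"
      using bdd_eq[OF H] T f(2) by (simp add: subspace_add)
    then show "H (T (x + y)) = H (T x) + H (T y)" using H(1) T(1) xy unfolding antilinear_def by simp
  next
    fix a x assume x: "x \<in> S"
    then have "H (T (a \<odot> x)) = H (a \<odot> T x)"
      using bdd_eq[OF H] T f(2) by (simp add: subspace_scale)
    then show "H (T (a \<odot> x)) = cnj a * H (T x)" using H(1) T(1) x unfolding antilinear_def by simp
  qed
  have "\<exists>x\<in>S. \<forall>v\<in>S. A x (T v) = G (T v)"
  proof (rule lax_milgram[OF f])
    show "sesq S (\<lambda>x v. A x (T v))"
    proof -
      have "antilinear S (\<lambda>v. A x (T v))" if "x \<in> S" for x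
      proof (rule lin)
        show "antilinear S (A x)" using A that unfolding sesq_def antilinear_def by blast
        show "cmod (A x y) \<le> (M * qn f x) * qn f y" if "y \<in> S" for y using bd \<open>x \<in> S\<close> that by blast
      qed
      then show ?thesis using A T(1) unfolding sesq_def antilinear_def by blast
    qed
    show "cmod (A x (T v)) \<le> (M * K) * qn f x * qn f v" if "x \<in> S" "v \<in> S" for x v
    proof -
      have "cmod (A x (T v)) \<le> (M * qn f x) * qn f (T v)" using bd that T(1) by blast
      also have "\<dots> \<le> (M * qn f x) * (K * qn f v)"
        using T(2) that M qn_nonneg[OF f(1)] by (intro mult_left_mono) auto
      finally show ?thesis by (simp add: algebra_simps)
    qed
    show "antilinear S (\<lambda>v. G (T v))" using lin[OF G Gb] .
    show "cmod (G (T x)) \<le> (\<bar>L\<bar> * K) * qn f x" if "x \<in> S" for x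
    proof -
      have "cmod (G (T x)) \<le> L * qn f (T x)" using Gb T(1) that by blast
      also have "\<dots> \<le> \<bar>L\<bar> * qn f (T x)" using qn_nonneg[OF f(1) T(1)[OF that]] by (simp add: mult_right_mono)
      also have "\<dots> \<le> \<bar>L\<bar> * (K * qn f x)" using T(2)[OF that] by (simp add: mult_left_mono)
      finally show ?thesis by simp
    qed
  qed (use co c in auto)
  \<comment> \<open>Surjectivity of \<open>T\<close> upgrades test vectors of the form
    \<open>T v\<close> to all test vectors.\<close>
  then show ?thesis using T(5) by metis
qed

section \<open>Variational eigenvectors and the reflection at a spectral level\<close>

definition eigvals :: "'a set \<Rightarrow> ('a \<Rightarrow> 'a \<Rightarrow> complex) \<Rightarrow> ('a \<Rightarrow> 'a \<Rightarrow> complex) \<Rightarrow> real set" where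
  "eigvals S e m = {\<kappa>. \<exists>\<psi>\<in>S. qn m \<psi> \<noteq> 0 \<and> (\<forall>v\<in>S. e \<psi> v = of_real \<kappa> * m \<psi> v)}"

text \<open>Compactness of the embedding of the \<open>f\<close>-seminorm into the
  \<open>m\<close>-seminorm. It is phrased with Cauchy subsequences so that no limit in the weaker
  seminorm has to exist.\<close>

definition qcompact :: "'a set \<Rightarrow> ('a \<Rightarrow> 'a \<Rightarrow> complex) \<Rightarrow> ('a \<Rightarrow> 'a \<Rightarrow> complex) \<Rightarrow> bool" where
  "qcompact S f m \<longleftrightarrow> (\<forall>X. (\<forall>n. X n \<in> S) \<longrightarrow> (\<exists>B. \<forall>n. qn f (X n) \<le> B) \<longrightarrow>
     (\<exists>r::nat\<Rightarrow>nat. strict_mono r \<and> (\<forall>\<epsilon>>0. \<exists>N. \<forall>j\<ge>N. \<forall>k\<ge>N. qn m (X (r j) - X (r k)) < \<epsilon>)))"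

abbreviation sumform :: "('a \<Rightarrow> 'a \<Rightarrow> complex) \<Rightarrow> ('a \<Rightarrow> 'a \<Rightarrow> complex) \<Rightarrow> 'a \<Rightarrow> 'a \<Rightarrow> complex" where
  "sumform e m \<equiv> (\<lambda>x y. e x y + m x y)"

text \<open>For a diagonalized pair of forms this is the identity minus twice the projection onto
  the modes below \<open>\<sigma>\<close>. Only the properties needed later are recorded: an
  involution, isometric for both forms, against which \<open>e - \<sigma> m\<close> is coercive with
  constant \<open>\<gamma>\<close>.\<close>

definition reflects ::
  "'a set \<Rightarrow> ('a \<Rightarrow> 'a \<Rightarrow> complex) \<Rightarrow> ('a \<Rightarrow> 'a \<Rightarrow> complex) \<Rightarrow> real \<Rightarrow> real \<Rightarrow> ('a \<Rightarrow> 'a) \<Rightarrow> bool" where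
  "reflects S e m \<sigma> \<gamma> T \<longleftrightarrow> (\<forall>u\<in>S. T u \<in> S) \<and> (\<forall>u\<in>S. \<forall>v\<in>S. T (u + v) = T u + T v) \<and>
     (\<forall>c. \<forall>u\<in>S. T (c \<odot> u) = c \<odot> T u) \<and> (\<forall>u\<in>S. T (T u) = u) \<and>
     (\<forall>u\<in>S. qn e (T u) = qn e u \<and> qn m (T u) = qn m u) \<and>
     (\<forall>u\<in>S. \<gamma> * ((qn e u)\<^sup>2 + (qn m u)\<^sup>2) \<le> Re (e u (T u)) - \<sigma> * Re (m u (T u)))"

lemma qn_sumform_sq:
  assumes "psd S e" "psd S m" "x \<in> S"
  shows "(qn (sumform e m) x)\<^sup>2 = (qn e x)\<^sup>2 + (qn m x)\<^sup>2"
  using qn_sq[OF assms(1,3)] qn_sq[OF assms(2,3)] qn_sq[OF psd_add[OF assms(1,2)] assms(3)] by simp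

lemma qn_le_sumform:
  assumes "psd S e" "psd S m" "x \<in> S"
  shows "qn m x \<le> qn (sumform e m) x" "qn e x \<le> qn (sumform e m) x"
  unfolding qn_def using psdD(3)[OF assms(1,3)] psdD(3)[OF assms(2,3)] by simp_all

text \<open>Minimize the energy on the unit sphere of \<open>m\<close>. Compactness makes a
  minimizing sequence Cauchy for \<open>m\<close>, and the parallelogram identity transfers this to
  \<open>e\<close>. At the limit the semidefinite form \<open>e - \<kappa> m\<close> vanishes, and
  Cauchy-Schwarz for that form is the eigenvalue equation.\<close>

lemma rayleigh_minimizer:
  assumes S: "subspace S" and e: "psd S e" and m: "psd S m" and com: "qcomplete S (sumform e m)"
    and cpt: "qcompact S (sumform e m) m" and ne: "u0 \<in> S" "qn m u0 \<noteq> 0"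
  obtains \<psi> \<kappa> where "\<psi> \<in> S" "qn m \<psi> = 1" "\<And>v. v \<in> S \<Longrightarrow> e \<psi> v = of_real \<kappa> * m \<psi> v"
    "\<And>v. v \<in> S \<Longrightarrow> \<kappa> * (qn m v)\<^sup>2 \<le> (qn e v)\<^sup>2"
proof -
  let ?E = "sumform e m"
  have E: "psd S ?E" by (rule psd_add[OF e m])
  define A where "A = {u\<in>S. qn m u = 1}"
  define J where "J u = (qn e u)\<^sup>2" for u
  have "of_real (1 / qn m u0) \<odot> u0 \<in> A"
    unfolding A_def using qn_scale[OF m S ne(1), of "of_real (1 / qn m u0)"] ne qn_nonneg[OF m ne(1)] S
    by (simp add: subspace_scale norm_divide)
  then have Ane: "A \<noteq> {}" by blast
  have bb: "bdd_below (J ` A)" by (rule bdd_belowI2[of _ 0]) (simp add: J_def)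
  define \<kappa> where "\<kappa> = Inf (J ` A)"
  obtain X where X: "\<And>n. X n \<in> A" "\<And>n. J (X n) < \<kappa> + 1 / real (Suc n)"
    using minimizing_sequence[OF Ane bb] unfolding \<kappa>_def by blast
  have XS: "X n \<in> S" "qn m (X n) = 1" for n using X(1)[of n] unfolding A_def by auto
  have \<kappa>le: "\<kappa> * (qn m v)\<^sup>2 \<le> (qn e v)\<^sup>2" if v: "v \<in> S" for v
  proof (cases "qn m v = 0")
    case False
    let ?c = "of_real (1 / qn m v) :: complex"
    have c: "cmod ?c = 1 / qn m v" using qn_nonneg[OF m v] by (simp add: norm_divide)
    have "?c \<odot> v \<in> A" unfolding A_def using qn_scale[OF m S v, of ?c] c False S v
      by (simp add: subspace_scale)
    then have "\<kappa> \<le> J (?c \<odot> v)" unfolding \<kappa>_def using bb by (intro cInf_lower) auto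
    also have "\<dots> = (qn e v / qn m v)\<^sup>2" unfolding J_def using qn_scale[OF e S v, of ?c] c by simp
    finally show ?thesis using False by (simp add: power_divide field_simps)
  qed simp
  have "\<kappa> \<ge> 0" unfolding \<kappa>_def using Ane by (intro cInf_greatest) (auto simp: J_def)
  have "qn ?E (X n) \<le> sqrt (\<kappa> + 2)" for n
  proof (rule real_le_rsqrt)
    have "1 / real (Suc n) \<le> 1" by simp
    moreover have "(qn ?E (X n))\<^sup>2 = (qn e (X n))\<^sup>2 + 1" using qn_sumform_sq[OF e m XS(1)] XS(2) by simp
    ultimately show "(qn ?E (X n))\<^sup>2 \<le> \<kappa> + 2" using X(2)[of n] unfolding J_def by linarith
  qed
  then obtain r :: "nat \<Rightarrow> nat" where r: "strict_mono r"
    "\<And>\<epsilon>. \<epsilon> > 0 \<Longrightarrow> \<exists>N. \<forall>j\<ge>N. \<forall>k\<ge>N. qn m (X (r j) - X (r k)) < \<epsilon>"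
    using cpt XS(1) unfolding qcompact_def by meson
  define Y where "Y n = X (r n)" for n
  have YS: "Y n \<in> S" "qn m (Y n) = 1" for n unfolding Y_def using XS by auto
  have YJ: "J (Y n) < \<kappa> + 1 / real (Suc n)" for n
  proof -
    have "1 / real (Suc (r n)) \<le> 1 / real (Suc n)" using seq_suble[OF r(1), of n] by (simp add: frac_le)
    then show ?thesis unfolding Y_def using X(2)[of "r n"] by simp
  qed
  \<comment> \<open>The energy of the sum is bounded below by \<open>\<kappa>\<close> times its
    mass; inserted in the parallelogram identity for \<open>e\<close>, this leaves only the mass of
    the difference and the excess over the infimum.\<close>
  have est: "(qn ?E (Y j - Y k))\<^sup>2 \<le> 2 / real (Suc j) + 2 / real (Suc k) + (\<kappa> + 1) * (qn m (Y j - Y k))\<^sup>2" for j k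
  proof -
    have sm: "Y j + Y k \<in> S" "Y j - Y k \<in> S" using YS S subspace_add subspace_diff by blast+
    have "\<kappa> * (qn m (Y j + Y k))\<^sup>2 = 4 * \<kappa> - \<kappa> * (qn m (Y j - Y k))\<^sup>2"
    proof -
      have "(qn m (Y j + Y k))\<^sup>2 = 4 - (qn m (Y j - Y k))\<^sup>2"
        using qn_parallelogram[OF m S YS(1) YS(1), of j k] YS(2) by simp
      then show ?thesis by (simp only:) (simp add: algebra_simps)
    qed
    then have "(qn e (Y j - Y k))\<^sup>2 \<le> 2 / real (Suc j) + 2 / real (Suc k) + \<kappa> * (qn m (Y j - Y k))\<^sup>2"
      using qn_parallelogram[OF e S YS(1) YS(1), of j k] \<kappa>le[OF sm(1)] YJ[of j] YJ[of k]
      unfolding J_def by simp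
    then show ?thesis using qn_sumform_sq[OF e m sm(2)] by (simp add: algebra_simps)
  qed
  have "\<exists>N. \<forall>j\<ge>N. \<forall>k\<ge>N. (qn ?E (Y j - Y k))\<^sup>2 < \<epsilon>" if e0: "\<epsilon> > 0" for \<epsilon>
  proof -
    \<comment> \<open>Chosen so that the mass term of \<open>est\<close> contributes at most half of
      \<open>\<epsilon>\<close>.\<close>
    define \<delta> where "\<delta> = sqrt (\<epsilon> / (2 * (\<kappa> + 1)))"
    have \<delta>: "\<delta> > 0" "(\<kappa> + 1) * \<delta>\<^sup>2 = \<epsilon> / 2" unfolding \<delta>_def using e0 \<open>\<kappa> \<ge> 0\<close> by (simp_all add: field_simps)
    obtain N1 where N1: "\<And>j k. j \<ge> N1 \<Longrightarrow> k \<ge> N1 \<Longrightarrow> qn m (Y j - Y k) < \<delta>"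
      using r(2)[OF \<delta>(1)] unfolding Y_def by blast
    obtain N2 where N2: "1 / real (Suc N2) < \<epsilon> / 8" using e0 nat_approx_posE[of "\<epsilon>/8"] by auto
    have "(qn ?E (Y j - Y k))\<^sup>2 < \<epsilon>" if "j \<ge> max N1 N2" "k \<ge> max N1 N2" for j k
    proof -
      have "1 / real (Suc j) \<le> 1 / real (Suc N2)" "1 / real (Suc k) \<le> 1 / real (Suc N2)"
        using that by (simp_all add: frac_le)
      moreover have "Y j - Y k \<in> S" using YS S subspace_diff by blast
      then have "(qn m (Y j - Y k))\<^sup>2 \<le> \<delta>\<^sup>2"
        using N1[of j k] that qn_nonneg[OF m] by (intro power_mono) auto
      then have "(\<kappa> + 1) * (qn m (Y j - Y k))\<^sup>2 \<le> \<epsilon> / 2"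
        using mult_left_mono[of "(qn m (Y j - Y k))\<^sup>2" "\<delta>\<^sup>2" "\<kappa> + 1"] \<delta>(2) \<open>\<kappa> \<ge> 0\<close> by simp
      ultimately show ?thesis using est[of j k] N2 by simp
    qed
    then show ?thesis by blast
  qed
  then obtain x where x: "x \<in> S" "(\<lambda>n. qn ?E (Y n - x)) \<longlonglongrightarrow> 0"
    using qcomplete_sq_criterion[OF com E S, of Y] YS(1) by blast
  have YxS: "Y n - x \<in> S" for n using YS x S subspace_diff by blast
  have lim: "(\<lambda>n. qn e (Y n - x)) \<longlonglongrightarrow> 0" "(\<lambda>n. qn m (Y n - x)) \<longlonglongrightarrow> 0"
    using qn_le_sumform[OF e m YxS] qn_nonneg[OF e YxS] qn_nonneg[OF m YxS]
    by (intro Lim_null_comparison[OF always_eventually x(2)]; simp)+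
  have "(\<lambda>n. qn m (Y n)) \<longlonglongrightarrow> qn m x" by (rule qn_tendsto[OF m S YS(1) x(1) lim(2)])
  then have mx: "qn m x = 1" by (simp add: YS(2) LIMSEQ_const_iff)
  have "(\<lambda>n. (qn e (Y n))\<^sup>2) \<longlonglongrightarrow> (qn e x)\<^sup>2"
    by (intro tendsto_power qn_tendsto[OF e S YS(1) x(1) lim(1)])
  moreover have "(\<lambda>n. \<kappa> + 1 / real (Suc n)) \<longlonglongrightarrow> \<kappa> + 0"
    using LIMSEQ_inverse_real_of_nat by (intro tendsto_add tendsto_const) (simp add: inverse_eq_divide)
  ultimately have "(qn e x)\<^sup>2 \<le> \<kappa> + 0"
    by (rule LIMSEQ_le) (use YJ less_imp_le in \<open>auto simp: J_def\<close>)
  then have ex: "(qn e x)\<^sup>2 = \<kappa>" using \<kappa>le[OF x(1)] mx by simp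
  \<comment> \<open>Semidefinite by minimality of \<open>\<kappa>\<close>, so no derivative of the
    Rayleigh quotient has to be taken.\<close>
  define g where "g u v = e u v + of_real (- \<kappa>) * m u v" for u v
  have g: "psd S g"
  proof (rule psdI)
    show "sesq S g" unfolding g_def by (intro sesq_add sesq_cmult psdD(1)[OF e] psdD(1)[OF m])
    show "g v u = cnj (g u v)" if "u \<in> S" "v \<in> S" for u v
      unfolding g_def psdD(2)[OF e that] psdD(2)[OF m that] by simp
    show "0 \<le> Re (g u u)" if "u \<in> S" for u
      unfolding g_def using \<kappa>le[OF that] qn_sq[OF e that] qn_sq[OF m that] by simp
  qed
  have "(qn g x)\<^sup>2 = 0"
    using qn_sq[OF g x(1)] qn_sq[OF e x(1)] qn_sq[OF m x(1)] ex mx unfolding g_def by simp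
  then have "qn g x = 0" by simp
  then have "g x v = 0" if "v \<in> S" for v using psd_eq_zero_if_qn_zero(1)[OF g S x(1) that] by simp
  then have "e x v = of_real \<kappa> * m x v" if "v \<in> S" for v using that unfolding g_def by simp
  then show ?thesis using that[of x \<kappa>] x(1) mx \<kappa>le by blast
qed

text \<open>The eigenvalue equation makes the \<open>m\<close>-orthogonal complement of
  \<open>\<psi>\<close> orthogonal for \<open>e\<close> as well, so both forms split along
  \<open>\<psi>\<close>. A reflection of the complement extends by changing the sign of the
  \<open>\<psi>\<close> component, which contributes \<open>\<sigma> - \<kappa>\<close> times the
  squared coefficient; \<open>gam\<close> says that this is enough.\<close>

lemma eigenvector_split:
  assumes V: "subspace S" and e: "psd S e" and m: "psd S m" and com: "qcomplete S (sumform e m)"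
    and psi: "\<psi> \<in> S" "qn m \<psi> = 1" "\<And>v. v \<in> S \<Longrightarrow> e \<psi> v = of_real \<kappa> * m \<psi> v"
    and gam: "\<gamma> * (1 + \<kappa>) \<le> \<sigma> - \<kappa>"
  defines "S' \<equiv> {u\<in>S. m u \<psi> = 0}"
  shows "subspace S'" "qcomplete S' (sumform e m)" "eigvals S' e m \<subseteq> eigvals S e m"
    "reflects S' e m \<sigma> \<gamma> T' \<Longrightarrow> \<exists>T. reflects S e m \<sigma> \<gamma> T"
proof -
  let ?E = "sumform e m"
  have E: "psd S ?E" by (rule psd_add[OF e m])
  have sm: "sesq S m" and se: "sesq S e" using psdD(1) e m by blast+
  show sub: "subspace S'"
    unfolding S'_def subspace_def
    using V psi(1) sesqD[OF sm] sesqD(3)[OF sm psi(1) psi(1), of 0]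
    by (auto simp: subspace_0 subspace_add subspace_scale)
  have S'S: "S' \<subseteq> S" unfolding S'_def by blast
  have m\<psi>: "m \<psi> \<psi> = 1" using psd_of_real[OF m psi(1)] psi(2) by simp
  have e\<psi>: "e \<psi> \<psi> = of_real \<kappa>" using psi(1,3) m\<psi> by simp
  have orth: "m y \<psi> = 0" "m \<psi> y = 0" "e \<psi> y = 0" "e y \<psi> = 0" if "y \<in> S'" for y
  proof -
    have y: "y \<in> S" "m y \<psi> = 0" using that unfolding S'_def by auto
    show "m y \<psi> = 0" by (fact y)
    show 1: "m \<psi> y = 0" using psdD(2)[OF m y(1) psi(1)] y(2) by simp
    show 2: "e \<psi> y = 0" using psi(3)[OF y(1)] 1 by simp
    show "e y \<psi> = 0" using psdD(2)[OF e psi(1) y(1)] 2 by simp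
  qed
  define P where "P u = u - m u \<psi> \<odot> \<psi>" for u
  have PS: "P u \<in> S'" if u: "u \<in> S" for u
  proof -
    have "m u \<psi> \<odot> \<psi> \<in> S" using psi(1) V subspace_scale by blast
    then show ?thesis unfolding S'_def P_def
      using sesq_diff(1)[OF sm V u _ psi(1)] sesqD(3)[OF sm psi(1) psi(1)] m\<psi> u V by (simp add: subspace_diff)
  qed
  have dec: "u = P u + m u \<psi> \<odot> \<psi>" for u unfolding P_def by simp
  show "qcomplete S' ?E"
    unfolding qcomplete_def
  proof (intro allI impI)
    fix X :: "nat \<Rightarrow> 'a" assume X: "\<forall>n. X n \<in> S'" "\<forall>\<epsilon>>0. \<exists>N. \<forall>i\<ge>N. \<forall>n\<ge>N. qn ?E (X i - X n) < \<epsilon>"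
    then have XS: "X n \<in> S" for n using S'S by blast
    then obtain x where x: "x \<in> S" "(\<lambda>n. qn ?E (X n - x)) \<longlonglongrightarrow> 0"
      using com X(2) unfolding qcomplete_def by blast
    \<comment> \<open>The functional \<open>m(., \<psi>)\<close> is continuous for the stronger
      seminorm, so the complement is closed and inherits completeness.\<close>
    have "(\<lambda>n. m (X n) \<psi>) \<longlonglongrightarrow> m x \<psi>"
    proof (rule sesq_bounded_tendsto[OF E V sm _ XS x psi(1)])
      show "cmod (m u v) \<le> 1 * qn ?E u * qn ?E v" if "u \<in> S" "v \<in> S" for u v
        using cauchy_schwarz[OF m V that] qn_le_sumform(1)[OF e m that(1)] qn_le_sumform(1)[OF e m that(2)]
          qn_nonneg[OF m that(1)] qn_nonneg[OF m that(2)]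
        by (smt (verit, best) mult_mono mult_1)
    qed
    moreover have "m (X n) \<psi> = 0" for n using X(1) orth(1) by blast
    ultimately have "m x \<psi> = 0" by (simp add: LIMSEQ_const_iff)
    then show "\<exists>x\<in>S'. (\<lambda>n. qn ?E (X n - x)) \<longlonglongrightarrow> 0" using x unfolding S'_def by blast
  qed
  show "eigvals S' e m \<subseteq> eigvals S e m"
  proof
    fix \<nu> assume "\<nu> \<in> eigvals S' e m"
    then obtain x where x: "x \<in> S'" "qn m x \<noteq> 0" "\<And>v. v \<in> S' \<Longrightarrow> e x v = of_real \<nu> * m x v"
      unfolding eigvals_def by blast
    have xS: "x \<in> S" using x S'S by blast
    have "e x v = of_real \<nu> * m x v" if v: "v \<in> S" for v
    proof -
      \<comment> \<open>An eigenvector of the complement is orthogonal to \<open>\<psi>\<close> for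
        both forms, so its equation needs to be checked only against \<open>P v\<close>.\<close>
      have p: "P v \<in> S" "m v \<psi> \<odot> \<psi> \<in> S" using PS[OF v] S'S psi(1) V subspace_scale by blast+
      have "e x (P v + m v \<psi> \<odot> \<psi>) = e x (P v)" "m x (P v + m v \<psi> \<odot> \<psi>) = m x (P v)"
        using sesqD(2)[OF se p xS] sesqD(2)[OF sm p xS] sesqD(4)[OF se xS psi(1)] sesqD(4)[OF sm xS psi(1)]
          orth[OF x(1)] by simp_all
      then show ?thesis using dec[of v] x(3)[OF PS[OF v]] by simp
    qed
    then show "\<nu> \<in> eigvals S e m" unfolding eigvals_def using xS x(2) by blast
  qed
  assume T': "reflects S' e m \<sigma> \<gamma> T'"
  have T'S: "T' y \<in> S'" and T'T': "T' (T' y) = y"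
    and T'iso: "qn e (T' y) = qn e y" "qn m (T' y) = qn m y"
    and T'co: "\<gamma> * ((qn e y)\<^sup>2 + (qn m y)\<^sup>2) \<le> Re (e y (T' y)) - \<sigma> * Re (m y (T' y))"
    and T'sc: "T' (c \<odot> y) = c \<odot> T' y"
    if "y \<in> S'" for y c using T' that unfolding reflects_def by blast+
  have T'add: "T' (y + z) = T' y + T' z" if "y \<in> S'" "z \<in> S'" for y z
    using T' that unfolding reflects_def by blast
  define T where "T u = T' (P u) - m u \<psi> \<odot> \<psi>" for u
  have a\<psi>: "a \<odot> \<psi> \<in> S" for a using psi(1) V subspace_scale by blast
  have TP: "P (y - a \<odot> \<psi>) = y" "m (y - a \<odot> \<psi>) \<psi> = - a" if y: "y \<in> S'" for y a
  proof -
    show "m (y - a \<odot> \<psi>) \<psi> = - a"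
      using sesq_diff(1)[OF sm V _ a\<psi> psi(1), of y] sesqD(3)[OF sm psi(1) psi(1)] orth[OF y] m\<psi> y S'S by auto
    then show "P (y - a \<odot> \<psi>) = y" unfolding P_def by simp
  qed
  have comb: "g (y + a \<odot> \<psi>) (z + b \<odot> \<psi>) = g y z + a * cnj b * g \<psi> \<psi>"
    if g: "sesq S g" "g y \<psi> = 0" "g \<psi> z = 0" and yz: "y \<in> S'" "z \<in> S'" for g y z a b
  proof -
    have yzS: "y \<in> S" "z \<in> S" "z + b \<odot> \<psi> \<in> S" using yz S'S a\<psi> V subspace_add by blast+
    have "g (y + a \<odot> \<psi>) (z + b \<odot> \<psi>) = g y (z + b \<odot> \<psi>) + a * g \<psi> (z + b \<odot> \<psi>)"
      using sesqD(1)[OF g(1) yzS(1) a\<psi> yzS(3)] sesqD(3)[OF g(1) psi(1) yzS(3)] by simp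
    also have "\<dots> = g y z + a * (cnj b * g \<psi> \<psi>)"
      using sesqD(2)[OF g(1) yzS(2) a\<psi>, of _ b] sesqD(4)[OF g(1) _ psi(1)] yzS psi(1) g(2,3) by simp
    finally show ?thesis by simp
  qed
  have qcomb: "(qn e (y + a \<odot> \<psi>))\<^sup>2 = (qn e y)\<^sup>2 + (cmod a)\<^sup>2 * \<kappa>"
    "(qn m (y + a \<odot> \<psi>))\<^sup>2 = (qn m y)\<^sup>2 + (cmod a)\<^sup>2" if y: "y \<in> S'" for y a
  proof -
    have yS: "y \<in> S" using y S'S by blast
    have "(qn e \<psi>)\<^sup>2 = \<kappa>" using qn_sq[OF e psi(1)] e\<psi> by simp
    then show "(qn e (y + a \<odot> \<psi>))\<^sup>2 = (qn e y)\<^sup>2 + (cmod a)\<^sup>2 * \<kappa>"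
      using qn_sq_add_scale[OF e V yS psi(1), of a] orth[OF y] by simp
    show "(qn m (y + a \<odot> \<psi>))\<^sup>2 = (qn m y)\<^sup>2 + (cmod a)\<^sup>2"
      using qn_sq_add_scale[OF m V yS psi(1), of a] orth[OF y] psi(2) by simp
  qed
  have Teq: "T u = T' (P u) + (- m u \<psi>) \<odot> \<psi>" for u unfolding T_def by simp
  have TS: "T u \<in> S" if "u \<in> S" for u
    unfolding T_def using T'S[OF PS[OF that]] S'S a\<psi> V subspace_diff by blast
  have Padd: "P (u + v) = P u + P v" if "u \<in> S" "v \<in> S" for u v
    unfolding P_def sesqD(1)[OF sm that psi(1)] by (simp add: scale_left_distrib)
  have Psc: "P (c \<odot> u) = c \<odot> P u" if "u \<in> S" for u c
    unfolding P_def sesqD(3)[OF sm that psi(1)] by (simp add: scale_right_diff_distrib)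
  have "reflects S e m \<sigma> \<gamma> T"
    unfolding reflects_def
  proof (intro conjI ballI allI)
    fix u assume u: "u \<in> S"
    show "T u \<in> S" using TS u .
    show "T (T u) = u"
    proof -
      have "T (T u) = T' (T' (P u)) - (- m u \<psi>) \<odot> \<psi>"
        using TP[OF T'S[OF PS[OF u]], of "m u \<psi>"] unfolding T_def by simp
      also have "\<dots> = u" using T'T'[OF PS[OF u]] dec[of u] by simp
      finally show ?thesis .
    qed
    have q: "(qn e (T u))\<^sup>2 = (qn e u)\<^sup>2" "(qn m (T u))\<^sup>2 = (qn m u)\<^sup>2"
      using qcomb[OF T'S[OF PS[OF u]], of "- m u \<psi>"] qcomb[OF PS[OF u], of "m u \<psi>"]
        T'iso[OF PS[OF u]] dec[of u] unfolding Teq by simp_all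
    show "qn e (T u) = qn e u" "qn m (T u) = qn m u"
      using q qn_nonneg[OF e u] qn_nonneg[OF e TS[OF u]] qn_nonneg[OF m u] qn_nonneg[OF m TS[OF u]]
      by (simp_all add: power2_eq_iff_nonneg)
    let ?y = "P u" and ?a = "m u \<psi>"
    have y: "?y \<in> S'" "T' ?y \<in> S'" using PS[OF u] T'S by blast+
    have aa: "Re (a * cnj (- a)) = - (cmod a)\<^sup>2" for a
      unfolding cmod_power2 by (simp add: power2_eq_square)
    have "e u (T u) = e ?y (T' ?y) + ?a * cnj (- ?a) * of_real \<kappa>"
      using comb[OF se _ _ y, of ?a "- ?a"] orth[OF y(1)] orth[OF y(2)] e\<psi> dec[of u] unfolding Teq by simp
    then have 1: "Re (e u (T u)) = Re (e ?y (T' ?y)) - (cmod ?a)\<^sup>2 * \<kappa>"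
      using aa[of ?a] by (simp only:) simp
    have "m u (T u) = m ?y (T' ?y) + ?a * cnj (- ?a)"
      using comb[OF sm _ _ y, of ?a "- ?a"] orth[OF y(1)] orth[OF y(2)] m\<psi> dec[of u] unfolding Teq by simp
    then have 2: "Re (m u (T u)) = Re (m ?y (T' ?y)) - (cmod ?a)\<^sup>2"
      using aa[of ?a] by (simp only:) simp
    have 3: "(qn e u)\<^sup>2 + (qn m u)\<^sup>2 = (qn e ?y)\<^sup>2 + (qn m ?y)\<^sup>2 + (cmod ?a)\<^sup>2 * (1 + \<kappa>)"
      using qcomb[OF y(1), of ?a] dec[of u] by (simp add: algebra_simps)
    \<comment> \<open>The component along \<open>\<psi>\<close> has squared energy plus mass
      \<open>1 + \<kappa>\<close> per unit coefficient, which explains the factor in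
      \<open>gam\<close>.\<close>
    have "(cmod ?a)\<^sup>2 * (\<gamma> * (1 + \<kappa>)) \<le> (cmod ?a)\<^sup>2 * (\<sigma> - \<kappa>)"
      using gam by (simp add: mult_left_mono)
    then show "\<gamma> * ((qn e u)\<^sup>2 + (qn m u)\<^sup>2) \<le> Re (e u (T u)) - \<sigma> * Re (m u (T u))"
      unfolding 1 2 3 using T'co[OF y(1)] by (simp add: algebra_simps)
  next
    fix u v assume uv: "u \<in> S" "v \<in> S"
    show "T (u + v) = T u + T v"
      unfolding T_def Padd[OF uv] T'add[OF PS[OF uv(1)] PS[OF uv(2)]] sesqD(1)[OF sm uv psi(1)]
      by (simp add: scale_left_distrib)
  next
    fix c u assume u: "u \<in> S"
    show "T (c \<odot> u) = c \<odot> T u"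
      unfolding T_def Psc[OF u] T'sc[OF PS[OF u]] sesqD(3)[OF sm u psi(1)]
      by (simp add: scale_right_diff_distrib)
  qed
  then show "\<exists>T. reflects S e m \<sigma> \<gamma> T" by blast
qed

text \<open>Splitting off Rayleigh minimizers below \<open>\<sigma>\<close> one at a time; compactness bounds their number.\<close>

theorem spectral_reflection:
  assumes V: "subspace V" and e: "psd V e" and m: "psd V m" and com: "qcomplete V (sumform e m)"
    and cpt: "qcompact V (sumform e m) m"
    and null: "\<And>u. u \<in> V \<Longrightarrow> qn m u = 0 \<Longrightarrow> qn e u = 0"
    and \<gamma>: "\<gamma> > 0" and gap: "\<And>\<kappa>. \<kappa> \<in> eigvals V e m \<Longrightarrow> \<gamma> * (1 + \<kappa>) \<le> \<bar>\<sigma> - \<kappa>\<bar>" and \<sigma>: "0 \<le> \<sigma>"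
  shows "\<exists>T. reflects V e m \<sigma> \<gamma> T"
proof (rule ccontr)
  let ?E = "sumform e m"
  \<comment> \<open>The descent runs by contradiction: a subspace without a reflection has a
    Rayleigh minimizer below \<open>\<sigma>\<close> whose complement again has none. Iterating
    gives infinitely many \<open>m\<close>-orthonormal vectors of bounded energy, which compactness
    forbids.\<close>
  define bad where "bad S \<longleftrightarrow> subspace S \<and> S \<subseteq> V \<and> qcomplete S ?E \<and> eigvals S e m \<subseteq> eigvals V e m
     \<and> \<not> (\<exists>T. reflects S e m \<sigma> \<gamma> T)" for S
  assume "\<not> ?thesis"
  then have badV: "bad V" unfolding bad_def using V com by blast
  have step: "\<exists>S'. bad S' \<and> (\<exists>\<psi>\<in>S. qn m \<psi> = 1 \<and> (qn e \<psi>)\<^sup>2 \<le> \<sigma> \<and> S' = {u\<in>S. m u \<psi> = 0})"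
    if bad: "bad S" for S
  proof -
    have S: "subspace S" "S \<subseteq> V" "qcomplete S ?E" "eigvals S e m \<subseteq> eigvals V e m"
      "\<And>T. \<not> reflects S e m \<sigma> \<gamma> T" using bad unfolding bad_def by blast+
    have eS: "psd S e" and mS: "psd S m" using psd_mono e m S(2) by blast+
    have cptS: "qcompact S ?E m" using cpt S(2) unfolding qcompact_def by (meson subsetD)
    \<comment> \<open>The identity is a reflection as soon as \<open>e - \<sigma> m\<close> itself
      is coercive on \<open>S\<close>, so on a bad subspace it never is.\<close>
    have idr: "reflects S e m \<sigma> \<gamma> (\<lambda>u. u)"
      if "\<And>u. u \<in> S \<Longrightarrow> \<gamma> * ((qn e u)\<^sup>2 + (qn m u)\<^sup>2) \<le> (qn e u)\<^sup>2 - \<sigma> * (qn m u)\<^sup>2"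
      using that qn_sq[OF eS] qn_sq[OF mS] unfolding reflects_def by simp
    \<comment> \<open>If all masses vanished, \<open>null\<close> would make all energies vanish
      too, and the identity would reflect trivially.\<close>
    have "\<exists>u0\<in>S. qn m u0 \<noteq> 0"
    proof (rule ccontr)
      assume "\<not> ?thesis"
      then have "qn m u = 0 \<and> qn e u = 0" if "u \<in> S" for u using null that S(2) by blast
      then show False using idr S(5) by simp
    qed
    then obtain u0 where "u0 \<in> S" "qn m u0 \<noteq> 0" by blast
    then obtain \<psi> \<kappa> where psi: "\<psi> \<in> S" "qn m \<psi> = 1" "\<And>v. v \<in> S \<Longrightarrow> e \<psi> v = of_real \<kappa> * m \<psi> v"
      and min: "\<And>v. v \<in> S \<Longrightarrow> \<kappa> * (qn m v)\<^sup>2 \<le> (qn e v)\<^sup>2"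
      using rayleigh_minimizer[OF S(1) eS mS S(3) cptS] by blast
    have "\<kappa> \<in> eigvals S e m" unfolding eigvals_def using psi by (intro CollectI bexI[of _ \<psi>]) auto
    then have g: "\<gamma> * (1 + \<kappa>) \<le> \<bar>\<sigma> - \<kappa>\<bar>" using gap S(4) by blast
    have "m \<psi> \<psi> = 1" using psd_of_real[OF mS psi(1)] psi(2) by simp
    then have e\<psi>: "(qn e \<psi>)\<^sup>2 = \<kappa>" using qn_sq[OF eS psi(1)] psi(3)[OF psi(1)] by simp
    then have "0 \<le> \<kappa>" using zero_le_power2 by metis
    \<comment> \<open>Otherwise the smallest Rayleigh quotient lies above \<open>\<sigma>\<close>,
      the gap reads \<open>\<sigma> + \<gamma> \<le> \<kappa> (1 - \<gamma>)\<close>, and by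
      minimality of \<open>\<kappa>\<close> the identity already works.\<close>
    have "\<kappa> \<le> \<sigma>"
    proof (rule ccontr)
      assume "\<not> ?thesis"
      then have g': "\<sigma> + \<gamma> \<le> \<kappa> * (1 - \<gamma>)" using g by (simp add: algebra_simps)
      then have "0 < \<kappa> * (1 - \<gamma>)" using \<gamma> \<sigma> by linarith
      then have g1: "0 < 1 - \<gamma>" using \<open>0 \<le> \<kappa>\<close> zero_less_mult_pos by (metis mult_zero_left order_le_less)
      have "\<gamma> * ((qn e u)\<^sup>2 + (qn m u)\<^sup>2) \<le> (qn e u)\<^sup>2 - \<sigma> * (qn m u)\<^sup>2" if u: "u \<in> S" for u
      proof -
        have "(\<sigma> + \<gamma>) * (qn m u)\<^sup>2 \<le> \<kappa> * (1 - \<gamma>) * (qn m u)\<^sup>2" using g' by (simp add: mult_right_mono)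
        also have "\<dots> = (1 - \<gamma>) * (\<kappa> * (qn m u)\<^sup>2)" by simp
        also have "\<dots> \<le> (1 - \<gamma>) * (qn e u)\<^sup>2" using min[OF u] g1 by (simp add: mult_left_mono)
        finally show ?thesis by (simp add: algebra_simps)
      qed
      then show False using idr S(5) by blast
    qed
    then have gam: "\<gamma> * (1 + \<kappa>) \<le> \<sigma> - \<kappa>" using g by simp
    note sp = eigenvector_split[OF S(1) eS mS S(3) psi gam]
    let ?S' = "{u\<in>S. m u \<psi> = 0}"
    have "bad ?S'" unfolding bad_def using sp S by blast
    then show ?thesis using psi e\<psi> \<open>\<kappa> \<le> \<sigma>\<close> by blast
  qed
  have "\<exists>W. \<forall>n. bad (W n) \<and> (\<exists>\<psi>\<in>W n. qn m \<psi> = 1 \<and> (qn e \<psi>)\<^sup>2 \<le> \<sigma> \<and> W (Suc n) = {u\<in>W n. m u \<psi> = 0})"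
    using dependent_nat_choice[of "\<lambda>_. bad" "\<lambda>_ S S'. \<exists>\<psi>\<in>S. qn m \<psi> = 1 \<and> (qn e \<psi>)\<^sup>2 \<le> \<sigma> \<and> S' = {u\<in>S. m u \<psi> = 0}"]
      badV step by blast
  then obtain W where W: "\<And>n. bad (W n)"
    "\<And>n. \<exists>\<psi>\<in>W n. qn m \<psi> = 1 \<and> (qn e \<psi>)\<^sup>2 \<le> \<sigma> \<and> W (Suc n) = {u\<in>W n. m u \<psi> = 0}" by blast
  then obtain \<psi> where psi: "\<And>n. \<psi> n \<in> W n" "\<And>n. qn m (\<psi> n) = 1" "\<And>n. (qn e (\<psi> n))\<^sup>2 \<le> \<sigma>"
    "\<And>n. W (Suc n) = {u\<in>W n. m u (\<psi> n) = 0}" by metis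
  have dec: "W (n + k) \<subseteq> W n" for n k by (induction k) (use psi(4) in auto)
  have psiV: "\<psi> n \<in> V" for n using psi(1) W(1) unfolding bad_def by blast
  have orth: "m (\<psi> j) (\<psi> i) = 0" if "i < j" for i j
  proof -
    have "\<psi> j \<in> W (Suc i)" using dec[of "Suc i" "j - Suc i"] psi(1)[of j] that by auto
    then show ?thesis using psi(4) by simp
  qed
  have "qn ?E (\<psi> n) \<le> sqrt (\<sigma> + 1)" for n
    using qn_sumform_sq[OF e m psiV, of n] psi(2,3)[of n] by (intro real_le_rsqrt) simp
  then obtain r :: "nat \<Rightarrow> nat" where r: "strict_mono r"
    "\<And>\<epsilon>. \<epsilon> > 0 \<Longrightarrow> \<exists>N. \<forall>j\<ge>N. \<forall>k\<ge>N. qn m (\<psi> (r j) - \<psi> (r k)) < \<epsilon>"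
    using cpt psiV unfolding qcompact_def by meson
  obtain N where "\<forall>j\<ge>N. \<forall>k\<ge>N. qn m (\<psi> (r j) - \<psi> (r k)) < 1" using r(2)[of 1] by auto
  then have "qn m (\<psi> (r (Suc N)) - \<psi> (r N)) < 1" by simp
  \<comment> \<open>Orthonormal vectors have squared distance 2, so no subsequence is
    Cauchy.\<close>
  moreover have "(qn m (\<psi> (r (Suc N)) - \<psi> (r N)))\<^sup>2 = 2"
    using qn_sq_diff[OF m V psiV psiV, of "r (Suc N)" "r N"] psi(2) orth[of "r N" "r (Suc N)"] r(1)
    by (simp add: strict_mono_Suc_iff)
  moreover have "0 \<le> qn m (\<psi> (r (Suc N)) - \<psi> (r N))"
    using qn_nonneg[OF m] psiV V subspace_diff by blast
  ultimately show False using abs_square_less_1[of "qn m (\<psi> (r (Suc N)) - \<psi> (r N))"] by simp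
qed

end

subsection \<open>Square integrable functions\<close>

lemma L2I: "f \<in> borel_measurable (lebesgue_on \<Omega>) \<Longrightarrow> integrable (lebesgue_on \<Omega>) (\<lambda>x. (cmod (f x))\<^sup>2) \<Longrightarrow> L2 \<Omega> f"
  unfolding L2_def by blast

lemma L2D:
  assumes "L2 \<Omega> f"
  shows "f \<in> borel_measurable (lebesgue_on \<Omega>)" "integrable (lebesgue_on \<Omega>) (\<lambda>x. (cmod (f x))\<^sup>2)"
  using assms unfolding L2_def by blast+

lemma L2_dominated:
  assumes "f \<in> borel_measurable (lebesgue_on \<Omega>)" "integrable (lebesgue_on \<Omega>) g"
    "AE x in lebesgue_on \<Omega>. (cmod (f x))\<^sup>2 \<le> g x"
  shows "L2 \<Omega> f"
proof (rule L2I[OF assms(1)])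
  show "integrable (lebesgue_on \<Omega>) (\<lambda>x. (cmod (f x))\<^sup>2)"
  proof (rule Bochner_Integration.integrable_bound[OF assms(2)])
    show "(\<lambda>x. (cmod (f x))\<^sup>2) \<in> borel_measurable (lebesgue_on \<Omega>)" using assms(1) by measurable
    show "AE x in lebesgue_on \<Omega>. norm ((cmod (f x))\<^sup>2) \<le> norm (g x)"
      using assms(3) by eventually_elim auto
  qed
qed

lemma sum_sq_le: "(cmod (a + b))\<^sup>2 \<le> 2 * (cmod a)\<^sup>2 + 2 * (cmod b)\<^sup>2"
proof -
  have "(cmod (a + b))\<^sup>2 \<le> (cmod a + cmod b)\<^sup>2" by (intro power_mono norm_triangle_ineq) auto
  also have "\<dots> \<le> 2 * (cmod a)\<^sup>2 + 2 * (cmod b)\<^sup>2"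
    using zero_le_power2[of "cmod a - cmod b"] by (simp add: power2_eq_square algebra_simps)
  finally show ?thesis .
qed

lemma L2_add:
  assumes "L2 \<Omega> f" "L2 \<Omega> g"
  shows "L2 \<Omega> (\<lambda>x. f x + g x)"
proof (rule L2_dominated)
  show "(\<lambda>x. f x + g x) \<in> borel_measurable (lebesgue_on \<Omega>)" using L2D(1)[OF assms(1)] L2D(1)[OF assms(2)] by measurable
  show "integrable (lebesgue_on \<Omega>) (\<lambda>x. 2 * (cmod (f x))\<^sup>2 + 2 * (cmod (g x))\<^sup>2)"
    using L2D(2)[OF assms(1)] L2D(2)[OF assms(2)] by simp
qed (simp add: sum_sq_le)

lemma L2_bounded_mult:
  assumes "L2 \<Omega> f" "k \<in> borel_measurable (lebesgue_on \<Omega>)" "\<And>x. x \<in> \<Omega> \<Longrightarrow> cmod (k x) \<le> B"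
  shows "L2 \<Omega> (\<lambda>x. k x * f x)"
proof (rule L2_dominated)
  show "(\<lambda>x. k x * f x) \<in> borel_measurable (lebesgue_on \<Omega>)" using L2D(1)[OF assms(1)] assms(2) by measurable
  show "integrable (lebesgue_on \<Omega>) (\<lambda>x. B\<^sup>2 * (cmod (f x))\<^sup>2)" using L2D(2)[OF assms(1)] by simp
  have "(cmod (k x * f x))\<^sup>2 \<le> B\<^sup>2 * (cmod (f x))\<^sup>2" if "x \<in> \<Omega>" for x
  proof -
    have "(cmod (k x))\<^sup>2 \<le> B\<^sup>2" using assms(3)[OF that] by (intro power_mono) auto
    then show ?thesis by (simp add: norm_mult power_mult_distrib mult_right_mono)
  qed
  then show "AE x in lebesgue_on \<Omega>. (cmod (k x * f x))\<^sup>2 \<le> B\<^sup>2 * (cmod (f x))\<^sup>2"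
    by (intro AE_I2) (simp add: space_restrict_space)
qed

lemma L2_cmult: "L2 \<Omega> f \<Longrightarrow> L2 \<Omega> (\<lambda>x. c * f x)"
  by (rule L2_bounded_mult[of \<Omega> f "\<lambda>_. c" "cmod c"]) auto

lemma L2_uminus: "L2 \<Omega> f \<Longrightarrow> L2 \<Omega> (\<lambda>x. - f x)"
  using L2_cmult[of \<Omega> f "-1"] by simp

lemma L2_diff: "L2 \<Omega> f \<Longrightarrow> L2 \<Omega> g \<Longrightarrow> L2 \<Omega> (\<lambda>x. f x - g x)"
  using L2_add[OF _ L2_uminus, of \<Omega> f g] by simp

lemma L2_zero: "L2 \<Omega> (\<lambda>x. 0)"
  unfolding L2_def by simp

lemma L2_sum: "(\<And>i. i \<in> I \<Longrightarrow> L2 \<Omega> (f i)) \<Longrightarrow> L2 \<Omega> (\<lambda>x. \<Sum>i\<in>I. f i x)"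
  by (induction I rule: infinite_finite_induct) (auto simp: L2_zero L2_add)

lemma integrable_L2_mult:
  assumes "L2 \<Omega> f" "L2 \<Omega> g"
  shows "integrable (lebesgue_on \<Omega>) (\<lambda>x. f x * g x)"
proof (rule Bochner_Integration.integrable_bound)
  show "integrable (lebesgue_on \<Omega>) (\<lambda>x. (cmod (f x))\<^sup>2 + (cmod (g x))\<^sup>2)"
    using L2D(2)[OF assms(1)] L2D(2)[OF assms(2)] by simp
  show "(\<lambda>x. f x * g x) \<in> borel_measurable (lebesgue_on \<Omega>)" using L2D(1)[OF assms(1)] L2D(1)[OF assms(2)] by measurable
  have "cmod a * cmod b \<le> (cmod a)\<^sup>2 + (cmod b)\<^sup>2" for a b
    using zero_le_power2[of "cmod a - cmod b"] zero_le_power2[of "cmod a"] zero_le_power2[of "cmod b"]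
    unfolding power2_diff by linarith
  then show "AE x in lebesgue_on \<Omega>. norm (f x * g x) \<le> norm ((cmod (f x))\<^sup>2 + (cmod (g x))\<^sup>2)"
    by (simp add: norm_mult)
qed

lemma L2_cnj: "L2 \<Omega> g \<Longrightarrow> L2 \<Omega> (\<lambda>x. cnj (g x))"
  unfolding L2_def by (auto intro!: borel_measurable_continuous_on[where f = cnj] continuous_intros)

lemma integrable_inner_L2: "L2 \<Omega> f \<Longrightarrow> L2 \<Omega> g \<Longrightarrow> integrable (lebesgue_on \<Omega>) (\<lambda>x. f x * cnj (g x))"
  using integrable_L2_mult L2_cnj by blast

lemma inner_L2_cong_AE:
  assumes "L2 \<Omega> f" "L2 \<Omega> f'" "L2 \<Omega> g" "L2 \<Omega> g'"
    "AE x in lebesgue_on \<Omega>. f x = f' x" "AE x in lebesgue_on \<Omega>. g x = g' x"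
  shows "inner_L2 \<Omega> f g = inner_L2 \<Omega> f' g'"
  unfolding inner_L2_def
proof (rule integral_cong_AE)
  show "AE x in lebesgue_on \<Omega>. f x * cnj (g x) = f' x * cnj (g' x)"
    using assms(5,6) by eventually_elim simp
qed (use borel_measurable_integrable[OF integrable_inner_L2[OF assms(1,3)]]
    borel_measurable_integrable[OF integrable_inner_L2[OF assms(2,4)]] in auto)

lemma norm_L2_nonneg: "0 \<le> norm_L2 \<Omega> f"
  unfolding norm_L2_def by simp

lemma norm_L2_sq: "(norm_L2 \<Omega> f)\<^sup>2 = (LINT x|lebesgue_on \<Omega>. (cmod (f x))\<^sup>2)"
  unfolding norm_L2_def by simp

lemma inner_L2_self: "inner_L2 \<Omega> f f = of_real ((norm_L2 \<Omega> f)\<^sup>2)"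
  unfolding inner_L2_def norm_L2_sq complex_norm_square[symmetric] of_real_power[symmetric]
  by (rule integral_complex_of_real)

lemma inner_L2_commute: "inner_L2 \<Omega> g f = cnj (inner_L2 \<Omega> f g)"
  unfolding inner_L2_def Bochner_Integration.integral_cnj[symmetric] by (simp add: mult.commute)

lemma norm_L2_cong_AE:
  assumes "L2 \<Omega> f" "L2 \<Omega> g" "AE x in lebesgue_on \<Omega>. f x = g x"
  shows "norm_L2 \<Omega> f = norm_L2 \<Omega> g"
proof -
  have "of_real ((norm_L2 \<Omega> f)\<^sup>2) = (of_real ((norm_L2 \<Omega> g)\<^sup>2) :: complex)"
    using inner_L2_cong_AE[OF assms(1,2,1,2,3,3)] by (simp only: inner_L2_self)
  then have "(norm_L2 \<Omega> f)\<^sup>2 = (norm_L2 \<Omega> g)\<^sup>2" by (simp only: of_real_eq_iff)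
  then show ?thesis using norm_L2_nonneg power2_eq_iff_nonneg by blast
qed

lemma norm_L2_eq_0_iff:
  assumes "L2 \<Omega> f"
  shows "norm_L2 \<Omega> f = 0 \<longleftrightarrow> (AE x in lebesgue_on \<Omega>. f x = 0)"
proof -
  have "norm_L2 \<Omega> f = 0 \<longleftrightarrow> (LINT x|lebesgue_on \<Omega>. (cmod (f x))\<^sup>2) = 0" unfolding norm_L2_def by simp
  also have "\<dots> \<longleftrightarrow> (AE x in lebesgue_on \<Omega>. (cmod (f x))\<^sup>2 = 0)"
    by (rule integral_nonneg_eq_0_iff_AE[OF L2D(2)[OF assms]]) simp
  finally show ?thesis by simp
qed

text \<open>There is one instance of the abstract theory per type of unknown: \<open>fn\<close> for
  scalar functions, \<open>vf\<close> for vector fields, \<open>uf\<close> for quadruples.\<close>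

interpretation fn: complex_vector_space "\<lambda>c (f :: 'b \<Rightarrow> complex) x. c * f x"
  by unfold_locales (auto simp: fun_eq_iff algebra_simps)

lemma fn_subspace_L2: "fn.subspace {f. L2 \<Omega> f}"
  unfolding fn.subspace_def using L2_zero L2_add L2_cmult by (auto simp: zero_fun_def plus_fun_def)

lemma psd_inner_L2: "fn.psd {f. L2 \<Omega> f} (inner_L2 \<Omega>)"
proof (rule fn.psdI)
  show "fn.sesq {f. L2 \<Omega> f} (inner_L2 \<Omega>)"
    unfolding fn.sesq_def
  proof (intro conjI ballI allI)
    fix f g h assume "f \<in> {f. L2 \<Omega> f}" "g \<in> {f. L2 \<Omega> f}" "h \<in> {f. L2 \<Omega> f}"
    then have L: "L2 \<Omega> f" "L2 \<Omega> g" "L2 \<Omega> h" by auto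
    show "inner_L2 \<Omega> (f + g) h = inner_L2 \<Omega> f h + inner_L2 \<Omega> g h" "inner_L2 \<Omega> h (f + g) = inner_L2 \<Omega> h f + inner_L2 \<Omega> h g"
      unfolding inner_L2_def
      using integrable_inner_L2[OF L(1,3)] integrable_inner_L2[OF L(2,3)]
        integrable_inner_L2[OF L(3,1)] integrable_inner_L2[OF L(3,2)]
      by (simp_all add: ring_distribs Bochner_Integration.integral_add)
  next
    fix c and f g :: "real^'a \<Rightarrow> complex"
    have "(\<lambda>x. f x * (cnj c * cnj (g x))) = (\<lambda>x. cnj c * (f x * cnj (g x)))" by (simp add: algebra_simps)
    then show "inner_L2 \<Omega> (\<lambda>x. c * f x) g = c * inner_L2 \<Omega> f g" "inner_L2 \<Omega> f (\<lambda>x. c * g x) = cnj c * inner_L2 \<Omega> f g"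
      unfolding inner_L2_def by (simp_all add: mult.assoc)
  qed
  show "inner_L2 \<Omega> y x = cnj (inner_L2 \<Omega> x y)" for x y by (rule inner_L2_commute)
qed (simp add: inner_L2_self)

lemma qn_inner_L2: "fn.qn (inner_L2 \<Omega>) f = norm_L2 \<Omega> f"
  unfolding fn.qn_def inner_L2_self using norm_L2_nonneg[of \<Omega> f] by simp

lemma cmod_inner_L2_le: "L2 \<Omega> f \<Longrightarrow> L2 \<Omega> g \<Longrightarrow> cmod (inner_L2 \<Omega> f g) \<le> norm_L2 \<Omega> f * norm_L2 \<Omega> g"
  using fn.cauchy_schwarz[OF psd_inner_L2 fn_subspace_L2, of f \<Omega> g] by (simp add: qn_inner_L2)

lemma norm_L2_triangle: "L2 \<Omega> f \<Longrightarrow> L2 \<Omega> g \<Longrightarrow> norm_L2 \<Omega> (\<lambda>x. f x + g x) \<le> norm_L2 \<Omega> f + norm_L2 \<Omega> g"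
  using fn.qn_triangle[OF psd_inner_L2 fn_subspace_L2, of f \<Omega> g] by (simp add: qn_inner_L2 plus_fun_def)

lemma norm_L2_triangle_diff:
  "L2 \<Omega> f \<Longrightarrow> L2 \<Omega> g \<Longrightarrow> L2 \<Omega> h \<Longrightarrow>
    norm_L2 \<Omega> (\<lambda>x. f x - h x) \<le> norm_L2 \<Omega> (\<lambda>x. f x - g x) + norm_L2 \<Omega> (\<lambda>x. g x - h x)"
  using norm_L2_triangle[OF L2_diff L2_diff, of \<Omega> f g g h] by simp

lemma norm_L2_cmult: "L2 \<Omega> f \<Longrightarrow> norm_L2 \<Omega> (\<lambda>x. c * f x) = cmod c * norm_L2 \<Omega> f"
  using fn.qn_scale[OF psd_inner_L2 fn_subspace_L2, of f \<Omega> c] by (simp add: qn_inner_L2)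

lemma norm_L2_bounded_mult:
  assumes "L2 \<Omega> f" "k \<in> borel_measurable (lebesgue_on \<Omega>)" "\<And>x. x \<in> \<Omega> \<Longrightarrow> cmod (k x) \<le> B" "0 \<le> B"
  shows "norm_L2 \<Omega> (\<lambda>x. k x * f x) \<le> B * norm_L2 \<Omega> f"
proof (rule power2_le_imp_le)
  have "(norm_L2 \<Omega> (\<lambda>x. k x * f x))\<^sup>2 \<le> (LINT x|lebesgue_on \<Omega>. B\<^sup>2 * (cmod (f x))\<^sup>2)"
    unfolding norm_L2_sq
  proof (rule integral_mono)
    show "integrable (lebesgue_on \<Omega>) (\<lambda>x. (cmod (k x * f x))\<^sup>2)" using L2D(2)[OF L2_bounded_mult[OF assms(1-3)]] .
    show "integrable (lebesgue_on \<Omega>) (\<lambda>x. B\<^sup>2 * (cmod (f x))\<^sup>2)" using L2D(2)[OF assms(1)] by simp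
    fix x assume "x \<in> space (lebesgue_on \<Omega>)"
    then have "(cmod (k x))\<^sup>2 \<le> B\<^sup>2" using assms(3) by (intro power_mono) (auto simp: space_restrict_space)
    then show "(cmod (k x * f x))\<^sup>2 \<le> B\<^sup>2 * (cmod (f x))\<^sup>2"
      by (simp add: norm_mult power_mult_distrib mult_right_mono)
  qed
  then show "(norm_L2 \<Omega> (\<lambda>x. k x * f x))\<^sup>2 \<le> (B * norm_L2 \<Omega> f)\<^sup>2"
    by (simp add: power_mult_distrib norm_L2_sq)
qed (use assms norm_L2_nonneg[of \<Omega> f] in simp)

section \<open>Completeness of the space of square integrable functions\<close>

lemma fast_Cauchy_subseq:
  fixes d :: "nat \<Rightarrow> nat \<Rightarrow> real"
  assumes "\<And>\<epsilon>. \<epsilon> > 0 \<Longrightarrow> \<exists>N. \<forall>m\<ge>N. \<forall>n\<ge>N. d m n < \<epsilon>"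
  obtains r :: "nat \<Rightarrow> nat" where "strict_mono r" "\<And>k. d (r (Suc k)) (r k) < (1/4) ^ k"
proof -
  have "\<exists>N. \<forall>m\<ge>N. \<forall>n\<ge>N. d m n < (1/4) ^ k" for k using assms[of "(1/4)^k"] by simp
  then obtain N where N: "\<And>k m n. m \<ge> N k \<Longrightarrow> n \<ge> N k \<Longrightarrow> d m n < (1/4) ^ k" by metis
  define r where "r = rec_nat (N 0) (\<lambda>k rk. max (Suc rk) (N (Suc k)))"
  have r0: "r 0 = N 0" and rS: "r (Suc k) = max (Suc (r k)) (N (Suc k))" for k
    unfolding r_def by simp_all
  have "strict_mono r" unfolding strict_mono_Suc_iff rS by (simp add: less_max_iff_disj)
  moreover have "N k \<le> r k" for k using r0 rS by (cases k) auto
  then have "d (r (Suc k)) (r k) < (1/4) ^ k" for k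
    using N[of k "r (Suc k)" "r k"] rS[of k] by (metis le_SucI le_max_iff_disj)
  ultimately show ?thesis using that by blast
qed

text \<open>The pointwise inequality \<open>h \<le> 2^(-k) + 2^k h^2\<close> replaces the Hoelder
  inequality: on a finite measure space squared increments of size \<open>4^(-k)\<close> give
  increments of integral of order \<open>2^(-k)\<close>, so the series of increments converges
  absolutely almost everywhere.\<close>

lemma AE_convergent_if_fast:
  fixes F :: "nat \<Rightarrow> 'a \<Rightarrow> complex"
  assumes fin: "finite_measure M" and meas: "\<And>n. F n \<in> borel_measurable M"
    and int: "\<And>k. integrable M (\<lambda>x. (cmod (F (Suc k) x - F k x))\<^sup>2)"
    and fast: "\<And>k. (LINT x|M. (cmod (F (Suc k) x - F k x))\<^sup>2) \<le> (1/4) ^ k"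
  shows "AE x in M. convergent (\<lambda>k. F k x)"
proof -
  interpret finite_measure M by (fact fin)
  let ?h = "\<lambda>k x. cmod (F (Suc k) x - F k x)"
  let ?g = "\<lambda>k x. (1/2::real) ^ k + 2 ^ k * (?h k x)\<^sup>2"
  have hg: "?h k x \<le> ?g k x" for k x
  proof (cases "?h k x \<le> (1/2) ^ k")
    case False
    then have "1 \<le> 2 ^ k * ?h k x" by (simp add: power_one_over field_simps)
    then have "1 * ?h k x \<le> 2 ^ k * ?h k x * ?h k x" by (intro mult_right_mono) auto
    then show ?thesis by (simp add: power2_eq_square mult.assoc add_increasing)
  qed (simp add: add_increasing2)
  have gi: "integrable M (?g k)" for k using int by simp
  have gI: "(LINT x|M. ?g k x) \<le> (measure M (space M) + 1) * (1/2) ^ k" for k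
  proof -
    have "(LINT x|M. ?g k x) = (1/2) ^ k * measure M (space M) + 2 ^ k * (LINT x|M. (?h k x)\<^sup>2)"
      using int by (simp add: mult.commute)
    also have "\<dots> \<le> (1/2) ^ k * measure M (space M) + 2 ^ k * (1/4) ^ k"
      using fast[of k] by simp
    also have "2 ^ k * (1/4) ^ k = ((1/2) ^ k :: real)" by (simp flip: power_mult_distrib)
    finally show ?thesis by (simp add: algebra_simps)
  qed
  have sg: "summable (\<lambda>k. (measure M (space M) + 1) * (1/2::real) ^ k)"
    by (intro summable_mult summable_geometric) simp
  have gm: "(\<lambda>x. ennreal (?g k x)) \<in> borel_measurable M" for k
    using borel_measurable_integrable[OF gi[of k]] by (rule measurable_compose) simp
  have "(\<integral>\<^sup>+ x. (\<Sum>k. ennreal (?g k x)) \<partial>M) = (\<Sum>k. \<integral>\<^sup>+ x. ennreal (?g k x) \<partial>M)"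
    by (rule nn_integral_suminf[OF gm])
  also have "\<dots> \<le> (\<Sum>k. ennreal ((measure M (space M) + 1) * (1/2) ^ k))"
  proof (intro suminf_le summableI)
    fix k
    have "(\<integral>\<^sup>+ x. ennreal (?g k x) \<partial>M) = ennreal (LINT x|M. ?g k x)"
      by (rule nn_integral_eq_integral[OF gi]) simp
    also have "\<dots> \<le> ennreal ((measure M (space M) + 1) * (1/2) ^ k)" by (rule ennreal_leI[OF gI])
    finally show "(\<integral>\<^sup>+ x. ennreal (?g k x) \<partial>M) \<le> ennreal ((measure M (space M) + 1) * (1/2) ^ k)" .
  qed
  also have "\<dots> = ennreal (\<Sum>k. (measure M (space M) + 1) * (1/2) ^ k)"
    by (intro suminf_ennreal2 sg) simp
  finally have "(\<integral>\<^sup>+ x. (\<Sum>k. ennreal (?g k x)) \<partial>M) \<noteq> \<infinity>" by (auto simp: top_unique)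
  then have "AE x in M. (\<Sum>k. ennreal (?g k x)) \<noteq> \<infinity>"
    by (intro nn_integral_PInf_AE borel_measurable_suminf_order gm)
  then show ?thesis
  proof eventually_elim
    fix x assume "(\<Sum>k. ennreal (?g k x)) \<noteq> \<infinity>"
    then have "summable (\<lambda>k. ?g k x)" by (intro summable_suminf_not_top) auto
    then have "summable (\<lambda>k. ?h k x)" using hg by (intro summable_comparison_test'[of _ 0 "\<lambda>k. ?h k x"]) auto
    then have "summable (\<lambda>k. F (Suc k) x - F k x)" by (rule summable_norm_cancel)
    then have "convergent (\<lambda>n. \<Sum>k<n. F (Suc k) x - F k x)" using summable_iff_convergent by blast
    moreover have "(\<Sum>k<n. F (Suc k) x - F k x) = F n x - F 0 x" for n
      using sum_lessThan_telescope[of "\<lambda>k. F k x" n] .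
    ultimately have "convergent (\<lambda>n. F n x - F 0 x)" by simp
    then have "convergent (\<lambda>n. (F n x - F 0 x) + F 0 x)" by (intro convergent_add convergent_const)
    then show "convergent (\<lambda>k. F k x)" by simp
  qed
qed

text \<open>The pattern of Riesz-Fischer: a fast subsequence converges almost everywhere, and the
  Fatou lemma shows that the pointwise limit is also the limit in the mean of the full
  sequence.\<close>

lemma L2_complete:
  fixes F :: "nat \<Rightarrow> real^'n::finite \<Rightarrow> complex"
  assumes fin: "finite_measure (lebesgue_on \<Omega>)" and F: "\<And>n. L2 \<Omega> (F n)"
    and Cau: "\<And>\<epsilon>. \<epsilon> > 0 \<Longrightarrow> \<exists>N. \<forall>m\<ge>N. \<forall>n\<ge>N. norm_L2 \<Omega> (\<lambda>x. F m x - F n x) < \<epsilon>"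
  shows "\<exists>f. L2 \<Omega> f \<and> (\<lambda>n. norm_L2 \<Omega> (\<lambda>x. F n x - f x)) \<longlonglongrightarrow> 0"
proof -
  let ?M = "lebesgue_on \<Omega>"
  have Cau2: "\<exists>N. \<forall>m\<ge>N. \<forall>n\<ge>N. (norm_L2 \<Omega> (\<lambda>x. F m x - F n x))\<^sup>2 < \<epsilon>" if e0: "\<epsilon> > 0" for \<epsilon>
  proof -
    obtain N where "\<forall>m\<ge>N. \<forall>n\<ge>N. norm_L2 \<Omega> (\<lambda>x. F m x - F n x) < sqrt \<epsilon>" using Cau[of "sqrt \<epsilon>"] e0 by auto
    then show ?thesis using norm_L2_nonneg by (metis real_sqrt_abs real_sqrt_less_iff abs_of_nonneg)
  qed
  obtain r where r: "strict_mono r"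
    "\<And>k. (norm_L2 \<Omega> (\<lambda>x. F (r (Suc k)) x - F (r k) x))\<^sup>2 < (1/4) ^ k"
    using fast_Cauchy_subseq[of "\<lambda>m n. (norm_L2 \<Omega> (\<lambda>x. F m x - F n x))\<^sup>2"] Cau2 by blast
  have meas: "F n \<in> borel_measurable ?M" for n using L2D(1)[OF F] .
  have conv: "AE x in ?M. convergent (\<lambda>k. F (r k) x)"
  proof (rule AE_convergent_if_fast[OF fin meas])
    show "integrable ?M (\<lambda>x. (cmod (F (r (Suc k)) x - F (r k) x))\<^sup>2)" for k using L2D(2)[OF L2_diff[OF F F]] .
    show "(LINT x|?M. (cmod (F (r (Suc k)) x - F (r k) x))\<^sup>2) \<le> (1/4) ^ k" for k
      using r(2)[of k] unfolding norm_L2_sq by simp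
  qed
  define f where "f x = lim (\<lambda>k. F (r k) x)" for x
  have fm: "f \<in> borel_measurable ?M" unfolding f_def by (intro borel_measurable_lim_metric meas)
  have lim: "AE x in ?M. (\<lambda>k. F (r k) x) \<longlonglongrightarrow> f x"
    using conv by eventually_elim (simp add: f_def convergent_LIMSEQ_iff)
  \<comment> \<open>A bound for the distances of \<open>F n\<close> to a tail of the sequence passes
    to the limit along the subsequence; square integrability of the difference comes with
    it.\<close>
  have fatou: "L2 \<Omega> (\<lambda>x. F n x - f x) \<and> (norm_L2 \<Omega> (\<lambda>x. F n x - f x))\<^sup>2 \<le> B"
    if B: "\<And>k. k \<ge> N \<Longrightarrow> (norm_L2 \<Omega> (\<lambda>x. F n x - F k x))\<^sup>2 \<le> B" and B0: "0 \<le> B" for n B N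
  proof -
    have "(\<integral>\<^sup>+ x. ennreal ((cmod (F n x - f x))\<^sup>2) \<partial>?M) \<le> (\<integral>\<^sup>+ x. liminf (\<lambda>k. ennreal ((cmod (F n x - F (r k) x))\<^sup>2)) \<partial>?M)"
    proof (rule nn_integral_mono_AE)
      show "AE x in ?M. ennreal ((cmod (F n x - f x))\<^sup>2) \<le> liminf (\<lambda>k. ennreal ((cmod (F n x - F (r k) x))\<^sup>2))"
        using lim
      proof eventually_elim
        fix x assume "(\<lambda>k. F (r k) x) \<longlonglongrightarrow> f x"
        then have "(\<lambda>k. ennreal ((cmod (F n x - F (r k) x))\<^sup>2)) \<longlonglongrightarrow> ennreal ((cmod (F n x - f x))\<^sup>2)"
          by (intro tendsto_ennrealI tendsto_power tendsto_norm tendsto_diff tendsto_const)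
        then show "ennreal ((cmod (F n x - f x))\<^sup>2) \<le> liminf (\<lambda>k. ennreal ((cmod (F n x - F (r k) x))\<^sup>2))"
          using lim_imp_Liminf[OF sequentially_bot] by (metis order_refl)
      qed
    qed
    also have "\<dots> \<le> liminf (\<lambda>k. \<integral>\<^sup>+ x. ennreal ((cmod (F n x - F (r k) x))\<^sup>2) \<partial>?M)"
    proof -
      have "(\<lambda>x. ennreal ((cmod (F n x - F (r k) x))\<^sup>2)) \<in> borel_measurable ?M" for k
        using meas[of n] meas[of "r k"] by measurable
      then show ?thesis by (rule nn_integral_liminf)
    qed
    also have "\<dots> \<le> ennreal B"
    proof (rule Liminf_le)
      have "(\<integral>\<^sup>+ x. ennreal ((cmod (F n x - F (r k) x))\<^sup>2) \<partial>?M) \<le> ennreal B" if "k \<ge> N" for k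
      proof -
        have "(\<integral>\<^sup>+ x. ennreal ((cmod (F n x - F (r k) x))\<^sup>2) \<partial>?M) = ennreal ((norm_L2 \<Omega> (\<lambda>x. F n x - F (r k) x))\<^sup>2)"
          unfolding norm_L2_sq by (rule nn_integral_eq_integral[OF L2D(2)[OF L2_diff[OF F F]]]) simp
        also have "\<dots> \<le> ennreal B" using B[of "r k"] seq_suble[OF r(1), of k] that by (intro ennreal_leI) simp
        finally show ?thesis .
      qed
      then show "\<forall>\<^sub>F k in sequentially. (\<integral>\<^sup>+ x. ennreal ((cmod (F n x - F (r k) x))\<^sup>2) \<partial>?M) \<le> ennreal B"
        unfolding eventually_sequentially by blast
    qed simp
    finally have le: "(\<integral>\<^sup>+ x. ennreal ((cmod (F n x - f x))\<^sup>2) \<partial>?M) \<le> ennreal B" .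
    have m: "(\<lambda>x. F n x - f x) \<in> borel_measurable ?M" using meas[of n] fm by measurable
    have i: "integrable ?M (\<lambda>x. (cmod (F n x - f x))\<^sup>2)"
    proof (rule integrableI_bounded)
      show "(\<lambda>x. (cmod (F n x - f x))\<^sup>2) \<in> borel_measurable ?M" using m by measurable
      show "(\<integral>\<^sup>+ x. ennreal (norm ((cmod (F n x - f x))\<^sup>2)) \<partial>?M) < \<infinity>"
        using le ennreal_less_top[of B] by (simp add: order_le_less_trans)
    qed
    have "ennreal ((norm_L2 \<Omega> (\<lambda>x. F n x - f x))\<^sup>2) \<le> ennreal B"
      using le nn_integral_eq_integral[OF i] unfolding norm_L2_sq by simp
    then show ?thesis using L2I[OF m i] B0 by (simp add: ennreal_le_iff)
  qed
  have ev: "\<exists>N. \<forall>n\<ge>N. L2 \<Omega> (\<lambda>x. F n x - f x) \<and> (norm_L2 \<Omega> (\<lambda>x. F n x - f x))\<^sup>2 \<le> \<epsilon>" if e0: "\<epsilon> > 0" for \<epsilon>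
  proof -
    obtain N where N: "\<forall>m\<ge>N. \<forall>n\<ge>N. (norm_L2 \<Omega> (\<lambda>x. F m x - F n x))\<^sup>2 < \<epsilon>" using Cau2[OF e0] by blast
    then have "L2 \<Omega> (\<lambda>x. F n x - f x) \<and> (norm_L2 \<Omega> (\<lambda>x. F n x - f x))\<^sup>2 \<le> \<epsilon>" if "n \<ge> N" for n
      using fatou[of N n \<epsilon>] that e0 less_imp_le by (simp add: less_imp_le)
    then show ?thesis by blast
  qed
  obtain N where "L2 \<Omega> (\<lambda>x. F N x - f x)" using ev[of 1] by auto
  then have "L2 \<Omega> f" using L2_diff[OF F[of N], of "\<lambda>x. F N x - f x"] by simp
  moreover have "(\<lambda>n. (norm_L2 \<Omega> (\<lambda>x. F n x - f x))\<^sup>2) \<longlonglongrightarrow> 0"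
  proof (rule LIMSEQ_I)
    fix \<epsilon> :: real assume "\<epsilon> > 0"
    then obtain N where "\<forall>n\<ge>N. (norm_L2 \<Omega> (\<lambda>x. F n x - f x))\<^sup>2 \<le> \<epsilon> / 2" using ev[of "\<epsilon>/2"] by auto
    then show "\<exists>N. \<forall>n\<ge>N. norm ((norm_L2 \<Omega> (\<lambda>x. F n x - f x))\<^sup>2 - 0) < \<epsilon>"
      using \<open>\<epsilon> > 0\<close> by (intro exI[of _ N]) fastforce
  qed
  then have "(\<lambda>n. sqrt ((norm_L2 \<Omega> (\<lambda>x. F n x - f x))\<^sup>2)) \<longlonglongrightarrow> sqrt 0" by (rule tendsto_real_sqrt)
  then have "(\<lambda>n. norm_L2 \<Omega> (\<lambda>x. F n x - f x)) \<longlonglongrightarrow> 0"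
    by (simp add: abs_of_nonneg[OF norm_L2_nonneg])
  ultimately show ?thesis by blast
qed

section \<open>Maps into L2 that are linear almost everywhere, and bounded forms built from
  them\<close>

context complex_vector_space
begin

text \<open>Values, components, weak derivatives and weak divergences all have this shape. The
  exceptional null set may depend on the vectors and on the scalar.\<close>

definition aelin :: "(real^'n::finite) set \<Rightarrow> 'a set \<Rightarrow> ('a \<Rightarrow> real^'n \<Rightarrow> complex) \<Rightarrow> bool" where
  "aelin \<Omega> S L \<longleftrightarrow> (\<forall>u\<in>S. L2 \<Omega> (L u)) \<and>
     (\<forall>u\<in>S. \<forall>v\<in>S. AE x in lebesgue_on \<Omega>. L (u + v) x = L u x + L v x) \<and>
     (\<forall>c. \<forall>u\<in>S. AE x in lebesgue_on \<Omega>. L (c \<odot> u) x = c * L u x)"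

lemma aelinI:
  assumes "\<And>u. u \<in> S \<Longrightarrow> L2 \<Omega> (L u)"
    "\<And>u v. u \<in> S \<Longrightarrow> v \<in> S \<Longrightarrow> AE x in lebesgue_on \<Omega>. L (u + v) x = L u x + L v x"
    "\<And>c u. u \<in> S \<Longrightarrow> AE x in lebesgue_on \<Omega>. L (c \<odot> u) x = c * L u x"
  shows "aelin \<Omega> S L"
  using assms unfolding aelin_def by blast

lemma aelinD:
  assumes "aelin \<Omega> S L" "u \<in> S"
  shows "L2 \<Omega> (L u)" "v \<in> S \<Longrightarrow> AE x in lebesgue_on \<Omega>. L (u + v) x = L u x + L v x"
    "AE x in lebesgue_on \<Omega>. L (c \<odot> u) x = c * L u x"
  using assms unfolding aelin_def by blast+

lemma aelin_diff:
  assumes "aelin \<Omega> S L" "subspace S" "u \<in> S" "v \<in> S"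
  shows "AE x in lebesgue_on \<Omega>. L (u - v) x = L u x - L v x"
proof -
  have m: "(-1) \<odot> v \<in> S" using assms subspace_scale by blast
  have "AE x in lebesgue_on \<Omega>. L (u + (-1) \<odot> v) x = L u x - L v x"
    using aelinD(2)[OF assms(1,3) m] aelinD(3)[OF assms(1,4), of "-1"] by eventually_elim simp
  then show ?thesis by simp
qed

lemma aelin_add:
  assumes "aelin \<Omega> S L" "aelin \<Omega> S L'"
  shows "aelin \<Omega> S (\<lambda>u x. L u x + L' u x)"
proof (rule aelinI)
  fix u v assume uv: "u \<in> S" "v \<in> S"
  show "AE x in lebesgue_on \<Omega>. L (u + v) x + L' (u + v) x = L u x + L' u x + (L v x + L' v x)"
    using aelinD(2)[OF assms(1) uv] aelinD(2)[OF assms(2) uv] by eventually_elim simp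
next
  fix c u assume u: "u \<in> S"
  show "AE x in lebesgue_on \<Omega>. L (c \<odot> u) x + L' (c \<odot> u) x = c * (L u x + L' u x)"
    using aelinD(3)[OF assms(1) u, of c] aelinD(3)[OF assms(2) u, of c] by eventually_elim (simp add: algebra_simps)
qed (use assms aelinD(1) L2_add in blast)

lemma aelin_bounded_mult:
  assumes "aelin \<Omega> S L" "k \<in> borel_measurable (lebesgue_on \<Omega>)" "\<And>x. x \<in> \<Omega> \<Longrightarrow> cmod (k x) \<le> B"
  shows "aelin \<Omega> S (\<lambda>u x. k x * L u x)"
proof (rule aelinI)
  show "L2 \<Omega> (\<lambda>x. k x * L u x)" if "u \<in> S" for u
    by (rule L2_bounded_mult[OF aelinD(1)[OF assms(1) that] assms(2,3)])
next
  fix u v assume uv: "u \<in> S" "v \<in> S"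
  show "AE x in lebesgue_on \<Omega>. k x * L (u + v) x = k x * L u x + k x * L v x"
    using aelinD(2)[OF assms(1) uv] by eventually_elim (simp add: algebra_simps)
next
  fix c u assume u: "u \<in> S"
  show "AE x in lebesgue_on \<Omega>. k x * L (c \<odot> u) x = c * (k x * L u x)"
    using aelinD(3)[OF assms(1) u, of c] by eventually_elim (simp add: algebra_simps)
qed

lemma aelin_cmult: "aelin \<Omega> S L \<Longrightarrow> aelin \<Omega> S (\<lambda>u x. c * L u x)"
  by (rule aelin_bounded_mult[of \<Omega> S L "\<lambda>_. c" "cmod c"]) auto

lemma aelin_zero: "aelin \<Omega> S (\<lambda>u x. 0)"
  by (rule aelinI) (auto simp: L2_zero)

lemma aelin_sum:
  assumes "\<And>i. i \<in> I \<Longrightarrow> aelin \<Omega> S (L i)"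
  shows "aelin \<Omega> S (\<lambda>u x. \<Sum>i\<in>I. L i u x)"
  using assms by (induction I rule: infinite_finite_induct) (auto simp: aelin_zero intro!: aelin_add)

text \<open>Integrals ignore null sets, so linearity almost everywhere of the two maps already gives
  exact sesquilinearity.\<close>

lemma sesq_inner_L2:
  assumes L: "aelin \<Omega> S L" and L': "aelin \<Omega> S L'" and S: "subspace S"
  shows "sesq S (\<lambda>u v. inner_L2 \<Omega> (L u) (L' v))"
proof -
  have s: "fn.sesq {f. L2 \<Omega> f} (inner_L2 \<Omega>)" using fn.psdD(1)[OF psd_inner_L2] .
  note fs = fn.sesqD[OF s, simplified]
  show ?thesis
    unfolding sesq_def
  proof (intro conjI ballI allI)
    fix x y z assume m: "x \<in> S" "y \<in> S" "z \<in> S"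
    then have xy: "x + y \<in> S" using S subspace_add by blast
    have "inner_L2 \<Omega> (L (x + y)) (L' z) = inner_L2 \<Omega> (L x + L y) (L' z)"
      using aelinD(1)[OF L] aelinD(1)[OF L'] m xy aelinD(2)[OF L m(1,2)]
      by (intro inner_L2_cong_AE) (auto simp: plus_fun_def L2_add)
    then show "inner_L2 \<Omega> (L (x + y)) (L' z) = inner_L2 \<Omega> (L x) (L' z) + inner_L2 \<Omega> (L y) (L' z)"
      using fs(1) aelinD(1)[OF L] aelinD(1)[OF L'] m by simp
    have "inner_L2 \<Omega> (L z) (L' (x + y)) = inner_L2 \<Omega> (L z) (L' x + L' y)"
      using aelinD(1)[OF L] aelinD(1)[OF L'] m xy aelinD(2)[OF L' m(1,2)]
      by (intro inner_L2_cong_AE) (auto simp: plus_fun_def L2_add)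
    then show "inner_L2 \<Omega> (L z) (L' (x + y)) = inner_L2 \<Omega> (L z) (L' x) + inner_L2 \<Omega> (L z) (L' y)"
      using fs(2) aelinD(1)[OF L] aelinD(1)[OF L'] m by simp
  next
    fix c x y assume m: "x \<in> S" "y \<in> S"
    then have cx: "c \<odot> x \<in> S" "c \<odot> y \<in> S" using S subspace_scale by blast+
    have "inner_L2 \<Omega> (L (c \<odot> x)) (L' y) = inner_L2 \<Omega> (\<lambda>t. c * L x t) (L' y)"
      using aelinD(1)[OF L] aelinD(1)[OF L'] m cx aelinD(3)[OF L m(1)]
      by (intro inner_L2_cong_AE) (auto simp: L2_cmult)
    then show "inner_L2 \<Omega> (L (c \<odot> x)) (L' y) = c * inner_L2 \<Omega> (L x) (L' y)"
      using fs(3) aelinD(1)[OF L] aelinD(1)[OF L'] m by simp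
    have "inner_L2 \<Omega> (L x) (L' (c \<odot> y)) = inner_L2 \<Omega> (L x) (\<lambda>t. c * L' y t)"
      using aelinD(1)[OF L] aelinD(1)[OF L'] m cx aelinD(3)[OF L' m(2)]
      by (intro inner_L2_cong_AE) (auto simp: L2_cmult)
    then show "inner_L2 \<Omega> (L x) (L' (c \<odot> y)) = cnj c * inner_L2 \<Omega> (L x) (L' y)"
      using fs(4) aelinD(1)[OF L] aelinD(1)[OF L'] m by simp
  qed
qed

lemma psd_inner_aelin:
  assumes "aelin \<Omega> S L" "subspace S"
  shows "psd S (\<lambda>u v. inner_L2 \<Omega> (L u) (L v))"
proof (rule psdI)
  show "inner_L2 \<Omega> (L y) (L x) = cnj (inner_L2 \<Omega> (L x) (L y))" for x y by (rule inner_L2_commute)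
qed (auto simp: inner_L2_self sesq_inner_L2[OF assms(1,1,2)])

lemma norm_L2_aelin_diff:
  assumes "aelin \<Omega> S L" "subspace S" "u \<in> S" "v \<in> S"
  shows "norm_L2 \<Omega> (L (u - v)) = norm_L2 \<Omega> (\<lambda>x. L u x - L v x)"
  using assms aelin_diff[OF assms] aelinD(1)[OF assms(1)] subspace_diff
  by (intro norm_L2_cong_AE L2_diff) blast+

definition fbounded :: "'a set \<Rightarrow> ('a \<Rightarrow> 'a \<Rightarrow> complex) \<Rightarrow> ('a \<Rightarrow> 'a \<Rightarrow> complex) \<Rightarrow> bool" where
  "fbounded S f B \<longleftrightarrow> (\<exists>M\<ge>0. \<forall>x\<in>S. \<forall>y\<in>S. cmod (B x y) \<le> M * qn f x * qn f y)"

definition lbounded :: "(real^'n::finite) set \<Rightarrow> 'a set \<Rightarrow> ('a \<Rightarrow> 'a \<Rightarrow> complex) \<Rightarrow> ('a \<Rightarrow> real^'n \<Rightarrow> complex) \<Rightarrow> bool" where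
  "lbounded \<Omega> S f L \<longleftrightarrow> (\<exists>M\<ge>0. \<forall>x\<in>S. norm_L2 \<Omega> (L x) \<le> M * qn f x)"

lemma fbounded_add:
  assumes "fbounded S f B" "fbounded S f C"
  shows "fbounded S f (\<lambda>x y. B x y + C x y)"
proof -
  obtain M N where M: "M \<ge> 0" "\<And>x y. x \<in> S \<Longrightarrow> y \<in> S \<Longrightarrow> cmod (B x y) \<le> M * qn f x * qn f y"
    and N: "N \<ge> 0" "\<And>x y. x \<in> S \<Longrightarrow> y \<in> S \<Longrightarrow> cmod (C x y) \<le> N * qn f x * qn f y"
    using assms unfolding fbounded_def by blast
  have "cmod (B x y + C x y) \<le> (M + N) * qn f x * qn f y" if "x \<in> S" "y \<in> S" for x y
    using norm_triangle_ineq[of "B x y" "C x y"] M(2)[OF that] N(2)[OF that] by (simp add: algebra_simps)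
  then show ?thesis unfolding fbounded_def using M(1) N(1) by (intro exI[of _ "M + N"]) auto
qed

lemma fbounded_cmult:
  assumes "fbounded S f B"
  shows "fbounded S f (\<lambda>x y. c * B x y)"
proof -
  obtain M where M: "M \<ge> 0" "\<And>x y. x \<in> S \<Longrightarrow> y \<in> S \<Longrightarrow> cmod (B x y) \<le> M * qn f x * qn f y"
    using assms unfolding fbounded_def by blast
  have "cmod (c * B x y) \<le> (cmod c * M) * qn f x * qn f y" if "x \<in> S" "y \<in> S" for x y
    using mult_left_mono[OF M(2)[OF that], of "cmod c"] by (simp add: norm_mult mult.assoc)
  then show ?thesis unfolding fbounded_def using M(1) by (intro exI[of _ "cmod c * M"]) auto
qed

lemma fbounded_sum:
  assumes "\<And>i. i \<in> I \<Longrightarrow> fbounded S f (B i)"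
  shows "fbounded S f (\<lambda>x y. \<Sum>i\<in>I. B i x y)"
  using assms
proof (induction I rule: infinite_finite_induct)
  case (insert i I)
  then show ?case using fbounded_add[of S f "B i" "\<lambda>x y. \<Sum>i\<in>I. B i x y"] by simp
qed (auto simp: fbounded_def)

lemma fbounded_inner:
  assumes "aelin \<Omega> S L" "aelin \<Omega> S L'" "lbounded \<Omega> S f L" "lbounded \<Omega> S f L'"
  shows "fbounded S f (\<lambda>x y. inner_L2 \<Omega> (L x) (L' y))"
proof -
  obtain M N where M: "M \<ge> 0" "\<And>x. x \<in> S \<Longrightarrow> norm_L2 \<Omega> (L x) \<le> M * qn f x"
    and N: "N \<ge> 0" "\<And>x. x \<in> S \<Longrightarrow> norm_L2 \<Omega> (L' x) \<le> N * qn f x"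
    using assms(3,4) unfolding lbounded_def by blast
  have "cmod (inner_L2 \<Omega> (L x) (L' y)) \<le> (M * N) * qn f x * qn f y" if "x \<in> S" "y \<in> S" for x y
  proof -
    have "cmod (inner_L2 \<Omega> (L x) (L' y)) \<le> norm_L2 \<Omega> (L x) * norm_L2 \<Omega> (L' y)"
      using cmod_inner_L2_le aelinD(1)[OF assms(1) that(1)] aelinD(1)[OF assms(2) that(2)] by blast
    also have "\<dots> \<le> (M * qn f x) * (N * qn f y)"
      using M(2)[OF that(1)] N(2)[OF that(2)] norm_L2_nonneg[of \<Omega> "L x"] norm_L2_nonneg[of \<Omega> "L' y"]
      by (intro mult_mono) linarith+
    finally show ?thesis by (simp add: algebra_simps)
  qed
  then show ?thesis unfolding fbounded_def using M(1) N(1) by (intro exI[of _ "M * N"]) auto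
qed

lemma lbounded_add:
  assumes "aelin \<Omega> S L" "aelin \<Omega> S L'" "lbounded \<Omega> S f L" "lbounded \<Omega> S f L'"
  shows "lbounded \<Omega> S f (\<lambda>u x. L u x + L' u x)"
proof -
  obtain M N where M: "M \<ge> 0" "\<And>x. x \<in> S \<Longrightarrow> norm_L2 \<Omega> (L x) \<le> M * qn f x"
    and N: "N \<ge> 0" "\<And>x. x \<in> S \<Longrightarrow> norm_L2 \<Omega> (L' x) \<le> N * qn f x"
    using assms(3,4) unfolding lbounded_def by blast
  have "norm_L2 \<Omega> (\<lambda>x. L u x + L' u x) \<le> (M + N) * qn f u" if "u \<in> S" for u
    using norm_L2_triangle[OF aelinD(1)[OF assms(1) that] aelinD(1)[OF assms(2) that]] M(2)[OF that] N(2)[OF that]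
    by (simp add: algebra_simps)
  then show ?thesis unfolding lbounded_def using M(1) N(1) by (intro exI[of _ "M + N"]) auto
qed

lemma lbounded_bounded_mult:
  assumes "aelin \<Omega> S L" "k \<in> borel_measurable (lebesgue_on \<Omega>)" "\<And>x. x \<in> \<Omega> \<Longrightarrow> cmod (k x) \<le> B"
    and B: "0 \<le> B" and "lbounded \<Omega> S f L"
  shows "lbounded \<Omega> S f (\<lambda>u x. k x * L u x)"
proof -
  obtain M where M: "M \<ge> 0" "\<And>x. x \<in> S \<Longrightarrow> norm_L2 \<Omega> (L x) \<le> M * qn f x"
    using assms(5) unfolding lbounded_def by blast
  have "norm_L2 \<Omega> (\<lambda>x. k x * L u x) \<le> (B * M) * qn f u" if "u \<in> S" for u
    using norm_L2_bounded_mult[OF aelinD(1)[OF assms(1) that] assms(2,3) B] mult_left_mono[OF M(2)[OF that] B]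
    by (simp add: mult.assoc)
  then show ?thesis unfolding lbounded_def using M(1) B by (intro exI[of _ "B * M"]) auto
qed

lemma lbounded_cmult: "aelin \<Omega> S L \<Longrightarrow> lbounded \<Omega> S f L \<Longrightarrow> lbounded \<Omega> S f (\<lambda>u x. c * L u x)"
  by (rule lbounded_bounded_mult[of \<Omega> S L "\<lambda>_. c" "cmod c"]) auto

lemma lbounded_sum:
  assumes "\<And>i. i \<in> I \<Longrightarrow> aelin \<Omega> S (L i)" "\<And>i. i \<in> I \<Longrightarrow> lbounded \<Omega> S f (L i)"
  shows "lbounded \<Omega> S f (\<lambda>u x. \<Sum>i\<in>I. L i u x)"
  using assms
proof (induction I rule: infinite_finite_induct)
  case (insert i I)
  then show ?case using lbounded_add[of \<Omega> S "L i" "\<lambda>u x. \<Sum>i\<in>I. L i u x" f] aelin_sum[of I \<Omega> S L] by simp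
qed (auto simp: lbounded_def norm_L2_def)

end

subsection \<open>Test functions\<close>

text \<open>The functions \<open>p(1/t) exp(-1/t)\<close>, extended by zero to \<open>t \<le> 0\<close>, are closed under
  differentiation; products of them in the coordinates provide the test functions.\<close>

definition expoly :: "real poly \<Rightarrow> real \<Rightarrow> real" where
  "expoly p t = (if 0 < t then poly p (1 / t) * exp (- (1 / t)) else 0)"

text \<open>With \<open>s = 1/t\<close> the derivative of \<open>p(s) exp(-s)\<close> in
  \<open>t\<close> is \<open>s^2 (p(s) - p'(s)) exp(-s)\<close>; the coefficient list is the factor
  \<open>s^2\<close>.\<close>

definition expoly_deriv :: "real poly \<Rightarrow> real poly" where
  "expoly_deriv p = [:0, 0, 1:] * (p - pderiv p)"

lemma poly_exp_decay: "((\<lambda>s. poly p s * exp (- s)) \<longlongrightarrow> (0::real)) at_top"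
proof -
  have "((\<lambda>s. \<Sum>i\<le>degree p. coeff p i * (s ^ i / exp s)) \<longlongrightarrow> (\<Sum>i\<le>degree p. coeff p i * 0)) at_top"
    by (intro tendsto_sum tendsto_mult tendsto_const tendsto_power_div_exp_0)
  moreover have "poly p s * exp (- s) = (\<Sum>i\<le>degree p. coeff p i * (s ^ i / exp s))" for s :: real
    by (simp add: poly_altdef sum_distrib_right exp_minus divide_inverse mult.assoc)
  ultimately show ?thesis by simp
qed

lemma expoly_has_derivative: "(expoly p has_real_derivative expoly (expoly_deriv p) t) (at t)"
proof -
  consider "t > 0" | "t < 0" | "t = 0" by linarith
  then show ?thesis
  proof cases
    case 1
    have "((\<lambda>t. poly p (1 / t) * exp (- (1 / t))) has_real_derivative
        (poly (pderiv p) (1 / t) * (- (1 / t\<^sup>2))) * exp (- (1 / t)) + exp (- (1 / t)) * (1 / t\<^sup>2) * poly p (1 / t)) (at t)"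
      using 1 by (auto intro!: derivative_eq_intros simp: power2_eq_square)
    moreover have "(poly (pderiv p) (1 / t) * (- (1 / t\<^sup>2))) * exp (- (1 / t)) + exp (- (1 / t)) * (1 / t\<^sup>2) * poly p (1 / t)
        = expoly (expoly_deriv p) t"
      using 1 by (simp add: expoly_def expoly_deriv_def power2_eq_square field_simps)
    ultimately have "((\<lambda>t. poly p (1 / t) * exp (- (1 / t))) has_real_derivative expoly (expoly_deriv p) t) (at t)"
      by simp
    then show ?thesis
      by (rule has_field_derivative_transform_within_open[of _ _ _ "{0<..}"]) (use 1 in \<open>auto simp: expoly_def\<close>)
  next
    case 2
    have "((\<lambda>t. 0) has_real_derivative expoly (expoly_deriv p) t) (at t)" using 2 by (simp add: expoly_def)
    then show ?thesis
      by (rule has_field_derivative_transform_within_open[of _ _ _ "{..<0}"]) (use 2 in \<open>auto simp: expoly_def\<close>)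
  next
    case 3
    \<comment> \<open>The difference quotient at 0 from the right is \<open>s p(s) exp(-s)\<close>
      with \<open>s = 1/h\<close>; the extra factor \<open>s\<close> is the division by
      \<open>h\<close>.\<close>
    have "((\<lambda>s. poly ([:0,1:] * p) s * exp (- s)) \<longlongrightarrow> 0) at_top" by (rule poly_exp_decay)
    then have "((\<lambda>t. poly ([:0,1:] * p) (inverse t) * exp (- inverse t)) \<longlongrightarrow> 0) (at_right 0)"
      by (rule filterlim_compose[OF _ filterlim_inverse_at_top_right])
    then have R: "((\<lambda>h. (expoly p (0 + h) - expoly p 0) / h) \<longlongrightarrow> 0) (at_right 0)"
    proof (rule Lim_transform_eventually)
      show "\<forall>\<^sub>F t in at_right 0. poly ([:0,1:] * p) (inverse t) * exp (- inverse t) = (expoly p (0 + t) - expoly p 0) / t"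
        unfolding eventually_at_right_field by (intro exI[of _ 1]) (simp add: expoly_def divide_inverse)
    qed
    have L: "((\<lambda>h. (expoly p (0 + h) - expoly p 0) / h) \<longlongrightarrow> 0) (at_left 0)"
    proof (rule Lim_transform_eventually[OF tendsto_const])
      show "\<forall>\<^sub>F t in at_left 0. 0 = (expoly p (0 + t) - expoly p 0) / t"
        unfolding eventually_at_left_field by (intro exI[of _ "-1"]) (simp add: expoly_def)
    qed
    show ?thesis unfolding DERIV_def 3 using L R by (simp add: filterlim_at_split expoly_def)
  qed
qed

text \<open>Smoothness is proved for a whole class at once: every member is differentiable and its
  partial derivatives are members again, so an induction on the list of indices handles all iterated
  derivatives.\<close>

inductive_set bump_algebra :: "(real^'n::finite \<Rightarrow> real) set" where
  const: "(\<lambda>x. c) \<in> bump_algebra"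
| expoly: "(\<lambda>x. expoly p (c * x $ i + d)) \<in> bump_algebra"
| add: "f \<in> bump_algebra \<Longrightarrow> g \<in> bump_algebra \<Longrightarrow> (\<lambda>x. f x + g x) \<in> bump_algebra"
| mult: "f \<in> bump_algebra \<Longrightarrow> g \<in> bump_algebra \<Longrightarrow> (\<lambda>x. f x * g x) \<in> bump_algebra"

lemma partial_eqI: "(f has_derivative D) (at x) \<Longrightarrow> partial i f x = D (axis i 1)"
  unfolding partial_def using frechet_derivative_at by metis

lemma differentiable_has_derivative:
  "f differentiable (at x) \<Longrightarrow> (f has_derivative frechet_derivative f (at x)) (at x)"
  using frechet_derivative_works by blast

lemma partial_add:
  assumes "f differentiable (at x)" "g differentiable (at x)"
  shows "partial i (\<lambda>x. f x + g x) x = partial i f x + partial i g x"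
  unfolding partial_def[of i f] partial_def[of i g]
  by (rule partial_eqI) (intro has_derivative_add differentiable_has_derivative assms)

lemma partial_mult:
  assumes "f differentiable (at x)" "g differentiable (at x)"
  shows "partial i (\<lambda>x. f x * g x) x = f x * partial i g x + partial i f x * g x"
  unfolding partial_def[of i f] partial_def[of i g]
  by (rule partial_eqI) (intro has_derivative_mult differentiable_has_derivative assms)

lemma bump_algebra_diff:
  fixes f :: "real^'n::finite \<Rightarrow> real"
  assumes "f \<in> bump_algebra"
  shows "(\<forall>x. f differentiable (at x)) \<and> (\<forall>i. partial i f \<in> bump_algebra)"
  using assms
proof induction
  case (const c)
  have "partial i (\<lambda>x. c) = (\<lambda>x. 0)" for i :: 'n
    by (rule ext) (rule partial_eqI[of _ "\<lambda>_. 0", simplified], simp)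
  then show ?case by (auto intro: bump_algebra.const)
next
  case (expoly p c i d)
  have D: "((\<lambda>x. expoly p (c * x $ i + d)) has_derivative
      (\<lambda>v. expoly (expoly_deriv p) (c * x $ i + d) * (c * v $ i))) (at x)" for x :: "real^'n"
  proof -
    have "((\<lambda>x. c * x $ i + d) has_derivative (\<lambda>v. c * v $ i)) (at x)"
      by (auto intro!: derivative_eq_intros bounded_linear_imp_has_derivative bounded_linear_vec_nth)
    then show ?thesis
      using has_derivative_compose[OF _ expoly_has_derivative[unfolded has_field_derivative_def]]
      by fastforce
  qed
  have "partial j (\<lambda>x. expoly p (c * x $ i + d)) = (\<lambda>x. (if j = i then c else 0) * expoly (expoly_deriv p) (c * x $ i + d))" for j
    by (rule ext) (auto simp: partial_eqI[OF D] axis_def)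
  moreover have "(\<lambda>x. (if j = i then c else 0) * expoly (expoly_deriv p) (c * x $ i + d)) \<in> bump_algebra" for j
    by (intro bump_algebra.mult bump_algebra.const bump_algebra.expoly)
  ultimately show ?case using D differentiableI by metis
next
  case (add f g)
  then have "partial i (\<lambda>x. f x + g x) = (\<lambda>x. partial i f x + partial i g x)" for i
    by (intro ext partial_add) auto
  then show ?case using add by (auto intro!: bump_algebra.add)
next
  case (mult f g)
  then have "partial i (\<lambda>x. f x * g x) = (\<lambda>x. f x * partial i g x + partial i f x * g x)" for i
    by (intro ext partial_mult) auto
  then show ?case using mult by (auto intro!: bump_algebra.add bump_algebra.mult)
qed

lemma bump_algebra_smooth:
  assumes "f \<in> bump_algebra"
  shows "smooth_fun f"
proof -
  have "iter_partial is f \<in> bump_algebra" for "is"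
    by (induction "is") (use assms bump_algebra_diff in auto)
  then show ?thesis unfolding smooth_fun_def using bump_algebra_diff by blast
qed

lemma bump_algebra_prod: "(\<And>i. i \<in> I \<Longrightarrow> f i \<in> bump_algebra) \<Longrightarrow> (\<lambda>x. \<Prod>i\<in>I. f i x) \<in> bump_algebra"
  by (induction I rule: infinite_finite_induct) (auto intro: bump_algebra.const bump_algebra.mult)

text \<open>\<open>exp(-1/(mt))\<close> tends to the indicator of \<open>t > 0\<close>, so these bumps increase to the
  indicator of the box.\<close>

definition box_bump :: "real^'n::finite \<Rightarrow> real^'n \<Rightarrow> real \<Rightarrow> real^'n \<Rightarrow> real" where
  "box_bump a b m x = (\<Prod>i\<in>UNIV. expoly 1 (m * x $ i + - (m * a $ i)) * expoly 1 (- m * x $ i + m * b $ i))"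

lemma expoly_1_bounds: "0 \<le> expoly 1 t" "expoly 1 t \<le> 1" "0 < expoly 1 t \<longleftrightarrow> 0 < t"
  unfolding expoly_def by auto

lemma box_bump_bounds: "0 \<le> box_bump a b m x" "box_bump a b m x \<le> 1"
  unfolding box_bump_def using expoly_1_bounds
  by (auto intro!: prod_nonneg prod_le_1 mult_nonneg_nonneg mult_le_one)

lemma box_bump_zero:
  assumes "m > 0" "x \<notin> box a b"
  shows "box_bump a b m x = 0"
proof -
  obtain i where i: "\<not> (a $ i < x $ i \<and> x $ i < b $ i)" using assms(2) by (auto simp: mem_box_cart)
  have "expoly 1 (m * x $ i + - (m * a $ i)) * expoly 1 (- m * x $ i + m * b $ i) = 0"
    using i assms(1) by (auto simp: expoly_def)
  then show ?thesis unfolding box_bump_def by (intro prod_zero) auto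
qed

lemma box_bump_tendsto:
  assumes "x \<in> box a b"
  shows "(\<lambda>k. box_bump a b (real (Suc k)) x) \<longlonglongrightarrow> 1"
proof -
  have one: "(\<lambda>k. expoly 1 (real (Suc k) * s)) \<longlonglongrightarrow> 1" if "s > 0" for s
  proof -
    have "(\<lambda>k. exp (- (inverse (real (Suc k)) * (1 / s)))) \<longlonglongrightarrow> exp (- (0 * (1 / s)))"
      by (intro tendsto_exp tendsto_minus tendsto_mult LIMSEQ_inverse_real_of_nat tendsto_const)
    then show ?thesis using that by (simp add: expoly_def divide_inverse)
  qed
  have "(\<lambda>k. \<Prod>i\<in>UNIV. expoly 1 (real (Suc k) * (x $ i - a $ i)) * expoly 1 (real (Suc k) * (b $ i - x $ i))) \<longlonglongrightarrow> (\<Prod>i\<in>(UNIV::'a set). 1 * 1)"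
    using assms by (intro tendsto_prod tendsto_mult one) (auto simp: mem_box_cart)
  then show ?thesis unfolding box_bump_def by (simp add: algebra_simps)
qed

lemma box_bump_test_fun:
  assumes "m > 0" "cbox a b \<subseteq> \<Omega>"
  shows "test_fun \<Omega> (box_bump a b m)"
proof -
  have "{x. box_bump a b m x \<noteq> 0} \<subseteq> cbox a b" using box_bump_zero[OF assms(1)] box_subset_cbox by blast
  then have s: "tsupport (box_bump a b m) \<subseteq> cbox a b"
    unfolding tsupport_def by (intro closure_minimal closed_cbox)
  have "box_bump a b m \<in> bump_algebra"
    unfolding box_bump_def by (intro bump_algebra_prod bump_algebra.mult bump_algebra.expoly)
  then have "smooth_fun (box_bump a b m)" by (rule bump_algebra_smooth)
  moreover have "compact (tsupport (box_bump a b m))"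
    using s compact_Int_closed[OF compact_cbox, of "tsupport (box_bump a b m)" a b]
    unfolding tsupport_def by (simp add: inf.absorb_iff2)
  ultimately show ?thesis unfolding test_fun_def using s assms(2) by blast
qed

section \<open>The fundamental lemma of the calculus of variations\<close>

lemma AE_zero_if_box_integrals_zero:
  fixes h :: "real^'n::finite \<Rightarrow> real"
  assumes h: "integrable lborel h" and z: "\<And>c d. (LINT x|lborel. indicator (box c d) x * h x) = 0"
  shows "AE x in lborel. h x = 0"
proof -
  let ?p = "\<lambda>x. ennreal (h x)" and ?n = "\<lambda>x. ennreal (- h x)"
  have hm: "h \<in> borel_measurable borel" using borel_measurable_integrable[OF h] by simp
  have pm: "?p \<in> borel_measurable lborel" "?n \<in> borel_measurable lborel" using hm by simp_all
  have fin: "(\<integral>\<^sup>+x. ?p x \<partial>lborel) \<noteq> \<infinity>"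
  proof -
    have "(\<integral>\<^sup>+x. ?p x \<partial>lborel) \<le> (\<integral>\<^sup>+x. ennreal (norm (h x)) \<partial>lborel)" by (intro nn_integral_mono ennreal_leI) simp
    then show ?thesis using h unfolding integrable_iff_bounded by (auto simp: top_unique less_top[symmetric])
  qed
  have eq: "(\<integral>\<^sup>+x. ?p x * indicator (box c d) x \<partial>lborel) = (\<integral>\<^sup>+x. ?n x * indicator (box c d) x \<partial>lborel)" for c d
  proof -
    let ?h = "\<lambda>x. indicator (box c d) x * h x"
    have hi: "integrable lborel ?h" using integrable_mult_indicator[OF _ h, of "box c d"] by simp
    have pp: "(\<integral>\<^sup>+x. ?p x * indicator (box c d) x \<partial>lborel) = (\<integral>\<^sup>+x. ennreal (?h x) \<partial>lborel)"
      "(\<integral>\<^sup>+x. ?n x * indicator (box c d) x \<partial>lborel) = (\<integral>\<^sup>+x. ennreal (- ?h x) \<partial>lborel)"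
      by (auto intro!: nn_integral_cong simp: indicator_def)
    have f: "(\<integral>\<^sup>+x. ennreal (?h x) \<partial>lborel) \<noteq> \<infinity>" "(\<integral>\<^sup>+x. ennreal (- ?h x) \<partial>lborel) \<noteq> \<infinity>"
      using hi unfolding real_integrable_def by simp_all
    have "enn2real (\<integral>\<^sup>+x. ennreal (?h x) \<partial>lborel) = enn2real (\<integral>\<^sup>+x. ennreal (- ?h x) \<partial>lborel)"
      using real_lebesgue_integral_def[OF hi] z[of c d] by simp
    moreover have "A = B" if "enn2real A = enn2real B" "A \<noteq> \<infinity>" "B \<noteq> \<infinity>" for A B :: ennreal
      using that by (cases A rule: ennreal_cases; cases B rule: ennreal_cases) auto
    ultimately show ?thesis unfolding pp using f by blast
  qed
  \<comment> \<open>The positive and negative parts are densities of two measures that agree on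
    boxes. Boxes are stable under intersection and generate the Borel sets, so the measures, and
    then the densities, coincide.\<close>
  have "density lborel ?p = density lborel ?n"
  proof (rule measure_eqI_generator_eq)
    let ?E = "range (\<lambda>(a, b). box a b :: (real^'n) set)"
    show "Int_stable ?E" by (auto simp: Int_stable_def Int_interval_cart box_Int_box)
    show "?E \<subseteq> Pow UNIV" by simp
    show "sets (density lborel ?p) = sigma_sets UNIV ?E" "sets (density lborel ?n) = sigma_sets UNIV ?E"
      by (simp_all add: borel_eq_box)
    show "emeasure (density lborel ?p) X = emeasure (density lborel ?n) X" if "X \<in> ?E" for X
      using that eq pm by (auto simp: emeasure_density)
    show "range (\<lambda>k. box (\<chi> i. - real k) (\<chi> i. real k)) \<subseteq> ?E" by auto
    show "(\<Union>k. box (\<chi> i. - real k) (\<chi> i. real k)) = (UNIV :: (real^'n) set)"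
    proof (intro set_eqI iffI UNIV_I)
      fix x :: "real^'n"
      obtain k :: nat where k: "norm x < real k" using reals_Archimedean2 by blast
      have "\<bar>x $ i\<bar> < real k" for i using component_le_norm_cart[of x i] k by linarith
      then show "x \<in> (\<Union>k. box (\<chi> i. - real k) (\<chi> i. real k))"
        by (auto simp: mem_box_cart abs_less_iff intro!: exI[of _ k]) (smt (verit))
    qed
    show "emeasure (density lborel ?p) (box (\<chi> i. - real k) (\<chi> i. real k)) \<noteq> \<infinity>" for k
    proof -
      have "emeasure (density lborel ?p) (box (\<chi> i. - real k) (\<chi> i. real k)) \<le> (\<integral>\<^sup>+x. ?p x \<partial>lborel)"
        using pm by (auto simp: emeasure_density intro!: nn_integral_mono split: split_indicator)
      then show ?thesis using fin by (auto simp: top_unique)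
    qed
  qed
  then have "AE x in lborel. ?p x = ?n x" using finite_density_unique[OF pm _ _ fin] by simp
  then show ?thesis
  proof eventually_elim
    fix x assume "?p x = ?n x"
    then show "h x = 0" by (smt (verit) ennreal_eq_zero_iff ennreal_neg)
  qed
qed

lemma integral_lebesgue_on_eq:
  fixes f :: "real^'n::finite \<Rightarrow> 'b::{banach, second_countable_topology}"
  assumes "\<Omega> \<in> sets lebesgue" "\<And>x. x \<notin> \<Omega> \<Longrightarrow> f x = 0"
  shows "(LINT x|lebesgue_on \<Omega>. f x) = (LINT x|lebesgue. f x)"
    "integrable (lebesgue_on \<Omega>) f \<longleftrightarrow> integrable lebesgue f"
proof -
  have "indicator \<Omega> x *\<^sub>R f x = f x" for x using assms(2)[of x] by (auto simp: indicator_def)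
  then show "(LINT x|lebesgue_on \<Omega>. f x) = (LINT x|lebesgue. f x)"
    "integrable (lebesgue_on \<Omega>) f \<longleftrightarrow> integrable lebesgue f"
    using assms(1) by (simp_all add: integral_restrict_space integrable_restrict_space)
qed

text \<open>Bumps converge to the indicator of a box, so the integrals of \<open>g\<close> over
  boxes with closure in the domain vanish. On each such box uniqueness of measures applies, and
  countably many of them cover the open set up to null boundaries.\<close>

lemma fundamental_lemma_real:
  fixes g :: "real^'n::finite \<Rightarrow> real"
  assumes O: "open \<Omega>" and g: "integrable (lebesgue_on \<Omega>) g"
    and z: "\<And>\<phi>. test_fun \<Omega> \<phi> \<Longrightarrow> (LINT x|lebesgue_on \<Omega>. g x * \<phi> x) = 0"
  shows "AE x in lebesgue_on \<Omega>. g x = 0"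
proof -
  have OM: "\<Omega> \<in> sets lebesgue" using O by (simp add: sets_completionI_sets)
  have box0: "(LINT x|lebesgue_on \<Omega>. indicator (box a b) x * g x) = 0" if ab: "cbox a b \<subseteq> \<Omega>" for a b
  proof -
    have "(\<lambda>k. LINT x|lebesgue_on \<Omega>. g x * box_bump a b (real (Suc k)) x) \<longlonglongrightarrow> (LINT x|lebesgue_on \<Omega>. indicator (box a b) x * g x)"
    proof (rule integral_dominated_convergence[where w = "\<lambda>x. norm (g x)"])
      have bm: "box_bump a b m \<in> borel_measurable borel" for m
      proof -
        have "continuous_on UNIV (box_bump a b m)"
        proof -
          have "box_bump a b m \<in> bump_algebra"
            unfolding box_bump_def by (intro bump_algebra_prod bump_algebra.mult bump_algebra.expoly)
          then show ?thesis using bump_algebra_diff differentiable_imp_continuous_within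
            by (metis continuous_at_imp_continuous_on)
        qed
        then show ?thesis by (rule borel_measurable_continuous_onI)
      qed
      have bm': "box_bump a b m \<in> borel_measurable (lebesgue_on \<Omega>)" for m
        using bm[of m] by (intro measurable_restrict_space1 measurable_completion) simp
      show "(\<lambda>x. g x * box_bump a b (real (Suc k)) x) \<in> borel_measurable (lebesgue_on \<Omega>)" for k
        using borel_measurable_integrable[OF g] bm' by measurable
      have "(indicator (box a b) :: _ \<Rightarrow> real) \<in> borel_measurable (lebesgue_on \<Omega>)"
        by (intro measurable_restrict_space1 measurable_completion) simp
      then show "(\<lambda>x. indicator (box a b) x * g x) \<in> borel_measurable (lebesgue_on \<Omega>)"
        using borel_measurable_integrable[OF g] by measurable
      show "integrable (lebesgue_on \<Omega>) (\<lambda>x. norm (g x))" using g by simp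
      show "AE x in lebesgue_on \<Omega>. (\<lambda>k. g x * box_bump a b (real (Suc k)) x) \<longlonglongrightarrow> indicator (box a b) x * g x"
      proof (rule AE_I2)
        fix x
        show "(\<lambda>k. g x * box_bump a b (real (Suc k)) x) \<longlonglongrightarrow> indicator (box a b) x * g x"
        proof (cases "x \<in> box a b")
          case True
          then show ?thesis using tendsto_mult[OF tendsto_const[of "g x"] box_bump_tendsto[OF True]] by simp
        next
          case False
          then show ?thesis using box_bump_zero[OF _ False] by simp
        qed
      qed
      show "AE x in lebesgue_on \<Omega>. norm (g x * box_bump a b (real (Suc k)) x) \<le> norm (g x)" for k
        by (intro AE_I2) (simp add: abs_mult abs_of_nonneg[OF box_bump_bounds(1)] mult_left_le box_bump_bounds(2))
    qed
    moreover have "(LINT x|lebesgue_on \<Omega>. g x * box_bump a b (real (Suc k)) x) = 0" for k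
      using z box_bump_test_fun[OF _ ab] by simp
    ultimately show ?thesis by (simp add: LIMSEQ_const_iff)
  qed
  have onbox: "AE x in lebesgue. x \<in> box a b \<longrightarrow> g x = 0" if ab: "cbox a b \<subseteq> \<Omega>" for a b
  proof -
    let ?h = "\<lambda>x. indicator (box a b) x * g x"
    have out: "?h x = 0" if "x \<notin> \<Omega>" for x using that ab box_subset_cbox by (auto simp: indicator_def)
    have "integrable (lebesgue_on \<Omega>) ?h"
    proof -
      have "box a b \<inter> \<Omega> = box a b" using ab box_subset_cbox by blast
      then have "box a b \<in> sets (lebesgue_on \<Omega>)"
        using OM by (auto simp: sets_restrict_space_iff)
      then show ?thesis using integrable_mult_indicator[OF _ g] by simp
    qed
    then have hi: "integrable lebesgue ?h" using integral_lebesgue_on_eq(2)[OF OM, of ?h] out by blast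
    \<comment> \<open>The uniqueness argument lives on the Borel sets, so the Lebesgue measurable
      function is replaced by a Borel representative.\<close>
    obtain h' where h': "h' \<in> borel_measurable lborel" "AE x in lborel. ?h x = h' x"
      using completion_ex_borel_measurable_real[OF borel_measurable_integrable[OF hi]] by blast
    have ae: "AE x in lebesgue. ?h x = h' x" using h'(2) by (rule AE_completion)
    have h'm: "h' \<in> borel_measurable lebesgue" using h'(1) by (rule measurable_completion)
    have "integrable lebesgue h'"
      using integrable_cong_AE_imp[OF hi h'm] ae by (auto simp: eq_commute)
    then have h'i: "integrable lborel h'" using h'(1) integrable_completion by blast
    have "(LINT x|lborel. indicator (box c d) x * h' x) = 0" for c d
    proof -
      \<comment> \<open>Boxes intersect in boxes, so testing the localized function with an
        arbitrary box is again an integral of \<open>g\<close> over a box whose closure stays inside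
        the domain.\<close>
      obtain a' b' where ab': "box a b \<inter> box c d = box a' b'" by (rule that[OF box_Int_box])
      have ind: "indicator (box c d) x * ?h x = indicator (box a' b') x * g x" for x
        using ab' by (auto simp: indicator_def)
      have "(LINT x|lborel. indicator (box c d) x * h' x) = (LINT x|lebesgue. indicator (box c d) x * h' x)"
        using h'(1) by (intro integral_completion[symmetric] borel_measurable_times) auto
      also have "\<dots> = (LINT x|lebesgue. indicator (box c d) x * ?h x)"
      proof (rule integral_cong_AE)
        have i: "(indicator (box c d) :: _ \<Rightarrow> real) \<in> borel_measurable lebesgue" by (intro measurable_completion) simp
        show "(\<lambda>x. indicator (box c d) x * h' x) \<in> borel_measurable lebesgue" using i h'm by measurable
        show "(\<lambda>x. indicator (box c d) x * ?h x) \<in> borel_measurable lebesgue"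
          using i borel_measurable_integrable[OF hi] by measurable
        show "AE x in lebesgue. indicator (box c d) x * h' x = indicator (box c d) x * ?h x"
          using ae by eventually_elim simp
      qed
      also have "\<dots> = (LINT x|lebesgue_on \<Omega>. indicator (box c d) x * ?h x)"
        using out by (intro integral_lebesgue_on_eq(1)[OF OM, symmetric]) auto
      also have "\<dots> = (LINT x|lebesgue_on \<Omega>. indicator (box a' b') x * g x)" unfolding ind ..
      also have "\<dots> = 0"
      proof (cases "box a' b' = {}")
        case False
        have "cbox a' b' = closure (box a' b')" using False by (simp add: closure_box)
        also have "\<dots> \<subseteq> cbox a b" using ab' box_subset_cbox by (intro closure_minimal closed_cbox) blast
        finally show ?thesis using box0 ab by blast
      qed simp
      finally show ?thesis .
    qed
    then have "AE x in lborel. h' x = 0" by (rule AE_zero_if_box_integrals_zero[OF h'i])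
    then have "AE x in lebesgue. h' x = 0" by (rule AE_completion)
    with ae show ?thesis by eventually_elim (auto simp: indicator_def)
  qed
  \<comment> \<open>The cover consists of closed boxes, while vanishing is known on open ones; the
    faces are null sets and the cover is countable.\<close>
  obtain \<D> where D: "countable \<D>" "\<D> \<subseteq> Pow \<Omega>" "\<And>X. X \<in> \<D> \<Longrightarrow> \<exists>a b. X = cbox a b" "\<Union>\<D> = \<Omega>"
    using open_countable_Union_open_cbox[OF O] by blast
  have cb: "AE x in lebesgue. x \<in> X \<longrightarrow> g x = 0" if XD: "X \<in> \<D>" for X
  proof -
    obtain a b where X: "X = cbox a b" using D(3)[OF XD] by blast
    have n: "AE x in lebesgue. x \<notin> cbox a b - box a b"
      using null_sets_cbox_Diff_box[of a b] AE_not_in AE_completion by blast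
    have "cbox a b \<subseteq> \<Omega>" using D(2) XD X by blast
    from onbox[OF this] n show ?thesis unfolding X by eventually_elim blast
  qed
  have "AE x in lebesgue. \<forall>X\<in>\<D>. x \<in> X \<longrightarrow> g x = 0"
    by (subst AE_ball_countable[OF D(1)]) (use cb in auto)
  then have "AE x in lebesgue. x \<in> \<Omega> \<longrightarrow> g x = 0" by eventually_elim (use D(4) in blast)
  then show ?thesis using OM by (subst AE_restrict_space_iff) auto
qed

lemma test_fun_differentiable:
  assumes "test_fun \<Omega> \<phi>"
  shows "\<phi> differentiable (at x)" "partial i \<phi> differentiable (at x)"
proof -
  have s: "iter_partial is \<phi> differentiable (at x)" for "is" x
    using assms unfolding test_fun_def smooth_fun_def by blast
  show "\<phi> differentiable (at x)" "partial i \<phi> differentiable (at x)" using s[of "[]"] s[of "[i]"] by auto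
qed

lemma test_fun_continuous:
  assumes "test_fun \<Omega> \<phi>"
  shows "continuous_on UNIV \<phi>" "continuous_on UNIV (partial i \<phi>)"
  using test_fun_differentiable[OF assms] differentiable_imp_continuous_within
  by (metis continuous_at_imp_continuous_on)+

lemma test_fun_measurable:
  assumes "test_fun \<Omega> \<phi>"
  shows "\<phi> \<in> borel_measurable borel" "partial i \<phi> \<in> borel_measurable borel"
  using test_fun_continuous[OF assms] by (auto intro: borel_measurable_continuous_onI)

lemma zero_outside_tsupport: "x \<notin> tsupport \<phi> \<Longrightarrow> \<phi> x = 0"
  unfolding tsupport_def using closure_subset[of "{x. \<phi> x \<noteq> 0}"] by blast

lemma partial_zero_outside:
  assumes "x \<notin> tsupport \<phi>"
  shows "partial i \<phi> x = 0"
proof -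
  have "open (- tsupport \<phi>)" unfolding tsupport_def by (intro open_Compl closed_closure)
  have "((\<lambda>_. 0) has_derivative (\<lambda>_. 0)) (at x)" by simp
  then have "(\<phi> has_derivative (\<lambda>_. 0)) (at x)"
    by (rule has_derivative_transform_within_open[of _ _ _ _ "- tsupport \<phi>"])
      (use assms zero_outside_tsupport \<open>open (- tsupport \<phi>)\<close> in auto)
  then show ?thesis by (rule partial_eqI)
qed

lemma iter_partial_snoc: "iter_partial (is @ [i]) \<phi> = iter_partial is (partial i \<phi>)"
  by (induction "is") simp_all

lemma test_fun_partial:
  assumes "test_fun \<Omega> \<phi>"
  shows "test_fun \<Omega> (partial i \<phi>)"
proof -
  have "tsupport (partial i \<phi>) \<subseteq> tsupport \<phi>"
    unfolding tsupport_def[of "partial i \<phi>"]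
    using partial_zero_outside[of _ \<phi> i] by (intro closure_minimal) (auto simp: tsupport_def)
  moreover have "compact (tsupport (partial i \<phi>))"
    using compact_Int_closed[of "tsupport \<phi>" "tsupport (partial i \<phi>)"] calculation assms
    unfolding test_fun_def by (metis inf.absorb_iff2 closed_closure tsupport_def)
  moreover have "smooth_fun (partial i \<phi>)"
    using assms unfolding test_fun_def smooth_fun_def by (metis iter_partial_snoc)
  ultimately show ?thesis using assms unfolding test_fun_def by blast
qed

lemma fundamental_lemma:
  fixes g :: "real^'n::finite \<Rightarrow> complex"
  assumes O: "open \<Omega>" and g: "integrable (lebesgue_on \<Omega>) g"
    and z: "\<And>\<phi>. test_fun \<Omega> \<phi> \<Longrightarrow> (LINT x|lebesgue_on \<Omega>. g x * of_real (\<phi> x)) = 0"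
  shows "AE x in lebesgue_on \<Omega>. g x = 0"
proof -
  have i: "integrable (lebesgue_on \<Omega>) (\<lambda>x. g x * of_real (\<phi> x))" if t: "test_fun \<Omega> \<phi>" for \<phi>
  proof -
    have "compact (\<phi> ` tsupport \<phi>)"
      using t test_fun_continuous(1)[OF t] unfolding test_fun_def
      by (meson compact_continuous_image continuous_on_subset subset_UNIV)
    then have "bounded (\<phi> ` tsupport \<phi>)" by (rule compact_imp_bounded)
    then obtain B where B: "\<And>x. x \<in> tsupport \<phi> \<Longrightarrow> \<bar>\<phi> x\<bar> \<le> B"
      unfolding bounded_iff by auto
    have B': "\<bar>\<phi> x\<bar> \<le> max B 0" for x using B[of x] zero_outside_tsupport[of x \<phi>] by (cases "x \<in> tsupport \<phi>") auto
    have m: "\<phi> \<in> borel_measurable (lebesgue_on \<Omega>)"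
      using test_fun_measurable(1)[OF t] by (intro measurable_restrict_space1 measurable_completion) simp
    show ?thesis
    proof (rule Bochner_Integration.integrable_bound[of _ "\<lambda>x. max B 0 * norm (g x)"])
      show "integrable (lebesgue_on \<Omega>) (\<lambda>x. max B 0 * norm (g x))" using g by simp
      show "(\<lambda>x. g x * of_real (\<phi> x)) \<in> borel_measurable (lebesgue_on \<Omega>)"
        using borel_measurable_integrable[OF g] m by measurable
      show "AE x in lebesgue_on \<Omega>. norm (g x * of_real (\<phi> x)) \<le> norm (max B 0 * norm (g x))"
        using B' by (intro AE_I2) (simp add: norm_mult mult.commute mult_right_mono)
    qed
  qed
  have "AE x in lebesgue_on \<Omega>. Re (g x) = 0"
  proof (rule fundamental_lemma_real[OF O])
    show "integrable (lebesgue_on \<Omega>) (\<lambda>x. Re (g x))" using g by simp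
    show "(LINT x|lebesgue_on \<Omega>. Re (g x) * \<phi> x) = 0" if "test_fun \<Omega> \<phi>" for \<phi>
      using z[OF that] integral_Re[OF i[OF that]] by simp
  qed
  moreover have "AE x in lebesgue_on \<Omega>. Im (g x) = 0"
  proof (rule fundamental_lemma_real[OF O])
    show "integrable (lebesgue_on \<Omega>) (\<lambda>x. Im (g x))" using g by simp
    show "(LINT x|lebesgue_on \<Omega>. Im (g x) * \<phi> x) = 0" if "test_fun \<Omega> \<phi>" for \<phi>
      using z[OF that] integral_Im[OF i[OF that]] by simp
  qed
  ultimately show ?thesis by eventually_elim (simp add: complex_eq_iff)
qed

subsection \<open>Compactly supported continuously differentiable functions\<close>

lemma bounded_cball_0:
  fixes S :: "(real^'n::finite) set"
  shows "bounded S \<Longrightarrow> \<exists>R. S \<subseteq> cball 0 R"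
  unfolding bounded_iff by (auto simp: subset_iff)

text \<open>Unlike \<open>test_fun\<close>, this class refers to no domain and to first derivatives
  only; products and differences of translates stay in it, and that is all the integral identities
  require.\<close>

definition C1c :: "(real^'n::finite \<Rightarrow> real) \<Rightarrow> bool" where
  "C1c f \<longleftrightarrow> (\<forall>x. f differentiable (at x)) \<and> (\<forall>i. continuous_on UNIV (partial i f)) \<and> compact (tsupport f)"

lemma C1cD:
  assumes "C1c f"
  shows "f differentiable (at x)" "continuous_on UNIV (partial i f)" "compact (tsupport f)" "continuous_on UNIV f"
    "f \<in> borel_measurable borel" "partial i f \<in> borel_measurable borel"
proof -
  show 1: "f differentiable (at x)" "continuous_on UNIV (partial i f)" "compact (tsupport f)" for x i
    using assms unfolding C1c_def by blast+
  show "continuous_on UNIV f"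
    using differentiable_imp_continuous_within[OF 1(1)] by (intro continuous_at_imp_continuous_on) auto
  then show "f \<in> borel_measurable borel" "partial i f \<in> borel_measurable borel"
    using 1(2) by (auto intro: borel_measurable_continuous_onI)
qed

lemma test_fun_C1c:
  assumes "test_fun \<Omega> \<phi>"
  shows "C1c \<phi>"
proof -
  have "compact (tsupport \<phi>)" using assms unfolding test_fun_def by blast
  then show ?thesis
    unfolding C1c_def using test_fun_differentiable(1)[OF assms] test_fun_continuous(2)[OF assms] by blast
qed

lemma continuous_bounded_outside_compact:
  fixes g :: "real^'n::finite \<Rightarrow> real"
  assumes "continuous_on UNIV g" "compact K" "\<And>x. x \<notin> K \<Longrightarrow> g x = 0"
  obtains B where "B \<ge> 0" "\<And>x. \<bar>g x\<bar> \<le> B"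
proof -
  have "compact (g ` K)" using assms compact_continuous_image continuous_on_subset by blast
  then have "bounded (g ` K)" by (rule compact_imp_bounded)
  then obtain B where B: "\<And>x. x \<in> K \<Longrightarrow> \<bar>g x\<bar> \<le> B" unfolding bounded_iff by auto
  have "\<bar>g x\<bar> \<le> max B 0" for x using B[of x] assms(3)[of x] by (cases "x \<in> K") auto
  then show ?thesis using that[of "max B 0"] by simp
qed

lemma integrable_continuous_compact_support:
  fixes g :: "real^'n::finite \<Rightarrow> real"
  assumes "continuous_on UNIV g" "compact K" "\<And>x. x \<notin> K \<Longrightarrow> g x = 0"
  shows "integrable lborel g"
proof -
  have "integrable lborel (\<lambda>x. indicator K x *\<^sub>R g x)"
    using assms by (intro borel_integrable_compact) (auto intro: continuous_on_subset)
  moreover have "(\<lambda>x. indicator K x *\<^sub>R g x) = g" using assms(3) by (intro ext) (auto simp: indicator_def)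
  ultimately show ?thesis by (simp only:)
qed

lemma C1c_integrable_mult:
  assumes "C1c f" "continuous_on UNIV g"
  shows "integrable lborel (\<lambda>x. f x * g x)" "integrable lborel (\<lambda>x. partial i f x * g x)"
  using C1cD[OF assms(1)] assms(2) zero_outside_tsupport[of _ f] partial_zero_outside[of _ f]
  by (auto intro!: integrable_continuous_compact_support[of _ "tsupport f"] continuous_intros)

lemma C1c_integrable: "C1c f \<Longrightarrow> integrable lborel f" "C1c f \<Longrightarrow> integrable lborel (partial i f)"
  using C1c_integrable_mult[of f "\<lambda>_. 1"] by auto

lemma partial_has_derivative_line:
  assumes "\<And>x. f differentiable (at x)"
  shows "((\<lambda>s. f (x + s *\<^sub>R axis i 1)) has_real_derivative partial i f (x + s *\<^sub>R axis i 1)) (at s)"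
proof -
  let ?D = "frechet_derivative f (at (x + s *\<^sub>R axis i 1))"
  have "((\<lambda>s. x + s *\<^sub>R axis i 1) has_derivative (\<lambda>h. h *\<^sub>R axis i 1)) (at s)"
    by (auto intro!: derivative_eq_intros)
  then have "((\<lambda>s. f (x + s *\<^sub>R axis i 1)) has_derivative (\<lambda>h. ?D (h *\<^sub>R axis i 1))) (at s)"
    by (rule has_derivative_compose[OF _ differentiable_has_derivative[OF assms]])
  moreover have "?D (h *\<^sub>R axis i 1) = partial i f (x + s *\<^sub>R axis i 1) * h" for h
    unfolding partial_def using linear_cmul[OF linear_frechet_derivative[OF assms]] by simp
  ultimately show ?thesis unfolding has_field_derivative_def by simp
qed

lemma lborel_translation:
  fixes f :: "real^'n::finite \<Rightarrow> real"
  assumes "f \<in> borel_measurable borel"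
  shows "(LINT x|lborel. f (x + a)) = (LINT x|lborel. f x)"
proof -
  have "(LINT x|lborel. f x) = (LINT x|distr lborel borel ((+) a). f x)" unfolding lborel_distr_plus ..
  also have "\<dots> = (LINT x|lborel. f (a + x))" using assms by (subst integral_distr) auto
  finally show ?thesis by (simp add: add.commute)
qed

lemma nn_lborel_translation:
  fixes f :: "real^'n::finite \<Rightarrow> ennreal"
  assumes "f \<in> borel_measurable borel"
  shows "(\<integral>\<^sup>+x. f (x + a) \<partial>lborel) = (\<integral>\<^sup>+x. f x \<partial>lborel)"
proof -
  have "(\<integral>\<^sup>+x. f x \<partial>lborel) = (\<integral>\<^sup>+x. f x \<partial>distr lborel borel ((+) a))" unfolding lborel_distr_plus ..
  also have "\<dots> = (\<integral>\<^sup>+x. f (a + x) \<partial>lborel)" using assms by (subst nn_integral_distr) auto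
  finally show ?thesis by (simp add: add.commute)
qed

text \<open>Dominated convergence: a bound on the partial derivative bounds the quotients. The sign
  \<open>c\<close> covers forward and backward quotients together; the discrete integration by parts
  behind the exchange of derivatives needs both.\<close>

lemma integral_difference_quotient:
  fixes f :: "real^'n::finite \<Rightarrow> real"
  assumes f: "C1c f" and g: "continuous_on UNIV g" and c: "\<bar>c\<bar> = 1"
  shows "(\<lambda>k. LINT x|lborel. real (Suc k) * (f (x + (c / real (Suc k)) *\<^sub>R axis i 1) - f x) * g x)
     \<longlonglongrightarrow> (LINT x|lborel. c * partial i f x * g x)"
proof -
  let ?e = "axis i 1 :: real^'n"
  obtain R where R: "tsupport f \<subseteq> cball 0 R"
    using bounded_cball_0[OF compact_imp_bounded[OF C1cD(3)[OF f]]] by blast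
  obtain B where B: "B \<ge> 0" "\<And>x. \<bar>partial i f x\<bar> \<le> B"
    by (rule continuous_bounded_outside_compact[OF C1cD(2)[OF f, of i] C1cD(3)[OF f]])
      (auto simp: partial_zero_outside)
  \<comment> \<open>Steps have length at most 1, so outside the ball of radius \<open>R + 1\<close>
    both the point and its translate miss the support.\<close>
  define S where "S = cball (0::real^'n) (R + 1)"
  have "compact (g ` S)" unfolding S_def by (intro compact_continuous_image continuous_on_subset[OF g]) auto
  then have "bounded (g ` S)" by (rule compact_imp_bounded)
  then obtain G where G: "\<And>x. x \<in> S \<Longrightarrow> \<bar>g x\<bar> \<le> G" unfolding bounded_iff by auto
  have lip: "\<bar>f (x + s *\<^sub>R ?e) - f x\<bar> \<le> B * \<bar>s\<bar>" for x s
    using field_differentiable_bound[of UNIV "\<lambda>s. f (x + s *\<^sub>R ?e)" "\<lambda>s. partial i f (x + s *\<^sub>R ?e)" B s 0]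
      partial_has_derivative_line[OF C1cD(1)[OF f]] B(2) by simp
  have gm: "g \<in> borel_measurable borel" using g by (rule borel_measurable_continuous_onI)
  show ?thesis
  proof (rule integral_dominated_convergence[where w = "\<lambda>x. indicator S x * (B * G)"])
    show "(\<lambda>x. c * partial i f x * g x) \<in> borel_measurable lborel"
      using C1cD(6)[OF f] gm by measurable
    show "(\<lambda>x. real (Suc k) * (f (x + (c / real (Suc k)) *\<^sub>R ?e) - f x) * g x) \<in> borel_measurable lborel" for k
      using C1cD(5)[OF f] gm by measurable
    have "emeasure lborel S < \<infinity>" unfolding S_def using emeasure_bounded_finite[OF bounded_cball] by simp
    then show "integrable lborel (\<lambda>x. indicator S x * (B * G))"
      unfolding S_def by (intro integrable_mult_left) (simp add: integrable_indicator_iff)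
    show "AE x in lborel. (\<lambda>k. real (Suc k) * (f (x + (c / real (Suc k)) *\<^sub>R ?e) - f x) * g x) \<longlonglongrightarrow> c * partial i f x * g x"
    proof (rule AE_I2)
      fix x
      have "((\<lambda>h. (f (x + (0 + h) *\<^sub>R ?e) - f (x + 0 *\<^sub>R ?e)) / h) \<longlongrightarrow> partial i f (x + 0 *\<^sub>R ?e)) (at 0)"
        using partial_has_derivative_line[OF C1cD(1)[OF f], of x i 0] unfolding DERIV_def .
      then have d: "((\<lambda>h. (f (x + h *\<^sub>R ?e) - f x) / h) \<longlongrightarrow> partial i f x) (at 0)" by simp
      have "(\<lambda>k. c / real (Suc k)) \<longlonglongrightarrow> 0"
        using tendsto_mult[OF tendsto_const[of c] LIMSEQ_inverse_real_of_nat] by (simp add: divide_inverse)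
      moreover have "c / real (Suc k) \<noteq> 0" for k using c by auto
      ultimately have "filterlim (\<lambda>k. c / real (Suc k)) (at 0) sequentially"
        by (intro filterlim_atI) auto
      from filterlim_compose[OF d this]
      have "(\<lambda>k. (f (x + (c / real (Suc k)) *\<^sub>R ?e) - f x) / (c / real (Suc k))) \<longlonglongrightarrow> partial i f x" .
      then have "(\<lambda>k. c * ((f (x + (c / real (Suc k)) *\<^sub>R ?e) - f x) / (c / real (Suc k))) * g x) \<longlonglongrightarrow> c * partial i f x * g x"
        by (intro tendsto_intros)
      moreover have "c * ((f (x + (c / real (Suc k)) *\<^sub>R ?e) - f x) / (c / real (Suc k))) * g x
          = real (Suc k) * (f (x + (c / real (Suc k)) *\<^sub>R ?e) - f x) * g x" for k
        using c by auto
      ultimately show "(\<lambda>k. real (Suc k) * (f (x + (c / real (Suc k)) *\<^sub>R ?e) - f x) * g x) \<longlonglongrightarrow> c * partial i f x * g x"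
        by (simp only:)
    qed
    fix k
    show "AE x in lborel. norm (real (Suc k) * (f (x + (c / real (Suc k)) *\<^sub>R ?e) - f x) * g x) \<le> indicator S x * (B * G)"
    proof (rule AE_I2)
      fix x
      let ?y = "x + (c / real (Suc k)) *\<^sub>R ?e"
      show "norm (real (Suc k) * (f ?y - f x) * g x) \<le> indicator S x * (B * G)"
      proof (cases "x \<in> S")
        case True
        have "real (Suc k) * \<bar>f ?y - f x\<bar> \<le> real (Suc k) * (B * \<bar>c / real (Suc k)\<bar>)"
          by (intro mult_left_mono lip) simp
        also have "\<dots> = B" using c by (simp add: abs_divide del: of_nat_Suc)
        finally have "real (Suc k) * \<bar>f ?y - f x\<bar> * \<bar>g x\<bar> \<le> B * G"
          using G[OF True] B(1) by (intro mult_mono) auto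
        then show ?thesis using True by (simp add: abs_mult del: of_nat_Suc)
      next
        case False
        have "norm ((c / real (Suc k)) *\<^sub>R ?e) \<le> 1" using c by simp
        moreover have "norm (x + z) \<ge> norm x - 1" if "norm z \<le> 1" for z :: "real^'n"
          using norm_triangle_ineq4[of "x + z" z] that by simp
        ultimately have "norm ?y \<ge> norm x - 1" by blast
        then have "x \<notin> cball 0 R" "?y \<notin> cball 0 R" using False unfolding S_def by auto
        then have "f x = 0" "f ?y = 0" using R zero_outside_tsupport by blast+
        then show ?thesis by (simp add: False)
      qed
    qed
  qed
qed

text \<open>By translation invariance the integral of every difference quotient is zero, and the
  limit inherits this. No iterated integral along coordinate lines is needed.\<close>

lemma C1c_partial_integral_zero:
  assumes "C1c f"
  shows "(LINT x|lborel. partial i f x) = 0"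
proof -
  have "(\<lambda>k. LINT x|lborel. real (Suc k) * (f (x + (1 / real (Suc k)) *\<^sub>R axis i 1) - f x) * 1) \<longlonglongrightarrow> (LINT x|lborel. 1 * partial i f x * 1)"
    by (rule integral_difference_quotient[OF assms]) auto
  moreover have "(LINT x|lborel. real (Suc k) * (f (x + (1 / real (Suc k)) *\<^sub>R axis i 1) - f x) * 1) = 0" for k
  proof -
    let ?a = "(1 / real (Suc k)) *\<^sub>R axis i 1"
    have "integrable lborel (\<lambda>x. f (x + ?a))"
    proof -
      have "integrable (distr lborel borel ((+) ?a)) f" unfolding lborel_distr_plus by (rule C1c_integrable[OF assms])
      then show ?thesis using C1cD(5)[OF assms] by (subst (asm) integrable_distr_eq) (auto simp: add.commute)
    qed
    then show ?thesis using C1c_integrable(1)[OF assms] lborel_translation[OF C1cD(5)[OF assms], of ?a]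
      by simp
  qed
  ultimately show ?thesis by (simp add: LIMSEQ_const_iff)
qed

lemma C1c_mult:
  assumes "C1c f" "C1c g"
  shows "C1c (\<lambda>x. f x * g x)"
proof -
  have p: "partial i (\<lambda>x. f x * g x) = (\<lambda>x. f x * partial i g x + partial i f x * g x)" for i
    using C1cD(1)[OF assms(1)] C1cD(1)[OF assms(2)] by (intro ext partial_mult) auto
  have s: "tsupport (\<lambda>x. f x * g x) \<subseteq> tsupport f" unfolding tsupport_def by (intro closure_mono) auto
  show ?thesis
    unfolding C1c_def p
  proof (intro conjI allI)
    show "(\<lambda>x. f x * g x) differentiable at x" for x
      using C1cD(1)[OF assms(1)] C1cD(1)[OF assms(2)] by (intro differentiable_mult) auto
    show "continuous_on UNIV (\<lambda>x. f x * partial i g x + partial i f x * g x)" for i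
      using C1cD(2,4)[OF assms(1)] C1cD(2,4)[OF assms(2)] by (intro continuous_intros) auto
    show "compact (tsupport (\<lambda>x. f x * g x))"
      using compact_Int_closed[OF C1cD(3)[OF assms(1)], of "tsupport (\<lambda>x. f x * g x)"] s
      unfolding tsupport_def by (simp add: inf.absorb2)
  qed
qed

lemma C1c_integration_by_parts:
  assumes "C1c f" "C1c g"
  shows "(LINT x|lborel. partial i f x * g x) = - (LINT x|lborel. f x * partial i g x)"
proof -
  have "(LINT x|lborel. f x * partial i g x + partial i f x * g x) = 0"
    using C1c_partial_integral_zero[OF C1c_mult[OF assms], of i]
      partial_mult[OF C1cD(1)[OF assms(1)] C1cD(1)[OF assms(2)], of i] by simp
  then show ?thesis
    using C1c_integrable_mult(1)[OF assms(1) C1cD(2)[OF assms(2)]]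
      C1c_integrable_mult(2)[OF assms(1) C1cD(4)[OF assms(2)]] by simp
qed

lemma partial_translate:
  assumes "\<And>x. f differentiable (at x)"
  shows "partial i (\<lambda>x. f (x + a)) x = partial i f (x + a)" "(\<lambda>x. f (x + a)) differentiable (at x)"
proof -
  have "((\<lambda>x. x + a) has_derivative (\<lambda>h. h)) (at x)" by (auto intro!: derivative_eq_intros)
  then have D: "((\<lambda>x. f (x + a)) has_derivative frechet_derivative f (at (x + a))) (at x)"
    by (rule has_derivative_compose[OF _ differentiable_has_derivative[OF assms], simplified])
  show "partial i (\<lambda>x. f (x + a)) x = partial i f (x + a)"
    using partial_eqI[OF D, of i] by (simp add: partial_def[of i f])
  show "(\<lambda>x. f (x + a)) differentiable (at x)" using D differentiableI by blast
qed

lemma C1c_translate_diff: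
  assumes "C1c f"
  shows "C1c (\<lambda>x. f (x + a) - f x)" "partial i (\<lambda>x. f (x + a) - f x) x = partial i f (x + a) - partial i f x"
proof -
  note d = C1cD(1)[OF assms]
  have D: "((\<lambda>x. f (x + a) - f x) has_derivative (\<lambda>v. frechet_derivative (\<lambda>x. f (x + a)) (at x) v - frechet_derivative f (at x) v)) (at x)" for x
    by (intro has_derivative_diff differentiable_has_derivative partial_translate(2) d)
  show p: "partial i (\<lambda>x. f (x + a) - f x) x = partial i f (x + a) - partial i f x" for i x
    using partial_eqI[OF D, of i x] partial_translate(1)[OF d, of i a x]
    by (simp add: partial_def[of i f] partial_def[of i "\<lambda>x. f (x + a)"])
  obtain R where R: "tsupport f \<subseteq> cball 0 R"
    using bounded_cball_0[OF compact_imp_bounded[OF C1cD(3)[OF assms]]] by blast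
  have "{x. f (x + a) - f x \<noteq> 0} \<subseteq> cball 0 (R + norm a)"
  proof
    fix x assume "x \<in> {x. f (x + a) - f x \<noteq> 0}"
    then have "x + a \<in> tsupport f \<or> x \<in> tsupport f" using zero_outside_tsupport[of _ f] by fastforce
    then have "norm (x + a) \<le> R \<or> norm x \<le> R" using R by auto
    then have "norm x \<le> R + norm a"
    proof
      assume "norm (x + a) \<le> R"
      then show ?thesis using norm_triangle_ineq4[of "x + a" a] by simp
    qed (use norm_ge_zero[of a] in linarith)
    then show "x \<in> cball 0 (R + norm a)" by simp
  qed
  then have "tsupport (\<lambda>x. f (x + a) - f x) \<subseteq> cball 0 (R + norm a)"
    unfolding tsupport_def by (intro closure_minimal) auto
  then have "compact (tsupport (\<lambda>x. f (x + a) - f x))"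
    using compact_Int_closed[OF compact_cball, of "tsupport (\<lambda>x. f (x + a) - f x)" 0 "R + norm a"]
    unfolding tsupport_def by (simp add: inf.absorb2)
  moreover have "continuous_on UNIV (partial i (\<lambda>x. f (x + a) - f x))" for i
  proof -
    have e: "partial i (\<lambda>x. f (x + a) - f x) = (\<lambda>x. partial i f (x + a) - partial i f x)" using p by blast
    have "continuous_on UNIV (\<lambda>x. partial i f (x + a))"
      by (rule continuous_on_compose2[OF C1cD(2)[OF assms]]) (auto intro!: continuous_intros)
    then show ?thesis unfolding e using C1cD(2)[OF assms] by (intro continuous_on_diff)
  qed
  ultimately show "C1c (\<lambda>x. f (x + a) - f x)"
    unfolding C1c_def using D differentiableI by blast
qed

text \<open>Obtained from difference quotients, so that no second derivatives are needed.\<close>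

lemma C1c_mixed_partials:
  assumes f: "C1c f" and g: "C1c g"
  shows "(LINT x|lborel. partial i f x * partial j g x) = (LINT x|lborel. partial j f x * partial i g x)"
proof -
  let ?e = "axis i 1"
  \<comment> \<open>Integrate by parts in direction \<open>j\<close>, then move the translation from
    \<open>f\<close> to \<open>g\<close> by invariance of the measure: the forward quotient of
    \<open>f\<close> becomes the backward quotient of \<open>g\<close>.\<close>
  have step: "(LINT x|lborel. real (Suc k) * (f (x + (1 / real (Suc k)) *\<^sub>R ?e) - f x) * partial j g x)
      = - (LINT x|lborel. real (Suc k) * (g (x + (- 1 / real (Suc k)) *\<^sub>R ?e) - g x) * partial j f x)" for k
  proof -
    let ?a = "(1 / real (Suc k)) *\<^sub>R ?e"
    let ?d = "\<lambda>x. f (x + ?a) - f x"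
    have i1: "integrable lborel (\<lambda>x. partial j f (x + ?a) * g x)"
    proof -
      have "continuous_on UNIV (\<lambda>x. partial j f (x + ?a))"
        by (rule continuous_on_compose2[OF C1cD(2)[OF f]]) (auto intro!: continuous_intros)
      from C1c_integrable_mult(1)[OF g this] show ?thesis by (simp add: mult.commute)
    qed
    have i2: "integrable lborel (\<lambda>x. partial j f x * g x)"
      using C1c_integrable_mult(2)[OF f C1cD(4)[OF g]] .
    have i3: "integrable lborel (\<lambda>x. partial j f x * g (x - ?a))"
    proof -
      have "continuous_on UNIV (\<lambda>x. g (x - ?a))"
        by (rule continuous_on_compose2[OF C1cD(4)[OF g]]) (auto intro!: continuous_intros)
      from C1c_integrable_mult(2)[OF f this] show ?thesis .
    qed
    have "(LINT x|lborel. ?d x * partial j g x) = - (LINT x|lborel. partial j ?d x * g x)"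
      using C1c_integration_by_parts[OF C1c_translate_diff(1)[OF f, of ?a] g, of j] by simp
    also have "(LINT x|lborel. partial j ?d x * g x) = (LINT x|lborel. partial j f (x + ?a) * g x - partial j f x * g x)"
      unfolding C1c_translate_diff(2)[OF f] by (simp add: algebra_simps)
    also have "\<dots> = (LINT x|lborel. partial j f (x + ?a) * g x) - (LINT x|lborel. partial j f x * g x)"
      using i1 i2 by simp
    also have "(LINT x|lborel. partial j f (x + ?a) * g x) = (LINT x|lborel. partial j f x * g (x - ?a))"
    proof -
      have m: "(\<lambda>x. partial j f x * g (x - ?a)) \<in> borel_measurable borel"
        using C1cD(6)[OF f] C1cD(5)[OF g] by measurable
      show ?thesis using lborel_translation[OF m, of ?a] by simp
    qed
    also have "\<dots> - (LINT x|lborel. partial j f x * g x) = (LINT x|lborel. (g (x - ?a) - g x) * partial j f x)"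
      using i3 i2 by (simp add: algebra_simps flip: Bochner_Integration.integral_diff)
    finally have "(LINT x|lborel. ?d x * partial j g x) = - (LINT x|lborel. (g (x - ?a) - g x) * partial j f x)" .
    then show ?thesis by (simp add: mult.assoc)
  qed
  have "(\<lambda>k. LINT x|lborel. real (Suc k) * (f (x + (1 / real (Suc k)) *\<^sub>R ?e) - f x) * partial j g x)
      \<longlonglongrightarrow> (LINT x|lborel. 1 * partial i f x * partial j g x)"
    by (rule integral_difference_quotient[OF f C1cD(2)[OF g]]) simp
  moreover have "(\<lambda>k. - (LINT x|lborel. real (Suc k) * (g (x + (- 1 / real (Suc k)) *\<^sub>R ?e) - g x) * partial j f x))
      \<longlonglongrightarrow> - (LINT x|lborel. - 1 * partial i g x * partial j f x)"
    by (intro tendsto_minus integral_difference_quotient[OF g C1cD(2)[OF f]]) simp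
  ultimately have "(LINT x|lborel. 1 * partial i f x * partial j g x) = - (LINT x|lborel. - 1 * partial i g x * partial j f x)"
    unfolding step by (rule LIMSEQ_unique)
  then show ?thesis by (simp add: mult.commute)
qed

section \<open>Translation estimates and Poincare inequalities on small cubes\<close>

lemma C1c_has_derivative_segment:
  assumes "C1c f"
  shows "((\<lambda>t. f (x + t *\<^sub>R y)) has_real_derivative (\<Sum>i\<in>UNIV. y $ i * partial i f (x + t *\<^sub>R y))) (at t)"
proof -
  let ?D = "frechet_derivative f (at (x + t *\<^sub>R y))"
  have "((\<lambda>s. x + s *\<^sub>R y) has_derivative (\<lambda>h. h *\<^sub>R y)) (at t)"
    by (auto intro!: derivative_eq_intros)
  then have "((\<lambda>s. f (x + s *\<^sub>R y)) has_derivative (\<lambda>h. ?D (h *\<^sub>R y))) (at t)"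
    by (rule has_derivative_compose[OF _ differentiable_has_derivative[OF C1cD(1)[OF assms]]])
  moreover have "?D (h *\<^sub>R y) = (\<Sum>i\<in>UNIV. y $ i * partial i f (x + t *\<^sub>R y)) * h" for h
  proof -
    have lin: "linear ?D" using linear_frechet_derivative[OF C1cD(1)[OF assms]] .
    have "y = (\<Sum>i\<in>UNIV. y $ i *\<^sub>R axis i 1)"
      by (simp add: basis_expansion[symmetric] scalar_mult_eq_scaleR[symmetric])
    then have "?D y = ?D (\<Sum>i\<in>UNIV. y $ i *\<^sub>R axis i 1)" by simp
    also have "\<dots> = (\<Sum>i\<in>UNIV. y $ i * partial i f (x + t *\<^sub>R y))"
      unfolding partial_def by (simp add: linear_sum[OF lin] linear_cmul[OF lin])
    finally show ?thesis using linear_cmul[OF lin, of h y] by simp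
  qed
  ultimately show ?thesis unfolding has_field_derivative_def by simp
qed

text \<open>The increment is the mean of the derivative on the unit interval, and the square of a
  mean is at most the mean of the square; the latter is obtained by expanding the integral of
  \<open>(h' - c)^2\<close>.\<close>

lemma sq_increment_le:
  fixes h h' :: "real \<Rightarrow> real"
  assumes "\<And>t. (h has_real_derivative h' t) (at t)" "continuous_on UNIV h'"
  shows "ennreal ((h 1 - h 0)\<^sup>2) \<le> (\<integral>\<^sup>+t. ennreal ((h' t)\<^sup>2) * indicator {0..1} t \<partial>lborel)"
proof -
  define c where "c = h 1 - h 0"
  have ci: "continuous_on {0..1} h'" using assms(2) continuous_on_subset by blast
  have I1: "integrable lborel (\<lambda>t. indicator {0..1} t *\<^sub>R h' t)"
    by (intro borel_integrable_compact ci) simp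
  have I2: "integrable lborel (\<lambda>t. indicator {0..1} t *\<^sub>R (h' t)\<^sup>2)"
    by (intro borel_integrable_compact continuous_intros ci) simp
  have I3: "integrable lborel (\<lambda>t. indicator {0..1::real} t *\<^sub>R c\<^sup>2)"
    by (intro borel_integrable_compact continuous_intros) simp
  have FTC: "(LINT t|lborel. indicator {0..1} t *\<^sub>R h' t) = c"
    unfolding c_def using assms(1) by (intro integral_FTC_atLeastAtMost ci)
      (auto simp: has_real_derivative_iff_has_vector_derivative[symmetric] intro: has_field_derivative_at_within)
  have "0 \<le> (LINT t|lborel. indicator {0..1} t * (h' t - c)\<^sup>2)"
    by (intro integral_nonneg_AE AE_I2) simp
  also have "\<dots> = (LINT t|lborel. (indicator {0..1} t *\<^sub>R (h' t)\<^sup>2 - 2 * c * (indicator {0..1} t *\<^sub>R h' t)) + indicator {0..1} t *\<^sub>R c\<^sup>2)"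
    by (intro Bochner_Integration.integral_cong) (auto simp: power2_eq_square algebra_simps)
  also have "\<dots> = (LINT t|lborel. indicator {0..1} t *\<^sub>R (h' t)\<^sup>2) - 2 * c * c + c\<^sup>2"
  proof -
    have lin: "(LINT t|lborel. (A t - 2 * c * B t) + D t) = (LINT t|lborel. A t) - 2 * c * (LINT t|lborel. B t) + (LINT t|lborel. D t)"
      if "integrable lborel A" "integrable lborel B" "integrable lborel D" for A B D :: "real \<Rightarrow> real"
      using that by simp
    show ?thesis unfolding lin[OF I2 I1 I3] FTC by simp
  qed
  finally have "c\<^sup>2 \<le> (LINT t|lborel. indicator {0..1} t *\<^sub>R (h' t)\<^sup>2)" by (simp add: power2_eq_square)
  then have "ennreal (c\<^sup>2) \<le> ennreal (LINT t|lborel. indicator {0..1} t *\<^sub>R (h' t)\<^sup>2)" by (rule ennreal_leI)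
  also have "\<dots> = (\<integral>\<^sup>+t. ennreal (indicator {0..1} t *\<^sub>R (h' t)\<^sup>2) \<partial>lborel)"
    by (rule nn_integral_eq_integral[OF I2, symmetric]) simp
  also have "\<dots> = (\<integral>\<^sup>+t. ennreal ((h' t)\<^sup>2) * indicator {0..1} t \<partial>lborel)"
    by (intro nn_integral_cong) (auto simp: indicator_def)
  finally show ?thesis unfolding c_def .
qed

text \<open>The increment is controlled by the squared directional derivative along the segment;
  exchanging the integrals and translating back removes the segment parameter. Nonnegative integrals
  spare every integrability check on the product.\<close>

lemma C1c_translation_estimate:
  fixes f :: "real^'n::finite \<Rightarrow> real"
  assumes f: "C1c f"
  shows "(\<integral>\<^sup>+x. ennreal ((f (x + y) - f x)\<^sup>2) \<partial>lborel) \<le> ennreal ((norm y)\<^sup>2 * (\<Sum>i\<in>UNIV. LINT x|lborel. (partial i f x)\<^sup>2))"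
proof -
  define G where "G x = (\<Sum>i\<in>UNIV. y $ i * partial i f x)" for x
  have Gc: "continuous_on UNIV G" unfolding G_def using C1cD(2)[OF f] by (intro continuous_intros)
  have Gm: "G \<in> borel_measurable borel" using Gc by (rule borel_measurable_continuous_onI)
  have "(\<integral>\<^sup>+x. ennreal ((f (x + y) - f x)\<^sup>2) \<partial>lborel)
      \<le> (\<integral>\<^sup>+x. (\<integral>\<^sup>+t. ennreal ((G (x + t *\<^sub>R y))\<^sup>2) * indicator {0..1} t \<partial>lborel) \<partial>lborel)"
  proof (rule nn_integral_mono)
    fix x
    have "continuous_on UNIV (\<lambda>t::real. G (x + t *\<^sub>R y))"
      by (rule continuous_on_compose2[OF Gc]) (auto intro!: continuous_intros)
    then show "ennreal ((f (x + y) - f x)\<^sup>2) \<le> (\<integral>\<^sup>+t. ennreal ((G (x + t *\<^sub>R y))\<^sup>2) * indicator {0..1} t \<partial>lborel)"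
      using sq_increment_le[of "\<lambda>t. f (x + t *\<^sub>R y)" "\<lambda>t. G (x + t *\<^sub>R y)"]
        C1c_has_derivative_segment[OF f] unfolding G_def by simp
  qed
  also have "\<dots> = (\<integral>\<^sup>+t. (\<integral>\<^sup>+x. ennreal ((G (x + t *\<^sub>R y))\<^sup>2) * indicator {0..1} t \<partial>lborel) \<partial>lborel)"
  proof -
    have "(\<lambda>(x, t). ennreal ((G (x + t *\<^sub>R y))\<^sup>2) * indicator {0..1} t) \<in> borel_measurable ((lborel :: (real^'n) measure) \<Otimes>\<^sub>M (lborel :: real measure))"
      using Gm by measurable
    from lborel_pair.Fubini'[OF this] show ?thesis by simp
  qed
  also have "\<dots> = (\<integral>\<^sup>+t. indicator {0..1::real} t * (\<integral>\<^sup>+x. ennreal ((G x)\<^sup>2) \<partial>lborel) \<partial>lborel)"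
  proof (rule nn_integral_cong)
    fix t :: real
    have m: "(\<lambda>x. ennreal ((G x)\<^sup>2)) \<in> borel_measurable borel" using Gm by measurable
    have m2: "(\<lambda>x. ennreal ((G (x + t *\<^sub>R y))\<^sup>2)) \<in> borel_measurable lborel" using Gm by measurable
    show "(\<integral>\<^sup>+x. ennreal ((G (x + t *\<^sub>R y))\<^sup>2) * indicator {0..1} t \<partial>lborel) = indicator {0..1} t * (\<integral>\<^sup>+x. ennreal ((G x)\<^sup>2) \<partial>lborel)"
      using nn_lborel_translation[OF m, of "t *\<^sub>R y"] nn_integral_multc[OF m2, of "indicator {0..1} t"]
      by (simp add: mult.commute)
  qed
  also have "\<dots> = (\<integral>\<^sup>+x. ennreal ((G x)\<^sup>2) \<partial>lborel)"
    by (subst nn_integral_multc) (auto simp: )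
  also have "\<dots> \<le> (\<integral>\<^sup>+x. ennreal ((norm y)\<^sup>2 * (\<Sum>i\<in>UNIV. (partial i f x)\<^sup>2)) \<partial>lborel)"
  proof (intro nn_integral_mono ennreal_leI)
    fix x
    have "(G x)\<^sup>2 \<le> (\<Sum>i\<in>UNIV. (y $ i)\<^sup>2) * (\<Sum>i\<in>UNIV. (partial i f x)\<^sup>2)"
      unfolding G_def by (rule Cauchy_Schwarz_ineq_sum)
    then show "(G x)\<^sup>2 \<le> (norm y)\<^sup>2 * (\<Sum>i\<in>UNIV. (partial i f x)\<^sup>2)"
      by (simp add: norm_vec_def L2_set_def sum_nonneg)
  qed
  also have "\<dots> = ennreal (LINT x|lborel. (norm y)\<^sup>2 * (\<Sum>i\<in>UNIV. (partial i f x)\<^sup>2))"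
  proof (rule nn_integral_eq_integral)
    show "integrable lborel (\<lambda>x. (norm y)\<^sup>2 * (\<Sum>i\<in>UNIV. (partial i f x)\<^sup>2))"
      using C1c_integrable_mult(2)[OF f C1cD(2)[OF f]] by (simp add: power2_eq_square)
  qed (simp add: sum_nonneg)
  also have "(LINT x|lborel. (norm y)\<^sup>2 * (\<Sum>i\<in>UNIV. (partial i f x)\<^sup>2)) = (norm y)\<^sup>2 * (\<Sum>i\<in>UNIV. LINT x|lborel. (partial i f x)\<^sup>2)"
    using C1c_integrable_mult(2)[OF f C1cD(2)[OF f]] by (simp add: power2_eq_square)
  finally show ?thesis .
qed

text \<open>Half-open cubes of mesh \<open>h\<close>, so that for \<open>h > 0\<close> every point
  lies in exactly one of them.\<close>

definition cell :: "real \<Rightarrow> ('n::finite \<Rightarrow> int) \<Rightarrow> (real^'n) set" where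
  "cell h k = {x. \<forall>i. h * of_int (k i) \<le> x $ i \<and> x $ i < h * (of_int (k i) + 1)}"

lemma cell_measurable: "cell h k \<in> sets borel"
proof -
  have "cell h k = (\<Inter>i. {x. h * of_int (k i) \<le> x $ i}) \<inter> (\<Inter>i. {x. x $ i < h * (of_int (k i) + 1)})"
    unfolding cell_def by auto
  moreover have "closed {x :: real^'a. h * of_int (k i) \<le> x $ i}" "open {x :: real^'a. x $ i < h * (of_int (k i) + 1)}" for i
    by (intro closed_Collect_le open_Collect_less continuous_intros)+
  ultimately show ?thesis by (auto intro!: sets.Int sets.finite_INT borel_open borel_closed)
qed

lemma emeasure_cell:
  assumes "h > 0"
  shows "emeasure lborel (cell h (k :: 'n::finite \<Rightarrow> int)) = ennreal (h ^ CARD('n))"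
proof -
  define l u :: "real^'n" where "l = (\<chi> i. h * of_int (k i))" and "u = (\<chi> i. h * (of_int (k i) + 1))"
  have le: "l $ i \<le> u $ i" for i unfolding l_def u_def using assms by simp
  then have ne: "cbox l u \<noteq> {}" by (simp add: interval_ne_empty_cart)
  have sub: "box l u \<subseteq> cell h k" "cell h k \<subseteq> cbox l u"
    unfolding cell_def l_def u_def by (auto simp: mem_box_cart less_imp_le)
  have "measure lborel (cbox l u) = h ^ CARD('n)"
    using content_cbox_cart[OF ne] unfolding l_def u_def by (simp add: algebra_simps)
  then have c: "emeasure lborel (cbox l u) = ennreal (h ^ CARD('n))"
    using emeasure_eq_ennreal_measure[of lborel "cbox l u"] emeasure_lborel_cbox_finite[of l u] by simp
  have b: "emeasure lborel (box l u) = emeasure lborel (cbox l u)"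
    unfolding emeasure_lborel_box_eq emeasure_lborel_cbox_eq ..
  have "emeasure lborel (cell h k) \<le> emeasure lborel (cbox l u)" using sub(2) by (intro emeasure_mono) auto
  moreover have "emeasure lborel (box l u) \<le> emeasure lborel (cell h k)"
    using sub(1) cell_measurable by (intro emeasure_mono) auto
  ultimately show ?thesis using b c by simp
qed

text \<open>Expanding the square gives twice \<open>q^2\<close> times the variance of
  \<open>u\<close> on \<open>Q\<close>. Integrating over pairs of points makes the variance
  accessible to translation estimates.\<close>

lemma cell_pair_integral:
  fixes u :: "real^'n::finite \<Rightarrow> real"
  assumes u: "C1c u" and Q: "Q \<in> sets borel" "emeasure lborel Q = ennreal q" and q: "0 \<le> q"
  shows "(\<integral>\<^sup>+x. (\<integral>\<^sup>+y. indicator Q x * indicator Q y * ennreal ((u x - u y)\<^sup>2) \<partial>lborel) \<partial>lborel)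
    = ennreal (2 * q * (LINT x|lborel. indicator Q x * (u x)\<^sup>2) - 2 * (LINT x|lborel. indicator Q x * u x)\<^sup>2)"
proof -
  define J M A :: "real^'n \<Rightarrow> real" where "J x = indicator Q x" and "M x = indicator Q x * u x" and "A x = indicator Q x * (u x)\<^sup>2" for x
  define m a where "m = (LINT x|lborel. M x)" and "a = (LINT x|lborel. A x)"
  have J: "integrable lborel J" "(LINT x|lborel. J x) = q"
    unfolding J_def using Q q by (simp_all add: measure_def)
  have M: "integrable lborel M"
    unfolding M_def using integrable_mult_indicator[OF _ C1c_integrable(1)[OF u], of Q] Q(1) by simp
  have "integrable lborel (\<lambda>x. (u x)\<^sup>2)" using C1c_integrable_mult(1)[OF u C1cD(4)[OF u]] by (simp add: power2_eq_square)
  from integrable_mult_indicator[OF _ this, of Q] have A: "integrable lborel A" unfolding A_def using Q(1) by simp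
  have inner: "(\<integral>\<^sup>+y. indicator Q x * indicator Q y * ennreal ((u x - u y)\<^sup>2) \<partial>lborel)
      = ennreal (indicator Q x * (q * (u x)\<^sup>2 - 2 * m * u x + a))" for x
  proof -
    have e: "J y * (u x - u y)\<^sup>2 = (u x)\<^sup>2 * J y - 2 * u x * M y + A y" for y
      unfolding J_def M_def A_def by (simp add: power2_eq_square algebra_simps)
    have i: "integrable lborel (\<lambda>y. J y * (u x - u y)\<^sup>2)" unfolding e using J M A by simp
    have v: "(LINT y|lborel. J y * (u x - u y)\<^sup>2) = (u x)\<^sup>2 * q - 2 * u x * m + a"
      unfolding e m_def a_def using J M A by simp
    have "(\<integral>\<^sup>+y. indicator Q x * indicator Q y * ennreal ((u x - u y)\<^sup>2) \<partial>lborel) = (\<integral>\<^sup>+y. indicator Q x * ennreal (J y * (u x - u y)\<^sup>2) \<partial>lborel)"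
      unfolding J_def by (intro nn_integral_cong) (auto simp: indicator_def)
    also have "\<dots> = indicator Q x * (\<integral>\<^sup>+y. ennreal (J y * (u x - u y)\<^sup>2) \<partial>lborel)"
      using borel_measurable_integrable[OF i] by (intro nn_integral_cmult measurable_compose[OF _ measurable_ennreal])
    also have "(\<integral>\<^sup>+y. ennreal (J y * (u x - u y)\<^sup>2) \<partial>lborel) = ennreal ((u x)\<^sup>2 * q - 2 * u x * m + a)"
      unfolding v[symmetric] by (rule nn_integral_eq_integral[OF i]) (simp add: J_def)
    finally show ?thesis by (simp add: indicator_def algebra_simps)
  qed
  have o: "indicator Q x * (q * (u x)\<^sup>2 - 2 * m * u x + a) = q * A x - 2 * m * M x + a * J x" for x
    unfolding J_def M_def A_def by (simp add: algebra_simps)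
  have oi: "integrable lborel (\<lambda>x. q * A x - 2 * m * M x + a * J x)" using J M A by simp
  have "q * A x - 2 * m * M x + a * J x \<ge> 0" for x
  proof (cases "x \<in> Q")
    case True
    have "0 \<le> (LINT y|lborel. J y * (u x - u y)\<^sup>2)" by (intro integral_nonneg_AE AE_I2) (simp add: J_def)
    also have "\<dots> = (LINT y|lborel. (u x)\<^sup>2 * J y - 2 * u x * M y + A y)"
      by (intro Bochner_Integration.integral_cong) (auto simp: J_def M_def A_def power2_eq_square algebra_simps)
    also have "\<dots> = (u x)\<^sup>2 * q - 2 * u x * m + a" unfolding m_def a_def using J M A by simp
    finally show ?thesis using True by (simp add: J_def M_def A_def algebra_simps)
  qed (simp add: J_def M_def A_def)
  then have "(\<integral>\<^sup>+x. ennreal (q * A x - 2 * m * M x + a * J x) \<partial>lborel) = ennreal (LINT x|lborel. q * A x - 2 * m * M x + a * J x)"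
    by (intro nn_integral_eq_integral[OF oi]) simp
  also have "(LINT x|lborel. q * A x - 2 * m * M x + a * J x) = 2 * q * a - 2 * m\<^sup>2"
    using J M A by (simp add: m_def[symmetric] a_def[symmetric] power2_eq_square)
  finally show ?thesis unfolding inner o unfolding m_def a_def A_def M_def .
qed

text \<open>Two points of one cell differ by a vector of the cube with half side \<open>h\<close>.
  Substituting this difference bounds the whole sum by an integral of translation errors over that
  cube, whose volume is \<open>(2 h) ^ CARD('n)\<close> and whose vectors satisfy
  \<open>|z|^2 \<le> CARD('n) h^2\<close>.\<close>

lemma cells_pair_bound:
  fixes u :: "real^'n::finite \<Rightarrow> real" and I :: "('n \<Rightarrow> int) set"
  assumes u: "C1c u" and h: "h > 0" and I: "finite I"
  shows "(\<Sum>k\<in>I. \<integral>\<^sup>+x. (\<integral>\<^sup>+y. indicator (cell h k) x * indicator (cell h k) y * ennreal ((u x - u y)\<^sup>2) \<partial>lborel) \<partial>lborel)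
    \<le> ennreal (real CARD('n) * h\<^sup>2 * (\<Sum>i\<in>UNIV. LINT x|lborel. (partial i u x)\<^sup>2) * (2 * h) ^ CARD('n))"
proof -
  define D where "D = (\<Sum>i\<in>UNIV. LINT x|lborel. (partial i u x)\<^sup>2)"
  have D0: "D \<ge> 0" unfolding D_def by (intro sum_nonneg integral_nonneg_AE) simp
  define Z :: "(real^'n) set" where "Z = box (\<chi> i. - h) (\<chi> i. h)"
  have um[measurable]: "u \<in> borel_measurable borel" by (rule C1cD(5)[OF u])
  have cm[measurable]: "cell h k \<in> sets borel" for k :: "'n \<Rightarrow> int" by (rule cell_measurable)
  have Zm[measurable]: "Z \<in> sets borel" unfolding Z_def by simp
  have "(\<Sum>k\<in>I. \<integral>\<^sup>+x. (\<integral>\<^sup>+y. indicator (cell h k) x * indicator (cell h k) y * ennreal ((u x - u y)\<^sup>2) \<partial>lborel) \<partial>lborel)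
      = (\<integral>\<^sup>+x. (\<integral>\<^sup>+y. (\<Sum>k\<in>I. indicator (cell h k) x * indicator (cell h k) y * ennreal ((u x - u y)\<^sup>2)) \<partial>lborel) \<partial>lborel)"
  proof -
    have "(\<integral>\<^sup>+x. (\<integral>\<^sup>+y. (\<Sum>k\<in>I. indicator (cell h k) x * indicator (cell h k) y * ennreal ((u x - u y)\<^sup>2)) \<partial>lborel) \<partial>lborel)
      = (\<integral>\<^sup>+x. (\<Sum>k\<in>I. \<integral>\<^sup>+y. indicator (cell h k) x * indicator (cell h k) y * ennreal ((u x - u y)\<^sup>2) \<partial>lborel) \<partial>lborel)"
      by (intro nn_integral_cong nn_integral_sum) measurable
    also have "\<dots> = (\<Sum>k\<in>I. \<integral>\<^sup>+x. (\<integral>\<^sup>+y. indicator (cell h k) x * indicator (cell h k) y * ennreal ((u x - u y)\<^sup>2) \<partial>lborel) \<partial>lborel)"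
      by (intro nn_integral_sum) measurable
    finally show ?thesis by simp
  qed
  also have "\<dots> \<le> (\<integral>\<^sup>+x. (\<integral>\<^sup>+y. indicator Z (y - x) * ennreal ((u x - u y)\<^sup>2) \<partial>lborel) \<partial>lborel)"
  proof (intro nn_integral_mono)
    fix x y :: "real^'n"
    \<comment> \<open>Cells are disjoint, so for fixed \<open>x\<close> and \<open>y\<close> at most
      one summand is nonzero.\<close>
    have same: "k = k' \<and> y - x \<in> Z" if "x \<in> cell h k" "y \<in> cell h k" "x \<in> cell h k'" for k k' :: "'n \<Rightarrow> int"
    proof
      show "k = k'"
      proof
        fix i
        have "h * of_int (k i) < h * (of_int (k' i) + 1)" "h * of_int (k' i) < h * (of_int (k i) + 1)"
          using that(1,3) unfolding cell_def by (force intro: order_le_less_trans)+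
        then have "of_int (k i) < (of_int (k' i) + 1 :: real)" "of_int (k' i) < (of_int (k i) + 1 :: real)" using h by auto
        then show "k i = k' i" by linarith
      qed
      have "- h < y $ i - x $ i \<and> y $ i - x $ i < h" for i
      proof -
        have "h * of_int (k i) \<le> x $ i" "x $ i < h * (of_int (k i) + 1)" "h * of_int (k i) \<le> y $ i" "y $ i < h * (of_int (k i) + 1)"
          using that(1,2) unfolding cell_def by auto
        then show ?thesis by (simp add: algebra_simps)
      qed
      then show "y - x \<in> Z" unfolding Z_def by (simp add: mem_box_cart)
    qed
    show "(\<Sum>k\<in>I. indicator (cell h k) x * indicator (cell h k) y * ennreal ((u x - u y)\<^sup>2)) \<le> indicator Z (y - x) * ennreal ((u x - u y)\<^sup>2)"
    proof (cases "\<exists>k\<in>I. x \<in> cell h k \<and> y \<in> cell h k")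
      case True
      then obtain k where k: "k \<in> I" "x \<in> cell h k" "y \<in> cell h k" by blast
      have "(\<Sum>k\<in>I. indicator (cell h k) x * indicator (cell h k) y * ennreal ((u x - u y)\<^sup>2))
          = (\<Sum>k'\<in>I. if k' = k then ennreal ((u x - u y)\<^sup>2) else 0)"
        using k same by (intro sum.cong) (auto simp: indicator_def)
      then show ?thesis using k same[OF k(2,3,2)] I by simp
    next
      case False
      then have "(\<Sum>k\<in>I. indicator (cell h k) x * indicator (cell h k) y * ennreal ((u x - u y)\<^sup>2)) = 0"
        by (intro sum.neutral) (auto simp: indicator_def)
      then show ?thesis by simp
    qed
  qed
  also have "\<dots> = (\<integral>\<^sup>+x. (\<integral>\<^sup>+z. indicator Z z * ennreal ((u x - u (z + x))\<^sup>2) \<partial>lborel) \<partial>lborel)"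
  proof (rule nn_integral_cong)
    fix x
    have "(\<lambda>y. indicator Z (y - x) * ennreal ((u x - u y)\<^sup>2)) \<in> borel_measurable borel" by measurable
    from nn_lborel_translation[OF this, of x]
    show "(\<integral>\<^sup>+y. indicator Z (y - x) * ennreal ((u x - u y)\<^sup>2) \<partial>lborel) = (\<integral>\<^sup>+z. indicator Z z * ennreal ((u x - u (z + x))\<^sup>2) \<partial>lborel)"
      by simp
  qed
  also have "\<dots> = (\<integral>\<^sup>+z. (\<integral>\<^sup>+x. indicator Z z * ennreal ((u x - u (z + x))\<^sup>2) \<partial>lborel) \<partial>lborel)"
  proof -
    have "(\<lambda>(x, z). indicator Z z * ennreal ((u x - u (z + x))\<^sup>2)) \<in> borel_measurable ((lborel :: (real^'n) measure) \<Otimes>\<^sub>M (lborel :: (real^'n) measure))"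
      by measurable
    from lborel_pair.Fubini'[OF this] show ?thesis by simp
  qed
  also have "\<dots> \<le> (\<integral>\<^sup>+z. ennreal (real CARD('n) * h\<^sup>2 * D) * indicator Z z \<partial>lborel)"
  proof (rule nn_integral_mono)
    fix z :: "real^'n"
    show "(\<integral>\<^sup>+x. indicator Z z * ennreal ((u x - u (z + x))\<^sup>2) \<partial>lborel) \<le> ennreal (real CARD('n) * h\<^sup>2 * D) * indicator Z z"
    proof (cases "z \<in> Z")
      case True
      have "(norm z)\<^sup>2 = (\<Sum>i\<in>UNIV. (z $ i)\<^sup>2)" by (simp add: norm_vec_def L2_set_def sum_nonneg)
      also have "\<dots> \<le> (\<Sum>i\<in>(UNIV::'n set). h\<^sup>2)"
      proof (rule sum_mono)
        fix i
        have "- h < z $ i" "z $ i < h" using True unfolding Z_def by (simp_all add: mem_box_cart)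
        then have "\<bar>z $ i\<bar> \<le> \<bar>h\<bar>" by linarith
        then show "(z $ i)\<^sup>2 \<le> h\<^sup>2" by (simp add: abs_le_square_iff)
      qed
      finally have z: "(norm z)\<^sup>2 \<le> real CARD('n) * h\<^sup>2" by simp
      have "(\<integral>\<^sup>+x. indicator Z z * ennreal ((u x - u (z + x))\<^sup>2) \<partial>lborel) = (\<integral>\<^sup>+x. ennreal ((u (x + z) - u x)\<^sup>2) \<partial>lborel)"
        using True by (intro nn_integral_cong) (simp add: power2_commute add.commute)
      also have "\<dots> \<le> ennreal ((norm z)\<^sup>2 * D)" unfolding D_def by (rule C1c_translation_estimate[OF u])
      also have "\<dots> \<le> ennreal (real CARD('n) * h\<^sup>2 * D)" using z D0 by (intro ennreal_leI mult_right_mono)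
      finally show ?thesis using True by simp
    qed simp
  qed
  also have "\<dots> = ennreal (real CARD('n) * h\<^sup>2 * D) * emeasure lborel Z" by (intro nn_integral_cmult_indicator) simp
  also have "emeasure lborel Z = ennreal ((2 * h) ^ CARD('n))"
  proof -
    let ?l = "(\<chi> i. - h) :: real^'n" and ?u = "(\<chi> i. h) :: real^'n"
    have ne: "cbox ?l ?u \<noteq> {}" using h by (simp add: interval_ne_empty_cart)
    have "measure lborel (cbox ?l ?u) = (2 * h) ^ CARD('n)" using content_cbox_cart[OF ne] by simp
    then have "emeasure lborel (cbox ?l ?u) = ennreal ((2 * h) ^ CARD('n))"
      using emeasure_eq_ennreal_measure[of lborel "cbox ?l ?u"] emeasure_lborel_cbox_finite[of ?l ?u] by simp
    then show ?thesis unfolding Z_def emeasure_lborel_box_eq emeasure_lborel_cbox_eq .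
  qed
  finally show ?thesis unfolding D_def[symmetric] using h D0 by (simp add: ennreal_mult)
qed

text \<open>The source of compactness: up to a small multiple of the gradient, the norm is
  controlled by finitely many linear functionals, the integrals over cells. It is the Poincare
  inequality on each cell, summed; the constant goes to zero with the mesh.\<close>

lemma cell_inequality:
  fixes \<Omega> :: "(real^'n::finite) set"
  assumes bdd: "bounded \<Omega>" and e: "\<epsilon> > 0"
  obtains I :: "('n \<Rightarrow> int) set" and h where "finite I" "h > 0"
    "\<And>\<phi>. test_fun \<Omega> \<phi> \<Longrightarrow> (LINT x|lborel. (\<phi> x)\<^sup>2) \<le>
       (\<Sum>k\<in>I. (1 / h ^ CARD('n)) * (LINT x|lborel. indicator (cell h k) x * \<phi> x)\<^sup>2)
       + \<epsilon> * (\<Sum>i\<in>UNIV. LINT x|lborel. (partial i \<phi> x)\<^sup>2)"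
proof -
  let ?n = "CARD('n)"
  \<comment> \<open>Solves \<open>CARD('n) h\<^sup>2 2 ^ CARD('n) / 2 = \<epsilon>\<close>, the
    constant left after dividing the pair bound by twice the cell volume.\<close>
  define h where "h = sqrt (2 * \<epsilon> / (real ?n * 2 ^ ?n))"
  have h: "h > 0" unfolding h_def using e by simp
  have hsq: "real ?n * h\<^sup>2 * 2 ^ ?n / 2 = \<epsilon>" unfolding h_def using e by simp
  obtain R where R: "\<Omega> \<subseteq> cball 0 R" using bounded_cball_0[OF bdd] by blast
  \<comment> \<open>A cell containing a point of the domain has all its indices between
    \<open>-N\<close> and \<open>N\<close>, which makes the index set finite.\<close>
  define N where "N = \<lceil>\<bar>R\<bar> / h\<rceil> + 1"
  define I :: "('n \<Rightarrow> int) set" where "I = PiE UNIV (\<lambda>_. {-N..N})"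
  have I: "finite I" unfolding I_def by (intro finite_PiE) auto
  define K where "K x = (\<lambda>i. \<lfloor>x $ i / h\<rfloor>)" for x :: "real^'n"
  have Kc: "x \<in> cell h (K x)" for x
  proof -
    have "h * of_int \<lfloor>x $ i / h\<rfloor> \<le> x $ i \<and> x $ i < h * (of_int \<lfloor>x $ i / h\<rfloor> + 1)" for i
    proof -
      have "of_int \<lfloor>x $ i / h\<rfloor> \<le> x $ i / h" "x $ i / h < of_int \<lfloor>x $ i / h\<rfloor> + 1" by linarith+
      from this(1)[THEN mult_left_mono, of h] this(2)[THEN mult_strict_left_mono, of h] show ?thesis using h by simp
    qed
    then show ?thesis unfolding cell_def K_def by simp
  qed
  have Ku: "k = K x" if "x \<in> cell h k" for x k
  proof
    fix i
    have "h * of_int (k i) \<le> x $ i" "x $ i < h * (of_int (k i) + 1)" using that unfolding cell_def by auto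
    then have "of_int (k i) \<le> x $ i / h" "x $ i / h < of_int (k i) + 1" using h by (simp_all add: field_simps)
    then show "k i = K x i" unfolding K_def by linarith
  qed
  have Kiff: "x \<in> cell h k \<longleftrightarrow> k = K x" for x k using Kc[of x] Ku[of x k] by blast
  have KI: "K x \<in> I" if "x \<in> \<Omega>" for x
  proof -
    have "- N \<le> K x i \<and> K x i \<le> N" for i
    proof -
      have "norm x \<le> \<bar>R\<bar>" using R that by auto
      then have "\<bar>x $ i\<bar> \<le> \<bar>R\<bar>" using component_le_norm_cart[of x i] by linarith
      then have "\<bar>x $ i / h\<bar> \<le> \<bar>R\<bar> / h" using h by (simp add: abs_divide divide_right_mono)
      then show ?thesis unfolding K_def N_def by linarith
    qed
    then show ?thesis unfolding I_def by (auto simp: PiE_def)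
  qed
  have "(LINT x|lborel. (\<phi> x)\<^sup>2) \<le> (\<Sum>k\<in>I. (1 / h ^ ?n) * (LINT x|lborel. indicator (cell h k) x * \<phi> x)\<^sup>2)
       + \<epsilon> * (\<Sum>i\<in>UNIV. LINT x|lborel. (partial i \<phi> x)\<^sup>2)" if t: "test_fun \<Omega> \<phi>" for \<phi>
  proof -
    have u: "C1c \<phi>" by (rule test_fun_C1c[OF t])
    define q where "q = h ^ ?n"
    have q: "q > 0" unfolding q_def using h by simp
    define A where "A k = (LINT x|lborel. indicator (cell h k) x * (\<phi> x)\<^sup>2)" for k
    define m where "m k = (LINT x|lborel. indicator (cell h k) x * \<phi> x)" for k
    define D where "D = (\<Sum>i\<in>UNIV. LINT x|lborel. (partial i \<phi> x)\<^sup>2)"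
    have D0: "D \<ge> 0" unfolding D_def by (intro sum_nonneg integral_nonneg_AE) simp
    have sqi: "integrable lborel (\<lambda>x. (\<phi> x)\<^sup>2)" using C1c_integrable_mult(1)[OF u C1cD(4)[OF u]] by (simp add: power2_eq_square)
    have "(\<Sum>k\<in>I. indicator (cell h k) x * (\<phi> x)\<^sup>2) = (\<phi> x)\<^sup>2" for x
    proof (cases "x \<in> \<Omega>")
      case True
      have "(\<Sum>k\<in>I. indicator (cell h k) x * (\<phi> x)\<^sup>2) = (\<Sum>k\<in>I. if k = K x then (\<phi> x)\<^sup>2 else 0)"
        using Kiff[of x] by (intro sum.cong) (simp_all add: indicator_def)
      then show ?thesis using I KI[OF True] by simp
    next
      case False
      then have "x \<notin> tsupport \<phi>" using t unfolding test_fun_def by blast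
      then show ?thesis using zero_outside_tsupport[of x \<phi>] by simp
    qed
    then have "(LINT x|lborel. (\<phi> x)\<^sup>2) = (LINT x|lborel. (\<Sum>k\<in>I. indicator (cell h k) x * (\<phi> x)\<^sup>2))" by simp
    also have "\<dots> = (\<Sum>k\<in>I. A k)"
      unfolding A_def
    proof (rule Bochner_Integration.integral_sum)
      show "integrable lborel (\<lambda>x. indicator (cell h k) x * (\<phi> x)\<^sup>2)" for k
        using integrable_mult_indicator[OF _ sqi, of "cell h k"] cell_measurable[of h k] by simp
    qed
    finally have tot: "(LINT x|lborel. (\<phi> x)\<^sup>2) = (\<Sum>k\<in>I. A k)" .
    \<comment> \<open>Conversion to \<open>ennreal\<close> truncates negative numbers, so each
      summand must be known nonnegative before the sum is converted; this is Cauchy-Schwarz on one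
      cell.\<close>
    have pos: "0 \<le> 2 * q * A k - 2 * (m k)\<^sup>2" for k
    proof -
      have "\<bar>m k\<bar> * \<bar>m k\<bar> \<le> q * A k"
      proof -
        have i1: "integrable lborel (\<lambda>x. indicator (cell h k) x * (\<phi> x)\<^sup>2)"
          using integrable_mult_indicator[OF _ sqi, of "cell h k"] cell_measurable[of h k] by simp
        have i2: "integrable lborel (\<lambda>x. indicator (cell h k) x * \<phi> x)"
          using integrable_mult_indicator[OF _ C1c_integrable(1)[OF u], of "cell h k"] cell_measurable[of h k] by simp
        have i3: "integrable lborel (indicator (cell h k) :: _ \<Rightarrow> real)" "(LINT x|lborel. indicator (cell h k) x) = q"
          using emeasure_cell[OF h, of k] cell_measurable[of h k] h unfolding q_def by (simp_all add: measure_def)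
        let ?c = "m k / q"
        have "0 \<le> (LINT x|lborel. indicator (cell h k) x * (\<phi> x - ?c)\<^sup>2)" by (intro integral_nonneg_AE AE_I2) simp
        also have "\<dots> = (LINT x|lborel. indicator (cell h k) x * (\<phi> x)\<^sup>2 - 2 * ?c * (indicator (cell h k) x * \<phi> x) + ?c\<^sup>2 * indicator (cell h k) x)"
          by (intro Bochner_Integration.integral_cong) (auto simp: power2_eq_square algebra_simps)
        also have "\<dots> = A k - 2 * ?c * m k + ?c\<^sup>2 * q"
        proof -
          have lin: "(LINT x|lborel. f x - 2 * ?c * g x + ?c\<^sup>2 * j x) = (LINT x|lborel. f x) - 2 * ?c * (LINT x|lborel. g x) + ?c\<^sup>2 * (LINT x|lborel. j x)"
            if "integrable lborel f" "integrable lborel g" "integrable lborel j" for f g j :: "real^'n \<Rightarrow> real"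
            using that by simp
          have "(LINT x|lborel. indicator (cell h k) x * (\<phi> x)\<^sup>2) = A k" "(LINT x|lborel. indicator (cell h k) x * \<phi> x) = m k"
            unfolding A_def m_def by simp_all
          then show ?thesis using lin[OF i1 i2 i3(1)] i3(2) by simp
        qed
        also have "\<dots> = A k - (m k)\<^sup>2 / q" using q by (simp add: power2_eq_square field_simps)
        finally show ?thesis using q by (simp add: field_simps power2_eq_square)
      qed
      then show ?thesis by (simp add: power2_eq_square abs_mult_self_eq)
    qed
    have "ennreal (\<Sum>k\<in>I. 2 * q * A k - 2 * (m k)\<^sup>2) = (\<Sum>k\<in>I. ennreal (2 * q * A k - 2 * (m k)\<^sup>2))"
      using pos by simp
    also have "\<dots> = (\<Sum>k\<in>I. \<integral>\<^sup>+x. (\<integral>\<^sup>+y. indicator (cell h k) x * indicator (cell h k) y * ennreal ((\<phi> x - \<phi> y)\<^sup>2) \<partial>lborel) \<partial>lborel)"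
      unfolding A_def m_def q_def
      by (intro sum.cong refl cell_pair_integral[OF u cell_measurable emeasure_cell[OF h], symmetric]) (use h in simp)
    also have "\<dots> \<le> ennreal (real ?n * h\<^sup>2 * D * (2 * h) ^ ?n)"
      unfolding D_def by (rule cells_pair_bound[OF u h I])
    finally have "(\<Sum>k\<in>I. 2 * q * A k - 2 * (m k)\<^sup>2) \<le> real ?n * h\<^sup>2 * D * (2 * h) ^ ?n"
      using D0 h by (subst (asm) ennreal_le_iff) auto
    also have "\<dots> = 2 * q * (\<epsilon> * D)" unfolding hsq[symmetric] q_def by (simp add: power_mult_distrib)
    finally have "2 * q * (\<Sum>k\<in>I. A k) \<le> 2 * (\<Sum>k\<in>I. (m k)\<^sup>2) + 2 * q * (\<epsilon> * D)"
      by (simp add: sum_subtractf sum_distrib_left)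
    then have "(\<Sum>k\<in>I. A k) \<le> (\<Sum>k\<in>I. (m k)\<^sup>2) / q + \<epsilon> * D" using q by (simp add: field_simps)
    then show ?thesis unfolding tot D_def m_def q_def by (simp add: sum_divide_distrib)
  qed
  then show ?thesis using that[OF I h] by blast
qed

subsection \<open>Sobolev spaces\<close>

context complex_vector_space
begin

text \<open>The common shape of \<open>H10\<close> and \<open>H0div\<close>: closures of the test
  functions inside a larger complete space.\<close>

definition qclosure :: "'a set \<Rightarrow> ('a \<Rightarrow> 'a \<Rightarrow> complex) \<Rightarrow> 'a set \<Rightarrow> 'a set" where
  "qclosure S f T = {x\<in>S. \<exists>\<psi>::nat\<Rightarrow>'a. (\<forall>k. \<psi> k \<in> T) \<and> (\<lambda>k. qn f (x - \<psi> k)) \<longlonglongrightarrow> 0}"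

lemma qn_zero:
  assumes "psd S f" "subspace S"
  shows "qn f 0 = 0"
  using qn_scale[OF assms subspace_0[OF assms(2)], of 0] by simp

lemma subspace_qclosure:
  assumes f: "psd S f" and S: "subspace S" and T: "T \<subseteq> S" "subspace T"
  shows "subspace (qclosure S f T)"
  unfolding subspace_def
proof (intro conjI ballI allI)
  show "0 \<in> qclosure S f T"
    unfolding qclosure_def using subspace_0[OF S] subspace_0[OF T(2)] qn_zero[OF f S]
    by (auto intro!: exI[of _ "\<lambda>_. 0"])
next
  fix x y assume "x \<in> qclosure S f T" "y \<in> qclosure S f T"
  then obtain a b where x: "x \<in> S" "\<And>k. a k \<in> T" "(\<lambda>k. qn f (x - a k)) \<longlonglongrightarrow> 0"
    and y: "y \<in> S" "\<And>k. b k \<in> T" "(\<lambda>k. qn f (y - b k)) \<longlonglongrightarrow> 0" unfolding qclosure_def by blast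
  have d: "x - a k \<in> S" "y - b k \<in> S" for k using x y T(1) S subspace_diff by blast+
  have "(\<lambda>k. qn f ((x + y) - (a k + b k))) \<longlonglongrightarrow> 0"
  proof (rule Lim_null_comparison)
    show "\<forall>\<^sub>F k in sequentially. norm (qn f ((x + y) - (a k + b k))) \<le> qn f (x - a k) + qn f (y - b k)"
    proof (rule always_eventually, rule allI)
      fix k
      have e: "(x + y) - (a k + b k) = (x - a k) + (y - b k)" by simp
      show "norm (qn f ((x + y) - (a k + b k))) \<le> qn f (x - a k) + qn f (y - b k)"
        unfolding e using qn_triangle[OF f S d] qn_nonneg[OF f subspace_add[OF S d]] by simp
    qed
    show "(\<lambda>k. qn f (x - a k) + qn f (y - b k)) \<longlonglongrightarrow> 0" using tendsto_add[OF x(3) y(3)] by simp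
  qed
  then show "x + y \<in> qclosure S f T"
    unfolding qclosure_def using x y S T(2) subspace_add by (auto intro!: exI[of _ "\<lambda>k. a k + b k"])
next
  fix c x assume "x \<in> qclosure S f T"
  then obtain a where x: "x \<in> S" "\<And>k. a k \<in> T" "(\<lambda>k. qn f (x - a k)) \<longlonglongrightarrow> 0" unfolding qclosure_def by blast
  have "qn f (c \<odot> x - c \<odot> a k) = cmod c * qn f (x - a k)" for k
    using qn_scale[OF f S, of "x - a k" c] x T(1) S by (simp add: scale_right_diff_distrib subsetD subspace_diff)
  then have "(\<lambda>k. qn f (c \<odot> x - c \<odot> a k)) \<longlonglongrightarrow> 0" using tendsto_mult_right_zero[OF x(3), of "cmod c"] by simp
  then show "c \<odot> x \<in> qclosure S f T"
    unfolding qclosure_def using x S T(2) subspace_scale by (auto intro!: exI[of _ "\<lambda>k. c \<odot> a k"])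
qed

text \<open>A limit exists in the larger space; replacing the n-th member by an approximation from
  \<open>T\<close> with error below \<open>1 / (n + 1)\<close> shows that the limit lies in the
  closure.\<close>

lemma qcomplete_qclosure:
  assumes f: "psd S f" and S: "subspace S" and T: "T \<subseteq> S" and com: "qcomplete S f"
  shows "qcomplete (qclosure S f T) f"
  unfolding qcomplete_def
proof (intro allI impI)
  fix X :: "nat \<Rightarrow> 'a"
  assume X: "\<forall>n. X n \<in> qclosure S f T" and C: "\<forall>\<epsilon>>0. \<exists>N. \<forall>m\<ge>N. \<forall>n\<ge>N. qn f (X m - X n) < \<epsilon>"
  have XS: "X n \<in> S" for n using X unfolding qclosure_def by blast
  obtain x where x: "x \<in> S" "(\<lambda>n. qn f (X n - x)) \<longlonglongrightarrow> 0" using com XS C unfolding qcomplete_def by blast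
  have "\<exists>\<psi>\<in>T. qn f (X n - \<psi>) < 1 / real (Suc n)" for n
  proof -
    obtain a :: "nat \<Rightarrow> 'a" where a: "\<And>k. a k \<in> T" "(\<lambda>k. qn f (X n - a k)) \<longlonglongrightarrow> 0" using X unfolding qclosure_def by blast
    have "\<forall>\<^sub>F k in sequentially. qn f (X n - a k) < 1 / real (Suc n)" by (rule order_tendstoD(2)[OF a(2)]) simp
    then show ?thesis using a(1) eventually_happens'[OF sequentially_bot] by blast
  qed
  then obtain b where b: "\<And>n. b n \<in> T" "\<And>n. qn f (X n - b n) < 1 / real (Suc n)" by metis
  have bS: "b n \<in> S" for n using b(1) T by blast
  have "(\<lambda>n. qn f (x - b n)) \<longlonglongrightarrow> 0"
  proof (rule Lim_null_comparison)
    show "\<forall>\<^sub>F n in sequentially. norm (qn f (x - b n)) \<le> qn f (X n - x) + 1 / real (Suc n)"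
    proof (rule always_eventually, rule allI)
      fix n
      have "qn f (x - b n) \<le> qn f (x - X n) + qn f (X n - b n)" by (rule qn_triangle_diff[OF f S x(1) XS bS])
      then show "norm (qn f (x - b n)) \<le> qn f (X n - x) + 1 / real (Suc n)"
        using b(2)[of n] qn_diff_commute[OF f S x(1) XS, of n] qn_nonneg[OF f subspace_diff[OF S x(1) bS]] by simp
    qed
    show "(\<lambda>n. qn f (X n - x) + 1 / real (Suc n)) \<longlonglongrightarrow> 0"
      using tendsto_add[OF x(2) LIMSEQ_inverse_real_of_nat] by (simp add: inverse_eq_divide)
  qed
  then have "x \<in> qclosure S f T" unfolding qclosure_def using x(1) b(1) by blast
  then show "\<exists>x\<in>qclosure S f T. (\<lambda>n. qn f (X n - x)) \<longlonglongrightarrow> 0" using x(2) by blast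
qed

lemma qcomplete_equivalent:
  assumes f: "psd S f" and g: "psd S g" and S: "subspace S" and com: "qcomplete S f"
    and le: "\<And>x. x \<in> S \<Longrightarrow> qn f x \<le> C * qn g x" "\<And>x. x \<in> S \<Longrightarrow> qn g x \<le> C * qn f x" and C: "C > 0"
  shows "qcomplete S g"
  unfolding qcomplete_def
proof (intro allI impI)
  fix X :: "nat \<Rightarrow> 'a"
  assume X: "\<forall>n. X n \<in> S" and Cau: "\<forall>\<epsilon>>0. \<exists>N. \<forall>m\<ge>N. \<forall>n\<ge>N. qn g (X m - X n) < \<epsilon>"
  have XS: "X n \<in> S" "X m - X n \<in> S" for m n using X S subspace_diff by blast+
  have "\<exists>N. \<forall>m\<ge>N. \<forall>n\<ge>N. qn f (X m - X n) < \<epsilon>" if e0: "\<epsilon> > 0" for \<epsilon>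
  proof -
    obtain N where N: "\<forall>m\<ge>N. \<forall>n\<ge>N. qn g (X m - X n) < \<epsilon> / C" using Cau divide_pos_pos[OF e0 C] by blast
    have "qn f (X m - X n) < \<epsilon>" if "m \<ge> N" "n \<ge> N" for m n
    proof -
      have "C * qn g (X m - X n) < \<epsilon>" using N that C by (simp add: field_simps)
      then show ?thesis using le(1)[OF XS(2), of m n] by simp
    qed
    then show ?thesis by blast
  qed
  then obtain x where x: "x \<in> S" "(\<lambda>n. qn f (X n - x)) \<longlonglongrightarrow> 0" using com XS(1) unfolding qcomplete_def by blast
  have xS: "X n - x \<in> S" for n using XS x S subspace_diff by blast
  have "(\<lambda>n. qn g (X n - x)) \<longlonglongrightarrow> 0"
  proof (rule Lim_null_comparison)
    show "\<forall>\<^sub>F n in sequentially. norm (qn g (X n - x)) \<le> C * qn f (X n - x)"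
      using le(2)[OF xS] qn_nonneg[OF g xS] by (intro always_eventually) simp
    show "(\<lambda>n. C * qn f (X n - x)) \<longlonglongrightarrow> 0" by (rule tendsto_mult_right_zero[OF x(2)])
  qed
  then show "\<exists>x\<in>S. (\<lambda>n. qn g (X n - x)) \<longlonglongrightarrow> 0" using x(1) by blast
qed

text \<open>Every inner product on the unknowns is of this kind, with a coordinate for the value and
  one for each weak derivative or divergence entering the norm; completeness and boundedness are
  then proved once.\<close>

definition coord_ip :: "(real^'n::finite) set \<Rightarrow> 'c set \<Rightarrow> ('c \<Rightarrow> 'a \<Rightarrow> real^'n \<Rightarrow> complex) \<Rightarrow> 'a \<Rightarrow> 'a \<Rightarrow> complex" where
  "coord_ip \<Omega> A L u v = (\<Sum>a\<in>A. inner_L2 \<Omega> (L a u) (L a v))"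

lemma psd_coord_ip:
  assumes "\<And>a. a \<in> A \<Longrightarrow> aelin \<Omega> S (L a)" "subspace S"
  shows "psd S (coord_ip \<Omega> A L)"
proof -
  have "psd S (\<lambda>u v. \<Sum>a\<in>A. inner_L2 \<Omega> (L a u) (L a v))"
    by (intro psd_sum psd_inner_aelin assms)
  then show ?thesis unfolding coord_ip_def[abs_def] .
qed

lemma qn_coord_ip: "qn (coord_ip \<Omega> A L) u = sqrt (\<Sum>a\<in>A. (norm_L2 \<Omega> (L a u))\<^sup>2)"
  unfolding qn_def coord_ip_def by (simp add: inner_L2_self)

lemma norm_L2_le_coord_ip:
  assumes "finite A" "a \<in> A"
  shows "norm_L2 \<Omega> (L a u) \<le> qn (coord_ip \<Omega> A L) u"
  unfolding qn_coord_ip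
  using member_le_sum[OF assms(2), of "\<lambda>a. (norm_L2 \<Omega> (L a u))\<^sup>2"] assms(1)
  by (intro real_le_rsqrt) auto

lemma lbounded_coord:
  assumes "finite A" "a \<in> A"
  shows "lbounded \<Omega> S (coord_ip \<Omega> A L) (L a)"
  unfolding lbounded_def using norm_L2_le_coord_ip[OF assms, of \<Omega> L] by (intro exI[of _ 1]) simp

text \<open>The coordinates of a Cauchy sequence converge separately in L2. The hypothesis
  \<open>cl\<close>, closedness of the weak differential operator, provides an element having the
  limits as its coordinates.\<close>

lemma qcomplete_coord_ip:
  assumes fin: "finite_measure (lebesgue_on \<Omega>)" and A: "finite A" and S: "subspace S"
    and L: "\<And>a. a \<in> A \<Longrightarrow> aelin \<Omega> S (L a)"
    and cl: "\<And>X g. (\<And>n. X n \<in> S) \<Longrightarrow> (\<And>a. a \<in> A \<Longrightarrow> L2 \<Omega> (g a)) \<Longrightarrow>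
       (\<And>a. a \<in> A \<Longrightarrow> (\<lambda>n::nat. norm_L2 \<Omega> (\<lambda>x. L a (X n) x - g a x)) \<longlonglongrightarrow> 0) \<Longrightarrow>
       \<exists>u\<in>S. \<forall>a\<in>A. AE x in lebesgue_on \<Omega>. L a u x = g a x"
  shows "qcomplete S (coord_ip \<Omega> A L)"
  unfolding qcomplete_def
proof (intro allI impI)
  fix X :: "nat \<Rightarrow> 'a"
  assume "\<forall>n. X n \<in> S" and Cau: "\<forall>\<epsilon>>0. \<exists>N. \<forall>m\<ge>N. \<forall>n\<ge>N. qn (coord_ip \<Omega> A L) (X m - X n) < \<epsilon>"
  then have XS: "X n \<in> S" for n by blast
  have "\<exists>g. L2 \<Omega> g \<and> (\<lambda>n. norm_L2 \<Omega> (\<lambda>x. L a (X n) x - g x)) \<longlonglongrightarrow> 0" if a: "a \<in> A" for a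
  proof (rule L2_complete[OF fin])
    show "L2 \<Omega> (L a (X n))" for n using aelinD(1)[OF L[OF a] XS] .
    fix \<epsilon> :: real assume "\<epsilon> > 0"
    then obtain N where N: "\<forall>m\<ge>N. \<forall>n\<ge>N. qn (coord_ip \<Omega> A L) (X m - X n) < \<epsilon>" using Cau by blast
    have "norm_L2 \<Omega> (\<lambda>x. L a (X m) x - L a (X n) x) < \<epsilon>" if "m \<ge> N" "n \<ge> N" for m n
      using norm_L2_le_coord_ip[OF A a, of \<Omega> L "X m - X n"] N that norm_L2_aelin_diff[OF L[OF a] S XS XS, of m n]
      by (metis order_le_less_trans)
    then show "\<exists>N. \<forall>m\<ge>N. \<forall>n\<ge>N. norm_L2 \<Omega> (\<lambda>x. L a (X m) x - L a (X n) x) < \<epsilon>" by blast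
  qed
  then have "\<exists>g. \<forall>a\<in>A. L2 \<Omega> (g a) \<and> (\<lambda>n. norm_L2 \<Omega> (\<lambda>x. L a (X n) x - g a x)) \<longlonglongrightarrow> 0"
    by (intro bchoice) simp
  then obtain g where g: "\<And>a. a \<in> A \<Longrightarrow> L2 \<Omega> (g a)" "\<And>a. a \<in> A \<Longrightarrow> (\<lambda>n. norm_L2 \<Omega> (\<lambda>x. L a (X n) x - g a x)) \<longlonglongrightarrow> 0"
    by blast
  obtain u where u: "u \<in> S" "\<forall>a\<in>A. AE x in lebesgue_on \<Omega>. L a u x = g a x" using cl[OF XS g] by blast
  have eq: "norm_L2 \<Omega> (L a (X n - u)) = norm_L2 \<Omega> (\<lambda>x. L a (X n) x - g a x)" if a: "a \<in> A" for a n
  proof -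
    have "norm_L2 \<Omega> (L a (X n - u)) = norm_L2 \<Omega> (\<lambda>x. L a (X n) x - L a u x)"
      by (rule norm_L2_aelin_diff[OF L[OF a] S XS u(1)])
    also have "\<dots> = norm_L2 \<Omega> (\<lambda>x. L a (X n) x - g a x)"
    proof (rule norm_L2_cong_AE)
      show "L2 \<Omega> (\<lambda>x. L a (X n) x - L a u x)" "L2 \<Omega> (\<lambda>x. L a (X n) x - g a x)"
        using aelinD(1)[OF L[OF a] XS] aelinD(1)[OF L[OF a] u(1)] g(1)[OF a] by (auto intro: L2_diff)
      show "AE x in lebesgue_on \<Omega>. L a (X n) x - L a u x = L a (X n) x - g a x"
        using u(2)[rule_format, OF a] by eventually_elim simp
    qed
    finally show ?thesis .
  qed
  have "(\<lambda>n. sqrt (\<Sum>a\<in>A. (norm_L2 \<Omega> (\<lambda>x. L a (X n) x - g a x))\<^sup>2)) \<longlonglongrightarrow> sqrt (\<Sum>a\<in>A. 0\<^sup>2)"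
    by (intro tendsto_real_sqrt tendsto_sum tendsto_power g(2))
  then have "(\<lambda>n. qn (coord_ip \<Omega> A L) (X n - u)) \<longlonglongrightarrow> 0"
    unfolding qn_coord_ip using eq by simp
  then show "\<exists>x\<in>S. (\<lambda>n. qn (coord_ip \<Omega> A L) (X n - x)) \<longlonglongrightarrow> 0" using u(1) by blast
qed

lemma coord_tendsto:
  assumes A: "finite A" "a \<in> A" and L: "aelin \<Omega> S (L a)" and S: "subspace S"
    and X: "\<And>n. X n \<in> S" "x \<in> S" "(\<lambda>n. qn (coord_ip \<Omega> A L) (X n - x)) \<longlonglongrightarrow> 0"
  shows "(\<lambda>n. norm_L2 \<Omega> (\<lambda>t. L a (X n) t - L a x t)) \<longlonglongrightarrow> 0"
proof (rule Lim_null_comparison[OF always_eventually X(3)], rule allI)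
  fix n
  show "norm (norm_L2 \<Omega> (\<lambda>t. L a (X n) t - L a x t)) \<le> qn (coord_ip \<Omega> A L) (X n - x)"
    using norm_L2_le_coord_ip[OF A, of \<Omega> L "X n - x"] norm_L2_aelin_diff[OF L S X(1,2), of n] norm_L2_nonneg
    by (metis real_norm_def abs_of_nonneg)
qed

end

lemma L2_limit_AE_unique:
  assumes F: "\<And>n. L2 \<Omega> (F n)" and g: "L2 \<Omega> g" "L2 \<Omega> h"
    and l: "(\<lambda>n::nat. norm_L2 \<Omega> (\<lambda>x. F n x - g x)) \<longlonglongrightarrow> 0" "(\<lambda>n. norm_L2 \<Omega> (\<lambda>x. F n x - h x)) \<longlonglongrightarrow> 0"
  shows "AE x in lebesgue_on \<Omega>. g x = h x"
proof -
  have le: "norm_L2 \<Omega> (\<lambda>x. g x - h x) \<le> norm_L2 \<Omega> (\<lambda>x. F n x - g x) + norm_L2 \<Omega> (\<lambda>x. F n x - h x)" for n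
  proof -
    have "norm_L2 \<Omega> (\<lambda>x. g x - F n x) = norm_L2 \<Omega> (\<lambda>x. F n x - g x)"
      unfolding norm_L2_def by (simp add: norm_minus_commute)
    then show ?thesis using norm_L2_triangle_diff[OF g(1) F g(2), of n] by simp
  qed
  have "(\<lambda>n. norm_L2 \<Omega> (\<lambda>x. F n x - g x) + norm_L2 \<Omega> (\<lambda>x. F n x - h x)) \<longlonglongrightarrow> 0" using tendsto_add[OF l] by simp
  then have "norm_L2 \<Omega> (\<lambda>x. g x - h x) \<le> 0" using le by (intro LIMSEQ_le_const) auto
  then have "norm_L2 \<Omega> (\<lambda>x. g x - h x) = 0" using norm_L2_nonneg[of \<Omega> "\<lambda>x. g x - h x"] by simp
  then have "AE x in lebesgue_on \<Omega>. g x - h x = 0" using norm_L2_eq_0_iff[OF L2_diff[OF g]] by simp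
  then show ?thesis by eventually_elim simp
qed

interpretation vf: complex_vector_space "\<lambda>c (f :: 'b \<Rightarrow> complex^'m::finite) x. c *s f x"
  by unfold_locales (auto simp: fun_eq_iff vec_eq_iff algebra_simps)

section \<open>Weak gradients and the scalar Sobolev spaces\<close>

locale domain =
  fixes \<Omega> :: "(real^'n::finite) set"
  assumes open_dom: "open \<Omega>" and bounded_dom: "bounded \<Omega>"
begin

lemma lmeasurable_dom: "\<Omega> \<in> lmeasurable"
  using open_dom bounded_dom by (simp add: lmeasurable_open)

lemma sets_dom: "\<Omega> \<in> sets lebesgue"
  using lmeasurable_dom by auto

lemma finite_dom: "finite_measure (lebesgue_on \<Omega>)"
  using lmeasurable_dom by (rule finite_measure_lebesgue_on)

lemma L2_const: "L2 \<Omega> (\<lambda>x. c)"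
proof -
  interpret finite_measure "lebesgue_on \<Omega>" by (rule finite_dom)
  show ?thesis unfolding L2_def by simp
qed

lemma L2_integrable: "L2 \<Omega> f \<Longrightarrow> integrable (lebesgue_on \<Omega>) f"
  using integrable_L2_mult[OF _ L2_const[of 1]] by simp

lemma L2_test:
  assumes "test_fun \<Omega> \<phi>"
  shows "L2 \<Omega> (\<lambda>x. of_real (\<phi> x))"
proof -
  obtain B where B: "B \<ge> 0" "\<And>x. \<bar>\<phi> x\<bar> \<le> B"
  proof (rule continuous_bounded_outside_compact[of \<phi> "tsupport \<phi>"])
    show "continuous_on UNIV \<phi>" by (rule test_fun_continuous(1)[OF assms])
    show "compact (tsupport \<phi>)" using assms unfolding test_fun_def by blast
  qed (use zero_outside_tsupport in auto)
  have "\<phi> \<in> borel_measurable (lebesgue_on \<Omega>)"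
    using test_fun_measurable(1)[OF assms] by (intro measurable_restrict_space1 measurable_completion) simp
  then have "L2 \<Omega> (\<lambda>x. of_real (\<phi> x) * 1)"
    using B by (intro L2_bounded_mult[OF L2_const, of _ B]) (auto intro: borel_measurable_of_real)
  then show ?thesis by simp
qed

lemma L2_test_partial: "test_fun \<Omega> \<phi> \<Longrightarrow> L2 \<Omega> (\<lambda>x. of_real (partial i \<phi> x))"
  using L2_test[OF test_fun_partial] by blast

lemma AE_eq_if_weak_eq:
  assumes "L2 \<Omega> g" "L2 \<Omega> h"
    and "\<And>\<phi>. test_fun \<Omega> \<phi> \<Longrightarrow> (LINT x|lebesgue_on \<Omega>. g x * of_real (\<phi> x)) = (LINT x|lebesgue_on \<Omega>. h x * of_real (\<phi> x))"
  shows "AE x in lebesgue_on \<Omega>. g x = h x"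
proof -
  have "AE x in lebesgue_on \<Omega>. g x - h x = 0"
  proof (rule fundamental_lemma[OF open_dom])
    show "integrable (lebesgue_on \<Omega>) (\<lambda>x. g x - h x)" using L2_integrable[OF L2_diff[OF assms(1,2)]] .
    fix \<phi> assume t: "test_fun \<Omega> \<phi>"
    show "(LINT x|lebesgue_on \<Omega>. (g x - h x) * of_real (\<phi> x)) = 0"
      using assms(3)[OF t] integrable_L2_mult[OF assms(1) L2_test[OF t]] integrable_L2_mult[OF assms(2) L2_test[OF t]]
      by (simp add: left_diff_distrib)
  qed
  then show ?thesis by eventually_elim simp
qed

lemma is_wgradD:
  assumes "is_wgrad \<Omega> f g"
  shows "L2 \<Omega> (\<lambda>x. g x $ i)"
    "test_fun \<Omega> \<phi> \<Longrightarrow> (LINT x|lebesgue_on \<Omega>. f x * of_real (partial i \<phi> x)) = - (LINT x|lebesgue_on \<Omega>. g x $ i * of_real (\<phi> x))"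
  using assms unfolding is_wgrad_def by blast+

text \<open>The fundamental lemma applied to the defining identity. The functions themselves may
  differ on a null set, so a function that is zero almost everywhere is also covered.\<close>

lemma is_wgrad_unique:
  assumes "is_wgrad \<Omega> f g" "is_wgrad \<Omega> f' h" "AE x in lebesgue_on \<Omega>. f x = f' x" "L2 \<Omega> f" "L2 \<Omega> f'"
  shows "AE x in lebesgue_on \<Omega>. g x $ i = h x $ i"
proof (rule AE_eq_if_weak_eq)
  show "L2 \<Omega> (\<lambda>x. g x $ i)" "L2 \<Omega> (\<lambda>x. h x $ i)" using is_wgradD(1) assms by blast+
  fix \<phi> assume t: "test_fun \<Omega> \<phi>"
  have "(LINT x|lebesgue_on \<Omega>. f x * of_real (partial i \<phi> x)) = (LINT x|lebesgue_on \<Omega>. f' x * of_real (partial i \<phi> x))"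
  proof (rule integral_cong_AE)
    show "(\<lambda>x. f x * of_real (partial i \<phi> x)) \<in> borel_measurable (lebesgue_on \<Omega>)"
      "(\<lambda>x. f' x * of_real (partial i \<phi> x)) \<in> borel_measurable (lebesgue_on \<Omega>)"
      using borel_measurable_integrable[OF integrable_L2_mult[OF assms(4) L2_test_partial[OF t]]]
        borel_measurable_integrable[OF integrable_L2_mult[OF assms(5) L2_test_partial[OF t]]] by auto
    show "AE x in lebesgue_on \<Omega>. f x * of_real (partial i \<phi> x) = f' x * of_real (partial i \<phi> x)"
      using assms(3) by eventually_elim simp
  qed
  then show "(LINT x|lebesgue_on \<Omega>. g x $ i * of_real (\<phi> x)) = (LINT x|lebesgue_on \<Omega>. h x $ i * of_real (\<phi> x))"
    using is_wgradD(2)[OF assms(1) t, of i] is_wgradD(2)[OF assms(2) t, of i] by simp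
qed

lemma is_wgrad_wgrad: "H1 \<Omega> f \<Longrightarrow> is_wgrad \<Omega> f (wgrad \<Omega> f)"
  unfolding H1_def wgrad_def by (metis someI_ex)

lemma is_wgrad_add:
  assumes "is_wgrad \<Omega> f g" "is_wgrad \<Omega> f' g'" "L2 \<Omega> f" "L2 \<Omega> f'"
  shows "is_wgrad \<Omega> (\<lambda>x. f x + f' x) (\<lambda>x. g x + g' x)"
  unfolding is_wgrad_def
proof (intro conjI allI impI)
  show "L2 \<Omega> (\<lambda>x. (g x + g' x) $ i)" for i using L2_add[OF is_wgradD(1)[OF assms(1)] is_wgradD(1)[OF assms(2)]] by simp
  fix \<phi> i assume t: "test_fun \<Omega> \<phi>"
  show "(LINT x|lebesgue_on \<Omega>. (f x + f' x) * of_real (partial i \<phi> x)) = - (LINT x|lebesgue_on \<Omega>. (g x + g' x) $ i * of_real (\<phi> x))"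
    using integrable_L2_mult[OF assms(3) L2_test_partial[OF t]] integrable_L2_mult[OF assms(4) L2_test_partial[OF t]]
      integrable_L2_mult[OF is_wgradD(1)[OF assms(1)] L2_test[OF t]] integrable_L2_mult[OF is_wgradD(1)[OF assms(2)] L2_test[OF t]]
      is_wgradD(2)[OF assms(1) t, of i] is_wgradD(2)[OF assms(2) t, of i]
    by (simp add: ring_distribs)
qed

lemma is_wgrad_cmult:
  assumes "is_wgrad \<Omega> f g"
  shows "is_wgrad \<Omega> (\<lambda>x. c * f x) (\<lambda>x. c *s g x)"
  unfolding is_wgrad_def
proof (intro conjI allI impI)
  show "L2 \<Omega> (\<lambda>x. (c *s g x) $ i)" for i using L2_cmult[OF is_wgradD(1)[OF assms]] by simp
  fix \<phi> i assume t: "test_fun \<Omega> \<phi>"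
  show "(LINT x|lebesgue_on \<Omega>. c * f x * of_real (partial i \<phi> x)) = - (LINT x|lebesgue_on \<Omega>. (c *s g x) $ i * of_real (\<phi> x))"
    using is_wgradD(2)[OF assms t, of i] by (simp add: mult.assoc)
qed

lemma H1_L2: "H1 \<Omega> f \<Longrightarrow> L2 \<Omega> f"
  unfolding H1_def by blast

lemma H1_I: "L2 \<Omega> f \<Longrightarrow> is_wgrad \<Omega> f g \<Longrightarrow> H1 \<Omega> f"
  unfolding H1_def by blast

lemma L2_wgrad: "H1 \<Omega> f \<Longrightarrow> L2 \<Omega> (\<lambda>x. wgrad \<Omega> f x $ i)"
  using is_wgradD(1)[OF is_wgrad_wgrad] .

lemma wgrad_AE:
  assumes "L2 \<Omega> f" "is_wgrad \<Omega> f g"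
  shows "AE x in lebesgue_on \<Omega>. wgrad \<Omega> f x $ i = g x $ i"
  using is_wgrad_unique[OF is_wgrad_wgrad[OF H1_I[OF assms]] assms(2) _ assms(1,1)] by simp

lemma fn_subspace_H1: "fn.subspace {f. H1 \<Omega> f}"
  unfolding fn.subspace_def
proof (intro conjI ballI allI; clarify?)
  have "is_wgrad \<Omega> (\<lambda>x. 0) (\<lambda>x. 0)" unfolding is_wgrad_def by (simp add: L2_zero)
  then show "H1 \<Omega> 0" unfolding zero_fun_def using H1_I[OF L2_zero] by simp
next
  fix f g assume "H1 \<Omega> f" "H1 \<Omega> g"
  then show "H1 \<Omega> (f + g)"
    unfolding plus_fun_def
    using H1_I[OF L2_add is_wgrad_add[OF is_wgrad_wgrad is_wgrad_wgrad]] H1_L2 by blast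
next
  fix c f assume "H1 \<Omega> f"
  then show "H1 \<Omega> (\<lambda>x. c * f x)"
    using H1_I[OF L2_cmult is_wgrad_cmult[OF is_wgrad_wgrad]] H1_L2 by blast
qed

lemma wgrad_aelin: "fn.aelin \<Omega> {f. H1 \<Omega> f} (\<lambda>f x. wgrad \<Omega> f x $ i)"
proof (rule fn.aelinI; clarify?)
  fix f g assume f: "H1 \<Omega> f" and g: "H1 \<Omega> g"
  show "AE x in lebesgue_on \<Omega>. wgrad \<Omega> (f + g) x $ i = wgrad \<Omega> f x $ i + wgrad \<Omega> g x $ i"
    using wgrad_AE[OF L2_add is_wgrad_add[OF is_wgrad_wgrad is_wgrad_wgrad], of f g i] f g H1_L2
    by (simp add: plus_fun_def)
next
  fix c f assume f: "H1 \<Omega> f"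
  show "AE x in lebesgue_on \<Omega>. wgrad \<Omega> (\<lambda>x. c * f x) x $ i = c * wgrad \<Omega> f x $ i"
    using wgrad_AE[OF L2_cmult is_wgrad_cmult[OF is_wgrad_wgrad], of f c i] f H1_L2 by simp
qed (auto simp: L2_wgrad)

definition LH1 :: "'n option \<Rightarrow> (real^'n \<Rightarrow> complex) \<Rightarrow> real^'n \<Rightarrow> complex" where
  "LH1 a f = (case a of None \<Rightarrow> f | Some i \<Rightarrow> (\<lambda>x. wgrad \<Omega> f x $ i))"

lemma LH1_aelin: "fn.aelin \<Omega> {f. H1 \<Omega> f} (LH1 a)"
proof (cases a)
  case None
  have "fn.aelin \<Omega> {f. H1 \<Omega> f} (\<lambda>f. f)" by (rule fn.aelinI) (auto simp: H1_L2)
  then show ?thesis using None unfolding LH1_def by simp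
next
  case (Some i)
  then show ?thesis using wgrad_aelin[of i] unfolding LH1_def by simp
qed

lemma sum_option: "(\<Sum>a\<in>UNIV. h a) = h None + (\<Sum>i\<in>UNIV. h (Some i))" for h :: "'i::finite option \<Rightarrow> 'b::comm_monoid_add"
  by (simp add: UNIV_option_conv sum.reindex)

lemma qn_H1: "fn.qn (fn.coord_ip \<Omega> UNIV LH1) f = norm_H1 \<Omega> f"
  unfolding fn.qn_coord_ip norm_H1_def sum_option by (simp add: LH1_def)

text \<open>Both sides of the defining identity are continuous in L2 for a fixed test function: the
  weak gradient is a closed operator.\<close>

lemma is_wgrad_limit:
  assumes F: "\<And>n::nat. H1 \<Omega> (F n)" and f: "L2 \<Omega> f" and g: "\<And>i. L2 \<Omega> (\<lambda>x. g x $ i)"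
    and lf: "(\<lambda>n. norm_L2 \<Omega> (\<lambda>x. F n x - f x)) \<longlonglongrightarrow> 0"
    and lg: "\<And>i. (\<lambda>n. norm_L2 \<Omega> (\<lambda>x. wgrad \<Omega> (F n) x $ i - g x $ i)) \<longlonglongrightarrow> 0"
  shows "is_wgrad \<Omega> f g"
  unfolding is_wgrad_def
proof (intro conjI allI impI g)
  fix \<phi> i assume t: "test_fun \<Omega> \<phi>"
  have lim: "(\<lambda>n. LINT x|lebesgue_on \<Omega>. H n x * of_real (\<theta> x)) \<longlonglongrightarrow> (LINT x|lebesgue_on \<Omega>. h x * of_real (\<theta> x))"
    if H: "\<And>n. L2 \<Omega> (H n)" "L2 \<Omega> h" "(\<lambda>n. norm_L2 \<Omega> (\<lambda>x. H n x - h x)) \<longlonglongrightarrow> 0" and \<theta>: "L2 \<Omega> (\<lambda>x. of_real (\<theta> x))"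
    for H h and \<theta> :: "real^'n \<Rightarrow> real"
  proof -
    let ?t = "\<lambda>x. complex_of_real (\<theta> x)"
    have S: "fn.subspace {f. L2 \<Omega> f}" by (rule fn_subspace_L2)
    have "(\<lambda>n. inner_L2 \<Omega> (H n) ?t) \<longlonglongrightarrow> inner_L2 \<Omega> h ?t"
      using fn.sesq_bounded_tendsto[OF psd_inner_L2 S fn.psdD(1)[OF psd_inner_L2], of 1 H h ?t] H \<theta>
        fn.cauchy_schwarz[OF psd_inner_L2 S] by (simp add: qn_inner_L2 fun_diff_def)
    then show ?thesis unfolding inner_L2_def by simp
  qed
  have "(\<lambda>n. LINT x|lebesgue_on \<Omega>. F n x * of_real (partial i \<phi> x)) \<longlonglongrightarrow> (LINT x|lebesgue_on \<Omega>. f x * of_real (partial i \<phi> x))"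
    by (rule lim[OF H1_L2[OF F] f lf L2_test_partial[OF t]])
  moreover have "(\<lambda>n. - (LINT x|lebesgue_on \<Omega>. wgrad \<Omega> (F n) x $ i * of_real (\<phi> x))) \<longlonglongrightarrow> - (LINT x|lebesgue_on \<Omega>. g x $ i * of_real (\<phi> x))"
    by (rule tendsto_minus[OF lim[OF L2_wgrad[OF F] g lg L2_test[OF t]]])
  moreover have "(LINT x|lebesgue_on \<Omega>. F n x * of_real (partial i \<phi> x)) = - (LINT x|lebesgue_on \<Omega>. wgrad \<Omega> (F n) x $ i * of_real (\<phi> x))" for n
    by (rule is_wgradD(2)[OF is_wgrad_wgrad[OF F] t])
  ultimately show "(LINT x|lebesgue_on \<Omega>. f x * of_real (partial i \<phi> x)) = - (LINT x|lebesgue_on \<Omega>. g x $ i * of_real (\<phi> x))"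
    using LIMSEQ_unique by simp
qed

lemma qcomplete_H1: "fn.qcomplete {f. H1 \<Omega> f} (fn.coord_ip \<Omega> UNIV LH1)"
proof (rule fn.qcomplete_coord_ip[OF finite_dom _ fn_subspace_H1 LH1_aelin])
  fix X :: "nat \<Rightarrow> real^'n \<Rightarrow> complex" and g :: "'n option \<Rightarrow> real^'n \<Rightarrow> complex"
  assume X: "\<And>n. X n \<in> {f. H1 \<Omega> f}" and g: "\<And>a. a \<in> UNIV \<Longrightarrow> L2 \<Omega> (g a)"
    and l: "\<And>a. a \<in> UNIV \<Longrightarrow> (\<lambda>n. norm_L2 \<Omega> (\<lambda>x. LH1 a (X n) x - g a x)) \<longlonglongrightarrow> 0"
  define G where "G x = (\<chi> i. g (Some i) x)" for x
  have w: "is_wgrad \<Omega> (g None) G"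
  proof (rule is_wgrad_limit[of X])
    show "(\<lambda>n. norm_L2 \<Omega> (\<lambda>x. X n x - g None x)) \<longlonglongrightarrow> 0" using l[of None] by (simp add: LH1_def)
    show "(\<lambda>n. norm_L2 \<Omega> (\<lambda>x. wgrad \<Omega> (X n) x $ i - G x $ i)) \<longlonglongrightarrow> 0" for i
      using l[of "Some i"] by (simp add: LH1_def G_def)
  qed (use X g in \<open>auto simp: G_def\<close>)
  have "AE x in lebesgue_on \<Omega>. LH1 a (g None) x = g a x" for a
    using wgrad_AE[OF g[of None] w] by (cases a) (simp_all add: LH1_def G_def)
  then show "\<exists>u\<in>{f. H1 \<Omega> f}. \<forall>a\<in>UNIV. AE x in lebesgue_on \<Omega>. LH1 a u x = g a x"
    using H1_I[OF _ w] g by (intro bexI[of _ "g None"]) auto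
qed simp

lemma psd_H1: "fn.psd {f. H1 \<Omega> f} (fn.coord_ip \<Omega> UNIV LH1)"
  by (rule fn.psd_coord_ip[OF LH1_aelin fn_subspace_H1])

lemma test_fun_zero: "test_fun \<Omega> (\<lambda>x. 0)"
proof -
  have "(\<lambda>x. 0) \<in> bump_algebra" by (rule bump_algebra.const)
  then show ?thesis unfolding test_fun_def using bump_algebra_smooth by (simp add: tsupport_def)
qed

lemma test_fun_lincomb:
  assumes f: "test_fun \<Omega> f" and g: "test_fun \<Omega> g"
  shows "test_fun \<Omega> (\<lambda>x. a * f x + b * g x)"
proof -
  have it: "iter_partial is (\<lambda>x. a * f x + b * g x) = (\<lambda>x. a * iter_partial is f x + b * iter_partial is g x)" for "is"
  proof (induction "is")
    case (Cons i "is")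
    have d: "iter_partial is f differentiable (at x)" "iter_partial is g differentiable (at x)" for x
      using f g unfolding test_fun_def smooth_fun_def by blast+
    have "partial i (\<lambda>x. a * iter_partial is f x + b * iter_partial is g x) x = a * partial i (iter_partial is f) x + b * partial i (iter_partial is g) x" for x
      unfolding partial_def[of i "iter_partial is f"] partial_def[of i "iter_partial is g"]
      by (rule partial_eqI) (intro has_derivative_add has_derivative_mult_right differentiable_has_derivative d)
    then show ?case using Cons by auto
  qed simp
  have "iter_partial is (\<lambda>x. a * f x + b * g x) differentiable (at x)" for "is" x
    unfolding it using f g unfolding test_fun_def smooth_fun_def
    by (intro differentiable_add differentiable_mult differentiable_const) blast+
  moreover have s: "tsupport (\<lambda>x. a * f x + b * g x) \<subseteq> tsupport f \<union> tsupport g"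
    unfolding tsupport_def closure_Un[symmetric] by (intro closure_mono) auto
  moreover have "compact (tsupport f \<union> tsupport g)" using f g unfolding test_fun_def by (intro compact_Un) blast+
  then have "compact (tsupport (\<lambda>x. a * f x + b * g x))"
    using compact_Int_closed[of "tsupport f \<union> tsupport g" "tsupport (\<lambda>x. a * f x + b * g x)"] s
    unfolding tsupport_def by (simp add: inf.absorb2)
  ultimately show ?thesis using f g unfolding test_fun_def smooth_fun_def by blast
qed

lemma ctest_subspace: "fn.subspace {\<psi>. ctest_fun \<Omega> \<psi>}"
  unfolding fn.subspace_def
proof (intro conjI ballI allI; clarify?)
  show "ctest_fun \<Omega> 0" unfolding ctest_fun_def zero_fun_def using test_fun_zero by simp
next
  fix f g assume "ctest_fun \<Omega> f" "ctest_fun \<Omega> g"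
  then show "ctest_fun \<Omega> (f + g)"
    unfolding ctest_fun_def using test_fun_lincomb[of "\<lambda>x. Re (f x)" "\<lambda>x. Re (g x)" 1 1] test_fun_lincomb[of "\<lambda>x. Im (f x)" "\<lambda>x. Im (g x)" 1 1] by simp
next
  fix c f assume "ctest_fun \<Omega> f"
  then show "ctest_fun \<Omega> (\<lambda>x. c * f x)"
    unfolding ctest_fun_def using test_fun_lincomb[of "\<lambda>x. Re (f x)" "\<lambda>x. Im (f x)" "Re c" "- Im c"] test_fun_lincomb[of "\<lambda>x. Re (f x)" "\<lambda>x. Im (f x)" "Im c" "Re c"]
    by (simp add: algebra_simps)
qed

definition cpartial :: "'n \<Rightarrow> (real^'n \<Rightarrow> complex) \<Rightarrow> real^'n \<Rightarrow> complex" where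
  "cpartial i \<psi> x = Complex (partial i (\<lambda>x. Re (\<psi> x)) x) (partial i (\<lambda>x. Im (\<psi> x)) x)"

lemma integral_dom_real:
  assumes "f \<in> borel_measurable borel" "\<And>x. x \<notin> \<Omega> \<Longrightarrow> f x = (0::real)"
  shows "(LINT x|lebesgue_on \<Omega>. f x) = (LINT x|lborel. f x)"
  using integral_lebesgue_on_eq(1)[OF sets_dom, of f] assms(2) integral_completion[of f lborel] assms(1) by simp

lemma test_fun_outside: "test_fun \<Omega> \<phi> \<Longrightarrow> x \<notin> \<Omega> \<Longrightarrow> \<phi> x = 0"
  unfolding test_fun_def using zero_outside_tsupport by blast

lemma test_integration_by_parts:
  assumes "test_fun \<Omega> \<phi>" "test_fun \<Omega> \<theta>"
  shows "(LINT x|lebesgue_on \<Omega>. \<theta> x * partial i \<phi> x) = - (LINT x|lebesgue_on \<Omega>. partial i \<theta> x * \<phi> x)"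
proof -
  have m: "\<phi> \<in> borel_measurable borel" "\<theta> \<in> borel_measurable borel" "partial i \<phi> \<in> borel_measurable borel" "partial i \<theta> \<in> borel_measurable borel"
    using test_fun_measurable assms by blast+
  have 1: "(LINT x|lebesgue_on \<Omega>. \<theta> x * partial i \<phi> x) = (LINT x|lborel. \<theta> x * partial i \<phi> x)"
    using m test_fun_outside[OF assms(2)] by (intro integral_dom_real) auto
  have 2: "(LINT x|lebesgue_on \<Omega>. partial i \<theta> x * \<phi> x) = (LINT x|lborel. partial i \<theta> x * \<phi> x)"
    using m test_fun_outside[OF assms(1)] by (intro integral_dom_real) auto
  show ?thesis unfolding 1 2
    using C1c_integration_by_parts[OF test_fun_C1c[OF assms(2)] test_fun_C1c[OF assms(1)], of i] by simp
qed

lemma integrable_test_mult: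
  assumes "test_fun \<Omega> \<phi>" "test_fun \<Omega> \<theta>"
  shows "integrable (lebesgue_on \<Omega>) (\<lambda>x. \<phi> x * \<theta> x)"
  using integrable_Re[OF integrable_L2_mult[OF L2_test[OF assms(1)] L2_test[OF assms(2)]]] by simp

lemma ctest_L2:
  assumes "ctest_fun \<Omega> \<psi>"
  shows "L2 \<Omega> \<psi>" "L2 \<Omega> (cpartial i \<psi>)"
proof -
  have t: "test_fun \<Omega> (\<lambda>x. Re (\<psi> x))" "test_fun \<Omega> (\<lambda>x. Im (\<psi> x))" using assms unfolding ctest_fun_def by blast+
  have "L2 \<Omega> (\<lambda>x. of_real (Re (\<psi> x)) + \<i> * of_real (Im (\<psi> x)))" by (intro L2_add L2_cmult L2_test t)
  then show "L2 \<Omega> \<psi>" by (simp add: complex_eq[symmetric])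
  have "L2 \<Omega> (\<lambda>x. of_real (partial i (\<lambda>x. Re (\<psi> x)) x) + \<i> * of_real (partial i (\<lambda>x. Im (\<psi> x)) x))"
    by (intro L2_add L2_cmult L2_test_partial t)
  then show "L2 \<Omega> (cpartial i \<psi>)" unfolding cpartial_def[abs_def] Complex_eq .
qed

lemma ctest_weak_partial:
  assumes \<psi>: "ctest_fun \<Omega> \<psi>" and t: "test_fun \<Omega> \<phi>"
  shows "(LINT x|lebesgue_on \<Omega>. \<psi> x * of_real (partial i \<phi> x)) = - (LINT x|lebesgue_on \<Omega>. cpartial i \<psi> x * of_real (\<phi> x))"
proof -
  have r: "test_fun \<Omega> (\<lambda>x. Re (\<psi> x))" "test_fun \<Omega> (\<lambda>x. Im (\<psi> x))" using \<psi> unfolding ctest_fun_def by blast+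
  have i1: "integrable (lebesgue_on \<Omega>) (\<lambda>x. \<psi> x * of_real (partial i \<phi> x))"
    by (intro integrable_L2_mult ctest_L2[OF \<psi>] L2_test_partial[OF t])
  have i2: "integrable (lebesgue_on \<Omega>) (\<lambda>x. cpartial i \<psi> x * of_real (\<phi> x))"
    by (intro integrable_L2_mult ctest_L2[OF \<psi>] L2_test[OF t])
  show ?thesis
  proof (rule complex_eqI)
    show "Re (LINT x|lebesgue_on \<Omega>. \<psi> x * of_real (partial i \<phi> x)) = Re (- (LINT x|lebesgue_on \<Omega>. cpartial i \<psi> x * of_real (\<phi> x)))"
      using integral_Re[OF i1] integral_Re[OF i2] test_integration_by_parts[OF t r(1), of i] by (simp add: cpartial_def)
    show "Im (LINT x|lebesgue_on \<Omega>. \<psi> x * of_real (partial i \<phi> x)) = Im (- (LINT x|lebesgue_on \<Omega>. cpartial i \<psi> x * of_real (\<phi> x)))"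
      using integral_Im[OF i1] integral_Im[OF i2] test_integration_by_parts[OF t r(2), of i] by (simp add: cpartial_def)
  qed
qed

lemma ctest_is_wgrad:
  assumes "ctest_fun \<Omega> \<psi>"
  shows "is_wgrad \<Omega> \<psi> (\<lambda>x. \<chi> i. cpartial i \<psi> x)"
  unfolding is_wgrad_def using ctest_L2[OF assms] ctest_weak_partial[OF assms] by simp

lemma ctest_H1: "ctest_fun \<Omega> \<psi> \<Longrightarrow> H1 \<Omega> \<psi>"
  using H1_I ctest_L2 ctest_is_wgrad by blast

lemma ctest_wgrad: "ctest_fun \<Omega> \<psi> \<Longrightarrow> AE x in lebesgue_on \<Omega>. wgrad \<Omega> \<psi> x $ i = cpartial i \<psi> x"
  using wgrad_AE[OF ctest_L2(1) ctest_is_wgrad, of \<psi> i] by simp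

lemma H10_eq_closure: "{f. H10 \<Omega> f} = fn.qclosure {f. H1 \<Omega> f} (fn.coord_ip \<Omega> UNIV LH1) {\<psi>. ctest_fun \<Omega> \<psi>}"
  unfolding fn.qclosure_def H10_def qn_H1 by (auto simp: fun_diff_def)

lemma H10_H1: "H10 \<Omega> f \<Longrightarrow> H1 \<Omega> f"
  unfolding H10_def by blast

lemma fn_subspace_H10: "fn.subspace {f. H10 \<Omega> f}"
  unfolding H10_eq_closure
  using fn.subspace_qclosure[OF psd_H1 fn_subspace_H1 _ ctest_subspace] ctest_H1 by blast

lemma qcomplete_H10: "fn.qcomplete {f. H10 \<Omega> f} (fn.coord_ip \<Omega> UNIV LH1)"
  unfolding H10_eq_closure
  using fn.qcomplete_qclosure[OF psd_H1 fn_subspace_H1 _ qcomplete_H1] ctest_H1 by blast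

end

context complex_vector_space
begin

text \<open>A converse of \<open>qcomplete_coord_ip\<close>. Completeness of \<open>H10\<close> and
  \<open>H0div\<close> comes from their description as closures; this lemma converts it back to
  closedness, the form in which it is needed to treat products component by component.\<close>

lemma qcomplete_coord_closed:
  assumes A: "finite A" and L: "\<And>a. a \<in> A \<Longrightarrow> aelin \<Omega> S (L a)" and S: "subspace S"
    and com: "qcomplete S (coord_ip \<Omega> A L)" and X: "\<And>n. X n \<in> S"
    and g: "\<And>a. a \<in> A \<Longrightarrow> L2 \<Omega> (g a)" "\<And>a. a \<in> A \<Longrightarrow> (\<lambda>n::nat. norm_L2 \<Omega> (\<lambda>x. L a (X n) x - g a x)) \<longlonglongrightarrow> 0"
  shows "\<exists>u\<in>S. \<forall>a\<in>A. AE x in lebesgue_on \<Omega>. L a u x = g a x"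
proof -
  define d where "d n = (\<Sum>a\<in>A. norm_L2 \<Omega> (\<lambda>x. L a (X n) x - g a x))" for n
  have d: "d \<longlonglongrightarrow> 0"
  proof -
    have "(\<lambda>n. \<Sum>a\<in>A. norm_L2 \<Omega> (\<lambda>x. L a (X n) x - g a x)) \<longlonglongrightarrow> (\<Sum>a\<in>A. 0)" by (intro tendsto_sum g(2))
    then show ?thesis unfolding d_def[abs_def] by simp
  qed
  have le: "qn (coord_ip \<Omega> A L) (X m - X n) \<le> d m + d n" for m n
  proof -
    have "norm_L2 \<Omega> (L a (X m - X n)) \<le> norm_L2 \<Omega> (\<lambda>x. L a (X m) x - g a x) + norm_L2 \<Omega> (\<lambda>x. L a (X n) x - g a x)"
      if a: "a \<in> A" for a
    proof -
      have "norm_L2 \<Omega> (\<lambda>x. g a x - L a (X n) x) = norm_L2 \<Omega> (\<lambda>x. L a (X n) x - g a x)"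
        unfolding norm_L2_def by (simp add: norm_minus_commute)
      then show ?thesis
        using norm_L2_triangle_diff[OF aelinD(1)[OF L[OF a] X[of m]] g(1)[OF a] aelinD(1)[OF L[OF a] X[of n]]]
          norm_L2_aelin_diff[OF L[OF a] S X X, of m n] by simp
    qed
    then have "(\<Sum>a\<in>A. norm_L2 \<Omega> (L a (X m - X n))) \<le> d m + d n"
      unfolding d_def sum.distrib[symmetric] by (intro sum_mono)
    moreover have "qn (coord_ip \<Omega> A L) (X m - X n) \<le> (\<Sum>a\<in>A. norm_L2 \<Omega> (L a (X m - X n)))"
      unfolding qn_coord_ip using L2_set_le_sum[of A "\<lambda>a. norm_L2 \<Omega> (L a (X m - X n))"] norm_L2_nonneg
      unfolding L2_set_def by blast
    ultimately show ?thesis by simp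
  qed
  have "\<exists>N. \<forall>m\<ge>N. \<forall>n\<ge>N. qn (coord_ip \<Omega> A L) (X m - X n) < \<epsilon>" if e0: "\<epsilon> > 0" for \<epsilon>
  proof -
    have "\<forall>\<^sub>F n in sequentially. d n < \<epsilon> / 2" using order_tendstoD(2)[OF d, of "\<epsilon> / 2"] e0 by simp
    then obtain N where N: "\<And>n. n \<ge> N \<Longrightarrow> d n < \<epsilon> / 2" unfolding eventually_sequentially by blast
    have "qn (coord_ip \<Omega> A L) (X m - X n) < \<epsilon>" if "m \<ge> N" "n \<ge> N" for m n
      using le[of m n] N[OF that(1)] N[OF that(2)] by simp
    then show ?thesis by blast
  qed
  then obtain u where u: "u \<in> S" "(\<lambda>n. qn (coord_ip \<Omega> A L) (X n - u)) \<longlonglongrightarrow> 0"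
    using com X unfolding qcomplete_def by blast
  have "AE x in lebesgue_on \<Omega>. L a u x = g a x" if a: "a \<in> A" for a
    by (rule L2_limit_AE_unique[OF aelinD(1)[OF L[OF a] X] aelinD(1)[OF L[OF a] u(1)] g(1)[OF a]
          coord_tendsto[OF A a L[OF a] S X u] g(2)[OF a]])
  then show ?thesis using u(1) by blast
qed

end

lemma finite_bounded_subseq:
  fixes a :: "'k \<Rightarrow> nat \<Rightarrow> complex"
  assumes "finite K" "\<And>k. k \<in> K \<Longrightarrow> bounded (range (a k))"
  shows "\<exists>r::nat\<Rightarrow>nat. strict_mono r \<and> (\<forall>k\<in>K. convergent (a k \<circ> r))"
  using assms
proof (induction K rule: finite_induct)
  case empty
  then show ?case by (intro exI[of _ id]) (simp add: strict_mono_def)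
next
  case (insert k K)
  then obtain r :: "nat \<Rightarrow> nat" where r: "strict_mono r" "\<forall>k\<in>K. convergent (a k \<circ> r)" by blast
  have "bounded (range (a k \<circ> r))" using insert.prems[of k] by (rule bounded_subset) auto
  then obtain l s where s: "strict_mono (s :: nat \<Rightarrow> nat)" "((a k \<circ> r) \<circ> s) \<longlonglongrightarrow> l"
    using bounded_imp_convergent_subsequence by blast
  have "convergent (a j \<circ> (r \<circ> s))" if "j \<in> insert k K" for j
  proof (cases "j = k")
    case True
    then show ?thesis using s(2) by (auto simp: convergent_def o_assoc)
  next
    case False
    then have "convergent (a j \<circ> r)" using r(2) that by blast
    then show ?thesis using convergent_subseq_convergent[OF _ s(1)] by (simp add: o_assoc)
  qed
  then show ?case using strict_mono_o[OF r(1) s(1)] by blast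
qed

lemma inner_L2_sum_self:
  assumes "finite I" "\<And>i. i \<in> I \<Longrightarrow> L2 \<Omega> (f i)"
  shows "(\<Sum>i\<in>I. \<Sum>j\<in>I. inner_L2 \<Omega> (f i) (f j)) = inner_L2 \<Omega> (\<lambda>x. \<Sum>i\<in>I. f i x) (\<lambda>x. \<Sum>i\<in>I. f i x)"
proof -
  have "(\<Sum>i\<in>I. \<Sum>j\<in>I. inner_L2 \<Omega> (f i) (f j)) = (LINT x|lebesgue_on \<Omega>. (\<Sum>i\<in>I. \<Sum>j\<in>I. f i x * cnj (f j x)))"
    unfolding inner_L2_def using integrable_inner_L2 assms by (subst Bochner_Integration.integral_sum) (auto intro!: sum.cong Bochner_Integration.integral_sum[symmetric] Bochner_Integration.integrable_sum)
  then show ?thesis unfolding inner_L2_def by (simp add: sum_product)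
qed

lemma norm_L2_add_sq:
  assumes "L2 \<Omega> f" "L2 \<Omega> g"
  shows "(norm_L2 \<Omega> (\<lambda>x. f x + g x))\<^sup>2 = (norm_L2 \<Omega> f)\<^sup>2 + 2 * Re (inner_L2 \<Omega> f g) + (norm_L2 \<Omega> g)\<^sup>2"
  using fn.qn_sq_add[OF psd_inner_L2 fn_subspace_L2, of f \<Omega> g] assms by (simp add: qn_inner_L2 plus_fun_def)

section \<open>Weak divergences and the flux space\<close>

context domain
begin

lemma is_wdivD:
  assumes "is_wdiv \<Omega> w h"
  shows "L2 \<Omega> h" "test_fun \<Omega> \<phi> \<Longrightarrow> (LINT x|lebesgue_on \<Omega>. (\<Sum>i\<in>UNIV. w x $ i * of_real (partial i \<phi> x))) = - (LINT x|lebesgue_on \<Omega>. h x * of_real (\<phi> x))"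
  using assms unfolding is_wdiv_def by blast+

lemma is_wdiv_wdiv: "Hdiv \<Omega> w \<Longrightarrow> is_wdiv \<Omega> w (wdiv \<Omega> w)"
  unfolding Hdiv_def wdiv_def by (metis someI_ex)

lemma Hdiv_L2: "Hdiv \<Omega> w \<Longrightarrow> L2 \<Omega> (\<lambda>x. w x $ i)"
  unfolding Hdiv_def by blast

lemma L2_wdiv: "Hdiv \<Omega> w \<Longrightarrow> L2 \<Omega> (wdiv \<Omega> w)"
  using is_wdivD(1)[OF is_wdiv_wdiv] .

lemma Hdiv_I: "(\<And>i. L2 \<Omega> (\<lambda>x. w x $ i)) \<Longrightarrow> is_wdiv \<Omega> w h \<Longrightarrow> Hdiv \<Omega> w"
  unfolding Hdiv_def by blast

lemma integral_test_sum:
  assumes "\<And>i. L2 \<Omega> (\<lambda>x. w x $ i)" "test_fun \<Omega> \<phi>"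
  shows "(LINT x|lebesgue_on \<Omega>. (\<Sum>i\<in>UNIV. w x $ i * of_real (partial i \<phi> x))) = (\<Sum>i\<in>UNIV. LINT x|lebesgue_on \<Omega>. w x $ i * of_real (partial i \<phi> x))"
  using integrable_L2_mult[OF assms(1) L2_test_partial[OF assms(2)]] by (rule Bochner_Integration.integral_sum)

lemma wdiv_AE:
  assumes "\<And>i. L2 \<Omega> (\<lambda>x. w x $ i)" "is_wdiv \<Omega> w h"
  shows "AE x in lebesgue_on \<Omega>. wdiv \<Omega> w x = h x"
proof (rule AE_eq_if_weak_eq)
  show "L2 \<Omega> (wdiv \<Omega> w)" "L2 \<Omega> h" using L2_wdiv[OF Hdiv_I[OF assms]] is_wdivD(1)[OF assms(2)] .
  show "(LINT x|lebesgue_on \<Omega>. wdiv \<Omega> w x * of_real (\<phi> x)) = (LINT x|lebesgue_on \<Omega>. h x * of_real (\<phi> x))"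
    if t: "test_fun \<Omega> \<phi>" for \<phi>
    using is_wdivD(2)[OF is_wdiv_wdiv[OF Hdiv_I[OF assms]] t] is_wdivD(2)[OF assms(2) t] by simp
qed

lemma is_wdiv_add:
  assumes "is_wdiv \<Omega> w h" "is_wdiv \<Omega> w' h'" "\<And>i. L2 \<Omega> (\<lambda>x. w x $ i)" "\<And>i. L2 \<Omega> (\<lambda>x. w' x $ i)"
  shows "is_wdiv \<Omega> (\<lambda>x. w x + w' x) (\<lambda>x. h x + h' x)"
  unfolding is_wdiv_def
proof (intro conjI allI impI)
  show "L2 \<Omega> (\<lambda>x. h x + h' x)" using L2_add[OF is_wdivD(1)[OF assms(1)] is_wdivD(1)[OF assms(2)]] .
  fix \<phi> assume t: "test_fun \<Omega> \<phi>"
  have s: "L2 \<Omega> (\<lambda>x. (w x + w' x) $ i)" for i using L2_add[OF assms(3,4)] by simp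
  have "(LINT x|lebesgue_on \<Omega>. (\<Sum>i\<in>UNIV. (w x + w' x) $ i * of_real (partial i \<phi> x)))
      = (LINT x|lebesgue_on \<Omega>. (\<Sum>i\<in>UNIV. w x $ i * of_real (partial i \<phi> x))) + (LINT x|lebesgue_on \<Omega>. (\<Sum>i\<in>UNIV. w' x $ i * of_real (partial i \<phi> x)))"
    unfolding integral_test_sum[OF s t] integral_test_sum[OF assms(3) t] integral_test_sum[OF assms(4) t] sum.distrib[symmetric]
    using integrable_L2_mult[OF assms(3) L2_test_partial[OF t]] integrable_L2_mult[OF assms(4) L2_test_partial[OF t]]
    by (intro sum.cong refl) (simp add: ring_distribs)
  also have "\<dots> = - (LINT x|lebesgue_on \<Omega>. h x * of_real (\<phi> x)) + - (LINT x|lebesgue_on \<Omega>. h' x * of_real (\<phi> x))"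
    unfolding is_wdivD(2)[OF assms(1) t] is_wdivD(2)[OF assms(2) t] ..
  also have "\<dots> = - (LINT x|lebesgue_on \<Omega>. (h x + h' x) * of_real (\<phi> x))"
    using integrable_L2_mult[OF is_wdivD(1)[OF assms(1)] L2_test[OF t]] integrable_L2_mult[OF is_wdivD(1)[OF assms(2)] L2_test[OF t]]
    by (simp add: ring_distribs)
  finally show "(LINT x|lebesgue_on \<Omega>. (\<Sum>i\<in>UNIV. (w x + w' x) $ i * of_real (partial i \<phi> x))) = - (LINT x|lebesgue_on \<Omega>. (h x + h' x) * of_real (\<phi> x))" .
qed

lemma is_wdiv_cmult:
  assumes "is_wdiv \<Omega> w h"
  shows "is_wdiv \<Omega> (\<lambda>x. c *s w x) (\<lambda>x. c * h x)"
  unfolding is_wdiv_def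
proof (intro conjI allI impI)
  show "L2 \<Omega> (\<lambda>x. c * h x)" using L2_cmult[OF is_wdivD(1)[OF assms]] .
  fix \<phi> assume t: "test_fun \<Omega> \<phi>"
  have "(\<Sum>i\<in>UNIV. (c *s w x) $ i * of_real (partial i \<phi> x)) = c * (\<Sum>i\<in>UNIV. w x $ i * of_real (partial i \<phi> x))" for x
    by (simp add: sum_distrib_left mult.assoc)
  then show "(LINT x|lebesgue_on \<Omega>. (\<Sum>i\<in>UNIV. (c *s w x) $ i * of_real (partial i \<phi> x))) = - (LINT x|lebesgue_on \<Omega>. c * h x * of_real (\<phi> x))"
    using is_wdivD(2)[OF assms t] by (simp add: mult.assoc)
qed

lemma vf_subspace_Hdiv: "vf.subspace {w. Hdiv \<Omega> w}"
  unfolding vf.subspace_def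
proof (intro conjI ballI allI; clarify?)
  have "is_wdiv \<Omega> (\<lambda>x. 0) (\<lambda>x. 0)" unfolding is_wdiv_def by (simp add: L2_zero)
  then show "Hdiv \<Omega> 0" unfolding zero_fun_def using Hdiv_I[of "\<lambda>x. 0" "\<lambda>x. 0"] L2_zero[of \<Omega>] by simp
next
  fix w w' assume w: "Hdiv \<Omega> w" "Hdiv \<Omega> w'"
  have "is_wdiv \<Omega> (\<lambda>x. w x + w' x) (\<lambda>x. wdiv \<Omega> w x + wdiv \<Omega> w' x)"
    by (intro is_wdiv_add is_wdiv_wdiv w Hdiv_L2)
  then show "Hdiv \<Omega> (w + w')"
    unfolding plus_fun_def using L2_add[OF Hdiv_L2[OF w(1)] Hdiv_L2[OF w(2)]] by (intro Hdiv_I) auto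
next
  fix c w assume w: "Hdiv \<Omega> w"
  show "Hdiv \<Omega> (\<lambda>x. c *s w x)"
    using is_wdiv_cmult[OF is_wdiv_wdiv[OF w], of c] L2_cmult[OF Hdiv_L2[OF w]] by (intro Hdiv_I) auto
qed

definition LDiv :: "'n option \<Rightarrow> (real^'n \<Rightarrow> complex^'n) \<Rightarrow> real^'n \<Rightarrow> complex" where
  "LDiv a w = (case a of None \<Rightarrow> wdiv \<Omega> w | Some i \<Rightarrow> (\<lambda>x. w x $ i))"

lemma LDiv_aelin: "vf.aelin \<Omega> {w. Hdiv \<Omega> w} (LDiv a)"
proof (cases a)
  case None
  have "vf.aelin \<Omega> {w. Hdiv \<Omega> w} (wdiv \<Omega>)"
  proof (rule vf.aelinI; clarify?)
    fix w w' assume w: "Hdiv \<Omega> w" "Hdiv \<Omega> w'"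
    have "L2 \<Omega> (\<lambda>x. (w x + w' x) $ i)" for i using L2_add[OF Hdiv_L2[OF w(1)] Hdiv_L2[OF w(2)]] by simp
    then show "AE x in lebesgue_on \<Omega>. wdiv \<Omega> (w + w') x = wdiv \<Omega> w x + wdiv \<Omega> w' x"
      unfolding plus_fun_def by (rule wdiv_AE) (intro is_wdiv_add is_wdiv_wdiv w Hdiv_L2)
  next
    fix c w assume w: "Hdiv \<Omega> w"
    have "L2 \<Omega> (\<lambda>x. (c *s w x) $ i)" for i using L2_cmult[OF Hdiv_L2[OF w]] by simp
    then show "AE x in lebesgue_on \<Omega>. wdiv \<Omega> (\<lambda>x. c *s w x) x = c * wdiv \<Omega> w x"
      by (rule wdiv_AE) (intro is_wdiv_cmult is_wdiv_wdiv w)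
  qed (auto simp: L2_wdiv)
  then show ?thesis using None unfolding LDiv_def by simp
next
  case (Some i)
  have "vf.aelin \<Omega> {w. Hdiv \<Omega> w} (\<lambda>w x. w x $ i)" by (rule vf.aelinI) (auto simp: Hdiv_L2)
  then show ?thesis using Some unfolding LDiv_def by simp
qed

lemma qn_Hdiv: "vf.qn (vf.coord_ip \<Omega> UNIV LDiv) w = norm_Hdiv \<Omega> w"
  unfolding vf.qn_coord_ip norm_Hdiv_def vnorm_L2_def sum_option by (simp add: LDiv_def sum_nonneg add.commute)

lemma psd_Hdiv: "vf.psd {w. Hdiv \<Omega> w} (vf.coord_ip \<Omega> UNIV LDiv)"
  by (rule vf.psd_coord_ip[OF LDiv_aelin vf_subspace_Hdiv])

lemma L2_mult_tendsto:
  assumes H: "\<And>n::nat. L2 \<Omega> (H n)" "L2 \<Omega> h" "(\<lambda>n. norm_L2 \<Omega> (\<lambda>x. H n x - h x)) \<longlonglongrightarrow> 0" and \<theta>: "L2 \<Omega> (\<lambda>x. of_real (\<theta> x))"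
  shows "(\<lambda>n. LINT x|lebesgue_on \<Omega>. H n x * of_real (\<theta> x)) \<longlonglongrightarrow> (LINT x|lebesgue_on \<Omega>. h x * of_real (\<theta> x))"
proof -
  let ?t = "\<lambda>x. complex_of_real (\<theta> x)"
  have S: "fn.subspace {f. L2 \<Omega> f}" by (rule fn_subspace_L2)
  have "(\<lambda>n. inner_L2 \<Omega> (H n) ?t) \<longlonglongrightarrow> inner_L2 \<Omega> h ?t"
    using fn.sesq_bounded_tendsto[OF psd_inner_L2 S fn.psdD(1)[OF psd_inner_L2], of 1 H h ?t] H \<theta>
      fn.cauchy_schwarz[OF psd_inner_L2 S] by (simp add: qn_inner_L2 fun_diff_def)
  then show ?thesis unfolding inner_L2_def by simp
qed

lemma qcomplete_Hdiv: "vf.qcomplete {w. Hdiv \<Omega> w} (vf.coord_ip \<Omega> UNIV LDiv)"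
proof (rule vf.qcomplete_coord_ip[OF finite_dom _ vf_subspace_Hdiv LDiv_aelin])
  fix X :: "nat \<Rightarrow> real^'n \<Rightarrow> complex^'n" and g :: "'n option \<Rightarrow> real^'n \<Rightarrow> complex"
  assume X: "\<And>n. X n \<in> {w. Hdiv \<Omega> w}" and g: "\<And>a. a \<in> UNIV \<Longrightarrow> L2 \<Omega> (g a)"
    and l: "\<And>a. a \<in> UNIV \<Longrightarrow> (\<lambda>n. norm_L2 \<Omega> (\<lambda>x. LDiv a (X n) x - g a x)) \<longlonglongrightarrow> 0"
  have XH: "Hdiv \<Omega> (X n)" for n using X by blast
  define G where "G x = (\<chi> i. g (Some i) x)" for x
  have GL: "L2 \<Omega> (\<lambda>x. G x $ i)" for i using g by (simp add: G_def)
  have w: "is_wdiv \<Omega> G (g None)"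
    unfolding is_wdiv_def
  proof (intro conjI allI impI)
    show "L2 \<Omega> (g None)" using g by simp
    fix \<phi> assume t: "test_fun \<Omega> \<phi>"
    have "(\<lambda>n. \<Sum>i\<in>UNIV. LINT x|lebesgue_on \<Omega>. X n x $ i * of_real (partial i \<phi> x)) \<longlonglongrightarrow> (\<Sum>i\<in>UNIV. LINT x|lebesgue_on \<Omega>. G x $ i * of_real (partial i \<phi> x))"
    proof (rule tendsto_sum, rule L2_mult_tendsto[OF Hdiv_L2[OF XH] GL _ L2_test_partial[OF t]])
      show "(\<lambda>n. norm_L2 \<Omega> (\<lambda>x. X n x $ i - G x $ i)) \<longlonglongrightarrow> 0" for i using l[of "Some i"] by (simp add: LDiv_def G_def)
    qed
    then have 1: "(\<lambda>n. LINT x|lebesgue_on \<Omega>. (\<Sum>i\<in>UNIV. X n x $ i * of_real (partial i \<phi> x))) \<longlonglongrightarrow> (LINT x|lebesgue_on \<Omega>. (\<Sum>i\<in>UNIV. G x $ i * of_real (partial i \<phi> x)))"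
      unfolding integral_test_sum[OF GL t] integral_test_sum[OF Hdiv_L2[OF XH] t] .
    have 2: "(\<lambda>n. - (LINT x|lebesgue_on \<Omega>. wdiv \<Omega> (X n) x * of_real (\<phi> x))) \<longlonglongrightarrow> - (LINT x|lebesgue_on \<Omega>. g None x * of_real (\<phi> x))"
      using l[of None] g by (intro tendsto_minus L2_mult_tendsto L2_wdiv XH L2_test[OF t]) (auto simp: LDiv_def)
    show "(LINT x|lebesgue_on \<Omega>. (\<Sum>i\<in>UNIV. G x $ i * of_real (partial i \<phi> x))) = - (LINT x|lebesgue_on \<Omega>. g None x * of_real (\<phi> x))"
      using 1 2 unfolding is_wdivD(2)[OF is_wdiv_wdiv[OF XH] t] by (rule LIMSEQ_unique)
  qed
  have "AE x in lebesgue_on \<Omega>. LDiv a G x = g a x" for a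
    using wdiv_AE[OF GL w] by (cases a) (simp_all add: LDiv_def G_def)
  then show "\<exists>u\<in>{w. Hdiv \<Omega> w}. \<forall>a\<in>UNIV. AE x in lebesgue_on \<Omega>. LDiv a u x = g a x"
    using Hdiv_I[OF GL w] by blast
qed simp

lemma vtest_subspace: "vf.subspace {\<psi>. vtest_fun \<Omega> \<psi>}"
  unfolding vf.subspace_def
proof (intro conjI ballI allI; clarify?)
  show "vtest_fun \<Omega> 0" using fn.subspace_0[OF ctest_subspace] by (simp add: vtest_fun_def zero_fun_def)
next
  fix f g :: "real^'n \<Rightarrow> complex^'n" assume "vtest_fun \<Omega> f" "vtest_fun \<Omega> g"
  then show "vtest_fun \<Omega> (f + g)"
    unfolding vtest_fun_def using fn.subspace_add[OF ctest_subspace] by (simp add: plus_fun_def)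
next
  fix c and f :: "real^'n \<Rightarrow> complex^'n" assume "vtest_fun \<Omega> f"
  then show "vtest_fun \<Omega> (\<lambda>x. c *s f x)"
    unfolding vtest_fun_def using fn.subspace_scale[OF ctest_subspace] by simp
qed

lemma vtest_Hdiv:
  assumes "vtest_fun \<Omega> \<psi>"
  shows "Hdiv \<Omega> \<psi>"
proof (rule Hdiv_I)
  have c: "ctest_fun \<Omega> (\<lambda>x. \<psi> x $ i)" for i using assms unfolding vtest_fun_def by blast
  show L: "L2 \<Omega> (\<lambda>x. \<psi> x $ i)" for i by (rule ctest_L2(1)[OF c])
  show "is_wdiv \<Omega> \<psi> (\<lambda>x. \<Sum>i\<in>UNIV. cpartial i (\<lambda>x. \<psi> x $ i) x)"
    unfolding is_wdiv_def
  proof (intro conjI allI impI)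
    show "L2 \<Omega> (\<lambda>x. \<Sum>i\<in>UNIV. cpartial i (\<lambda>x. \<psi> x $ i) x)" by (intro L2_sum ctest_L2(2) c)
    fix \<phi> assume t: "test_fun \<Omega> \<phi>"
    have "(LINT x|lebesgue_on \<Omega>. (\<Sum>i\<in>UNIV. cpartial i (\<lambda>x. \<psi> x $ i) x) * of_real (\<phi> x)) = (\<Sum>i\<in>UNIV. LINT x|lebesgue_on \<Omega>. cpartial i (\<lambda>x. \<psi> x $ i) x * of_real (\<phi> x))"
      unfolding sum_distrib_right
      by (intro Bochner_Integration.integral_sum integrable_L2_mult ctest_L2(2) c L2_test t)
    then show "(LINT x|lebesgue_on \<Omega>. (\<Sum>i\<in>UNIV. \<psi> x $ i * of_real (partial i \<phi> x))) = - (LINT x|lebesgue_on \<Omega>. (\<Sum>i\<in>UNIV. cpartial i (\<lambda>x. \<psi> x $ i) x) * of_real (\<phi> x))"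
      unfolding integral_test_sum[OF L t] using ctest_weak_partial[OF c t] by (simp add: sum_negf)
  qed
qed

lemma H0div_eq_closure: "{w. H0div \<Omega> w} = vf.qclosure {w. Hdiv \<Omega> w} (vf.coord_ip \<Omega> UNIV LDiv) {\<psi>. vtest_fun \<Omega> \<psi>}"
  unfolding vf.qclosure_def H0div_def qn_Hdiv by (auto simp: fun_diff_def)

lemma H0div_Hdiv: "H0div \<Omega> w \<Longrightarrow> Hdiv \<Omega> w"
  unfolding H0div_def by blast

lemma vf_subspace_H0div: "vf.subspace {w. H0div \<Omega> w}"
  unfolding H0div_eq_closure
  using vf.subspace_qclosure[OF psd_Hdiv vf_subspace_Hdiv _ vtest_subspace] vtest_Hdiv by blast

lemma qcomplete_H0div: "vf.qcomplete {w. H0div \<Omega> w} (vf.coord_ip \<Omega> UNIV LDiv)"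
  unfolding H0div_eq_closure
  using vf.qcomplete_qclosure[OF psd_Hdiv vf_subspace_Hdiv _ qcomplete_Hdiv] vtest_Hdiv by blast

section \<open>The displacement space\<close>

definition LV :: "'n \<times> 'n option \<Rightarrow> (real^'n \<Rightarrow> complex^'n) \<Rightarrow> real^'n \<Rightarrow> complex" where
  "LV c u = LH1 (snd c) (\<lambda>x. u x $ fst c)"

lemma vf_subspace_V: "vf.subspace {u. Vsp \<Omega> u}"
  unfolding vf.subspace_def
proof (intro conjI ballI allI; clarify?)
  show "Vsp \<Omega> 0" using fn.subspace_0[OF fn_subspace_H10] by (simp add: Vsp_def zero_fun_def)
next
  fix f g :: "real^'n \<Rightarrow> complex^'n" assume "Vsp \<Omega> f" "Vsp \<Omega> g"
  then show "Vsp \<Omega> (f + g)"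
    unfolding Vsp_def using fn.subspace_add[OF fn_subspace_H10] by (simp add: plus_fun_def)
next
  fix c and f :: "real^'n \<Rightarrow> complex^'n" assume "Vsp \<Omega> f"
  then show "Vsp \<Omega> (\<lambda>x. c *s f x)"
    unfolding Vsp_def using fn.subspace_scale[OF fn_subspace_H10] by simp
qed

lemma Vsp_H1: "Vsp \<Omega> u \<Longrightarrow> H1 \<Omega> (\<lambda>x. u x $ i)"
  unfolding Vsp_def using H10_H1 by blast

lemma LV_aelin: "vf.aelin \<Omega> {u. Vsp \<Omega> u} (LV c)"
proof (rule vf.aelinI; clarify?)
  fix u :: "real^'n \<Rightarrow> complex^'n" assume u: "Vsp \<Omega> u"
  show "L2 \<Omega> (LV c u)" unfolding LV_def using fn.aelinD(1)[OF LH1_aelin] Vsp_H1[OF u] by blast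
  fix v :: "real^'n \<Rightarrow> complex^'n" assume v: "Vsp \<Omega> v"
  have "(\<lambda>x. (u + v) x $ fst c) = (\<lambda>x. u x $ fst c) + (\<lambda>x. v x $ fst c)" by (simp add: fun_eq_iff)
  then show "AE x in lebesgue_on \<Omega>. LV c (u + v) x = LV c u x + LV c v x"
    unfolding LV_def using fn.aelinD(2)[OF LH1_aelin] Vsp_H1[OF u] Vsp_H1[OF v] by simp
next
  fix k and u :: "real^'n \<Rightarrow> complex^'n" assume u: "Vsp \<Omega> u"
  show "AE x in lebesgue_on \<Omega>. LV c (\<lambda>x. k *s u x) x = k * LV c u x"
    unfolding LV_def using fn.aelinD(3)[OF LH1_aelin, of "\<lambda>x. u x $ fst c" "snd c" k] Vsp_H1[OF u] by simp
qed

lemma sum_UNIV_prod: "(\<Sum>c\<in>UNIV. h c) = (\<Sum>i\<in>UNIV. \<Sum>a\<in>UNIV. h (i, a))" for h :: "'i::finite \<times> 'j::finite \<Rightarrow> 'b::comm_monoid_add"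
  by (simp add: sum.cartesian_product UNIV_Times_UNIV)

lemma norm_H1_sq: "(norm_H1 \<Omega> f)\<^sup>2 = (\<Sum>a\<in>UNIV. (norm_L2 \<Omega> (LH1 a f))\<^sup>2)"
  unfolding qn_H1[symmetric] fn.qn_coord_ip by (simp add: sum_nonneg)

lemma qn_V: "vf.qn (vf.coord_ip \<Omega> UNIV LV) u = norm_V \<Omega> u"
  unfolding vf.qn_coord_ip norm_V_def norm_H1_sq sum_UNIV_prod by (simp add: LV_def)

lemma psd_V: "vf.psd {u. Vsp \<Omega> u} (vf.coord_ip \<Omega> UNIV LV)"
  by (rule vf.psd_coord_ip[OF LV_aelin vf_subspace_V])

lemma H10_closed:
  assumes X: "\<And>n::nat. H10 \<Omega> (X n)" and g: "\<And>a. L2 \<Omega> (g a)" "\<And>a. (\<lambda>n. norm_L2 \<Omega> (\<lambda>x. LH1 a (X n) x - g a x)) \<longlonglongrightarrow> 0"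
  shows "\<exists>f. H10 \<Omega> f \<and> (\<forall>a. AE x in lebesgue_on \<Omega>. LH1 a f x = g a x)"
proof -
  have "fn.aelin \<Omega> {f. H10 \<Omega> f} (LH1 a)" for a
    using LH1_aelin[of a] H10_H1 unfolding fn.aelin_def by blast
  from fn.qcomplete_coord_closed[OF _ this fn_subspace_H10 qcomplete_H10, of X g] show ?thesis using X g by simp
qed

lemma V_closed:
  assumes X: "\<And>n::nat. Vsp \<Omega> (X n)" and g: "\<And>c. L2 \<Omega> (g c)" "\<And>c. (\<lambda>n. norm_L2 \<Omega> (\<lambda>x. LV c (X n) x - g c x)) \<longlonglongrightarrow> 0"
  shows "\<exists>u. Vsp \<Omega> u \<and> (\<forall>c. AE x in lebesgue_on \<Omega>. LV c u x = g c x)"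
proof -
  have "\<exists>f. H10 \<Omega> f \<and> (\<forall>a. AE x in lebesgue_on \<Omega>. LH1 a f x = g (i, a) x)" for i
    by (rule H10_closed[of "\<lambda>n x. X n x $ i"]) (use X g g(2)[of "(i, _)"] in \<open>auto simp: Vsp_def LV_def\<close>)
  then obtain f where f: "\<And>i. H10 \<Omega> (f i)" "\<And>i a. AE x in lebesgue_on \<Omega>. LH1 a (f i) x = g (i, a) x" by metis
  have "Vsp \<Omega> (\<lambda>x. \<chi> i. f i x)" "AE x in lebesgue_on \<Omega>. LV c (\<lambda>x. \<chi> i. f i x) x = g c x" for c
    using f f(2)[of "snd c" "fst c"] by (simp_all add: Vsp_def LV_def)
  then show ?thesis by blast
qed

lemma qcomplete_V: "vf.qcomplete {u. Vsp \<Omega> u} (vf.coord_ip \<Omega> UNIV LV)"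
proof (rule vf.qcomplete_coord_ip[OF finite_dom _ vf_subspace_V LV_aelin])
  fix X :: "nat \<Rightarrow> real^'n \<Rightarrow> complex^'n" and g :: "'n \<times> 'n option \<Rightarrow> real^'n \<Rightarrow> complex"
  assume "\<And>n. X n \<in> {u. Vsp \<Omega> u}" "\<And>a. a \<in> UNIV \<Longrightarrow> L2 \<Omega> (g a)"
    "\<And>a. a \<in> UNIV \<Longrightarrow> (\<lambda>n. norm_L2 \<Omega> (\<lambda>x. LV a (X n) x - g a x)) \<longlonglongrightarrow> 0"
  then show "\<exists>u\<in>{u. Vsp \<Omega> u}. \<forall>a\<in>UNIV. AE x in lebesgue_on \<Omega>. LV a u x = g a x"
    using V_closed[of X g] by simp
qed simp

lemma wpart_eq_LV: "wpart \<Omega> u i j = LV (i, Some j) u"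
  unfolding wpart_def[abs_def] LV_def LH1_def by simp

lemma comp_eq_LV: "(\<lambda>x. u x $ i) = LV (i, None) u"
  unfolding LV_def LH1_def by simp

lemma L2_wpart: "Vsp \<Omega> u \<Longrightarrow> L2 \<Omega> (wpart \<Omega> u i j)"
  unfolding wpart_eq_LV using vf.aelinD(1)[OF LV_aelin] by blast

lemma ctest_H10: "ctest_fun \<Omega> \<psi> \<Longrightarrow> H10 \<Omega> \<psi>"
  unfolding H10_def using ctest_H1[of \<psi>] fn.qn_zero[OF psd_H1 fn_subspace_H1]
  by (intro conjI exI[of _ "\<lambda>_. \<psi>"]) (auto simp: qn_H1 zero_fun_def)

lemma V_approx:
  assumes "Vsp \<Omega> u"
  shows "\<exists>\<psi>. (\<forall>k::nat. vtest_fun \<Omega> (\<psi> k)) \<and> (\<lambda>k. vf.qn (vf.coord_ip \<Omega> UNIV LV) (\<psi> k - u)) \<longlonglongrightarrow> 0"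
proof -
  have "\<exists>\<psi>::nat \<Rightarrow> real^'n \<Rightarrow> complex. (\<forall>k. ctest_fun \<Omega> (\<psi> k)) \<and> (\<lambda>k. norm_H1 \<Omega> (\<lambda>x. u x $ i - \<psi> k x)) \<longlonglongrightarrow> 0" for i
    using assms unfolding Vsp_def H10_def by blast
  then obtain \<psi> :: "'n \<Rightarrow> nat \<Rightarrow> real^'n \<Rightarrow> complex" where
    c: "\<And>i k. ctest_fun \<Omega> (\<psi> i k)" "\<And>i. (\<lambda>k. norm_H1 \<Omega> (\<lambda>x. u x $ i - \<psi> i k x)) \<longlonglongrightarrow> 0" by metis
  define \<Psi> where "\<Psi> k = (\<lambda>x. \<chi> i. \<psi> i k x)" for k
  have v: "vtest_fun \<Omega> (\<Psi> k)" for k using c(1) by (simp add: vtest_fun_def \<Psi>_def)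
  have V: "Vsp \<Omega> (\<Psi> k)" for k using c(1) ctest_H10 by (simp add: Vsp_def \<Psi>_def)
  have "(\<lambda>k. sqrt (\<Sum>i\<in>UNIV. (norm_H1 \<Omega> (\<lambda>x. u x $ i - \<psi> i k x))\<^sup>2)) \<longlonglongrightarrow> sqrt (\<Sum>i\<in>(UNIV::'n set). 0\<^sup>2)"
    by (intro tendsto_real_sqrt tendsto_sum tendsto_power c(2))
  then have "(\<lambda>k. norm_V \<Omega> (u - \<Psi> k)) \<longlonglongrightarrow> 0" unfolding norm_V_def by (simp add: \<Psi>_def fun_diff_def)
  moreover have "vf.qn (vf.coord_ip \<Omega> UNIV LV) (\<Psi> k - u) = norm_V \<Omega> (u - \<Psi> k)" for k
    unfolding qn_V[symmetric] by (rule vf.qn_diff_commute[OF psd_V vf_subspace_V]) (use V assms in auto)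
  ultimately show ?thesis using v by (intro exI[of _ \<Psi>]) simp
qed

section \<open>The Korn inequality\<close>

lemma ctest_mixed:
  assumes f: "ctest_fun \<Omega> f" and g: "ctest_fun \<Omega> g"
  shows "Re (inner_L2 \<Omega> (cpartial j f) (cpartial i g)) = Re (inner_L2 \<Omega> (cpartial i f) (cpartial j g))"
proof -
  have t: "test_fun \<Omega> (\<lambda>x. Re (f x))" "test_fun \<Omega> (\<lambda>x. Im (f x))" "test_fun \<Omega> (\<lambda>x. Re (g x))" "test_fun \<Omega> (\<lambda>x. Im (g x))"
    using f g unfolding ctest_fun_def by blast+
  have e: "Re (inner_L2 \<Omega> (cpartial j f) (cpartial i g)) =
      (LINT x|lborel. partial j (\<lambda>x. Re (f x)) x * partial i (\<lambda>x. Re (g x)) x) + (LINT x|lborel. partial j (\<lambda>x. Im (f x)) x * partial i (\<lambda>x. Im (g x)) x)" for i j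
  proof -
    have int: "integrable (lebesgue_on \<Omega>) (\<lambda>x. cpartial j f x * cnj (cpartial i g x))"
      by (intro integrable_inner_L2 ctest_L2 f g)
    have "Re (inner_L2 \<Omega> (cpartial j f) (cpartial i g)) = (LINT x|lebesgue_on \<Omega>. partial j (\<lambda>x. Re (f x)) x * partial i (\<lambda>x. Re (g x)) x + partial j (\<lambda>x. Im (f x)) x * partial i (\<lambda>x. Im (g x)) x)"
      unfolding inner_L2_def integral_Re[OF int, symmetric] by (simp add: cpartial_def)
    also have "\<dots> = (LINT x|lebesgue_on \<Omega>. partial j (\<lambda>x. Re (f x)) x * partial i (\<lambda>x. Re (g x)) x) + (LINT x|lebesgue_on \<Omega>. partial j (\<lambda>x. Im (f x)) x * partial i (\<lambda>x. Im (g x)) x)"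
      by (intro Bochner_Integration.integral_add integrable_test_mult test_fun_partial t)
    also have "(LINT x|lebesgue_on \<Omega>. partial j (\<lambda>x. Re (f x)) x * partial i (\<lambda>x. Re (g x)) x) = (LINT x|lborel. partial j (\<lambda>x. Re (f x)) x * partial i (\<lambda>x. Re (g x)) x)"
      using test_fun_measurable(2)[OF t(1)] test_fun_measurable(2)[OF t(3)] test_fun_outside[OF test_fun_partial[OF t(1)]]
      by (intro integral_dom_real) auto
    also have "(LINT x|lebesgue_on \<Omega>. partial j (\<lambda>x. Im (f x)) x * partial i (\<lambda>x. Im (g x)) x) = (LINT x|lborel. partial j (\<lambda>x. Im (f x)) x * partial i (\<lambda>x. Im (g x)) x)"
      using test_fun_measurable(2)[OF t(2)] test_fun_measurable(2)[OF t(4)] test_fun_outside[OF test_fun_partial[OF t(2)]]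
      by (intro integral_dom_real) auto
    finally show ?thesis .
  qed
  show ?thesis unfolding e
    using C1c_mixed_partials[OF test_fun_C1c[OF t(1)] test_fun_C1c[OF t(3)], of j i]
      C1c_mixed_partials[OF test_fun_C1c[OF t(2)] test_fun_C1c[OF t(4)], of j i] by simp
qed

text \<open>For test fields the derivatives can be exchanged, and the sum becomes the squared norm
  of the divergence. The sum is a bounded sesquilinear form, so its sign survives the passage to the
  closure.\<close>

lemma cross_gradient_nonneg:
  assumes u: "Vsp \<Omega> u"
  shows "0 \<le> (\<Sum>i\<in>UNIV. \<Sum>j\<in>UNIV. Re (inner_L2 \<Omega> (wpart \<Omega> u i j) (wpart \<Omega> u j i)))"
proof -
  define B where "B u v = (\<Sum>i\<in>UNIV. \<Sum>j\<in>UNIV. inner_L2 \<Omega> (LV (i, Some j) u) (LV (j, Some i) v))" for u v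
  have B: "vf.sesq {u. Vsp \<Omega> u} B" unfolding B_def[abs_def]
    by (intro vf.sesq_sum vf.sesq_inner_L2 LV_aelin vf_subspace_V)
  have "vf.fbounded {u. Vsp \<Omega> u} (vf.coord_ip \<Omega> UNIV LV) B" unfolding B_def[abs_def]
    by (intro vf.fbounded_sum vf.fbounded_inner LV_aelin vf.lbounded_coord) auto
  then obtain M where M: "M \<ge> 0" "\<And>x y. Vsp \<Omega> x \<Longrightarrow> Vsp \<Omega> y \<Longrightarrow> cmod (B x y) \<le> M * vf.qn (vf.coord_ip \<Omega> UNIV LV) x * vf.qn (vf.coord_ip \<Omega> UNIV LV) y"
    unfolding vf.fbounded_def by blast
  obtain \<psi> :: "nat \<Rightarrow> real^'n \<Rightarrow> complex^'n" where \<psi>: "\<And>k. vtest_fun \<Omega> (\<psi> k)" "(\<lambda>k. vf.qn (vf.coord_ip \<Omega> UNIV LV) (\<psi> k - u)) \<longlonglongrightarrow> 0"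
    using V_approx[OF u] by blast
  have V: "Vsp \<Omega> (\<psi> k)" for k using \<psi>(1)[of k] ctest_H10 by (simp add: Vsp_def vtest_fun_def)
  have "0 \<le> Re (B u u)"
  proof (rule vf.sesq_bounded_nonneg_limit[OF psd_V vf_subspace_V B _ M(1) _ _ \<psi>(2)])
    fix k
    have c: "ctest_fun \<Omega> (\<lambda>x. \<psi> k x $ i)" for i using \<psi>(1) unfolding vtest_fun_def by blast
    let ?c = "\<lambda>i j. cpartial j (\<lambda>x. \<psi> k x $ i)"
    have L: "inner_L2 \<Omega> (LV (i, Some j) (\<psi> k)) (LV (j, Some i) (\<psi> k)) = inner_L2 \<Omega> (?c i j) (?c j i)" for i j
      using ctest_wgrad[OF c, of i j] ctest_wgrad[OF c, of j i] L2_wgrad[OF ctest_H1[OF c]] ctest_L2(2)[OF c]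
      by (intro inner_L2_cong_AE) (auto simp: LV_def LH1_def)
    have "Re (B (\<psi> k) (\<psi> k)) = (\<Sum>i\<in>UNIV. \<Sum>j\<in>UNIV. Re (inner_L2 \<Omega> (?c i i) (?c j j)))"
      unfolding B_def L Re_sum using ctest_mixed[OF c c] by (intro sum.cong refl)
    also have "\<dots> = Re (inner_L2 \<Omega> (\<lambda>x. \<Sum>i\<in>UNIV. ?c i i x) (\<lambda>x. \<Sum>i\<in>UNIV. ?c i i x))"
      using inner_L2_sum_self[of UNIV \<Omega> "\<lambda>i. ?c i i"] ctest_L2(2)[OF c] by (simp flip: Re_sum)
    also have "\<dots> \<ge> 0" by (simp add: inner_L2_self)
    finally show "0 \<le> Re (B (\<psi> k) (\<psi> k))" .
  qed (use M(2) V u in auto)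
  then show ?thesis unfolding B_def wpart_eq_LV by simp
qed

text \<open>Expanding the square of the symmetrized gradient produces the full gradient twice and a
  cross term whose sum is nonnegative.\<close>

lemma korn:
  assumes u: "Vsp \<Omega> u"
  shows "(\<Sum>i\<in>UNIV. \<Sum>j\<in>UNIV. (norm_L2 \<Omega> (wpart \<Omega> u i j))\<^sup>2) \<le> 2 * (\<Sum>i\<in>UNIV. \<Sum>j\<in>UNIV. (norm_L2 \<Omega> (eps \<Omega> u i j))\<^sup>2)"
proof -
  let ?w = "\<lambda>i j. wpart \<Omega> u i j"
  have "4 * (norm_L2 \<Omega> (eps \<Omega> u i j))\<^sup>2 = (norm_L2 \<Omega> (?w i j))\<^sup>2 + 2 * Re (inner_L2 \<Omega> (?w i j) (?w j i)) + (norm_L2 \<Omega> (?w j i))\<^sup>2" for i j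
  proof -
    have "eps \<Omega> u i j = (\<lambda>x. (1/2) * (?w i j x + ?w j i x))" unfolding eps_def[abs_def] by simp
    then have "norm_L2 \<Omega> (eps \<Omega> u i j) = (1/2) * norm_L2 \<Omega> (\<lambda>x. ?w i j x + ?w j i x)"
      using norm_L2_cmult[OF L2_add[OF L2_wpart[OF u] L2_wpart[OF u]], of "1/2" i j j i] by simp
    then have "4 * (norm_L2 \<Omega> (eps \<Omega> u i j))\<^sup>2 = (norm_L2 \<Omega> (\<lambda>x. ?w i j x + ?w j i x))\<^sup>2"
      by (simp only:) (simp add: power_divide)
    then show ?thesis using norm_L2_add_sq[OF L2_wpart[OF u] L2_wpart[OF u], of i j j i] by simp
  qed
  then have "4 * (\<Sum>i\<in>UNIV. \<Sum>j\<in>UNIV. (norm_L2 \<Omega> (eps \<Omega> u i j))\<^sup>2) =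
     (\<Sum>i\<in>UNIV. \<Sum>j\<in>UNIV. (norm_L2 \<Omega> (?w i j))\<^sup>2) + 2 * (\<Sum>i\<in>UNIV. \<Sum>j\<in>UNIV. Re (inner_L2 \<Omega> (?w i j) (?w j i))) + (\<Sum>i\<in>UNIV. \<Sum>j\<in>UNIV. (norm_L2 \<Omega> (?w j i))\<^sup>2)"
    by (simp add: sum_distrib_left sum.distrib)
  also have "(\<Sum>i\<in>UNIV. \<Sum>j\<in>UNIV. (norm_L2 \<Omega> (?w j i))\<^sup>2) = (\<Sum>i\<in>UNIV. \<Sum>j\<in>UNIV. (norm_L2 \<Omega> (?w i j))\<^sup>2)"
    by (rule sum.swap)
  finally show ?thesis using cross_gradient_nonneg[OF u] by simp
qed

section \<open>Compactness of the embedding into L2\<close>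

lemma indicator_dom_measurable: "Q \<in> sets borel \<Longrightarrow> (indicator Q :: real^'n \<Rightarrow> real) \<in> borel_measurable (lebesgue_on \<Omega>)"
  by (intro measurable_restrict_space1 measurable_completion) simp

lemma L2_indicator:
  assumes "Q \<in> sets borel"
  shows "L2 \<Omega> (\<lambda>x. of_real (indicator Q x))"
proof -
  have "L2 \<Omega> (\<lambda>x. of_real (indicator Q x) * 1)"
  proof (rule L2_bounded_mult[OF L2_const])
    show "(\<lambda>x. complex_of_real (indicator Q x)) \<in> borel_measurable (lebesgue_on \<Omega>)"
      using indicator_dom_measurable[OF assms] by measurable
    show "cmod (of_real (indicator Q x)) \<le> 1" for x by (simp add: indicator_def)
  qed
  then show ?thesis by simp
qed

text \<open>The cell inequality is about real test functions; these identities split all its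
  ingredients into real and imaginary parts, so that it can be added up.\<close>

lemma ctest_real_parts:
  assumes "ctest_fun \<Omega> \<psi>"
  shows "(norm_L2 \<Omega> \<psi>)\<^sup>2 = (LINT x|lborel. (Re (\<psi> x))\<^sup>2) + (LINT x|lborel. (Im (\<psi> x))\<^sup>2)"
    "(norm_L2 \<Omega> (cpartial i \<psi>))\<^sup>2 = (LINT x|lborel. (partial i (\<lambda>x. Re (\<psi> x)) x)\<^sup>2) + (LINT x|lborel. (partial i (\<lambda>x. Im (\<psi> x)) x)\<^sup>2)"
    "Q \<in> sets borel \<Longrightarrow> (cmod (inner_L2 \<Omega> \<psi> (\<lambda>x. of_real (indicator Q x))))\<^sup>2 =
       (LINT x|lborel. indicator Q x * Re (\<psi> x))\<^sup>2 + (LINT x|lborel. indicator Q x * Im (\<psi> x))\<^sup>2"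
proof -
  have t: "test_fun \<Omega> (\<lambda>x. Re (\<psi> x))" "test_fun \<Omega> (\<lambda>x. Im (\<psi> x))" using assms unfolding ctest_fun_def by blast+
  have sq: "(LINT x|lebesgue_on \<Omega>. (f x)\<^sup>2 + (g x)\<^sup>2) = (LINT x|lborel. (f x)\<^sup>2) + (LINT x|lborel. (g x)\<^sup>2)"
    if "test_fun \<Omega> f" "test_fun \<Omega> g" for f g
  proof -
    have "(LINT x|lebesgue_on \<Omega>. (f x)\<^sup>2 + (g x)\<^sup>2) = (LINT x|lebesgue_on \<Omega>. (f x)\<^sup>2) + (LINT x|lebesgue_on \<Omega>. (g x)\<^sup>2)"
      using integrable_test_mult[OF that(1,1)] integrable_test_mult[OF that(2,2)] by (simp add: power2_eq_square)
    also have "(LINT x|lebesgue_on \<Omega>. (f x)\<^sup>2) = (LINT x|lborel. (f x)\<^sup>2)"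
      using test_fun_measurable(1)[OF that(1)] test_fun_outside[OF that(1)] by (intro integral_dom_real) auto
    also have "(LINT x|lebesgue_on \<Omega>. (g x)\<^sup>2) = (LINT x|lborel. (g x)\<^sup>2)"
      using test_fun_measurable(1)[OF that(2)] test_fun_outside[OF that(2)] by (intro integral_dom_real) auto
    finally show ?thesis .
  qed
  show "(norm_L2 \<Omega> \<psi>)\<^sup>2 = (LINT x|lborel. (Re (\<psi> x))\<^sup>2) + (LINT x|lborel. (Im (\<psi> x))\<^sup>2)"
    unfolding norm_L2_sq cmod_power2 by (rule sq[OF t])
  show "(norm_L2 \<Omega> (cpartial i \<psi>))\<^sup>2 = (LINT x|lborel. (partial i (\<lambda>x. Re (\<psi> x)) x)\<^sup>2) + (LINT x|lborel. (partial i (\<lambda>x. Im (\<psi> x)) x)\<^sup>2)"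
    unfolding norm_L2_sq cmod_power2 using sq[OF test_fun_partial[OF t(1)] test_fun_partial[OF t(2)], of i i] by (simp add: cpartial_def)
  assume Q: "Q \<in> sets borel"
  let ?I = "inner_L2 \<Omega> \<psi> (\<lambda>x. of_real (indicator Q x))"
  have int: "integrable (lebesgue_on \<Omega>) (\<lambda>x. \<psi> x * cnj (of_real (indicator Q x)))"
    by (intro integrable_inner_L2 ctest_L2[OF assms] L2_indicator[OF Q])
  have dom: "(LINT x|lebesgue_on \<Omega>. f x * indicator Q x) = (LINT x|lborel. indicator Q x * f x)" if "test_fun \<Omega> f" for f
    using integral_dom_real[of "\<lambda>x. indicator Q x * f x"] test_fun_measurable(1)[OF that] test_fun_outside[OF that] Q by (simp add: mult.commute)
  have "Re ?I = (LINT x|lborel. indicator Q x * Re (\<psi> x))" "Im ?I = (LINT x|lborel. indicator Q x * Im (\<psi> x))"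
    unfolding inner_L2_def integral_Re[OF int, symmetric] integral_Im[OF int, symmetric]
    using dom[OF t(1)] dom[OF t(2)] by simp_all
  then show "(cmod ?I)\<^sup>2 = (LINT x|lborel. indicator Q x * Re (\<psi> x))\<^sup>2 + (LINT x|lborel. indicator Q x * Im (\<psi> x))\<^sup>2"
    unfolding cmod_power2 by simp
qed

text \<open>Quadratic inequalities pass from test functions to the closure when the difference of
  the two sides is the diagonal of a bounded sesquilinear form; \<open>B\<close> is that
  form.\<close>

lemma H10_cell_inequality:
  assumes e: "\<epsilon> > 0"
  obtains I :: "('n \<Rightarrow> int) set" and h where "finite I" "h > 0"
    "\<And>f. H10 \<Omega> f \<Longrightarrow> (norm_L2 \<Omega> f)\<^sup>2 \<le>
       (\<Sum>k\<in>I. (1 / h ^ CARD('n)) * (cmod (inner_L2 \<Omega> f (\<lambda>x. of_real (indicator (cell h k) x))))\<^sup>2)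
       + \<epsilon> * (norm_H1 \<Omega> f)\<^sup>2"
proof -
  obtain I :: "('n \<Rightarrow> int) set" and h where I: "finite I" "h > 0"
    and ineq: "\<And>\<phi>. test_fun \<Omega> \<phi> \<Longrightarrow> (LINT x|lborel. (\<phi> x)\<^sup>2) \<le>
       (\<Sum>k\<in>I. (1 / h ^ CARD('n)) * (LINT x|lborel. indicator (cell h k) x * \<phi> x)\<^sup>2)
       + \<epsilon> * (\<Sum>i\<in>UNIV. LINT x|lborel. (partial i \<phi> x)\<^sup>2)"
    using cell_inequality[OF bounded_dom e] by blast
  define c where "c = 1 / h ^ CARD('n)"
  define J where "J k = (\<lambda>x::real^'n. complex_of_real (indicator (cell h k) x))" for k
  have JL: "L2 \<Omega> (J k)" for k unfolding J_def by (rule L2_indicator[OF cell_measurable])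
  let ?S = "{f. H1 \<Omega> f}" and ?ip = "fn.coord_ip \<Omega> UNIV LH1"
  \<comment> \<open>A form of rank one whose diagonal is the squared modulus of the integral over
    the cell.\<close>
  define F where "F k f g = inner_L2 \<Omega> f (J k) * cnj (inner_L2 \<Omega> g (J k))" for k f g
  have LH: "fn.aelin \<Omega> ?S (\<lambda>f. f)" by (rule fn.aelinI) (auto simp: H1_L2)
  have Fs: "fn.sesq ?S (F k)" for k
  proof -
    have s: "fn.sesq {f. L2 \<Omega> f} (inner_L2 \<Omega>)" by (rule fn.psdD(1)[OF psd_inner_L2])
    have "inner_L2 \<Omega> (f + g) (J k) = inner_L2 \<Omega> f (J k) + inner_L2 \<Omega> g (J k)" if "H1 \<Omega> f" "H1 \<Omega> g" for f g
      using fn.sesqD(1)[OF s, of f g "J k"] H1_L2 that JL by simp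
    moreover have "inner_L2 \<Omega> (\<lambda>x. a * f x) (J k) = a * inner_L2 \<Omega> f (J k)" if "H1 \<Omega> f" for f a
      using fn.sesqD(3)[OF s, of f "J k" a] H1_L2 that JL by simp
    ultimately show ?thesis unfolding fn.sesq_def F_def by (simp add: algebra_simps)
  qed
  have H1c: "norm_L2 \<Omega> f \<le> fn.qn ?ip f" for f
    using fn.norm_L2_le_coord_ip[of UNIV None \<Omega> LH1 f] by (simp add: LH1_def)
  have Fb: "fn.fbounded ?S ?ip (F k)" for k
    unfolding fn.fbounded_def
  proof (intro exI[of _ "(norm_L2 \<Omega> (J k))\<^sup>2"] conjI ballI)
    fix f g assume "f \<in> ?S" "g \<in> ?S"
    then have L: "L2 \<Omega> f" "L2 \<Omega> g" using H1_L2 by auto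
    have "cmod (inner_L2 \<Omega> f (J k)) \<le> fn.qn ?ip f * norm_L2 \<Omega> (J k)"
      using cmod_inner_L2_le[OF L(1) JL] mult_right_mono[OF H1c[of f] norm_L2_nonneg] order_trans by blast
    moreover have "cmod (inner_L2 \<Omega> g (J k)) \<le> fn.qn ?ip g * norm_L2 \<Omega> (J k)"
      using cmod_inner_L2_le[OF L(2) JL] mult_right_mono[OF H1c[of g] norm_L2_nonneg] order_trans by blast
    ultimately have "cmod (F k f g) \<le> (fn.qn ?ip f * norm_L2 \<Omega> (J k)) * (fn.qn ?ip g * norm_L2 \<Omega> (J k))"
      unfolding F_def norm_mult complex_mod_cnj
      using norm_L2_nonneg[of \<Omega> f] norm_L2_nonneg[of \<Omega> "J k"] H1c[of f] by (intro mult_mono) auto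
    then show "cmod (F k f g) \<le> (norm_L2 \<Omega> (J k))\<^sup>2 * fn.qn ?ip f * fn.qn ?ip g"
      by (simp add: power2_eq_square algebra_simps)
  qed simp
  define B where "B f g = (\<Sum>k\<in>I. of_real c * F k f g) + of_real \<epsilon> * ?ip f g + (-1) * inner_L2 \<Omega> f g" for f g
  have B: "fn.sesq ?S B" unfolding B_def[abs_def]
    by (intro fn.sesq_add fn.sesq_sum fn.sesq_cmult Fs fn.psdD(1)[OF psd_H1] fn.sesq_inner_L2[OF LH LH fn_subspace_H1])
  have ipb: "fn.fbounded ?S ?ip ?ip"
    unfolding fn.fbounded_def using fn.cauchy_schwarz[OF psd_H1 fn_subspace_H1] by (intro exI[of _ 1]) auto
  have Lb: "fn.lbounded \<Omega> ?S ?ip (\<lambda>f. f)" unfolding fn.lbounded_def using H1c by (intro exI[of _ 1]) auto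
  have "fn.fbounded ?S ?ip B" unfolding B_def[abs_def]
    by (intro fn.fbounded_add fn.fbounded_sum fn.fbounded_cmult Fb ipb fn.fbounded_inner[OF LH LH Lb Lb])
  then obtain M where M: "M \<ge> 0" "\<And>x y. x \<in> ?S \<Longrightarrow> y \<in> ?S \<Longrightarrow> cmod (B x y) \<le> M * fn.qn ?ip x * fn.qn ?ip y"
    unfolding fn.fbounded_def by blast
  have ReB: "Re (B f f) = (\<Sum>k\<in>I. c * (cmod (inner_L2 \<Omega> f (J k)))\<^sup>2) + \<epsilon> * (norm_H1 \<Omega> f)\<^sup>2 - (norm_L2 \<Omega> f)\<^sup>2" if "H1 \<Omega> f" for f
  proof -
    have "F k f f = of_real ((cmod (inner_L2 \<Omega> f (J k)))\<^sup>2)" for k unfolding F_def by (simp only: complex_norm_square)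
    moreover have "?ip f f = of_real ((norm_H1 \<Omega> f)\<^sup>2)" unfolding qn_H1[symmetric] by (rule fn.psd_of_real[OF psd_H1]) (use that in simp)
    ultimately show ?thesis unfolding B_def inner_L2_self by simp
  qed
  have tst: "0 \<le> Re (B \<psi> \<psi>)" if c\<psi>: "ctest_fun \<Omega> \<psi>" for \<psi>
  proof -
    have t: "test_fun \<Omega> (\<lambda>x. Re (\<psi> x))" "test_fun \<Omega> (\<lambda>x. Im (\<psi> x))" using c\<psi> unfolding ctest_fun_def by blast+
    have g: "norm_L2 \<Omega> (\<lambda>x. wgrad \<Omega> \<psi> x $ i) = norm_L2 \<Omega> (cpartial i \<psi>)" for i
      by (rule norm_L2_cong_AE[OF L2_wgrad[OF ctest_H1[OF c\<psi>]] ctest_L2(2)[OF c\<psi>] ctest_wgrad[OF c\<psi>]])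
    have "(norm_L2 \<Omega> \<psi>)\<^sup>2 \<le> (\<Sum>k\<in>I. c * (cmod (inner_L2 \<Omega> \<psi> (J k)))\<^sup>2) + \<epsilon> * (\<Sum>i\<in>UNIV. (norm_L2 \<Omega> (cpartial i \<psi>))\<^sup>2)"
      using ineq[OF t(1)] ineq[OF t(2)] unfolding ctest_real_parts(1,2)[OF c\<psi>] J_def ctest_real_parts(3)[OF c\<psi> cell_measurable] c_def
      by (simp add: distrib_left sum.distrib)
    also have "\<dots> \<le> (\<Sum>k\<in>I. c * (cmod (inner_L2 \<Omega> \<psi> (J k)))\<^sup>2) + \<epsilon> * (norm_H1 \<Omega> \<psi>)\<^sup>2"
      using e unfolding norm_H1_def g by (simp add: sum_nonneg)
    finally show ?thesis unfolding ReB[OF ctest_H1[OF c\<psi>]] by simp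
  qed
  have "0 \<le> Re (B f f)" if f: "H10 \<Omega> f" for f
  proof -
    have fH: "H1 \<Omega> f" using H10_H1 f by blast
    obtain \<psi> :: "nat \<Rightarrow> real^'n \<Rightarrow> complex" where p: "\<And>k. ctest_fun \<Omega> (\<psi> k)" "(\<lambda>k. norm_H1 \<Omega> (\<lambda>x. f x - \<psi> k x)) \<longlonglongrightarrow> 0"
      using f unfolding H10_def by blast
    have "fn.qn ?ip (\<psi> k - f) = norm_H1 \<Omega> (\<lambda>x. f x - \<psi> k x)" for k
      using fn.qn_diff_commute[OF psd_H1 fn_subspace_H1, of "\<psi> k" f] ctest_H1[OF p(1)] fH by (simp add: qn_H1 fun_diff_def)
    then have l: "(\<lambda>k. fn.qn ?ip (\<psi> k - f)) \<longlonglongrightarrow> 0" using p(2) by simp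
    show ?thesis
    proof (rule fn.sesq_bounded_nonneg_limit[OF psd_H1 fn_subspace_H1 B _ M(1) _ _ l])
      show "0 \<le> Re (B (\<psi> n) (\<psi> n))" for n by (rule tst[OF p(1)])
      show "\<psi> n \<in> ?S" for n using ctest_H1[OF p(1)] by simp
      show "f \<in> ?S" using fH by simp
      show "cmod (B x y) \<le> M * fn.qn ?ip x * fn.qn ?ip y" if "x \<in> ?S" "y \<in> ?S" for x y by (rule M(2)[OF that])
    qed
  qed
  then have "(norm_L2 \<Omega> f)\<^sup>2 \<le> (\<Sum>k\<in>I. c * (cmod (inner_L2 \<Omega> f (J k)))\<^sup>2) + \<epsilon> * (norm_H1 \<Omega> f)\<^sup>2" if "H10 \<Omega> f" for f
    using ReB[OF H10_H1[OF that]] that by fastforce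
  then show ?thesis using that[OF I] unfolding c_def J_def by blast
qed

lemma norm_H1_component_le: "norm_H1 \<Omega> (\<lambda>x. u x $ i) \<le> norm_V \<Omega> u"
  unfolding norm_V_def using member_le_sum[of i UNIV "\<lambda>i. (norm_H1 \<Omega> (\<lambda>x. u x $ i))\<^sup>2"]
  by (intro real_le_rsqrt) auto

text \<open>The gradient part of the cell inequality is small uniformly on bounded sets. The rest
  depends on finitely many bounded complex numbers, for which a common convergent subsequence
  exists.\<close>

lemma V_totally_bounded:
  assumes X: "\<And>n::nat. Vsp \<Omega> (X n)" and b: "\<And>n. norm_V \<Omega> (X n) \<le> B" and d: "\<delta> > 0"
  shows "\<exists>r::nat\<Rightarrow>nat. strict_mono r \<and> (\<exists>N. \<forall>j\<ge>N. \<forall>k\<ge>N. \<forall>i. norm_L2 \<Omega> (\<lambda>x. X (r j) x $ i - X (r k) x $ i) < \<delta>)"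
proof -
  \<comment> \<open>Differences have norm at most \<open>2 B\<close>, so the gradient part stays
    below half of \<open>\<delta>\<^sup>2\<close>; the summand 1 protects against
    \<open>B = 0\<close>.\<close>
  define \<epsilon> where "\<epsilon> = \<delta>\<^sup>2 / (2 * (4 * B\<^sup>2 + 1))"
  have B1: "0 < 4 * B\<^sup>2 + 1" by (simp add: add_nonneg_pos)
  have e: "\<epsilon> > 0" unfolding \<epsilon>_def using d B1 by simp
  have eB: "\<epsilon> * (4 * B\<^sup>2) < \<delta>\<^sup>2 / 2"
  proof -
    have "\<epsilon> * (4 * B\<^sup>2) < \<epsilon> * (4 * B\<^sup>2 + 1)" using e by simp
    also have "\<dots> = \<delta>\<^sup>2 / 2" unfolding \<epsilon>_def using B1 by (simp add: field_simps)
    finally show ?thesis .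
  qed
  obtain I :: "('n \<Rightarrow> int) set" and h where I: "finite I" "h > 0"
    and ineq: "\<And>f. H10 \<Omega> f \<Longrightarrow> (norm_L2 \<Omega> f)\<^sup>2 \<le>
       (\<Sum>k\<in>I. (1 / h ^ CARD('n)) * (cmod (inner_L2 \<Omega> f (\<lambda>x. of_real (indicator (cell h k) x))))\<^sup>2)
       + \<epsilon> * (norm_H1 \<Omega> f)\<^sup>2"
    using H10_cell_inequality[OF e] by blast
  define c where "c = 1 / h ^ CARD('n)"
  have c0: "c > 0" unfolding c_def using I(2) by simp
  define J where "J k = (\<lambda>x::real^'n. complex_of_real (indicator (cell h k) x))" for k
  have JL: "L2 \<Omega> (J k)" for k unfolding J_def by (rule L2_indicator[OF cell_measurable])
  define a where "a p n = inner_L2 \<Omega> (\<lambda>x. X n x $ fst p) (J (snd p))" for p n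
  have XL: "L2 \<Omega> (\<lambda>x. X n x $ i)" for n i using H1_L2[OF Vsp_H1[OF X]] .
  have nH: "norm_L2 \<Omega> f \<le> norm_H1 \<Omega> f" for f
    using fn.norm_L2_le_coord_ip[of UNIV None \<Omega> LH1 f] by (simp add: LH1_def qn_H1)
  have "bounded (range (a p))" for p
  proof -
    have "norm (a p n) \<le> B * norm_L2 \<Omega> (J (snd p))" for n
    proof -
      have "norm (a p n) \<le> norm_L2 \<Omega> (\<lambda>x. X n x $ fst p) * norm_L2 \<Omega> (J (snd p))"
        unfolding a_def by (rule cmod_inner_L2_le[OF XL JL])
      moreover have "norm_L2 \<Omega> (\<lambda>x. X n x $ fst p) \<le> B"
        using nH[of "\<lambda>x. X n x $ fst p"] norm_H1_component_le[of "X n" "fst p"] b[of n] by linarith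
      ultimately show ?thesis using mult_right_mono[OF _ norm_L2_nonneg] order_trans by blast
    qed
    then show ?thesis unfolding bounded_iff by blast
  qed
  then obtain r :: "nat \<Rightarrow> nat" where r: "strict_mono r" "\<forall>p\<in>UNIV \<times> I. convergent (a p \<circ> r)"
    using finite_bounded_subseq[of "UNIV \<times> I" a] I(1) by auto
  \<comment> \<open>Tolerance for a single cell integral that keeps the sum over all cells below
    half of \<open>\<delta>\<^sup>2\<close>; the summand 1 protects against an empty index
    set.\<close>
  define \<eta> where "\<eta> = sqrt (\<delta>\<^sup>2 / (2 * (c * real (card I) + 1)))"
  have \<eta>: "\<eta> > 0" unfolding \<eta>_def using d c0 by (simp add: add_nonneg_pos)
  have \<eta>2: "c * real (card I) * \<eta>\<^sup>2 \<le> \<delta>\<^sup>2 / 2"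
  proof -
    have p: "0 < c * real (card I) + 1" using c0 by (simp add: add_nonneg_pos)
    have "\<eta>\<^sup>2 = \<delta>\<^sup>2 / (2 * (c * real (card I) + 1))" unfolding \<eta>_def using p by simp
    then have "(c * real (card I) + 1) * \<eta>\<^sup>2 = \<delta>\<^sup>2 / 2" using p by (simp add: field_simps)
    moreover have "c * real (card I) * \<eta>\<^sup>2 \<le> (c * real (card I) + 1) * \<eta>\<^sup>2" by (intro mult_right_mono) auto
    ultimately show ?thesis by simp
  qed
  have "\<exists>N. \<forall>j\<ge>N. \<forall>k\<ge>N. cmod (a p (r j) - a p (r k)) < \<eta>" if "p \<in> UNIV \<times> I" for p
  proof -
    have "Cauchy (a p \<circ> r)" using r(2) that convergent_Cauchy by blast
    then show ?thesis using \<eta> unfolding Cauchy_iff by auto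
  qed
  then obtain N where N: "\<And>p j k. p \<in> UNIV \<times> I \<Longrightarrow> j \<ge> N p \<Longrightarrow> k \<ge> N p \<Longrightarrow> cmod (a p (r j) - a p (r k)) < \<eta>" by metis
  \<comment> \<open>The sum serves as a common upper bound, also for an empty index set.\<close>
  define N0 where "N0 = (\<Sum>p\<in>UNIV \<times> I. N p)"
  have NN: "N p \<le> N0" if "p \<in> UNIV \<times> I" for p
    unfolding N0_def using that I(1) by (intro member_le_sum) auto
  have "norm_L2 \<Omega> (\<lambda>x. X (r j) x $ i - X (r k) x $ i) < \<delta>" if jk: "j \<ge> N0" "k \<ge> N0" for i j k
  proof -
    let ?d = "\<lambda>x. X (r j) x $ i - X (r k) x $ i"
    have H: "H10 \<Omega> ?d"
      using fn.subspace_diff[OF fn_subspace_H10, of "\<lambda>x. X (r j) x $ i" "\<lambda>x. X (r k) x $ i"] X unfolding Vsp_def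
      by (simp add: fun_diff_def)
    have "norm_H1 \<Omega> ?d \<le> norm_H1 \<Omega> (\<lambda>x. X (r j) x $ i) + norm_H1 \<Omega> (\<lambda>x. X (r k) x $ i)"
    proof -
      have m: "(\<lambda>x. X (r j) x $ i) \<in> {f. H1 \<Omega> f}" "- (\<lambda>x. X (r k) x $ i) \<in> {f. H1 \<Omega> f}" "(\<lambda>x. X (r k) x $ i) \<in> {f. H1 \<Omega> f}"
        using Vsp_H1[OF X] fn.subspace_neg[OF fn_subspace_H1] by blast+
      have "(\<lambda>x. X (r j) x $ i) + - (\<lambda>x. X (r k) x $ i) = ?d" by (simp add: fun_eq_iff)
      then show ?thesis using fn.qn_triangle[OF psd_H1 fn_subspace_H1 m(1,2)] fn.qn_uminus[OF psd_H1 fn_subspace_H1 m(3)] by (simp add: qn_H1)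
    qed
    also have "\<dots> \<le> 2 * B"
      using norm_H1_component_le[of "X (r j)" i] norm_H1_component_le[of "X (r k)" i] b[of "r j"] b[of "r k"] by simp
    finally have "(norm_H1 \<Omega> ?d)\<^sup>2 \<le> (2 * B)\<^sup>2" by (intro power_mono) (auto simp: norm_H1_def sum_nonneg)
    then have "(norm_H1 \<Omega> ?d)\<^sup>2 \<le> 4 * B\<^sup>2" by (simp add: power_mult_distrib)
    from mult_left_mono[OF this, of \<epsilon>] have 1: "\<epsilon> * (norm_H1 \<Omega> ?d)\<^sup>2 < \<delta>\<^sup>2 / 2" using e eB by linarith
    have "(cmod (inner_L2 \<Omega> ?d (J q)))\<^sup>2 \<le> \<eta>\<^sup>2" if q: "q \<in> I" for q
    proof -
      have p: "(i, q) \<in> UNIV \<times> I" using q by simp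
      have "inner_L2 \<Omega> ?d (J q) = a (i, q) (r j) - a (i, q) (r k)"
        using fn.sesq_diff(1)[OF fn.psdD(1)[OF psd_inner_L2] fn_subspace_L2, of "\<lambda>x. X (r j) x $ i" \<Omega> "\<lambda>x. X (r k) x $ i" "J q"] XL JL
        unfolding a_def by (simp add: fun_diff_def)
      then have "cmod (inner_L2 \<Omega> ?d (J q)) < \<eta>" using N[OF p, of j k] NN[OF p] jk by simp
      then show ?thesis by (intro power_mono) auto
    qed
    then have "(\<Sum>q\<in>I. c * (cmod (inner_L2 \<Omega> ?d (J q)))\<^sup>2) \<le> (\<Sum>q\<in>I. c * \<eta>\<^sup>2)"
      using c0 by (intro sum_mono mult_left_mono) auto
    also have "\<dots> \<le> \<delta>\<^sup>2 / 2" using \<eta>2 by (simp add: algebra_simps)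
    finally have "(norm_L2 \<Omega> ?d)\<^sup>2 < \<delta>\<^sup>2" using ineq[OF H] 1 unfolding c_def[symmetric] J_def[symmetric] by simp
    then show ?thesis using d power_less_imp_less_base[of _ 2 \<delta>] by simp
  qed
  then show ?thesis using r(1) by blast
qed

text \<open>Total boundedness yields a subsequence for one tolerance only; a diagonal sequence over
  the tolerances \<open>1 / (n + 1)\<close> is Cauchy.\<close>

lemma rellich_V:
  assumes X: "\<And>n::nat. Vsp \<Omega> (X n)" and b: "\<And>n. norm_V \<Omega> (X n) \<le> B"
  shows "\<exists>r::nat\<Rightarrow>nat. strict_mono r \<and> (\<forall>\<delta>>0. \<exists>N. \<forall>j\<ge>N. \<forall>k\<ge>N. \<forall>i. norm_L2 \<Omega> (\<lambda>x. X (r j) x $ i - X (r k) x $ i) < \<delta>)"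
proof -
  define P where "P n s \<longleftrightarrow> (\<exists>N. \<forall>j\<ge>N. \<forall>k\<ge>N. \<forall>i. norm_L2 \<Omega> (\<lambda>x. X (s j) x $ i - X (s k) x $ i) < 1 / real (Suc n))" for n and s :: "nat \<Rightarrow> nat"
  interpret subseqs P
  proof
    fix n and s :: "nat \<Rightarrow> nat" assume "strict_mono s"
    then show "\<exists>r'. strict_mono r' \<and> P n (s \<circ> r')"
      using V_totally_bounded[of "\<lambda>n. X (s n)" B "1 / real (Suc n)"] X b unfolding P_def by simp
  qed
  have "P k (diagseq \<circ> (+) (Suc k))" for k
  proof (rule diagseq_holds)
    fix r s n assume r: "strict_mono (r :: nat \<Rightarrow> nat)" and "P n s"
    then obtain N where N: "\<forall>j\<ge>N. \<forall>k\<ge>N. \<forall>i. norm_L2 \<Omega> (\<lambda>x. X (s j) x $ i - X (s k) x $ i) < 1 / real (Suc n)" unfolding P_def by blast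
    then show "P n (s \<circ> r)" unfolding P_def using seq_suble[OF r] by (intro exI[of _ N]) (simp, meson le_trans)
  qed
  \<comment> \<open>The diagonal sequence refines the n-th subsequence only from index
    \<open>Suc n\<close> on, hence the shift of the threshold.\<close>
  then have D: "\<exists>N. \<forall>j\<ge>N. \<forall>k\<ge>N. \<forall>i. norm_L2 \<Omega> (\<lambda>x. X (diagseq j) x $ i - X (diagseq k) x $ i) < 1 / real (Suc n)" for n
  proof -
    obtain N where N: "\<And>j k i. j \<ge> N \<Longrightarrow> k \<ge> N \<Longrightarrow> norm_L2 \<Omega> (\<lambda>x. X (diagseq (Suc n + j)) x $ i - X (diagseq (Suc n + k)) x $ i) < 1 / real (Suc n)"
      using \<open>\<And>k. P k (diagseq \<circ> (+) (Suc k))\<close>[of n] unfolding P_def by auto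
    have "norm_L2 \<Omega> (\<lambda>x. X (diagseq j) x $ i - X (diagseq k) x $ i) < 1 / real (Suc n)" if "j \<ge> Suc n + N" "k \<ge> Suc n + N" for i j k
      using N[of "j - Suc n" "k - Suc n" i] that by simp
    then show ?thesis by blast
  qed
  have "\<exists>N. \<forall>j\<ge>N. \<forall>k\<ge>N. \<forall>i. norm_L2 \<Omega> (\<lambda>x. X (diagseq j) x $ i - X (diagseq k) x $ i) < \<delta>" if d0: "\<delta> > 0" for \<delta>
  proof -
    obtain n where n: "1 / real (Suc n) < \<delta>" using nat_approx_posE[OF d0] by blast
    obtain N where "\<forall>j\<ge>N. \<forall>k\<ge>N. \<forall>i. norm_L2 \<Omega> (\<lambda>x. X (diagseq j) x $ i - X (diagseq k) x $ i) < 1 / real (Suc n)" using D[of n] by blast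
    then show ?thesis using n by (intro exI[of _ N]) (meson less_trans)
  qed
  then show ?thesis using subseq_diagseq by blast
qed

end

subsection \<open>Tensor fields and the quadratic form estimate\<close>

lemma sym_matrix_inner:
  fixes A :: "real^'n::finite^'n"
  assumes "transpose A = A"
  shows "x \<bullet> (A *v y) = (A *v x) \<bullet> y"
  using dot_lmul_matrix[of x A y] assms by (metis vector_transpose_matrix)

text \<open>Polarization with two coordinate vectors: four times the entry is a difference of two
  values of the quadratic form, each between 0 and \<open>4 M\<close>.\<close>

lemma sym_matrix_entry_bound:
  fixes A :: "real^'n::finite^'n"
  assumes A: "transpose A = A" and b: "\<And>\<xi>. 0 \<le> \<xi> \<bullet> (A *v \<xi>)" "\<And>\<xi>. \<xi> \<bullet> (A *v \<xi>) \<le> M * (norm \<xi>)\<^sup>2" and M: "0 \<le> M"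
  shows "\<bar>A $ i $ j\<bar> \<le> M"
proof -
  let ?a = "axis i 1 :: real^'n" and ?b = "axis j 1 :: real^'n"
  have e: "?a \<bullet> (A *v ?b) = A $ i $ j" by (simp add: matrix_vector_mul_component inner_axis' inner_axis row_def matrix_vector_mult_basis column_def)
  have s: "?b \<bullet> (A *v ?a) = ?a \<bullet> (A *v ?b)" using sym_matrix_inner[OF A, of ?b ?a] by (simp add: inner_commute)
  have p: "(?a + ?b) \<bullet> (A *v (?a + ?b)) - (?a - ?b) \<bullet> (A *v (?a - ?b)) = 4 * A $ i $ j"
    using s e by (simp add: matrix_vector_right_distrib matrix_vector_mult_diff_distrib inner_add_left inner_add_right inner_diff_left inner_diff_right)
  have n: "(norm (?a + ?b))\<^sup>2 \<le> 4" "(norm (?a - ?b))\<^sup>2 \<le> 4"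
  proof -
    have "norm (?a + ?b) \<le> 2" "norm (?a - ?b) \<le> 2"
      using norm_triangle_ineq[of ?a ?b] norm_triangle_ineq4[of ?a ?b] by simp_all
    then show "(norm (?a + ?b))\<^sup>2 \<le> 4" "(norm (?a - ?b))\<^sup>2 \<le> 4"
      using power_mono[of "norm (?a + ?b)" 2 2] power_mono[of "norm (?a - ?b)" 2 2] by simp_all
  qed
  have "(?a + ?b) \<bullet> (A *v (?a + ?b)) \<le> 4 * M" "(?a - ?b) \<bullet> (A *v (?a - ?b)) \<le> 4 * M"
    using b(2)[of "?a + ?b"] b(2)[of "?a - ?b"] mult_left_mono[OF n(1) M] mult_left_mono[OF n(2) M] by linarith+
  then show ?thesis using p b(1)[of "?a + ?b"] b(1)[of "?a - ?b"] by linarith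
qed

text \<open>The ellipticity bounds change places under inversion. Symmetry of the inverse follows
  because its transpose is a left inverse of \<open>A\<close>.\<close>

lemma matrix_inv_bounds:
  fixes A :: "real^'n::finite^'n"
  assumes A: "transpose A = A" and b: "\<And>\<xi>. a * (norm \<xi>)\<^sup>2 \<le> \<xi> \<bullet> (A *v \<xi>)" "\<And>\<xi>. \<xi> \<bullet> (A *v \<xi>) \<le> M * (norm \<xi>)\<^sup>2"
    and a: "0 < a" and M: "0 < M"
  shows "A *v (matrix_inv A *v \<xi>) = \<xi>" "transpose (matrix_inv A) = matrix_inv A"
    "(1 / M) * (norm \<xi>)\<^sup>2 \<le> \<xi> \<bullet> (matrix_inv A *v \<xi>)" "\<xi> \<bullet> (matrix_inv A *v \<xi>) \<le> (1 / a) * (norm \<xi>)\<^sup>2"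
    "det A \<noteq> 0"
proof -
  have ker: "x = 0" if "A *v x = 0" for x
  proof -
    have "a * (norm x)\<^sup>2 \<le> 0" using b(1)[of x] that by simp
    then show ?thesis using a by (simp add: mult_le_0_iff)
  qed
  then have inv: "invertible A" using invertible_left_inverse matrix_left_invertible_ker by blast
  then show "det A \<noteq> 0" using invertible_det_nz by blast
  have ii: "A ** matrix_inv A = mat 1" "matrix_inv A ** A = mat 1"
    using inv someI_ex[of "\<lambda>B. A ** B = mat 1 \<and> B ** A = mat 1"] unfolding invertible_def matrix_inv_def by blast+
  show r: "A *v (matrix_inv A *v \<xi>) = \<xi>" for \<xi> by (simp add: matrix_vector_mul_assoc ii(1))
  have "transpose (matrix_inv A) ** A = mat 1"
    using arg_cong[OF ii(1), of transpose] A by (simp add: matrix_transpose_mul)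
  then show "transpose (matrix_inv A) = matrix_inv A"
    using ii(1) by (metis matrix_mul_assoc matrix_mul_lid matrix_mul_rid)
  let ?\<eta> = "matrix_inv A *v \<xi>"
  let ?t = "1 / M"
  \<comment> \<open>Testing \<open>A\<close> with \<open>?\<eta> - \<xi> / M\<close> gives the lower
    bound without eigenvalues; the upper bound comes from coercivity at \<open>?\<eta>\<close> and
    Cauchy-Schwarz.\<close>
  have "0 \<le> (?\<eta> - ?t *\<^sub>R \<xi>) \<bullet> (A *v (?\<eta> - ?t *\<^sub>R \<xi>))"
    using b(1)[of "?\<eta> - ?t *\<^sub>R \<xi>"] a by (meson mult_nonneg_nonneg less_imp_le order_trans zero_le_power2)
  also have "\<dots> = ?\<eta> \<bullet> \<xi> - 2 * ?t * (\<xi> \<bullet> \<xi>) + ?t\<^sup>2 * (\<xi> \<bullet> (A *v \<xi>))"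
    using sym_matrix_inner[OF A, of ?\<eta> \<xi>] r[of \<xi>]
    by (simp add: matrix_vector_mult_diff_distrib matrix_vector_mult_scaleR inner_diff_left inner_diff_right power2_eq_square inner_commute)
  also have "\<dots> \<le> ?\<eta> \<bullet> \<xi> - 2 * ?t * (norm \<xi>)\<^sup>2 + ?t\<^sup>2 * (M * (norm \<xi>)\<^sup>2)"
    using mult_left_mono[OF b(2)[of \<xi>], of "?t\<^sup>2"] by (simp add: power2_norm_eq_inner)
  also have "\<dots> = ?\<eta> \<bullet> \<xi> - ?t * (norm \<xi>)\<^sup>2" using M by (simp add: power2_eq_square field_simps)
  finally show "?t * (norm \<xi>)\<^sup>2 \<le> \<xi> \<bullet> ?\<eta>" by (simp add: inner_commute)
  have "a * (norm ?\<eta>)\<^sup>2 \<le> \<xi> \<bullet> ?\<eta>" using b(1)[of ?\<eta>] r[of \<xi>] by (simp add: inner_commute)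
  also have cs: "\<xi> \<bullet> ?\<eta> \<le> norm \<xi> * norm ?\<eta>" by (rule norm_cauchy_schwarz)
  finally have "a * norm ?\<eta> \<le> norm \<xi>"
    by (cases "norm ?\<eta> = 0") (auto simp: power2_eq_square)
  then have "norm ?\<eta> \<le> norm \<xi> / a" using a by (simp add: field_simps)
  then have "norm \<xi> * norm ?\<eta> \<le> norm \<xi> * (norm \<xi> / a)" by (intro mult_left_mono) auto
  then show "\<xi> \<bullet> ?\<eta> \<le> (1 / a) * (norm \<xi>)\<^sup>2" using cs by (simp add: power2_eq_square)
qed

text \<open>A real symmetric matrix acts separately on real and imaginary parts, and by symmetry the
  mixed terms cancel, so the value is real.\<close>

lemma rmat_cvec_inner:
  fixes A :: "real^'n::finite^'n"
  assumes A: "transpose A = A"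
  shows "(\<Sum>i\<in>UNIV. rmat_cvec A w $ i * cnj (w $ i)) =
    of_real ((\<chi> i. Re (w $ i)) \<bullet> (A *v (\<chi> i. Re (w $ i))) + (\<chi> i. Im (w $ i)) \<bullet> (A *v (\<chi> i. Im (w $ i))))"
proof -
  have sw: "(\<Sum>i\<in>UNIV. \<Sum>j\<in>UNIV. A $ i $ j * f j * g i) = (\<Sum>i\<in>UNIV. \<Sum>j\<in>UNIV. A $ i $ j * g j * f i)" for f g :: "'n \<Rightarrow> real"
  proof -
    have "A $ j $ i = A $ i $ j" for i j using A by (metis transpose_def vec_lambda_beta)
    then show ?thesis by (subst sum.swap) (auto intro!: sum.cong)
  qed
  show ?thesis
  proof (rule complex_eqI)
    show "Re (\<Sum>i\<in>UNIV. rmat_cvec A w $ i * cnj (w $ i)) = Re (of_real ((\<chi> i. Re (w $ i)) \<bullet> (A *v (\<chi> i. Re (w $ i))) + (\<chi> i. Im (w $ i)) \<bullet> (A *v (\<chi> i. Im (w $ i)))))"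
      by (simp add: rmat_cvec_def inner_vec_def matrix_vector_mult_def sum_distrib_left sum_distrib_right sum.distrib mult.commute)
    have "Im (\<Sum>i\<in>UNIV. rmat_cvec A w $ i * cnj (w $ i)) = (\<Sum>i\<in>UNIV. \<Sum>j\<in>UNIV. A $ i $ j * Im (w $ j) * Re (w $ i)) - (\<Sum>i\<in>UNIV. \<Sum>j\<in>UNIV. A $ i $ j * Re (w $ j) * Im (w $ i))"
      by (simp add: rmat_cvec_def sum_distrib_right sum_subtractf)
    then show "Im (\<Sum>i\<in>UNIV. rmat_cvec A w $ i * cnj (w $ i)) = Im (of_real ((\<chi> i. Re (w $ i)) \<bullet> (A *v (\<chi> i. Re (w $ i))) + (\<chi> i. Im (w $ i)) \<bullet> (A *v (\<chi> i. Im (w $ i)))))"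
      using sw[of "\<lambda>i. Im (w $ i)" "\<lambda>i. Re (w $ i)"] by simp
  qed
qed

text \<open>The form in which \<open>\<Theta>\<close> and the inverse of \<open>K\<close> are used
  alike: the lower bound serves coercivity, the bound on the entries serves boundedness of the
  forms.\<close>

definition tensor_field :: "(real^'n::finite) set \<Rightarrow> (real^'n \<Rightarrow> real^'n^'n) \<Rightarrow> real \<Rightarrow> real \<Rightarrow> bool" where
  "tensor_field \<Omega> A a B \<longleftrightarrow> (\<forall>i j. (\<lambda>x. A x $ i $ j) \<in> borel_measurable (lebesgue_on \<Omega>)) \<and>
     (\<forall>x\<in>\<Omega>. transpose (A x) = A x \<and> (\<forall>\<xi>. a * (norm \<xi>)\<^sup>2 \<le> \<xi> \<bullet> (A x *v \<xi>)) \<and> (\<forall>i j. \<bar>A x $ i $ j\<bar> \<le> B))"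

lemma tensor_field_sym:
  assumes "sym_tensor_field \<Omega> K a B" "a > 0" "B > 0"
  shows "tensor_field \<Omega> K a B"
  unfolding tensor_field_def
proof (intro conjI allI ballI)
  fix x i j assume "x \<in> \<Omega>"
  then have s: "transpose (K x) = K x" "\<And>\<xi>. a * (norm \<xi>)\<^sup>2 \<le> \<xi> \<bullet> (K x *v \<xi>)" "\<And>\<xi>. \<xi> \<bullet> (K x *v \<xi>) \<le> B * (norm \<xi>)\<^sup>2"
    using assms(1) unfolding sym_tensor_field_def by blast+
  have "0 \<le> \<xi> \<bullet> (K x *v \<xi>)" for \<xi> using s(2)[of \<xi>] assms(2) by (meson mult_nonneg_nonneg less_imp_le order_trans zero_le_power2)
  then show "\<bar>K x $ i $ j\<bar> \<le> B" using sym_matrix_entry_bound[OF s(1) _ s(3)] assms(3) by simp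
qed (use assms(1) in \<open>auto simp: sym_tensor_field_def\<close>)

text \<open>The delicate point is measurability, since \<open>matrix_inv\<close> is defined by
  choice; the Cramer rule writes its entries as quotients of determinants, which are polynomials in
  the measurable entries of \<open>K\<close>.\<close>

lemma tensor_field_inv:
  assumes K: "sym_tensor_field \<Omega> K a B" "a > 0" "B > 0" and meas: "\<Omega> \<in> sets lebesgue"
  shows "tensor_field \<Omega> (\<lambda>x. matrix_inv (K x)) (1 / B) (1 / a)"
proof -
  have m: "(\<lambda>x. K x $ i $ j) \<in> borel_measurable (lebesgue_on \<Omega>)" for i j using K(1) unfolding sym_tensor_field_def by blast
  have s: "transpose (K x) = K x" "\<And>\<xi>. a * (norm \<xi>)\<^sup>2 \<le> \<xi> \<bullet> (K x *v \<xi>)" "\<And>\<xi>. \<xi> \<bullet> (K x *v \<xi>) \<le> B * (norm \<xi>)\<^sup>2" if "x \<in> \<Omega>" for x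
    using K(1) that unfolding sym_tensor_field_def by blast+
  note mi = matrix_inv_bounds[OF s K(2,3)]
  show ?thesis
    unfolding tensor_field_def
  proof (intro conjI allI ballI)
    fix i j
    \<comment> \<open>The matrix \<open>K x\<close> with column \<open>i\<close> replaced by the
      j-th unit vector, the numerator in the Cramer rule.\<close>
    define C where "C x = (\<chi> p q. if q = i then (axis j 1 :: real^'a) $ p else K x $ p $ q)" for x
    have "matrix_inv (K x) $ i $ j = det (C x) / det (K x)" if x: "x \<in> \<Omega>" for x
    proof -
      have "matrix_inv (K x) *v axis j 1 = (\<chi> k. det (\<chi> p q. if q = k then (axis j 1 :: real^'a) $ p else K x $ p $ q) / det (K x))"
        using cramer[OF mi(5)[OF x x x], of "matrix_inv (K x) *v axis j 1" "axis j 1"] mi(1)[OF x x x] by simp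
      then have "(matrix_inv (K x) *v axis j 1) $ i = det (C x) / det (K x)" unfolding C_def by simp
      then show ?thesis by (simp add: matrix_vector_mult_basis column_def)
    qed
    moreover have "(\<lambda>x. det (C x) / det (K x)) \<in> borel_measurable (lebesgue_on \<Omega>)"
    proof -
      have "(\<lambda>x. C x $ p $ q) \<in> borel_measurable (lebesgue_on \<Omega>)" for p q unfolding C_def using m by (cases "q = i") simp_all
      then show ?thesis unfolding det_def using m
        by (intro borel_measurable_divide borel_measurable_sum borel_measurable_times borel_measurable_prod borel_measurable_const) auto
    qed
    ultimately show "(\<lambda>x. matrix_inv (K x) $ i $ j) \<in> borel_measurable (lebesgue_on \<Omega>)"
      by (subst measurable_cong[where g = "\<lambda>x. det (C x) / det (K x)"]) (auto simp: space_restrict_space)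
  next
    fix x assume x: "x \<in> \<Omega>"
    show t: "transpose (matrix_inv (K x)) = matrix_inv (K x)" by (rule mi(2)[OF x x x])
    show l: "1 / B * (norm \<xi>)\<^sup>2 \<le> \<xi> \<bullet> (matrix_inv (K x) *v \<xi>)" for \<xi> by (rule mi(3)[OF x x x])
    have "0 \<le> \<xi> \<bullet> (matrix_inv (K x) *v \<xi>)" for \<xi>
      using l[of \<xi>] K(3) by (meson divide_nonneg_pos mult_nonneg_nonneg less_imp_le order_trans zero_le_power2 zero_le_one)
    then show "\<bar>matrix_inv (K x) $ i $ j\<bar> \<le> 1 / a" for i j
      using sym_matrix_entry_bound[OF t _ mi(4)[OF x x x]] K(2) by simp
  qed
qed

text \<open>That the value is real matters later: after multiplication by a complex coefficient its
  real and imaginary parts are determined by the coefficient alone.\<close>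

lemma tensor_form:
  fixes w :: "real^'n::finite \<Rightarrow> complex^'n"
  assumes A: "tensor_field \<Omega> A a B" and w: "\<And>i. L2 \<Omega> (\<lambda>x. w x $ i)"
  shows "\<exists>X\<ge>a * (\<Sum>i\<in>UNIV. (norm_L2 \<Omega> (\<lambda>x. w x $ i))\<^sup>2). vinner_L2 \<Omega> (\<lambda>x. rmat_cvec (A x) (w x)) w = of_real X"
proof -
  define f where "f x = (\<chi> i. Re (w x $ i)) \<bullet> (A x *v (\<chi> i. Re (w x $ i))) + (\<chi> i. Im (w x $ i)) \<bullet> (A x *v (\<chi> i. Im (w x $ i)))" for x
  have pt: "(\<Sum>i\<in>UNIV. rmat_cvec (A x) (w x) $ i * cnj (w x $ i)) = of_real (f x)" if "x \<in> \<Omega>" for x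
    unfolding f_def by (rule rmat_cvec_inner) (use A that in \<open>simp add: tensor_field_def\<close>)
  have L: "L2 \<Omega> (\<lambda>x. rmat_cvec (A x) (w x) $ i)" for i
  proof -
    have "L2 \<Omega> (\<lambda>x. \<Sum>j\<in>UNIV. of_real (A x $ i $ j) * w x $ j)"
    proof (intro L2_sum L2_bounded_mult[OF w])
      show "(\<lambda>x. complex_of_real (A x $ i $ j)) \<in> borel_measurable (lebesgue_on \<Omega>)" for j
      proof -
        have "(\<lambda>x. A x $ i $ j) \<in> borel_measurable (lebesgue_on \<Omega>)" using A unfolding tensor_field_def by blast
        then show ?thesis by measurable
      qed
      show "cmod (of_real (A x $ i $ j)) \<le> B" if "x \<in> \<Omega>" for x j using A that unfolding tensor_field_def by simp
    qed
    then show ?thesis unfolding rmat_cvec_def by simp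
  qed
  have i: "integrable (lebesgue_on \<Omega>) (\<lambda>x. \<Sum>i\<in>UNIV. rmat_cvec (A x) (w x) $ i * cnj (w x $ i))"
    by (intro Bochner_Integration.integrable_sum integrable_inner_L2 L w)
  have eq: "vinner_L2 \<Omega> (\<lambda>x. rmat_cvec (A x) (w x)) w = (LINT x|lebesgue_on \<Omega>. complex_of_real (f x))"
    unfolding vinner_L2_def by (rule Bochner_Integration.integral_cong) (auto simp: pt space_restrict_space)
  have "integrable (lebesgue_on \<Omega>) (\<lambda>x. complex_of_real (f x))"
    using i by (subst Bochner_Integration.integrable_cong[where g = "\<lambda>x. \<Sum>i\<in>UNIV. rmat_cvec (A x) (w x) $ i * cnj (w x $ i)"]) (auto simp: pt space_restrict_space)
  from integrable_Re[OF this] have fi: "integrable (lebesgue_on \<Omega>) f" by simp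
  have wi: "integrable (lebesgue_on \<Omega>) (\<lambda>x. (cmod (w x $ i))\<^sup>2)" for i by (rule L2D(2)[OF w])
  have "a * (\<Sum>i\<in>UNIV. (norm_L2 \<Omega> (\<lambda>x. w x $ i))\<^sup>2) = (LINT x|lebesgue_on \<Omega>. a * (\<Sum>i\<in>UNIV. (cmod (w x $ i))\<^sup>2))"
    unfolding norm_L2_sq using wi by simp
  also have "\<dots> \<le> (LINT x|lebesgue_on \<Omega>. f x)"
  proof (rule integral_mono[OF _ fi])
    show "integrable (lebesgue_on \<Omega>) (\<lambda>x. a * (\<Sum>i\<in>UNIV. (cmod (w x $ i))\<^sup>2))" using wi by simp
    fix x assume "x \<in> space (lebesgue_on \<Omega>)"
    then have "a * (norm \<xi>)\<^sup>2 \<le> \<xi> \<bullet> (A x *v \<xi>)" for \<xi> using A unfolding tensor_field_def by (simp add: space_restrict_space)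
    from this[of "\<chi> i. Re (w x $ i)"] this[of "\<chi> i. Im (w x $ i)"]
    show "a * (\<Sum>i\<in>UNIV. (cmod (w x $ i))\<^sup>2) \<le> f x"
      unfolding f_def by (simp add: cmod_power2 sum.distrib norm_vec_def L2_set_def sum_nonneg distrib_left)
  qed
  finally have "a * (\<Sum>i\<in>UNIV. (norm_L2 \<Omega> (\<lambda>x. w x $ i))\<^sup>2) \<le> (LINT x|lebesgue_on \<Omega>. f x)" .
  then show ?thesis using eq by (intro exI[of _ "LINT x|lebesgue_on \<Omega>. f x"]) simp
qed

text \<open>The constants come from \<open>1 + \<surd>2 \<le> 5/2\<close> and from Young's inequality for each coupling term;
  a fixed fraction of every diagonal term is kept.\<close>

lemma coercive_quadratic_form:
  fixes \<gamma> \<rho> D c0 a0 b0 \<alpha> \<beta> lam \<theta> k :: real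
  assumes pos: "\<gamma> > 0" "\<rho> > 0" "D > 0" "c0 > 0" "lam > 0" "\<theta> > 0" "\<alpha> > 0" "\<beta> > 0" "b0 > 0" "k > 0"
    and hk: "2 * k\<^sup>2 < \<gamma> * \<rho> * D" and ha: "a0 > 2 * b0\<^sup>2 / c0"
    and h1: "16 * \<alpha>\<^sup>2 < \<gamma> * lam * c0" and h2: "8 * \<beta>\<^sup>2 < \<gamma> * lam * (a0 - 2 * b0\<^sup>2 / c0)"
  obtains \<delta> c where "\<delta> > 0" "c > 0"
    "\<And>E N W P T G d x. 0 \<le> x \<Longrightarrow> 0 \<le> E \<Longrightarrow> 0 \<le> N \<Longrightarrow> 0 \<le> W \<Longrightarrow> 0 \<le> P \<Longrightarrow> 0 \<le> T \<Longrightarrow> 0 \<le> d \<Longrightarrow> lam * x\<^sup>2 \<le> E \<Longrightarrow>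
      c * (E + N\<^sup>2 + W\<^sup>2 + P\<^sup>2 + T\<^sup>2 + G\<^sup>2 + d\<^sup>2) \<le>
      \<gamma> * (E + \<rho> * N\<^sup>2) + D * W\<^sup>2 + c0 * P\<^sup>2 + a0 * T\<^sup>2 + \<theta> * G\<^sup>2 + \<delta> * d\<^sup>2
      - 5/2 * k * W * N - 5/2 * \<alpha> * P * x - 2 * b0 * T * P - 5/2 * \<beta> * T * x - \<delta> * d * (\<alpha> * x + c0 * P + b0 * T)"
proof -
  \<comment> \<open>What remains of the temperature term after half of the pressure term has
    absorbed the coupling \<open>2 b0 T P\<close>.\<close>
  define a' where "a' = a0 - 2 * b0\<^sup>2 / c0"
  have a': "a' > 0" unfolding a'_def using ha by simp
  \<comment> \<open>One bound for each summand in the term multiplied by \<open>\<delta> d\<close>: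
    they limit its cost to a quarter of \<open>\<gamma> E\<close>, to \<open>c0 / 40\<close> of the
    pressure and to \<open>a' / 20\<close> of the temperature.\<close>
  define \<delta> where "\<delta> = min (\<gamma> * lam / (6 * \<alpha>\<^sup>2)) (min (1 / (60 * c0)) (a' / (30 * b0\<^sup>2)))"
  have d0: "\<delta> > 0" unfolding \<delta>_def using pos a' by simp
  have dl: "\<delta> * (6 * \<alpha>\<^sup>2) \<le> \<gamma> * lam" "\<delta> * (60 * c0) \<le> 1" "\<delta> * (30 * b0\<^sup>2) \<le> a'"
  proof -
    have "\<delta> \<le> \<gamma> * lam / (6 * \<alpha>\<^sup>2)" "\<delta> \<le> 1 / (60 * c0)" "\<delta> \<le> a' / (30 * b0\<^sup>2)" unfolding \<delta>_def by auto
    then show "\<delta> * (6 * \<alpha>\<^sup>2) \<le> \<gamma> * lam" "\<delta> * (60 * c0) \<le> 1" "\<delta> * (30 * b0\<^sup>2) \<le> a'" using pos by (simp_all add: field_simps)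
  qed
  \<comment> \<open>The unspent shares. Energy: three quarters are used. Mass and flux: nine tenths.
    Pressure: \<open>1/2 + 9/20 + 1/40\<close>. Reduced temperature: \<open>9/10 + 1/20\<close>.
    Divergence: one half.\<close>
  define c where "c = Min {\<gamma> / 4, \<gamma> * \<rho> / 10, D / 10, c0 / 40, a' / 20, \<theta>, \<delta> / 2}"
  have c: "c > 0" unfolding c_def using pos a' d0 by simp
  have cl: "c \<le> \<gamma> / 4" "c \<le> \<gamma> * \<rho> / 10" "c \<le> D / 10" "c \<le> c0 / 40" "c \<le> a' / 20" "c \<le> \<theta>" "c \<le> \<delta> / 2"
    unfolding c_def by (rule Min_le; simp)+
  have main: "c * (E + N\<^sup>2 + W\<^sup>2 + P\<^sup>2 + T\<^sup>2 + G\<^sup>2 + d\<^sup>2) \<le>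
      \<gamma> * (E + \<rho> * N\<^sup>2) + D * W\<^sup>2 + c0 * P\<^sup>2 + a0 * T\<^sup>2 + \<theta> * G\<^sup>2 + \<delta> * d\<^sup>2
      - 5/2 * k * W * N - 5/2 * \<alpha> * P * x - 2 * b0 * T * P - 5/2 * \<beta> * T * x - \<delta> * d * (\<alpha> * x + c0 * P + b0 * T)"
    if nn: "0 \<le> x" "0 \<le> E" "0 \<le> N" "0 \<le> W" "0 \<le> P" "0 \<le> T" "0 \<le> d" and xE: "lam * x\<^sup>2 \<le> E" for E N W P T G d x :: real
  proof -
    have x0: "\<gamma> * (lam * x\<^sup>2) \<le> \<gamma> * E" using xE pos(1) by (intro mult_left_mono) auto
    \<comment> \<open>Complete the square with leading coefficient \<open>9/10\<close>; the slack is
      \<open>(5/2)^2 = 6.25 < 6.48 = 4 (9/10)^2 2\<close>, the factor 2 coming from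
      \<open>hk\<close>.\<close>
    have s1: "5/2 * k * W * N \<le> 9/10 * (D * W\<^sup>2 + \<gamma> * \<rho> * N\<^sup>2)"
    proof -
      have "0 \<le> (9/10) * (D * W - (25/18) * k * N)\<^sup>2 + (9/5 - 125/72) * k\<^sup>2 * N\<^sup>2" by simp
      also have "\<dots> = 9/10 * (D * W)\<^sup>2 - 5/2 * k * (D * W) * N + 9/5 * k\<^sup>2 * N\<^sup>2" by (simp add: power2_eq_square algebra_simps)
      also have "\<dots> \<le> 9/10 * (D * W)\<^sup>2 - 5/2 * k * (D * W) * N + 9/10 * (\<gamma> * \<rho> * D) * N\<^sup>2"
        using mult_right_mono[OF less_imp_le[OF hk], of "N\<^sup>2"] by (simp add: algebra_simps)
      also have "\<dots> = D * (9/10 * (D * W\<^sup>2 + \<gamma> * \<rho> * N\<^sup>2) - 5/2 * k * W * N)" by (simp add: power2_eq_square algebra_simps)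
      finally show ?thesis using pos(3) by (simp add: zero_le_mult_iff)
    qed
    have s2: "2 * b0 * T * P \<le> c0 / 2 * P\<^sup>2 + 2 * b0\<^sup>2 / c0 * T\<^sup>2"
    proof -
      have "0 \<le> (c0 * P - 2 * b0 * T)\<^sup>2 / (2 * c0)" using pos by simp
      also have "\<dots> = c0 / 2 * P\<^sup>2 + 2 * b0\<^sup>2 / c0 * T\<^sup>2 - 2 * b0 * T * P" using pos(4) by (simp add: power2_eq_square field_simps)
      finally show ?thesis by simp
    qed
    \<comment> \<open>With coefficient \<open>9/20\<close> on the pressure, completing the square
      costs \<open>125/36\<close>, which is below the value \<open>4\<close> that \<open>h1\<close>
      provides.\<close>
    have s3: "5/2 * \<alpha> * P * x \<le> 9/20 * c0 * P\<^sup>2 + \<gamma> * E / 4"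
    proof -
      have "0 \<le> (9/20) * (c0 * P - (25/9) * \<alpha> * x)\<^sup>2" by simp
      also have "\<dots> = 9/20 * (c0 * P)\<^sup>2 - 5/2 * \<alpha> * (c0 * P) * x + 125/36 * \<alpha>\<^sup>2 * x\<^sup>2" by (simp add: power2_eq_square algebra_simps)
      also have "\<dots> \<le> 9/20 * (c0 * P)\<^sup>2 - 5/2 * \<alpha> * (c0 * P) * x + (\<gamma> * lam * c0) / 4 * x\<^sup>2"
      proof -
        have "125/36 * \<alpha>\<^sup>2 \<le> \<gamma> * lam * c0 / 4" using h1 zero_le_power2[of \<alpha>] by linarith
        from mult_right_mono[OF this, of "x\<^sup>2"] show ?thesis by (simp add: algebra_simps)
      qed
      also have "\<dots> = c0 * (9/20 * c0 * P\<^sup>2 - 5/2 * \<alpha> * P * x + \<gamma> * (lam * x\<^sup>2) / 4)" by (simp add: power2_eq_square algebra_simps)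
      finally have "0 \<le> 9/20 * c0 * P\<^sup>2 - 5/2 * \<alpha> * P * x + \<gamma> * (lam * x\<^sup>2) / 4" using pos(4) by (simp add: zero_le_mult_iff)
      then show ?thesis using x0 by linarith
    qed
    \<comment> \<open>Completing the square costs \<open>125/72\<close>, while \<open>h2\<close>
      provides 2.\<close>
    have s4: "5/2 * \<beta> * T * x \<le> 9/10 * a' * T\<^sup>2 + \<gamma> * E / 4"
    proof -
      have "0 \<le> (9/10) * (a' * T - (25/18) * \<beta> * x)\<^sup>2" by simp
      also have "\<dots> = 9/10 * (a' * T)\<^sup>2 - 5/2 * \<beta> * (a' * T) * x + 125/72 * \<beta>\<^sup>2 * x\<^sup>2" by (simp add: power2_eq_square algebra_simps)
      also have "\<dots> \<le> 9/10 * (a' * T)\<^sup>2 - 5/2 * \<beta> * (a' * T) * x + (\<gamma> * lam * a') / 4 * x\<^sup>2"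
      proof -
        have "125/72 * \<beta>\<^sup>2 \<le> \<gamma> * lam * a' / 4" using h2 zero_le_power2[of \<beta>] unfolding a'_def[symmetric] by linarith
        from mult_right_mono[OF this, of "x\<^sup>2"] show ?thesis by (simp add: algebra_simps)
      qed
      also have "\<dots> = a' * (9/10 * a' * T\<^sup>2 - 5/2 * \<beta> * T * x + \<gamma> * (lam * x\<^sup>2) / 4)" by (simp add: power2_eq_square algebra_simps)
      finally have "0 \<le> 9/10 * a' * T\<^sup>2 - 5/2 * \<beta> * T * x + \<gamma> * (lam * x\<^sup>2) / 4" using a' by (simp add: zero_le_mult_iff)
      then show ?thesis using x0 by linarith
    qed
    have s5: "\<delta> * d * (\<alpha> * x + c0 * P + b0 * T) \<le> \<delta> / 2 * d\<^sup>2 + \<gamma> * E / 4 + c0 / 40 * P\<^sup>2 + a' / 20 * T\<^sup>2"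
    proof -
      define Y where "Y = \<alpha> * x + c0 * P + b0 * T"
      have "0 \<le> (d - Y)\<^sup>2" by simp
      then have 1: "d * Y \<le> d\<^sup>2 / 2 + Y\<^sup>2 / 2" by (simp add: power2_diff)
      have "0 \<le> (\<alpha> * x - c0 * P)\<^sup>2 + (\<alpha> * x - b0 * T)\<^sup>2 + (c0 * P - b0 * T)\<^sup>2" by simp
      then have 2: "Y\<^sup>2 \<le> 3 * (\<alpha>\<^sup>2 * x\<^sup>2 + c0\<^sup>2 * P\<^sup>2 + b0\<^sup>2 * T\<^sup>2)" unfolding Y_def by (simp add: power2_eq_square algebra_simps)
      have "d * Y \<le> d\<^sup>2 / 2 + 3 * (\<alpha>\<^sup>2 * x\<^sup>2 + c0\<^sup>2 * P\<^sup>2 + b0\<^sup>2 * T\<^sup>2) / 2" using 1 2 by linarith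
      then have "\<delta> * (d * Y) \<le> \<delta> * (d\<^sup>2 / 2 + 3 * (\<alpha>\<^sup>2 * x\<^sup>2 + c0\<^sup>2 * P\<^sup>2 + b0\<^sup>2 * T\<^sup>2) / 2)"
        using d0 by (intro mult_left_mono) auto
      also have "\<dots> = \<delta> / 2 * d\<^sup>2 + (\<delta> * (6 * \<alpha>\<^sup>2)) * x\<^sup>2 / 4 + (\<delta> * (60 * c0)) * (c0 / 40 * P\<^sup>2) + (\<delta> * (30 * b0\<^sup>2)) / 20 * T\<^sup>2"
        by (simp add: power2_eq_square algebra_simps)
      also have "\<dots> \<le> \<delta> / 2 * d\<^sup>2 + (\<gamma> * lam) * x\<^sup>2 / 4 + 1 * (c0 / 40 * P\<^sup>2) + a' / 20 * T\<^sup>2"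
        using pos dl by (intro add_mono mult_right_mono divide_right_mono) auto
      also have "\<dots> \<le> \<delta> / 2 * d\<^sup>2 + \<gamma> * E / 4 + c0 / 40 * P\<^sup>2 + a' / 20 * T\<^sup>2" using x0 by linarith
      finally show ?thesis unfolding Y_def by (simp add: mult.assoc)
    qed
    have f: "c * E \<le> \<gamma> / 4 * E" "c * N\<^sup>2 \<le> \<gamma> * \<rho> / 10 * N\<^sup>2" "c * W\<^sup>2 \<le> D / 10 * W\<^sup>2" "c * P\<^sup>2 \<le> c0 / 40 * P\<^sup>2" "c * T\<^sup>2 \<le> a' / 20 * T\<^sup>2"
      "c * G\<^sup>2 \<le> \<theta> * G\<^sup>2" "c * d\<^sup>2 \<le> \<delta> / 2 * d\<^sup>2"
      using cl nn by (intro mult_right_mono; simp)+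
    have a0T: "a0 * T\<^sup>2 = a' * T\<^sup>2 + 2 * b0\<^sup>2 / c0 * T\<^sup>2" unfolding a'_def by (simp add: algebra_simps)
    have lhs: "c * (E + N\<^sup>2 + W\<^sup>2 + P\<^sup>2 + T\<^sup>2 + G\<^sup>2 + d\<^sup>2) = c * E + c * N\<^sup>2 + c * W\<^sup>2 + c * P\<^sup>2 + c * T\<^sup>2 + c * G\<^sup>2 + c * d\<^sup>2"
      by (simp add: algebra_simps)
    have r0: "\<gamma> * (E + \<rho> * N\<^sup>2) = \<gamma> * E + \<gamma> * \<rho> * N\<^sup>2" by (simp add: algebra_simps)
    \<comment> \<open>The bookkeeping of shares with every product replaced by a variable, so that
      it is a small problem of linear arithmetic.\<close>
    have combine: "l1 + l2 + l3 + l4 + l5 + l6 + l7 \<le> (A1 + A2) + A3 + A4 + (A5 + A8) + A6 + A7 - B1 - B2 - B3 - B4 - B5"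
      if "B1 \<le> 9/10 * (A3 + A2)" "B3 \<le> A4 / 2 + A8" "B2 \<le> 9/20 * A4 + A1 / 4" "B4 \<le> 9/10 * A5 + A1 / 4"
        "B5 \<le> A7 / 2 + A1 / 4 + A4 / 40 + A5 / 20" "l1 \<le> A1 / 4" "l2 \<le> A2 / 10" "l3 \<le> A3 / 10" "l4 \<le> A4 / 40"
        "l5 \<le> A5 / 20" "l6 \<le> A6" "l7 \<le> A7 / 2"
      for A1 A2 A3 A4 A5 A6 A7 A8 B1 B2 B3 B4 B5 l1 l2 l3 l4 l5 l6 l7 :: real
    proof -
      have "B1 + l2 + l3 \<le> A2 + A3" using that(1,7,8) by simp
      moreover have "B2 + B3 + B4 + B5 + l1 + l4 + l5 + l7 \<le> A1 + A4 + A5 + A7 + A8"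
      proof -
        have "B2 + B4 + l1 \<le> 9/20 * A4 + 9/10 * A5 + 3/4 * A1" using that(3,4,6) by simp
        moreover have "B3 + B5 + l4 + l5 + l7 \<le> 11/20 * A4 + A8 + A7 + A1 / 4 + A5 / 10"
          using that(2,5,9,10,12) by simp
        ultimately show ?thesis by simp
      qed
      ultimately show ?thesis using that(11) by simp
    qed
    show ?thesis unfolding lhs a0T r0
      by (rule combine) (use s1 s2 s3 s4 s5 f in \<open>simp_all add: mult.assoc\<close>)
  qed
  show ?thesis by (rule that[OF d0 c main])
qed

subsection \<open>The elasticity form\<close>

lemma add_U_eq: "add_U U V = U + V"
  unfolding add_U_def by (auto simp: plus_fun_def split: prod.split)

lemma scale_U_components:
  "fst (scale_U c U) = (\<lambda>x. c *s fst U x)" "fst (snd (scale_U c U)) = (\<lambda>x. c *s fst (snd U) x)"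
  "fst (snd (snd (scale_U c U))) = (\<lambda>x. c * fst (snd (snd U)) x)" "snd (snd (snd (scale_U c U))) = (\<lambda>x. c * snd (snd (snd U)) x)"
  by (simp_all add: scale_U_def split: prod.split)

interpretation uf: complex_vector_space "scale_U :: complex \<Rightarrow> 'n::finite Uelt \<Rightarrow> 'n Uelt"
proof unfold_locales
  fix a b :: complex and x y :: "'n Uelt"
  obtain u w p T where x: "x = (u, w, p, T)" by (rule prod_cases4)
  obtain u' w' p' T' where y: "y = (u', w', p', T')" by (rule prod_cases4)
  show "scale_U a (x + y) = scale_U a x + scale_U a y"
    unfolding x y scale_U_def by (simp only: prod.case add_Pair distrib_left vector_add_ldistrib plus_fun_def)
  show "scale_U (a + b) x = scale_U a x + scale_U b x"
    unfolding x scale_U_def by (simp only: prod.case add_Pair distrib_right vector_sadd_rdistrib plus_fun_def)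
  show "scale_U a (scale_U b x) = scale_U (a * b) x"
    unfolding x scale_U_def by (simp only: prod.case mult.assoc vector_smult_assoc)
  show "scale_U 1 x = x"
    unfolding x scale_U_def by (simp only: prod.case mult_1_left vector_smult_lid)
qed

lemma diff_U_eq: "diff_U U V = U - V"
  unfolding diff_U_def add_U_eq using uf.diff_eq_scale[of U V] by simp

lemma sum_UNIV_sum: "(\<Sum>c\<in>UNIV. h c) = (\<Sum>a\<in>UNIV. h (Inl a)) + (\<Sum>b\<in>UNIV. h (Inr b))"
  for h :: "'i::finite + 'j::finite \<Rightarrow> 'b::comm_monoid_add"
  unfolding UNIV_Plus_UNIV[symmetric] by (subst sum.Plus) (auto simp: o_def)

context complex_vector_space
begin

lemma sesq_cong:
  assumes "sesq S f" "subspace S" "\<And>x y. x \<in> S \<Longrightarrow> y \<in> S \<Longrightarrow> g x y = f x y"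
  shows "sesq S g"
  using assms unfolding sesq_def by (simp add: subspace_add subspace_scale)

definition bform :: "'a set \<Rightarrow> ('a \<Rightarrow> 'a \<Rightarrow> complex) \<Rightarrow> ('a \<Rightarrow> 'a \<Rightarrow> complex) \<Rightarrow> bool" where
  "bform S f B \<longleftrightarrow> sesq S B \<and> fbounded S f B"

lemma bform_add: "bform S f B \<Longrightarrow> bform S f C \<Longrightarrow> bform S f (\<lambda>x y. B x y + C x y)"
  unfolding bform_def using sesq_add fbounded_add by blast

lemma bform_cmult: "bform S f B \<Longrightarrow> bform S f (\<lambda>x y. c * B x y)"
  unfolding bform_def using sesq_cmult fbounded_cmult by blast

lemma bform_sum: "(\<And>i. i \<in> I \<Longrightarrow> bform S f (B i)) \<Longrightarrow> bform S f (\<lambda>x y. \<Sum>i\<in>I. B i x y)"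
  unfolding bform_def using sesq_sum[of I S B] fbounded_sum[of I S f B] by blast

definition blin :: "(real^'n::finite) set \<Rightarrow> 'a set \<Rightarrow> ('a \<Rightarrow> 'a \<Rightarrow> complex) \<Rightarrow> ('a \<Rightarrow> real^'n \<Rightarrow> complex) \<Rightarrow> bool" where
  "blin \<Omega> S f L \<longleftrightarrow> aelin \<Omega> S L \<and> lbounded \<Omega> S f L"

lemma bform_inner:
  assumes "blin \<Omega> S f L" "blin \<Omega> S f L'" "subspace S"
  shows "bform S f (\<lambda>x y. inner_L2 \<Omega> (L x) (L' y))"
  using assms sesq_inner_L2 fbounded_inner unfolding bform_def blin_def by blast

lemma blin_add: "blin \<Omega> S f L \<Longrightarrow> blin \<Omega> S f L' \<Longrightarrow> blin \<Omega> S f (\<lambda>u x. L u x + L' u x)"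
  unfolding blin_def using aelin_add lbounded_add by blast

lemma blin_cmult: "blin \<Omega> S f L \<Longrightarrow> blin \<Omega> S f (\<lambda>u x. c * L u x)"
  unfolding blin_def using aelin_cmult lbounded_cmult by blast

lemma blin_sum: "(\<And>i. i \<in> I \<Longrightarrow> blin \<Omega> S f (L i)) \<Longrightarrow> blin \<Omega> S f (\<lambda>u x. \<Sum>i\<in>I. L i u x)"
  unfolding blin_def using aelin_sum[of I \<Omega> S L] lbounded_sum[of I \<Omega> S L f] by blast

lemma blin_bounded_mult:
  assumes "blin \<Omega> S f L" "k \<in> borel_measurable (lebesgue_on \<Omega>)" "\<And>x. x \<in> \<Omega> \<Longrightarrow> cmod (k x) \<le> B" "0 \<le> B"
  shows "blin \<Omega> S f (\<lambda>u x. k x * L u x)"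
  unfolding blin_def
  using aelin_bounded_mult[OF _ assms(2,3), of S L] lbounded_bounded_mult[OF _ assms(2-4), of S L f] assms(1) unfolding blin_def by simp

lemma blin_coord: "aelin \<Omega> S (L a) \<Longrightarrow> finite A \<Longrightarrow> a \<in> A \<Longrightarrow> blin \<Omega> S (coord_ip \<Omega> A L) (L a)"
  unfolding blin_def by (intro conjI lbounded_coord)

end

lemma vinner_L2_sum:
  assumes "\<And>i. L2 \<Omega> (\<lambda>x. u x $ i)" "\<And>i. L2 \<Omega> (\<lambda>x. v x $ i)"
  shows "vinner_L2 \<Omega> u v = (\<Sum>i\<in>UNIV. inner_L2 \<Omega> (\<lambda>x. u x $ i) (\<lambda>x. v x $ i))"
  unfolding vinner_L2_def inner_L2_def
  by (rule Bochner_Integration.integral_sum) (intro integrable_inner_L2 assms)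

lemma inner_L2_cmult_right: "L2 \<Omega> f \<Longrightarrow> L2 \<Omega> g \<Longrightarrow> inner_L2 \<Omega> f (\<lambda>x. c * g x) = cnj c * inner_L2 \<Omega> f g"
  using fn.sesqD(4)[OF fn.psdD(1)[OF psd_inner_L2], of f \<Omega> g c] by simp

lemma inner_L2_add_right: "L2 \<Omega> f \<Longrightarrow> L2 \<Omega> g \<Longrightarrow> L2 \<Omega> h \<Longrightarrow> inner_L2 \<Omega> f (\<lambda>x. g x + h x) = inner_L2 \<Omega> f g + inner_L2 \<Omega> f h"
  using fn.sesqD(2)[OF fn.psdD(1)[OF psd_inner_L2], of g \<Omega> h f] by (simp add: plus_fun_def)

context domain
begin

lemma L2_eps: "Vsp \<Omega> u \<Longrightarrow> L2 \<Omega> (eps \<Omega> u i j)"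
  using L2_cmult[OF L2_add[OF L2_wpart L2_wpart], of u u "1/2" i j j i] by (simp add: eps_def[abs_def])

lemma L2_divV: "Vsp \<Omega> u \<Longrightarrow> L2 \<Omega> (divV \<Omega> u)"
  unfolding divV_def[abs_def] by (intro L2_sum L2_wpart)

lemma inner_eps_sum:
  assumes "Vsp \<Omega> u" "Vsp \<Omega> v"
  shows "inner_eps \<Omega> u v = (\<Sum>i\<in>UNIV. \<Sum>j\<in>UNIV. inner_L2 \<Omega> (eps \<Omega> u i j) (eps \<Omega> v i j))"
proof -
  have i: "integrable (lebesgue_on \<Omega>) (\<lambda>x. eps \<Omega> u i j x * cnj (eps \<Omega> v i j x))" for i j
    by (intro integrable_inner_L2 L2_eps assms)
  show ?thesis unfolding inner_eps_def inner_L2_def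
    using i by (subst Bochner_Integration.integral_sum) (auto intro!: sum.cong Bochner_Integration.integral_sum Bochner_Integration.integrable_sum)
qed

lemma eps_blin: "vf.blin \<Omega> {u. Vsp \<Omega> u} (vf.coord_ip \<Omega> UNIV LV) (\<lambda>u. eps \<Omega> u i j)"
proof -
  have "vf.blin \<Omega> {u. Vsp \<Omega> u} (vf.coord_ip \<Omega> UNIV LV) (\<lambda>u x. (1/2) * (LV (i, Some j) u x + LV (j, Some i) u x))"
    by (intro vf.blin_cmult vf.blin_add vf.blin_coord LV_aelin) auto
  then show ?thesis by (simp add: eps_def[abs_def] wpart_eq_LV)
qed

lemma divV_blin: "vf.blin \<Omega> {u. Vsp \<Omega> u} (vf.coord_ip \<Omega> UNIV LV) (\<lambda>u. divV \<Omega> u)"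
proof -
  have "vf.blin \<Omega> {u. Vsp \<Omega> u} (vf.coord_ip \<Omega> UNIV LV) (\<lambda>u x. \<Sum>i\<in>UNIV. LV (i, Some i) u x)"
    by (intro vf.blin_sum vf.blin_coord LV_aelin) auto
  then show ?thesis by (simp add: divV_def[abs_def] wpart_eq_LV)
qed

lemma comp_blin: "vf.blin \<Omega> {u. Vsp \<Omega> u} (vf.coord_ip \<Omega> UNIV LV) (\<lambda>u x. u x $ i)"
  unfolding comp_eq_LV by (intro vf.blin_coord LV_aelin) auto

text \<open>Elastic energy, paired with the mass form \<open>mf\<close>: on the displacement space
  \<open>form_a1\<close> is \<open>ef - \<omega>\<^sup>2 mf\<close>. Sums of scalar inner products
  replace the single integrals so that the closure rules for forms apply; the density
  \<open>\<rho>\<close> sits in \<open>mf\<close>, which makes the abstract eigenvalues the given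
  ones.\<close>

definition ef :: "real \<Rightarrow> real \<Rightarrow> (real^'n \<Rightarrow> complex^'n) \<Rightarrow> (real^'n \<Rightarrow> complex^'n) \<Rightarrow> complex" where
  "ef \<mu> lam u v = of_real (2 * \<mu>) * (\<Sum>i\<in>UNIV. \<Sum>j\<in>UNIV. inner_L2 \<Omega> (eps \<Omega> u i j) (eps \<Omega> v i j)) + of_real lam * inner_L2 \<Omega> (divV \<Omega> u) (divV \<Omega> v)"

definition mf :: "real \<Rightarrow> (real^'n \<Rightarrow> complex^'n) \<Rightarrow> (real^'n \<Rightarrow> complex^'n) \<Rightarrow> complex" where
  "mf \<rho> u v = of_real \<rho> * (\<Sum>i\<in>UNIV. inner_L2 \<Omega> (\<lambda>x. u x $ i) (\<lambda>x. v x $ i))"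

lemma psd_ef: "0 \<le> \<mu> \<Longrightarrow> 0 \<le> lam \<Longrightarrow> vf.psd {u. Vsp \<Omega> u} (ef \<mu> lam)"
  unfolding ef_def[abs_def]
  using eps_blin divV_blin unfolding vf.blin_def
  by (intro vf.psd_add vf.psd_cmult vf.psd_sum vf.psd_inner_aelin vf_subspace_V) auto

lemma psd_mf: "0 \<le> \<rho> \<Longrightarrow> vf.psd {u. Vsp \<Omega> u} (mf \<rho>)"
  unfolding mf_def[abs_def]
  using comp_blin unfolding vf.blin_def
  by (intro vf.psd_cmult vf.psd_sum vf.psd_inner_aelin vf_subspace_V) auto

lemma bform_sumform: "vf.bform {u. Vsp \<Omega> u} (vf.coord_ip \<Omega> UNIV LV) (vf.sumform (ef \<mu> lam) (mf \<rho>))"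
  unfolding ef_def mf_def
  by (intro vf.bform_add vf.bform_cmult vf.bform_sum vf.bform_inner eps_blin divV_blin comp_blin vf_subspace_V)

lemma qn_ef_sq: "Vsp \<Omega> u \<Longrightarrow> 0 \<le> \<mu> \<Longrightarrow> 0 \<le> lam \<Longrightarrow> (vf.qn (ef \<mu> lam) u)\<^sup>2 = 2 * \<mu> * (\<Sum>i\<in>UNIV. \<Sum>j\<in>UNIV. (norm_L2 \<Omega> (eps \<Omega> u i j))\<^sup>2) + lam * (norm_L2 \<Omega> (divV \<Omega> u))\<^sup>2"
  using vf.qn_sq[OF psd_ef, of \<mu> lam u] by (simp add: ef_def inner_L2_self)

lemma qn_mf_sq: "Vsp \<Omega> u \<Longrightarrow> 0 \<le> \<rho> \<Longrightarrow> (vf.qn (mf \<rho>) u)\<^sup>2 = \<rho> * (\<Sum>i\<in>UNIV. (norm_L2 \<Omega> (\<lambda>x. u x $ i))\<^sup>2)"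
  using vf.qn_sq[OF psd_mf, of \<rho> u] by (simp add: mf_def inner_L2_self)

lemma norm_V_sq: "(norm_V \<Omega> u)\<^sup>2 = (\<Sum>i\<in>UNIV. (norm_L2 \<Omega> (\<lambda>x. u x $ i))\<^sup>2) + (\<Sum>i\<in>UNIV. \<Sum>j\<in>UNIV. (norm_L2 \<Omega> (wpart \<Omega> u i j))\<^sup>2)"
proof -
  have "(norm_V \<Omega> u)\<^sup>2 = (\<Sum>i\<in>UNIV. (norm_H1 \<Omega> (\<lambda>x. u x $ i))\<^sup>2)" unfolding norm_V_def by (simp add: sum_nonneg)
  then show ?thesis unfolding norm_H1_sq sum_option by (simp add: LH1_def sum.distrib wpart_def[abs_def])
qed

lemma norm_V_nonneg: "0 \<le> norm_V \<Omega> u"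
  unfolding norm_V_def by (simp add: sum_nonneg)

lemma norm_V_sq_le:
  assumes u: "Vsp \<Omega> u" and p: "\<mu> > 0" "lam \<ge> 0"
  shows "(norm_V \<Omega> u)\<^sup>2 \<le> (\<Sum>i\<in>UNIV. (norm_L2 \<Omega> (\<lambda>x. u x $ i))\<^sup>2) + (vf.qn (ef \<mu> lam) u)\<^sup>2 / \<mu>"
proof -
  have "\<mu> * (\<Sum>i\<in>UNIV. \<Sum>j\<in>UNIV. (norm_L2 \<Omega> (wpart \<Omega> u i j))\<^sup>2) \<le> \<mu> * (2 * (\<Sum>i\<in>UNIV. \<Sum>j\<in>UNIV. (norm_L2 \<Omega> (eps \<Omega> u i j))\<^sup>2))"
    using korn[OF u] p by (intro mult_left_mono) auto
  also have "\<dots> \<le> (vf.qn (ef \<mu> lam) u)\<^sup>2" using qn_ef_sq[OF u, of \<mu> lam] p by simp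
  finally have "(\<Sum>i\<in>UNIV. \<Sum>j\<in>UNIV. (norm_L2 \<Omega> (wpart \<Omega> u i j))\<^sup>2) \<le> (vf.qn (ef \<mu> lam) u)\<^sup>2 / \<mu>" using p by (simp add: field_simps)
  then show ?thesis unfolding norm_V_sq by simp
qed

text \<open>The lower estimate is the Korn inequality together with the mass term, the upper one
  boundedness of the form. It carries completeness and compactness over from \<open>norm_V\<close>
  to the energy seminorm.\<close>

lemma sumform_equivalent:
  assumes p: "\<mu> > 0" "lam > 0" "\<rho> > 0"
  shows "\<exists>C>0. \<forall>u. Vsp \<Omega> u \<longrightarrow> norm_V \<Omega> u \<le> C * vf.qn (vf.sumform (ef \<mu> lam) (mf \<rho>)) u
     \<and> vf.qn (vf.sumform (ef \<mu> lam) (mf \<rho>)) u \<le> C * norm_V \<Omega> u"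
proof -
  let ?f = "vf.sumform (ef \<mu> lam) (mf \<rho>)"
  have e: "vf.psd {u. Vsp \<Omega> u} (ef \<mu> lam)" and m: "vf.psd {u. Vsp \<Omega> u} (mf \<rho>)" using psd_ef psd_mf p by auto
  have f: "vf.psd {u. Vsp \<Omega> u} ?f" by (rule vf.psd_add[OF e m])
  obtain M where M: "M \<ge> 0" "\<And>u v. Vsp \<Omega> u \<Longrightarrow> Vsp \<Omega> v \<Longrightarrow> cmod (?f u v) \<le> M * norm_V \<Omega> u * norm_V \<Omega> v"
    using bform_sumform[of \<mu> lam \<rho>] unfolding vf.bform_def vf.fbounded_def qn_V by auto
  define C where "C = sqrt M + sqrt (1 / \<rho> + 1 / \<mu>)"
  have C: "C > 0" unfolding C_def using M(1) p by (simp add: add_nonneg_pos)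
  have "norm_V \<Omega> u \<le> C * vf.qn ?f u \<and> vf.qn ?f u \<le> C * norm_V \<Omega> u" if u: "Vsp \<Omega> u" for u
  proof
    have uS: "u \<in> {u. Vsp \<Omega> u}" using u by simp
    note q0 = vf.qn_nonneg[OF f uS]
    have sq: "(vf.qn ?f u)\<^sup>2 = (vf.qn (ef \<mu> lam) u)\<^sup>2 + (vf.qn (mf \<rho>) u)\<^sup>2" by (rule vf.qn_sumform_sq[OF e m uS])
    have "(norm_V \<Omega> u)\<^sup>2 \<le> (vf.qn (mf \<rho>) u)\<^sup>2 / \<rho> + (vf.qn (ef \<mu> lam) u)\<^sup>2 / \<mu>"
      using norm_V_sq_le[OF u p(1), of lam] qn_mf_sq[OF u, of \<rho>] p by simp
    also have "\<dots> \<le> (1 / \<rho> + 1 / \<mu>) * (vf.qn ?f u)\<^sup>2" unfolding sq using p by (simp add: distrib_left distrib_right)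
    finally have "norm_V \<Omega> u \<le> sqrt ((1 / \<rho> + 1 / \<mu>) * (vf.qn ?f u)\<^sup>2)" by (rule real_le_rsqrt)
    also have "\<dots> = sqrt (1 / \<rho> + 1 / \<mu>) * vf.qn ?f u" using q0 by (simp add: real_sqrt_mult)
    also have "\<dots> \<le> C * vf.qn ?f u" unfolding C_def using M(1) q0 by (intro mult_right_mono) auto
    finally show "norm_V \<Omega> u \<le> C * vf.qn ?f u" .
    have "(vf.qn ?f u)\<^sup>2 \<le> M * norm_V \<Omega> u * norm_V \<Omega> u"
      using vf.qn_sq[OF f uS] M(2)[OF u u] complex_Re_le_cmod order_trans by metis
    then have "vf.qn ?f u \<le> sqrt (M * (norm_V \<Omega> u)\<^sup>2)" by (intro real_le_rsqrt) (simp add: power2_eq_square mult.assoc)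
    also have "\<dots> = sqrt M * norm_V \<Omega> u" using norm_V_nonneg[of u] by (simp add: real_sqrt_mult)
    also have "\<dots> \<le> C * norm_V \<Omega> u" unfolding C_def using p norm_V_nonneg[of u] by (intro mult_right_mono) auto
    finally show "vf.qn ?f u \<le> C * norm_V \<Omega> u" .
  qed
  then show ?thesis using C by blast
qed

lemma elast_eigenvalues_eq:
  assumes "\<rho> > 0"
  shows "elast_eigenvalues \<Omega> \<mu> lam \<rho> = vf.eigvals {u. Vsp \<Omega> u} (ef \<mu> lam) (mf \<rho>)"
proof -
  have n: "(vf.qn (mf \<rho>) \<psi> \<noteq> 0) = (vnorm_L2 \<Omega> \<psi> \<noteq> 0)" if "Vsp \<Omega> \<psi>" for \<psi>
  proof -
    have "(vf.qn (mf \<rho>) \<psi>)\<^sup>2 = \<rho> * (vnorm_L2 \<Omega> \<psi>)\<^sup>2" using qn_mf_sq[OF that] assms by (simp add: vnorm_L2_def sum_nonneg)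
    from arg_cong[OF this, of "\<lambda>t. t = 0"] show ?thesis using assms by simp
  qed
  have i: "inner_eps \<Omega> \<psi> v = (\<Sum>i\<in>UNIV. \<Sum>j\<in>UNIV. inner_L2 \<Omega> (eps \<Omega> \<psi> i j) (eps \<Omega> v i j))"
    "vinner_L2 \<Omega> \<psi> v = (\<Sum>i\<in>UNIV. inner_L2 \<Omega> (\<lambda>x. \<psi> x $ i) (\<lambda>x. v x $ i))" if "Vsp \<Omega> \<psi>" "Vsp \<Omega> v" for \<psi> v
    using inner_eps_sum[OF that] vinner_L2_sum[OF H1_L2[OF Vsp_H1[OF that(1)]] H1_L2[OF Vsp_H1[OF that(2)]]] by auto
  show ?thesis
  proof (rule set_eqI)
    fix \<kappa>
    have "(\<forall>v. Vsp \<Omega> v \<longrightarrow> of_real (2 * \<mu>) * inner_eps \<Omega> \<psi> v + of_real lam * inner_L2 \<Omega> (divV \<Omega> \<psi>) (divV \<Omega> v) = of_real (\<kappa> * \<rho>) * vinner_L2 \<Omega> \<psi> v)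
      \<longleftrightarrow> (\<forall>v\<in>{u. Vsp \<Omega> u}. ef \<mu> lam \<psi> v = of_real \<kappa> * mf \<rho> \<psi> v)" if "Vsp \<Omega> \<psi>" for \<psi>
      using i[OF that] unfolding ef_def mf_def by (simp add: mult.assoc)
    then show "\<kappa> \<in> elast_eigenvalues \<Omega> \<mu> lam \<rho> \<longleftrightarrow> \<kappa> \<in> vf.eigvals {u. Vsp \<Omega> u} (ef \<mu> lam) (mf \<rho>)"
      unfolding elast_eigenvalues_def vf.eigvals_def using n by auto
  qed
qed

lemma elastic_reflection:
  assumes p: "\<mu> > 0" "lam > 0" "\<rho> > 0" and g: "\<gamma> > 0" "\<sigma> \<ge> 0"
    and gap: "\<And>\<kappa>. \<kappa> \<in> elast_eigenvalues \<Omega> \<mu> lam \<rho> \<Longrightarrow> \<gamma> * (1 + \<kappa>) \<le> \<bar>\<sigma> - \<kappa>\<bar>"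
  shows "\<exists>T. vf.reflects {u. Vsp \<Omega> u} (ef \<mu> lam) (mf \<rho>) \<sigma> \<gamma> T"
proof (rule vf.spectral_reflection[OF vf_subspace_V _ _ _ _ _ g(1) _ g(2)])
  let ?S = "{u. Vsp \<Omega> u}" and ?f = "vf.sumform (ef \<mu> lam) (mf \<rho>)"
  show e: "vf.psd ?S (ef \<mu> lam)" and m: "vf.psd ?S (mf \<rho>)" using psd_ef psd_mf p by auto
  obtain C where C: "C > 0" "\<And>u. Vsp \<Omega> u \<Longrightarrow> norm_V \<Omega> u \<le> C * vf.qn ?f u" "\<And>u. Vsp \<Omega> u \<Longrightarrow> vf.qn ?f u \<le> C * norm_V \<Omega> u"
    using sumform_equivalent[OF p] by blast
  show "vf.qcomplete ?S ?f"
    by (rule vf.qcomplete_equivalent[OF psd_V vf.psd_add[OF e m] vf_subspace_V qcomplete_V _ _ C(1)]) (use C in \<open>auto simp: qn_V\<close>)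
  \<comment> \<open>A bound in the energy seminorm is a bound in \<open>norm_V\<close>, so the
    Rellich theorem gives a subsequence whose components are Cauchy in L2.\<close>
  show "vf.qcompact ?S ?f (mf \<rho>)"
    unfolding vf.qcompact_def
  proof (intro allI impI)
    fix X :: "nat \<Rightarrow> real^'n \<Rightarrow> complex^'n"
    assume X: "\<forall>n. X n \<in> ?S" and "\<exists>B. \<forall>n. vf.qn ?f (X n) \<le> B"
    then obtain B where B: "\<And>n. vf.qn ?f (X n) \<le> B" by blast
    have XV: "Vsp \<Omega> (X n)" for n using X by blast
    have "norm_V \<Omega> (X n) \<le> C * B" for n using C(2)[OF XV] mult_left_mono[OF B, of C] C(1) order_trans less_imp_le by blast
    from rellich_V[of X "C * B", OF XV this] obtain r :: "nat \<Rightarrow> nat" where r: "strict_mono r"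
      "\<forall>\<delta>>0. \<exists>N. \<forall>j\<ge>N. \<forall>k\<ge>N. \<forall>i. norm_L2 \<Omega> (\<lambda>x. X (r j) x $ i - X (r k) x $ i) < \<delta>" by auto
    have "\<exists>N. \<forall>j\<ge>N. \<forall>k\<ge>N. vf.qn (mf \<rho>) (X (r j) - X (r k)) < \<epsilon>" if e0: "\<epsilon> > 0" for \<epsilon>
    proof -
      define n where "n = real CARD('n)"
      have n: "n > 0" unfolding n_def by simp
      \<comment> \<open>The mass seminorm sums over all components and carries the density, hence
        the division by the root of \<open>\<rho> n\<close>.\<close>
      define \<delta> where "\<delta> = \<epsilon> / sqrt (\<rho> * n)"
      have \<delta>: "\<delta> > 0" unfolding \<delta>_def using e0 p n by simp
      obtain N where N: "\<forall>j\<ge>N. \<forall>k\<ge>N. \<forall>i. norm_L2 \<Omega> (\<lambda>x. X (r j) x $ i - X (r k) x $ i) < \<delta>" using r(2)[rule_format, OF \<delta>] by blast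
      have "vf.qn (mf \<rho>) (X (r j) - X (r k)) < \<epsilon>" if jk: "j \<ge> N" "k \<ge> N" for j k
      proof -
        have V: "Vsp \<Omega> (X (r j) - X (r k))" using vf.subspace_diff[OF vf_subspace_V] XV by blast
        have "(norm_L2 \<Omega> (\<lambda>x. (X (r j) - X (r k)) x $ i))\<^sup>2 < \<delta>\<^sup>2" for i
          using N jk norm_L2_nonneg by (intro power_strict_mono) (auto simp: fun_diff_def)
        then have "(\<Sum>i\<in>(UNIV::'n set). (norm_L2 \<Omega> (\<lambda>x. (X (r j) - X (r k)) x $ i))\<^sup>2) < (\<Sum>i\<in>(UNIV::'n set). \<delta>\<^sup>2)"
          by (intro sum_strict_mono) auto
        then have "(vf.qn (mf \<rho>) (X (r j) - X (r k)))\<^sup>2 < \<rho> * (n * \<delta>\<^sup>2)"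
          unfolding n_def using qn_mf_sq[OF V, of \<rho>] p(3) by simp
        also have "\<dots> = \<epsilon>\<^sup>2" unfolding \<delta>_def using p n by (simp add: power_divide)
        finally show ?thesis using e0 power_less_imp_less_base[of _ 2 \<epsilon>] by simp
      qed
      then show ?thesis by blast
    qed
    then have "\<forall>\<epsilon>>0. \<exists>N. \<forall>j\<ge>N. \<forall>k\<ge>N. vf.qn (mf \<rho>) (X (r j) - X (r k)) < \<epsilon>" by (intro allI impI)
    with r(1) show "\<exists>r::nat\<Rightarrow>nat. strict_mono r \<and> (\<forall>\<epsilon>>0. \<exists>N. \<forall>j\<ge>N. \<forall>k\<ge>N. vf.qn (mf \<rho>) (X (r j) - X (r k)) < \<epsilon>)" by (auto intro!: exI[of _ r])
  qed
  \<comment> \<open>A field of mass zero vanishes almost everywhere; by uniqueness its weak gradient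
    then does so too, although it is some chosen function.\<close>
  show "vf.qn (ef \<mu> lam) u = 0" if u: "u \<in> ?S" and z: "vf.qn (mf \<rho>) u = 0" for u
  proof -
    have uV: "Vsp \<Omega> u" using u by simp
    have "(\<Sum>i\<in>UNIV. (norm_L2 \<Omega> (\<lambda>x. u x $ i))\<^sup>2) = 0" using qn_mf_sq[OF uV, of \<rho>] z p by simp
    then have n0: "norm_L2 \<Omega> (\<lambda>x. u x $ i) = 0" for i by (simp add: sum_nonneg_eq_0_iff)
    have "AE x in lebesgue_on \<Omega>. wgrad \<Omega> (\<lambda>x. u x $ i) x $ j = 0" for i j
    proof -
      have H: "H1 \<Omega> (\<lambda>x. u x $ i)" by (rule Vsp_H1[OF uV])
      have "AE x in lebesgue_on \<Omega>. u x $ i = 0" using norm_L2_eq_0_iff[OF H1_L2[OF H]] n0 by simp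
      moreover have "is_wgrad \<Omega> (\<lambda>x. 0) (\<lambda>x. 0)" unfolding is_wgrad_def by (simp add: L2_zero)
      ultimately show ?thesis using is_wgrad_unique[OF is_wgrad_wgrad[OF H] _ _ H1_L2[OF H] L2_zero, of "\<lambda>x. 0" j] by simp
    qed
    then have "norm_L2 \<Omega> (wpart \<Omega> u i j) = 0" for i j
      using norm_L2_eq_0_iff[OF L2_wpart[OF uV]] by (simp add: wpart_def)
    then have "norm_V \<Omega> u = 0" using norm_V_sq[of u] n0 by simp
    then have "vf.qn ?f u \<le> 0" using C(3)[OF uV] by simp
    then show ?thesis using vf.qn_le_sumform(2)[OF e m u] vf.qn_nonneg[OF e u] by simp
  qed
  show "\<gamma> * (1 + \<kappa>) \<le> \<bar>\<sigma> - \<kappa>\<bar>" if "\<kappa> \<in> vf.eigvals ?S (ef \<mu> lam) (mf \<rho>)" for \<kappa>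
    using gap that elast_eigenvalues_eq[OF p(3)] by simp
qed

end

subsection \<open>The product space and the coupled form\<close>

context complex_vector_space
begin

lemma bform_cong:
  assumes f: "bform S f B" and S: "subspace S" and e: "\<And>x y. x \<in> S \<Longrightarrow> y \<in> S \<Longrightarrow> C x y = B x y"
  shows "bform S f C"
proof -
  have "sesq S C" by (rule sesq_cong[OF _ S e]) (use f in \<open>simp_all add: bform_def\<close>)
  moreover have "fbounded S f C" using f e unfolding bform_def fbounded_def by simp
  ultimately show ?thesis unfolding bform_def ..
qed

lemma bform_vinner:
  assumes L: "\<And>i. blin \<Omega> S f (\<lambda>u x. L u x $ i)" "\<And>i. blin \<Omega> S f (\<lambda>u x. L' u x $ i)" and S: "subspace S"
  shows "bform S f (\<lambda>u v. vinner_L2 \<Omega> (L u) (L' v))"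
proof (rule bform_cong[OF _ S])
  show "bform S f (\<lambda>u v. \<Sum>i\<in>UNIV. inner_L2 \<Omega> (\<lambda>x. L u x $ i) (\<lambda>x. L' v x $ i))"
    by (intro bform_sum bform_inner L S)
  show "vinner_L2 \<Omega> (L u) (L' v) = (\<Sum>i\<in>UNIV. inner_L2 \<Omega> (\<lambda>x. L u x $ i) (\<lambda>x. L' v x $ i))" if "u \<in> S" "v \<in> S" for u v
    using L that unfolding blin_def aelin_def by (intro vinner_L2_sum) blast+
qed

lemma blin_tensor:
  fixes \<Omega> :: "(real^'n::finite) set"
  assumes A: "tensor_field \<Omega> A a B" and B: "0 \<le> B" and L: "\<And>i. blin \<Omega> S f (\<lambda>u x. L u x $ i)"
  shows "blin \<Omega> S f (\<lambda>u x. rmat_cvec (A x) (L u x) $ i)"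
proof -
  have "(\<lambda>x. A x $ i $ j) \<in> borel_measurable (lebesgue_on \<Omega>)" for j
    using A unfolding tensor_field_def by blast
  then have "(\<lambda>x. complex_of_real (A x $ i $ j)) \<in> borel_measurable (lebesgue_on \<Omega>)" for j
    by (rule measurable_compose[OF _ borel_measurable_continuous_onI[OF continuous_on_of_real_id]])
  moreover have "cmod (complex_of_real (A x $ i $ j)) \<le> B" if "x \<in> \<Omega>" for x j
    using A that unfolding tensor_field_def by simp
  ultimately have "blin \<Omega> S f (\<lambda>u x. \<Sum>j\<in>UNIV. complex_of_real (A x $ i $ j) * L u x $ j)"
    by (intro blin_sum blin_bounded_mult[OF L _ _ B]) auto
  then show ?thesis by (simp add: rmat_cvec_def)
qed

end

lemma vinner_L2_commute: "vinner_L2 \<Omega> v u = cnj (vinner_L2 \<Omega> u v)"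
  unfolding vinner_L2_def Bochner_Integration.integral_cnj[symmetric] by (simp add: mult.commute)

lemma vinner_L2_cmult_right: "vinner_L2 \<Omega> u (\<lambda>x. c *s v x) = cnj c * vinner_L2 \<Omega> u v"
proof -
  have "(\<Sum>i\<in>UNIV. u x $ i * cnj ((c *s v x) $ i)) = cnj c * (\<Sum>i\<in>UNIV. u x $ i * cnj (v x $ i))" for x
    by (simp add: sum_distrib_left mult.left_commute)
  then show ?thesis unfolding vinner_L2_def by simp
qed

lemma vinner_L2_self:
  assumes "\<And>i. L2 \<Omega> (\<lambda>x. u x $ i)"
  shows "vinner_L2 \<Omega> u u = of_real ((vnorm_L2 \<Omega> u)\<^sup>2)"
  unfolding vinner_L2_sum[OF assms assms] inner_L2_self vnorm_L2_def by (simp add: sum_nonneg)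

lemma vnorm_L2_nonneg: "0 \<le> vnorm_L2 \<Omega> u"
  unfolding vnorm_L2_def by (simp add: sum_nonneg)

lemma cmod_vinner_L2_le:
  assumes u: "\<And>i. L2 \<Omega> (\<lambda>x. u x $ i)" and v: "\<And>i. L2 \<Omega> (\<lambda>x. v x $ i)"
  shows "cmod (vinner_L2 \<Omega> u v) \<le> vnorm_L2 \<Omega> u * vnorm_L2 \<Omega> v"
proof -
  have "cmod (vinner_L2 \<Omega> u v) \<le> (\<Sum>i\<in>UNIV. cmod (inner_L2 \<Omega> (\<lambda>x. u x $ i) (\<lambda>x. v x $ i)))"
    unfolding vinner_L2_sum[OF u v] by (rule norm_sum)
  also have "\<dots> \<le> (\<Sum>i\<in>UNIV. \<bar>norm_L2 \<Omega> (\<lambda>x. u x $ i)\<bar> * \<bar>norm_L2 \<Omega> (\<lambda>x. v x $ i)\<bar>)"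
    using cmod_inner_L2_le[OF u v] by (intro sum_mono) (simp add: abs_of_nonneg[OF norm_L2_nonneg])
  also have "\<dots> \<le> vnorm_L2 \<Omega> u * vnorm_L2 \<Omega> v"
    using L2_set_mult_ineq[of "\<lambda>i. norm_L2 \<Omega> (\<lambda>x. u x $ i)" "\<lambda>i. norm_L2 \<Omega> (\<lambda>x. v x $ i)" UNIV]
    unfolding L2_set_def vnorm_L2_def .
  finally show ?thesis .
qed

text \<open>A normal form used twice. Adjoints are resolved into inner products linear in the trial
  function, each with an explicit factor, so that boundedness follows summand by summand and real
  parts can be computed.\<close>

lemma form_A_expand:
  "form_A \<Omega> \<rho> \<rho>f \<rho>w \<mu> lam \<alpha> c0 \<beta> b0 a0 \<tau> \<omega> K \<Theta> (u, w, p, T) (v, z, q, s) =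
     of_real (2 * \<mu>) * inner_eps \<Omega> u v + of_real lam * inner_L2 \<Omega> (divV \<Omega> u) (divV \<Omega> v)
     + of_real (- (\<omega>\<^sup>2 * \<rho>)) * vinner_L2 \<Omega> u v
     + of_real (- (\<omega>\<^sup>2 * \<rho>w)) * vinner_L2 \<Omega> w z
     + (\<i> * of_real \<omega>) * vinner_L2 \<Omega> (\<lambda>x. rmat_cvec (matrix_inv (K x)) (w x)) z
     + of_real (- (\<omega>\<^sup>2 * \<rho>f)) * vinner_L2 \<Omega> w v + of_real (- (\<omega>\<^sup>2 * \<rho>f)) * vinner_L2 \<Omega> u z
     + of_real (- \<alpha>) * inner_L2 \<Omega> p (divV \<Omega> v) + (- 1) * inner_L2 \<Omega> p (wdiv \<Omega> z)
     + of_real \<alpha> * inner_L2 \<Omega> (divV \<Omega> u) q + 1 * inner_L2 \<Omega> (wdiv \<Omega> w) q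
     + of_real c0 * inner_L2 \<Omega> p q + of_real (- \<beta>) * inner_L2 \<Omega> T (divV \<Omega> v) + of_real (- b0) * inner_L2 \<Omega> T q
     + (\<i> * of_real \<beta>) * inner_L2 \<Omega> (divV \<Omega> u) s + (- (\<i> * of_real b0)) * inner_L2 \<Omega> p s
     + (\<i> * of_real a0) * inner_L2 \<Omega> T s
     + (1 / (of_real \<omega> * (1 + \<i> * of_real \<omega> * of_real \<tau>))) * vinner_L2 \<Omega> (\<lambda>x. rmat_cvec (\<Theta> x) (wgrad \<Omega> T x)) (wgrad \<Omega> s)"
proof -
  have "adj (form_b1 \<Omega> \<rho>f \<omega>) u z = of_real (- (\<omega>\<^sup>2 * \<rho>f)) * vinner_L2 \<Omega> u z"
    unfolding adj_def form_b1_def vinner_L2_commute[of \<Omega> z u] by simp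
  moreover have "adj (form_b2 \<Omega> \<alpha>) u q = - (of_real \<alpha> * inner_L2 \<Omega> (divV \<Omega> u) q)"
    unfolding adj_def form_b2_def inner_L2_commute[of \<Omega> q "divV \<Omega> u"] by simp
  moreover have "adj (form_b3 \<Omega>) w q = - inner_L2 \<Omega> (wdiv \<Omega> w) q"
    unfolding adj_def form_b3_def inner_L2_commute[of \<Omega> q "wdiv \<Omega> w"] by simp
  moreover have "adj (form_c1 \<Omega> \<beta>) u s = - (of_real \<beta> * inner_L2 \<Omega> (divV \<Omega> u) s)"
    unfolding adj_def form_c1_def inner_L2_commute[of \<Omega> s "divV \<Omega> u"] by simp
  moreover have "adj (form_c2 \<Omega> b0) p s = - (of_real b0 * inner_L2 \<Omega> p s)"
    unfolding adj_def form_c2_def inner_L2_commute[of \<Omega> s p] by simp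
  ultimately show ?thesis
    by (simp add: form_A_def form_a1_def form_a2_def form_b1_def form_b2_def form_b3_def form_d_def form_c1_def form_c2_def form_a3_def)
qed

lemma Usp_iff: "Usp \<Omega> U \<longleftrightarrow> Vsp \<Omega> (fst U) \<and> H0div \<Omega> (fst (snd U)) \<and> L2 \<Omega> (fst (snd (snd U))) \<and> H10 \<Omega> (snd (snd (snd U)))"
  unfolding Usp_def by (simp split: prod.split)

lemma uf_aelin_vf:
  fixes \<pi> :: "'n::finite Uelt \<Rightarrow> real^'n \<Rightarrow> complex^'n"
  assumes L: "vf.aelin \<Omega> A L" and p: "\<And>U. U \<in> S \<Longrightarrow> \<pi> U \<in> A" "\<And>U V. \<pi> (U + V) = \<pi> U + \<pi> V"
    "\<And>c U. \<pi> (scale_U c U) = (\<lambda>x. c *s \<pi> U x)"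
  shows "uf.aelin \<Omega> S (\<lambda>U. L (\<pi> U))"
  using vf.aelinD[OF L p(1)] by (intro uf.aelinI) (simp_all add: p)

lemma uf_aelin_fn:
  fixes \<pi> :: "'n::finite Uelt \<Rightarrow> real^'n \<Rightarrow> complex"
  assumes L: "fn.aelin \<Omega> A L" and p: "\<And>U. U \<in> S \<Longrightarrow> \<pi> U \<in> A" "\<And>U V. \<pi> (U + V) = \<pi> U + \<pi> V"
    "\<And>c U. \<pi> (scale_U c U) = (\<lambda>x. c * \<pi> U x)"
  shows "uf.aelin \<Omega> S (\<lambda>U. L (\<pi> U))"
  using fn.aelinD[OF L p(1)] by (intro uf.aelinI) (simp_all add: p)

context domain
begin

text \<open>The nested sum type lists the coordinates of displacement, flux, pressure and
  temperature; with it the product norm is one more \<open>coord_ip\<close>.\<close>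

definition LU :: "('n \<times> 'n option + 'n option) + (unit + 'n option) \<Rightarrow> 'n Uelt \<Rightarrow> real^'n \<Rightarrow> complex" where
  "LU c U = (case c of Inl b \<Rightarrow> (case b of Inl a \<Rightarrow> LV a (fst U) | Inr a \<Rightarrow> LDiv a (fst (snd U)))
     | Inr b \<Rightarrow> (case b of Inl _ \<Rightarrow> fst (snd (snd U)) | Inr a \<Rightarrow> LH1 a (snd (snd (snd U)))))"

lemma LU_aelin: "uf.aelin \<Omega> {U. Usp \<Omega> U} (LU c)"
proof -
  have 1: "uf.aelin \<Omega> {U. Usp \<Omega> U} (\<lambda>U. LV a (fst U))" for a
    by (rule uf_aelin_vf[OF LV_aelin]) (simp_all add: Usp_iff scale_U_components)
  have 2: "uf.aelin \<Omega> {U. Usp \<Omega> U} (\<lambda>U. LDiv a (fst (snd U)))" for a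
    by (rule uf_aelin_vf[OF LDiv_aelin]) (simp_all add: Usp_iff scale_U_components H0div_Hdiv)
  have 3: "uf.aelin \<Omega> {U. Usp \<Omega> U} (\<lambda>U. fst (snd (snd U)))"
    by (rule uf.aelinI) (simp_all add: Usp_iff scale_U_components)
  have 4: "uf.aelin \<Omega> {U. Usp \<Omega> U} (\<lambda>U. LH1 a (snd (snd (snd U))))" for a
    by (rule uf_aelin_fn[OF LH1_aelin]) (simp_all add: Usp_iff scale_U_components H10_H1)
  show ?thesis
  proof (cases c)
    case (Inl b)
    then show ?thesis using 1 2 by (cases b) (simp_all add: LU_def[abs_def])
  next
    case (Inr b)
    then show ?thesis using 3 4 by (cases b) (simp_all add: LU_def[abs_def])
  qed
qed

lemma uf_subspace_U: "uf.subspace {U. Usp \<Omega> U}"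
  unfolding uf.subspace_def
  using vf.subspace_0[OF vf_subspace_V] vf.subspace_0[OF vf_subspace_H0div] fn.subspace_0[OF fn_subspace_L2, of \<Omega>] fn.subspace_0[OF fn_subspace_H10]
    vf.subspace_add[OF vf_subspace_V] vf.subspace_add[OF vf_subspace_H0div] fn.subspace_add[OF fn_subspace_L2, of _ \<Omega>] fn.subspace_add[OF fn_subspace_H10]
    vf.subspace_scale[OF vf_subspace_V] vf.subspace_scale[OF vf_subspace_H0div] fn.subspace_scale[OF fn_subspace_L2, of _ \<Omega>] fn.subspace_scale[OF fn_subspace_H10]
  by (simp add: Usp_iff scale_U_components)

lemma psd_U: "uf.psd {U. Usp \<Omega> U} (uf.coord_ip \<Omega> UNIV LU)"
  by (rule uf.psd_coord_ip[OF LU_aelin uf_subspace_U])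

lemma qn_U: "uf.qn (uf.coord_ip \<Omega> UNIV LU) U = norm_U \<Omega> U"
proof -
  have "(norm_V \<Omega> (fst U))\<^sup>2 = (\<Sum>a\<in>UNIV. (norm_L2 \<Omega> (LV a (fst U)))\<^sup>2)"
    "(norm_Hdiv \<Omega> (fst (snd U)))\<^sup>2 = (\<Sum>a\<in>UNIV. (norm_L2 \<Omega> (LDiv a (fst (snd U))))\<^sup>2)"
    unfolding qn_V[symmetric] qn_Hdiv[symmetric] vf.qn_coord_ip by (simp_all add: sum_nonneg)
  then show ?thesis
    unfolding uf.qn_coord_ip sum_UNIV_sum norm_U_def
    by (cases U) (simp add: LU_def norm_H1_sq)
qed

lemma qcomplete_U: "uf.qcomplete {U. Usp \<Omega> U} (uf.coord_ip \<Omega> UNIV LU)"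
proof (rule uf.qcomplete_coord_ip[OF finite_dom _ uf_subspace_U LU_aelin])
  fix X :: "nat \<Rightarrow> 'n Uelt" and g :: "('n \<times> 'n option + 'n option) + (unit + 'n option) \<Rightarrow> real^'n \<Rightarrow> complex"
  assume X: "\<And>n. X n \<in> {U. Usp \<Omega> U}" and g: "\<And>a. a \<in> UNIV \<Longrightarrow> L2 \<Omega> (g a)"
    and l: "\<And>a. a \<in> UNIV \<Longrightarrow> (\<lambda>n. norm_L2 \<Omega> (\<lambda>x. LU a (X n) x - g a x)) \<longlonglongrightarrow> 0"
  have X': "Vsp \<Omega> (fst (X n))" "H0div \<Omega> (fst (snd (X n)))" "H10 \<Omega> (snd (snd (snd (X n))))" for n
    using X[of n] by (simp_all add: Usp_iff)
  have gL: "L2 \<Omega> (g a)" for a by (rule g) simp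
  have "\<exists>u. Vsp \<Omega> u \<and> (\<forall>c. AE x in lebesgue_on \<Omega>. LV c u x = g (Inl (Inl c)) x)"
    by (rule V_closed[OF X'(1) gL]) (use l[of "Inl (Inl _)"] in \<open>simp add: LU_def\<close>)
  then obtain u where u: "Vsp \<Omega> u" "\<And>c. AE x in lebesgue_on \<Omega>. LV c u x = g (Inl (Inl c)) x" by blast
  have ld: "vf.aelin \<Omega> {w. H0div \<Omega> w} (LDiv a)" for a
    using LDiv_aelin[of a] H0div_Hdiv unfolding vf.aelin_def by blast
  have "\<exists>w\<in>{w. H0div \<Omega> w}. \<forall>c\<in>UNIV. AE x in lebesgue_on \<Omega>. LDiv c w x = g (Inl (Inr c)) x"
    by (rule vf.qcomplete_coord_closed[OF _ ld vf_subspace_H0div qcomplete_H0div _ gL, of "\<lambda>n. fst (snd (X n))"])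
      (use X'(2) l[of "Inl (Inr _)"] in \<open>simp_all add: LU_def\<close>)
  then obtain w where w: "H0div \<Omega> w" "\<And>c. AE x in lebesgue_on \<Omega>. LDiv c w x = g (Inl (Inr c)) x" by blast
  have "\<exists>f. H10 \<Omega> f \<and> (\<forall>a. AE x in lebesgue_on \<Omega>. LH1 a f x = g (Inr (Inr a)) x)"
    by (rule H10_closed[OF X'(3) gL]) (use l[of "Inr (Inr _)"] in \<open>simp add: LU_def\<close>)
  then obtain T where T: "H10 \<Omega> T" "\<And>c. AE x in lebesgue_on \<Omega>. LH1 c T x = g (Inr (Inr c)) x" by blast
  have "AE x in lebesgue_on \<Omega>. LU c (u, w, g (Inr (Inl ())), T) x = g c x" for c
    using u(2) w(2) T(2) by (auto simp: LU_def split: sum.split)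
  moreover have "Usp \<Omega> (u, w, g (Inr (Inl ())), T)" using u(1) w(1) T(1) gL by (simp add: Usp_iff)
  ultimately show "\<exists>u\<in>{U. Usp \<Omega> U}. \<forall>a\<in>UNIV. AE x in lebesgue_on \<Omega>. LU a u x = g a x" by blast
qed simp

lemma LU_blin: "uf.blin \<Omega> {U. Usp \<Omega> U} (uf.coord_ip \<Omega> UNIV LU) (LU c)"
  by (rule uf.blin_coord[where L = LU, OF LU_aelin]) auto

lemma blin_components:
  "uf.blin \<Omega> {U. Usp \<Omega> U} (uf.coord_ip \<Omega> UNIV LU) (\<lambda>U x. fst U x $ i)"
  "uf.blin \<Omega> {U. Usp \<Omega> U} (uf.coord_ip \<Omega> UNIV LU) (\<lambda>U. wpart \<Omega> (fst U) i j)"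
  "uf.blin \<Omega> {U. Usp \<Omega> U} (uf.coord_ip \<Omega> UNIV LU) (\<lambda>U x. fst (snd U) x $ i)"
  "uf.blin \<Omega> {U. Usp \<Omega> U} (uf.coord_ip \<Omega> UNIV LU) (\<lambda>U. wdiv \<Omega> (fst (snd U)))"
  "uf.blin \<Omega> {U. Usp \<Omega> U} (uf.coord_ip \<Omega> UNIV LU) (\<lambda>U. fst (snd (snd U)))"
  "uf.blin \<Omega> {U. Usp \<Omega> U} (uf.coord_ip \<Omega> UNIV LU) (\<lambda>U. snd (snd (snd U)))"
  "uf.blin \<Omega> {U. Usp \<Omega> U} (uf.coord_ip \<Omega> UNIV LU) (\<lambda>U x. wgrad \<Omega> (snd (snd (snd U))) x $ i)"
  using LU_blin[of "Inl (Inl (i, None))"] LU_blin[of "Inl (Inl (i, Some j))"] LU_blin[of "Inl (Inr (Some i))"] LU_blin[of "Inl (Inr None)"]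
    LU_blin[of "Inr (Inl ())"] LU_blin[of "Inr (Inr None)"] LU_blin[of "Inr (Inr (Some i))"]
  by (simp_all add: LU_def[abs_def] LV_def LDiv_def LH1_def wpart_def[abs_def])

lemma eps_blin_U: "uf.blin \<Omega> {U. Usp \<Omega> U} (uf.coord_ip \<Omega> UNIV LU) (\<lambda>U. eps \<Omega> (fst U) i j)"
  using uf.blin_cmult[OF uf.blin_add[OF blin_components(2)[of i j] blin_components(2)[of j i]], of "1/2"]
  by (simp add: eps_def[abs_def])

lemma divV_blin_U: "uf.blin \<Omega> {U. Usp \<Omega> U} (uf.coord_ip \<Omega> UNIV LU) (\<lambda>U. divV \<Omega> (fst U))"
  unfolding divV_def[abs_def] by (intro uf.blin_sum blin_components)

lemma bform_A:
  assumes K: "tensor_field \<Omega> (\<lambda>x. matrix_inv (K x)) k B" "0 \<le> B" and Th: "tensor_field \<Omega> \<Theta> t C" "0 \<le> C"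
  shows "uf.bform {U. Usp \<Omega> U} (uf.coord_ip \<Omega> UNIV LU) (form_A \<Omega> \<rho> \<rho>f \<rho>w \<mu> lam \<alpha> c0 \<beta> b0 a0 \<tau> \<omega> K \<Theta>)"
proof -
  let ?S = "{U. Usp \<Omega> U}" and ?f = "uf.coord_ip \<Omega> UNIV LU"
  have eps: "uf.bform ?S ?f (\<lambda>U V. inner_eps \<Omega> (fst U) (fst V))"
  proof (rule uf.bform_cong[OF _ uf_subspace_U])
    show "uf.bform ?S ?f (\<lambda>U V. \<Sum>i\<in>UNIV. \<Sum>j\<in>UNIV. inner_L2 \<Omega> (eps \<Omega> (fst U) i j) (eps \<Omega> (fst V) i j))"
      by (intro uf.bform_sum uf.bform_inner eps_blin_U uf_subspace_U)
  qed (simp add: inner_eps_sum Usp_iff)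
  have eq: "form_A \<Omega> \<rho> \<rho>f \<rho>w \<mu> lam \<alpha> c0 \<beta> b0 a0 \<tau> \<omega> K \<Theta> = (\<lambda>U V.
     form_A \<Omega> \<rho> \<rho>f \<rho>w \<mu> lam \<alpha> c0 \<beta> b0 a0 \<tau> \<omega> K \<Theta> (fst U, fst (snd U), fst (snd (snd U)), snd (snd (snd U))) (fst V, fst (snd V), fst (snd (snd V)), snd (snd (snd V))))"
    by (simp add: fun_eq_iff)
  show ?thesis
    by (subst eq, unfold form_A_expand, intro uf.bform_add uf.bform_cmult eps uf.bform_inner uf.bform_vinner divV_blin_U blin_components uf_subspace_U
      uf.blin_tensor[OF K] uf.blin_tensor[OF Th])
qed

end

subsection \<open>The test operator\<close>

text \<open>Rotation by \<open>1 + i\<close> or \<open>1 - i\<close> costs \<open>sqrt 2\<close>,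
  rounded up to \<open>3/2\<close>; together with an unrotated copy of the same coupling this gives
  \<open>5/2\<close>.\<close>

lemma abs_Re_Im_le: "\<bar>Re z - Im z\<bar> \<le> 3/2 * cmod z" "\<bar>Re z + Im z\<bar> \<le> 3/2 * cmod z"
proof -
  have c: "cmod (1 + \<i>) \<le> 3/2" "cmod (1 - \<i>) \<le> 3/2"
    unfolding cmod_def by (rule real_le_lsqrt; simp add: power2_eq_square)+
  have m: "cmod ((1 + \<i>) * z) \<le> 3/2 * cmod z" "cmod ((1 - \<i>) * z) \<le> 3/2 * cmod z"
    unfolding norm_mult by (rule mult_right_mono[OF c(1) norm_ge_zero], rule mult_right_mono[OF c(2) norm_ge_zero])
  have "Re z - Im z = Re ((1 + \<i>) * z)" "Re z + Im z = Re ((1 - \<i>) * z)" by simp_all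
  then show "\<bar>Re z - Im z\<bar> \<le> 3/2 * cmod z" "\<bar>Re z + Im z\<bar> \<le> 3/2 * cmod z"
    using m abs_Re_le_cmod order_trans by metis+
qed

lemma vinner_L2_cong_AE:
  assumes "\<And>i. L2 \<Omega> (\<lambda>x. u x $ i)" "\<And>i. L2 \<Omega> (\<lambda>x. v x $ i)" "\<And>i. L2 \<Omega> (\<lambda>x. v' x $ i)"
    "\<And>i. AE x in lebesgue_on \<Omega>. v x $ i = v' x $ i"
  shows "vinner_L2 \<Omega> u v = vinner_L2 \<Omega> u v'"
  unfolding vinner_L2_sum[OF assms(1,2)] vinner_L2_sum[OF assms(1,3)]
  by (rule sum.cong[OF refl], rule inner_L2_cong_AE) (use assms in auto)

lemma L2_tensor:
  assumes A: "tensor_field \<Omega> A a B" and w: "\<And>i. L2 \<Omega> (\<lambda>x. w x $ i)"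
  shows "L2 \<Omega> (\<lambda>x. rmat_cvec (A x) (w x) $ i)"
proof -
  have "(\<lambda>x. A x $ i $ j) \<in> borel_measurable (lebesgue_on \<Omega>)" for j
    using A unfolding tensor_field_def by blast
  then have "(\<lambda>x. complex_of_real (A x $ i $ j)) \<in> borel_measurable (lebesgue_on \<Omega>)" for j
    by (rule measurable_compose[OF _ borel_measurable_continuous_onI[OF continuous_on_of_real_id]])
  moreover have "cmod (complex_of_real (A x $ i $ j)) \<le> B" if "x \<in> \<Omega>" for x j
    using A that unfolding tensor_field_def by simp
  ultimately have "L2 \<Omega> (\<lambda>x. \<Sum>j\<in>UNIV. complex_of_real (A x $ i $ j) * w x $ j)"
    by (intro L2_sum L2_bounded_mult[OF w]) auto
  then show ?thesis by (simp add: rmat_cvec_def)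
qed

text \<open>Rationalizing the denominator gives \<open>(1 - i \<omega> \<tau>) / (\<omega> (1 +
  \<omega>\<^sup>2 \<tau>\<^sup>2))\<close>; multiplied by \<open>1 - i\<close>, the numerator has
  real part \<open>1 - \<omega> \<tau>\<close>, so the sign is decided by
  \<open>\<tau> < 1 / \<omega>\<close>.\<close>

lemma Re_heat_coefficient:
  assumes "\<omega> > 0"
  shows "Re (1 / (of_real \<omega> * (1 + \<i> * of_real \<omega> * of_real \<tau>)) * (cnj (1 + \<i>) * of_real Y)) = (1 - \<omega> * \<tau>) / (\<omega> * (1 + \<omega>\<^sup>2 * \<tau>\<^sup>2)) * Y"
proof -
  define D where "D = 1 + \<omega>\<^sup>2 * \<tau>\<^sup>2"
  have D: "D > 0" unfolding D_def by (simp add: add_pos_nonneg)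
  have e: "(1 - \<i> * of_real (\<omega> * \<tau>)) * (1 + \<i> * of_real \<omega> * of_real \<tau>) = of_real D"
    unfolding D_def by (simp add: complex_eq_iff power2_eq_square)
  then have n: "1 + \<i> * of_real \<omega> * of_real \<tau> \<noteq> 0" using D by auto
  define r where "r = 1 / (\<omega> * D)"
  have "1 / (of_real \<omega> * (1 + \<i> * of_real \<omega> * of_real \<tau>)) = of_real (1 / (\<omega> * D)) * (1 - \<i> * of_real (\<omega> * \<tau>))"
    using e n D assms by (simp add: divide_eq_eq eq_divide_eq mult.assoc mult.left_commute)
  then have k: "1 / (of_real \<omega> * (1 + \<i> * of_real \<omega> * of_real \<tau>)) = of_real r * (1 - \<i> * of_real (\<omega> * \<tau>))"
    unfolding r_def .
  have "(1 - \<omega> * \<tau>) / (\<omega> * D) * Y = r * ((1 - \<omega> * \<tau>) * Y)" unfolding r_def by simp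
  then show ?thesis unfolding k D_def[symmetric] by (simp add: algebra_simps)
qed

context domain
begin

lemma H10_wgrad_L2: "H10 \<Omega> T \<Longrightarrow> L2 \<Omega> (\<lambda>x. wgrad \<Omega> T x $ i)"
  using L2_wgrad[OF H10_H1] .

text \<open>Reduction of coercivity to an inequality between real numbers. The displacement test
  function \<open>v\<close> is left general; \<open>N\<close> and \<open>x\<close> bound the norms
  and the divergences of \<open>u\<close> and \<open>v\<close> simultaneously, as they will for a
  reflection that preserves mass and energy.\<close>

lemma Re_form_A_test:
  fixes u w v :: "real^'n \<Rightarrow> complex^'n" and p T :: "real^'n \<Rightarrow> complex"
  assumes mem: "Vsp \<Omega> u" "H0div \<Omega> w" "L2 \<Omega> p" "H10 \<Omega> T" "Vsp \<Omega> v"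
    and K: "tensor_field \<Omega> (\<lambda>x. matrix_inv (K x)) (1 / kmax) B" and Th: "tensor_field \<Omega> \<Theta> \<theta>min C"
    and pos: "\<rho>f > 0" "\<alpha> > 0" "c0 > 0" "\<beta> > 0" "b0 > 0" "\<omega> > 0" "\<omega> * \<tau> < 1" "\<delta> > 0"
    and N: "vnorm_L2 \<Omega> u \<le> N" "vnorm_L2 \<Omega> v \<le> N" and x: "norm_L2 \<Omega> (divV \<Omega> u) \<le> x" "norm_L2 \<Omega> (divV \<Omega> v) \<le> x"
  defines "W \<equiv> vnorm_L2 \<Omega> w" and "P \<equiv> norm_L2 \<Omega> p" and "t \<equiv> norm_L2 \<Omega> T" and "d \<equiv> norm_L2 \<Omega> (wdiv \<Omega> w)"
    and "G \<equiv> vnorm_L2 \<Omega> (wgrad \<Omega> T)"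
  shows "Re (ef \<mu> lam u v) - \<omega>\<^sup>2 * Re (mf \<rho> u v) + \<omega> * (1 / kmax - \<omega> * \<rho>w) * W\<^sup>2 + c0 * P\<^sup>2 + a0 * t\<^sup>2
      + \<theta>min * (1 - \<omega> * \<tau>) / (\<omega> * (1 + \<omega>\<^sup>2 * \<tau>\<^sup>2)) * G\<^sup>2 + \<delta> * d\<^sup>2
      - 5/2 * (\<omega>\<^sup>2 * \<rho>f) * W * N - 5/2 * \<alpha> * P * x - 2 * b0 * t * P - 5/2 * \<beta> * t * x - \<delta> * d * (\<alpha> * x + c0 * P + b0 * t)
    \<le> Re (form_A \<Omega> \<rho> \<rho>f \<rho>w \<mu> lam \<alpha> c0 \<beta> b0 a0 \<tau> \<omega> K \<Theta> (u, w, p, T)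
        (v, \<lambda>x. (1 + \<i>) *s w x, \<lambda>x. (1 - \<i>) * p x + of_real \<delta> * wdiv \<Omega> w x, \<lambda>x. (1 + \<i>) * T x))"
proof -
  let ?h = "wdiv \<Omega> w" and ?z = "\<lambda>x. (1 + \<i>) *s w x" and ?s = "\<lambda>x. (1 + \<i>) * T x"
  let ?q = "\<lambda>x. (1 - \<i>) * p x + of_real \<delta> * wdiv \<Omega> w x"
  have uL: "L2 \<Omega> (\<lambda>x. u x $ i)" and vL: "L2 \<Omega> (\<lambda>x. v x $ i)" for i
    using H1_L2[OF Vsp_H1] mem(1,5) by auto
  have wL: "L2 \<Omega> (\<lambda>x. w x $ i)" for i by (rule Hdiv_L2[OF H0div_Hdiv[OF mem(2)]])
  have hL: "L2 \<Omega> ?h" by (rule L2_wdiv[OF H0div_Hdiv[OF mem(2)]])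
  have TL: "L2 \<Omega> T" by (rule H1_L2[OF H10_H1[OF mem(4)]])
  have gL: "L2 \<Omega> (\<lambda>x. wgrad \<Omega> T x $ i)" for i by (rule H10_wgrad_L2[OF mem(4)])
  have uD: "L2 \<Omega> (divV \<Omega> u)" and vD: "L2 \<Omega> (divV \<Omega> v)" using L2_divV mem by auto
  note pL = mem(3)
  have zH: "H0div \<Omega> ?z" using vf.subspace_scale[OF vf_subspace_H0div] mem(2) by blast
  have sH: "H10 \<Omega> ?s" using fn.subspace_scale[OF fn_subspace_H10] mem(4) by blast
  \<comment> \<open>The weak divergence is homogeneous only almost everywhere, which suffices inside
    an inner product.\<close>
  have e1: "inner_L2 \<Omega> p (wdiv \<Omega> ?z) = (1 - \<i>) * inner_L2 \<Omega> p ?h"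
  proof -
    have "AE x in lebesgue_on \<Omega>. wdiv \<Omega> ?z x = (1 + \<i>) * ?h x"
      using vf.aelinD(3)[OF LDiv_aelin[of None], of w "1 + \<i>"] H0div_Hdiv[OF mem(2)] by (simp add: LDiv_def)
    then have "inner_L2 \<Omega> p (wdiv \<Omega> ?z) = inner_L2 \<Omega> p (\<lambda>x. (1 + \<i>) * ?h x)"
      by (intro inner_L2_cong_AE pL L2_cmult hL L2_wdiv[OF H0div_Hdiv[OF zH]]) auto
    then show ?thesis using inner_L2_cmult_right[OF pL hL] by simp
  qed
  let ?Tg = "\<lambda>x. rmat_cvec (\<Theta> x) (wgrad \<Omega> T x)"
  have e2: "vinner_L2 \<Omega> ?Tg (wgrad \<Omega> ?s) = cnj (1 + \<i>) * vinner_L2 \<Omega> ?Tg (wgrad \<Omega> T)"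
  proof -
    have "AE x in lebesgue_on \<Omega>. wgrad \<Omega> ?s x $ i = ((1 + \<i>) *s wgrad \<Omega> T x) $ i" for i
      using fn.aelinD(3)[OF LH1_aelin[of "Some i"], of T "1 + \<i>"] H10_H1[OF mem(4)] by (simp add: LH1_def distrib_right)
    then have "vinner_L2 \<Omega> ?Tg (wgrad \<Omega> ?s) = vinner_L2 \<Omega> ?Tg (\<lambda>x. (1 + \<i>) *s wgrad \<Omega> T x)"
      by (intro vinner_L2_cong_AE L2_tensor[OF Th] gL H10_wgrad_L2[OF sH]) (use L2_add[OF gL L2_cmult[OF gL]] in auto)
    then show ?thesis unfolding vinner_L2_cmult_right .
  qed
  have q: "inner_L2 \<Omega> f ?q = (1 + \<i>) * inner_L2 \<Omega> f p + of_real \<delta> * inner_L2 \<Omega> f ?h" if f: "L2 \<Omega> f" for f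
    using inner_L2_add_right[OF f L2_cmult[OF pL] L2_cmult[OF hL], of "1 - \<i>" "of_real \<delta>"]
      inner_L2_cmult_right[OF f pL, of "1 - \<i>"] inner_L2_cmult_right[OF f hL, of "of_real \<delta>"] by simp
  have s: "inner_L2 \<Omega> f ?s = (1 - \<i>) * inner_L2 \<Omega> f T" if f: "L2 \<Omega> f" for f
    using inner_L2_cmult_right[OF f TL, of "1 + \<i>"] by simp
  have W2: "W\<^sup>2 = (\<Sum>i\<in>UNIV. (norm_L2 \<Omega> (\<lambda>x. w x $ i))\<^sup>2)"
    and G2: "G\<^sup>2 = (\<Sum>i\<in>UNIV. (norm_L2 \<Omega> (\<lambda>x. wgrad \<Omega> T x $ i))\<^sup>2)"
    unfolding W_def G_def vnorm_L2_def by (simp_all add: sum_nonneg)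
  obtain X where X: "1 / kmax * W\<^sup>2 \<le> X" "vinner_L2 \<Omega> (\<lambda>x. rmat_cvec (matrix_inv (K x)) (w x)) w = of_real X"
    using tensor_form[OF K wL] unfolding W2[symmetric] by blast
  have "\<exists>Y\<ge>\<theta>min * G\<^sup>2. vinner_L2 \<Omega> ?Tg (wgrad \<Omega> T) = of_real Y"
    unfolding G2 by (rule tensor_form[OF Th gL])
  then obtain Y where Y: "\<theta>min * G\<^sup>2 \<le> Y" "vinner_L2 \<Omega> ?Tg (wgrad \<Omega> T) = of_real Y"
    by (elim exE conjE)
  have m1: "of_real (- (\<omega>\<^sup>2 * \<rho>)) * z = - (of_real (\<omega>\<^sup>2) * (of_real \<rho> * z))" for z :: complex
    by (simp only: of_real_minus of_real_mult mult_minus_left mult.assoc)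
  have a1: "of_real (2 * \<mu>) * inner_eps \<Omega> u v + of_real lam * inner_L2 \<Omega> (divV \<Omega> u) (divV \<Omega> v)
     + of_real (- (\<omega>\<^sup>2 * \<rho>)) * vinner_L2 \<Omega> u v = ef \<mu> lam u v - of_real (\<omega>\<^sup>2) * mf \<rho> u v"
    unfolding ef_def mf_def inner_eps_sum[OF mem(1,5)] vinner_L2_sum[OF uL vL] m1 by (rule diff_conv_add_uminus[symmetric])
  define D1 where "D1 = vinner_L2 \<Omega> w v"
  define D2 where "D2 = vinner_L2 \<Omega> u w"
  define D3 where "D3 = inner_L2 \<Omega> p (divV \<Omega> v)"
  define D4 where "D4 = inner_L2 \<Omega> p ?h"
  define D5 where "D5 = inner_L2 \<Omega> (divV \<Omega> u) p"
  define D6 where "D6 = inner_L2 \<Omega> (divV \<Omega> u) ?h"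
  define D7 where "D7 = inner_L2 \<Omega> T (divV \<Omega> v)"
  define D8 where "D8 = inner_L2 \<Omega> T p"
  define D9 where "D9 = inner_L2 \<Omega> T ?h"
  define D0 where "D0 = inner_L2 \<Omega> (divV \<Omega> u) T"
  \<comment> \<open>The coupling of \<open>p\<close> with the divergence of \<open>w\<close>
    survives only through the part of the pressure test function multiplied by
    \<open>\<delta>\<close>, as \<open>\<delta> * d\<^sup>2\<close> and
    \<open>c0 * \<delta> * Re D4\<close>. In the coupling of \<open>p\<close> with \<open>T\<close>
    the two contributions are conjugate up to the common factor \<open>-(1 + i)\<close>, so they add
    up to \<open>-2 b0 Re D8\<close>.\<close>
  have A: "Re (form_A \<Omega> \<rho> \<rho>f \<rho>w \<mu> lam \<alpha> c0 \<beta> b0 a0 \<tau> \<omega> K \<Theta> (u, w, p, T) (v, ?z, ?q, ?s)) =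
      Re (ef \<mu> lam u v) - \<omega>\<^sup>2 * Re (mf \<rho> u v) - \<omega>\<^sup>2 * \<rho>w * W\<^sup>2 + \<omega> * X - \<omega>\<^sup>2 * \<rho>f * Re D1 - \<omega>\<^sup>2 * \<rho>f * (Re D2 + Im D2)
      - \<alpha> * Re D3 + \<alpha> * (Re D5 - Im D5) + \<alpha> * \<delta> * Re D6 + \<delta> * d\<^sup>2 + c0 * P\<^sup>2 + c0 * \<delta> * Re D4
      - \<beta> * Re D7 - b0 * \<delta> * Re D9 - 2 * b0 * Re D8 + \<beta> * (Re D0 - Im D0) + a0 * t\<^sup>2
      + (1 - \<omega> * \<tau>) / (\<omega> * (1 + \<omega>\<^sup>2 * \<tau>\<^sup>2)) * Y"
    unfolding form_A_expand a1 e1 e2 q[OF uD] q[OF hL] q[OF pL] q[OF TL] s[OF uD] s[OF pL] s[OF TL] vinner_L2_cmult_right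
      X(2) Y(2) vinner_L2_self[OF wL] inner_L2_self plus_complex.sel(1) Re_heat_coefficient[OF pos(6)]
      inner_L2_commute[of \<Omega> ?h p] inner_L2_commute[of \<Omega> p T]
      D1_def[symmetric] D2_def[symmetric] D3_def[symmetric] D4_def[symmetric] D5_def[symmetric] D6_def[symmetric]
      D7_def[symmetric] D8_def[symmetric] D9_def[symmetric] D0_def[symmetric]
      W_def[symmetric] P_def[symmetric] t_def[symmetric] d_def[symmetric]
    by (simp add: algebra_simps)
  have nn: "0 \<le> W" "0 \<le> P" "0 \<le> t" "0 \<le> d"
    unfolding W_def P_def t_def d_def by (simp_all add: vnorm_L2_nonneg norm_L2_nonneg)
  have b1: "cmod D1 \<le> W * N" unfolding D1_def
    using cmod_vinner_L2_le[OF wL vL] mult_left_mono[OF N(2) nn(1)] unfolding W_def by linarith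
  have b2: "cmod D2 \<le> W * N" unfolding D2_def
    using cmod_vinner_L2_le[OF uL wL] mult_right_mono[OF N(1) nn(1)] unfolding W_def by (simp add: mult.commute)
  have b3: "cmod D3 \<le> P * x" unfolding D3_def
    using cmod_inner_L2_le[OF pL vD] mult_left_mono[OF x(2) nn(2)] unfolding P_def by linarith
  have b4: "cmod D4 \<le> P * d" unfolding D4_def P_def d_def by (rule cmod_inner_L2_le[OF pL hL])
  have b5: "cmod D5 \<le> P * x" unfolding D5_def
    using cmod_inner_L2_le[OF uD pL] mult_right_mono[OF x(1) nn(2)] unfolding P_def by (simp add: mult.commute)
  have b6: "cmod D6 \<le> d * x" unfolding D6_def
    using cmod_inner_L2_le[OF uD hL] mult_right_mono[OF x(1) nn(4)] unfolding d_def by (simp add: mult.commute)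
  have b7: "cmod D7 \<le> t * x" unfolding D7_def
    using cmod_inner_L2_le[OF TL vD] mult_left_mono[OF x(2) nn(3)] unfolding t_def by linarith
  have b8: "cmod D8 \<le> t * P" unfolding D8_def t_def P_def by (rule cmod_inner_L2_le[OF TL pL])
  have b9: "cmod D9 \<le> t * d" unfolding D9_def t_def d_def by (rule cmod_inner_L2_le[OF TL hL])
  have b0': "cmod D0 \<le> t * x" unfolding D0_def
    using cmod_inner_L2_le[OF uD TL] mult_right_mono[OF x(1) nn(3)] unfolding t_def by (simp add: mult.commute)
  have r: "\<bar>Re z\<bar> \<le> B" "\<bar>Re z - Im z\<bar> \<le> 3/2 * B" "\<bar>Re z + Im z\<bar> \<le> 3/2 * B" if "cmod z \<le> B" for z B
    using that abs_Re_le_cmod[of z] abs_Re_Im_le[of z] by linarith+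
  have m: "k * y \<le> k * B" "- (k * B) \<le> k * y" if "\<bar>y\<bar> \<le> B" "k > 0" for k y B :: real
    using that mult_left_mono[of "- B" y k] by auto
  define k where "k = \<omega>\<^sup>2 * \<rho>f"
  have k: "k > 0" unfolding k_def using pos by simp
  have "k * Re D1 \<le> k * (W * N)" by (rule m(1)[OF r(1)[OF b1] k])
  moreover have "k * (Re D2 + Im D2) \<le> k * (3/2 * (W * N))" by (rule m(1)[OF r(3)[OF b2] k])
  moreover have "\<alpha> * Re D3 \<le> \<alpha> * (P * x)" by (rule m(1)[OF r(1)[OF b3] pos(2)])
  moreover have "- (\<alpha> * (3/2 * (P * x))) \<le> \<alpha> * (Re D5 - Im D5)" by (rule m(2)[OF r(2)[OF b5] pos(2)])
  moreover have "- (\<alpha> * \<delta> * (d * x)) \<le> \<alpha> * \<delta> * Re D6" by (rule m(2)[OF r(1)[OF b6]]) (use pos in simp)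
  moreover have "- (c0 * \<delta> * (P * d)) \<le> c0 * \<delta> * Re D4" by (rule m(2)[OF r(1)[OF b4]]) (use pos in simp)
  moreover have "\<beta> * Re D7 \<le> \<beta> * (t * x)" by (rule m(1)[OF r(1)[OF b7] pos(4)])
  moreover have "b0 * \<delta> * Re D9 \<le> b0 * \<delta> * (t * d)" by (rule m(1)[OF r(1)[OF b9]]) (use pos in simp)
  moreover have "2 * b0 * Re D8 \<le> 2 * b0 * (t * P)" by (rule m(1)[OF r(1)[OF b8]]) (use pos in simp)
  moreover have "- (\<beta> * (3/2 * (t * x))) \<le> \<beta> * (Re D0 - Im D0)" by (rule m(2)[OF r(2)[OF b0'] pos(4)])
  moreover have "\<omega> * (1 / kmax * W\<^sup>2) \<le> \<omega> * X" by (rule mult_left_mono[OF X(1)]) (use pos in simp)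
  moreover have "(1 - \<omega> * \<tau>) / (\<omega> * (1 + \<omega>\<^sup>2 * \<tau>\<^sup>2)) * (\<theta>min * G\<^sup>2) \<le> (1 - \<omega> * \<tau>) / (\<omega> * (1 + \<omega>\<^sup>2 * \<tau>\<^sup>2)) * Y"
    using Y(1) pos by (intro mult_left_mono) (auto simp: add_nonneg_nonneg)
  moreover have "5/2 * k * W * N = k * (W * N) + k * (3/2 * (W * N))" "5/2 * \<alpha> * P * x = \<alpha> * (P * x) + \<alpha> * (3/2 * (P * x))"
    "5/2 * \<beta> * t * x = \<beta> * (t * x) + \<beta> * (3/2 * (t * x))" "2 * b0 * t * P = 2 * b0 * (t * P)"
    "\<delta> * d * (\<alpha> * x + c0 * P + b0 * t) = \<alpha> * \<delta> * (d * x) + c0 * \<delta> * (P * d) + b0 * \<delta> * (t * d)"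
    "\<omega> * (1 / kmax - \<omega> * \<rho>w) * W\<^sup>2 = \<omega> * (1 / kmax * W\<^sup>2) - \<omega>\<^sup>2 * \<rho>w * W\<^sup>2"
    "\<theta>min * (1 - \<omega> * \<tau>) / (\<omega> * (1 + \<omega>\<^sup>2 * \<tau>\<^sup>2)) * G\<^sup>2 = (1 - \<omega> * \<tau>) / (\<omega> * (1 + \<omega>\<^sup>2 * \<tau>\<^sup>2)) * (\<theta>min * G\<^sup>2)"
    by (simp_all add: algebra_simps power2_eq_square)
  ultimately show ?thesis unfolding A k_def[symmetric] by linarith
qed

end

context domain
begin

definition test_op :: "((real^'n \<Rightarrow> complex^'n) \<Rightarrow> real^'n \<Rightarrow> complex^'n) \<Rightarrow> real \<Rightarrow> 'n Uelt \<Rightarrow> 'n Uelt" where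
  "test_op R \<delta> U = (R (fst U), \<lambda>x. (1 + \<i>) *s fst (snd U) x,
     \<lambda>x. (1 - \<i>) * fst (snd (snd U)) x + of_real \<delta> * wdiv \<Omega> (fst (snd U)) x, \<lambda>x. (1 + \<i>) * snd (snd (snd U)) x)"

lemma H0div_scale: "H0div \<Omega> w \<Longrightarrow> H0div \<Omega> (\<lambda>x. c *s w x)"
  using vf.subspace_scale[OF vf_subspace_H0div] by blast

lemma H10_scale: "H10 \<Omega> T \<Longrightarrow> H10 \<Omega> (\<lambda>x. c * T x)"
  using fn.subspace_scale[OF fn_subspace_H10] by blast

lemma L2_wdiv0: "H0div \<Omega> w \<Longrightarrow> L2 \<Omega> (wdiv \<Omega> w)"
  using L2_wdiv[OF H0div_Hdiv] .

lemma norm_U_le: "norm_U \<Omega> (u, w, p, T) \<le> norm_V \<Omega> u + norm_Hdiv \<Omega> w + norm_L2 \<Omega> p + norm_H1 \<Omega> T"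
proof -
  have nn: "0 \<le> norm_V \<Omega> u" "0 \<le> norm_Hdiv \<Omega> w" "0 \<le> norm_L2 \<Omega> p" "0 \<le> norm_H1 \<Omega> T"
    by (simp_all add: norm_V_nonneg norm_L2_nonneg norm_Hdiv_def norm_H1_def sum_nonneg)
  have "a\<^sup>2 + b\<^sup>2 + c\<^sup>2 + d\<^sup>2 \<le> (a + b + c + d)\<^sup>2" if "0 \<le> a" "0 \<le> b" "0 \<le> c" "0 \<le> d" for a b c d :: real
  proof -
    have "0 \<le> a * b" "0 \<le> a * c" "0 \<le> a * d" "0 \<le> b * c" "0 \<le> b * d" "0 \<le> c * d" using that by auto
    moreover have e: "(a + b + c + d)\<^sup>2 = a\<^sup>2 + b\<^sup>2 + c\<^sup>2 + d\<^sup>2 + 2 * (a * b + a * c + a * d + b * c + b * d + c * d)"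
      by (simp add: power2_eq_square algebra_simps)
    ultimately show ?thesis unfolding e by simp
  qed
  from this[OF nn] show ?thesis unfolding norm_U_def using nn by (auto intro!: real_le_lsqrt)
qed

lemma norm_le_norm_U:
  "norm_V \<Omega> (fst U) \<le> norm_U \<Omega> U" "norm_Hdiv \<Omega> (fst (snd U)) \<le> norm_U \<Omega> U"
  "norm_L2 \<Omega> (fst (snd (snd U))) \<le> norm_U \<Omega> U" "norm_H1 \<Omega> (snd (snd (snd U))) \<le> norm_U \<Omega> U"
  "norm_L2 \<Omega> (wdiv \<Omega> (fst (snd U))) \<le> norm_U \<Omega> U"
proof -
  show *: "norm_V \<Omega> (fst U) \<le> norm_U \<Omega> U" "norm_Hdiv \<Omega> (fst (snd U)) \<le> norm_U \<Omega> U"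
    "norm_L2 \<Omega> (fst (snd (snd U))) \<le> norm_U \<Omega> U" "norm_H1 \<Omega> (snd (snd (snd U))) \<le> norm_U \<Omega> U"
    by (cases U; simp add: norm_U_def; rule real_le_rsqrt; simp)+
  have "norm_L2 \<Omega> (wdiv \<Omega> (fst (snd U))) \<le> norm_Hdiv \<Omega> (fst (snd U))"
    unfolding norm_Hdiv_def by (rule real_le_rsqrt) simp
  then show "norm_L2 \<Omega> (wdiv \<Omega> (fst (snd U))) \<le> norm_U \<Omega> U" using *(2) by linarith
qed

text \<open>The test operator fails to be linear only in its pressure component, where
  \<open>wdiv\<close> enters; the seminorm of the defect is therefore that of one scalar
  function.\<close>

lemma norm_U_pressure: "norm_U \<Omega> (0, 0, r, 0) = norm_L2 \<Omega> r"
proof -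
  have "norm_V \<Omega> 0 = 0" "norm_Hdiv \<Omega> 0 = 0" "norm_H1 \<Omega> 0 = 0"
    using vf.qn_zero[OF psd_V vf_subspace_V] vf.qn_zero[OF psd_Hdiv vf_subspace_Hdiv] fn.qn_zero[OF psd_H1 fn_subspace_H1]
    unfolding qn_V qn_Hdiv qn_H1 .
  then show ?thesis unfolding norm_U_def by (simp add: norm_L2_nonneg)
qed

context
  fixes R :: "(real^'n \<Rightarrow> complex^'n) \<Rightarrow> real^'n \<Rightarrow> complex^'n" and \<mu> lam \<rho> \<sigma> \<gamma> \<delta> :: real
  assumes R: "vf.reflects {u. Vsp \<Omega> u} (ef \<mu> lam) (mf \<rho>) \<sigma> \<gamma> R"
    and coeff: "\<mu> > 0" "lam > 0" "\<rho> > 0" "\<delta> > 0"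
begin

lemma reflection:
  assumes "Vsp \<Omega> u"
  shows "Vsp \<Omega> (R u)" "Vsp \<Omega> v \<Longrightarrow> R (u + v) = R u + R v" "R (\<lambda>x. c *s u x) = (\<lambda>x. c *s R u x)" "R (R u) = u"
    "vf.qn (ef \<mu> lam) (R u) = vf.qn (ef \<mu> lam) u" "vf.qn (mf \<rho>) (R u) = vf.qn (mf \<rho>) u"
    "\<gamma> * ((vf.qn (ef \<mu> lam) u)\<^sup>2 + (vf.qn (mf \<rho>) u)\<^sup>2) \<le> Re (ef \<mu> lam u (R u)) - \<sigma> * Re (mf \<rho> u (R u))"
  using R assms unfolding vf.reflects_def by simp_all

lemma test_op_mem: "Usp \<Omega> U \<Longrightarrow> Usp \<Omega> (test_op R \<delta> U)"
  unfolding Usp_iff test_op_def fst_conv snd_conv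
  by (elim conjE) (intro conjI reflection(1) H0div_scale H10_scale L2_add L2_cmult L2_wdiv0; assumption)

text \<open>The reflection is isometric for the energy seminorm, hence bounded for
  \<open>norm_V\<close> by passing to the equivalent seminorm and back, which costs the constant
  twice.\<close>

lemma test_op_bounded: "\<exists>C>0. \<forall>U. Usp \<Omega> U \<longrightarrow> norm_U \<Omega> (test_op R \<delta> U) \<le> C * norm_U \<Omega> U"
proof -
  let ?f = "vf.sumform (ef \<mu> lam) (mf \<rho>)"
  have e: "vf.psd {u. Vsp \<Omega> u} (ef \<mu> lam)" and m: "vf.psd {u. Vsp \<Omega> u} (mf \<rho>)" using psd_ef psd_mf coeff by auto
  obtain C where C: "C > 0" "\<And>u. Vsp \<Omega> u \<Longrightarrow> norm_V \<Omega> u \<le> C * vf.qn ?f u" "\<And>u. Vsp \<Omega> u \<Longrightarrow> vf.qn ?f u \<le> C * norm_V \<Omega> u"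
    using sumform_equivalent[OF coeff(1-3)] by blast
  have c2: "cmod (1 + \<i>) \<le> 2" "cmod (1 - \<i>) \<le> 2" using norm_triangle_ineq[of 1 \<i>] norm_triangle_ineq4[of 1 \<i>] by simp_all
  have "norm_U \<Omega> (test_op R \<delta> U) \<le> (C * C + 6 + \<delta>) * norm_U \<Omega> U" if U: "Usp \<Omega> U" for U
  proof -
    have mem: "Vsp \<Omega> (fst U)" "H0div \<Omega> (fst (snd U))" "L2 \<Omega> (fst (snd (snd U)))" "H10 \<Omega> (snd (snd (snd U)))"
      using U unfolding Usp_iff by auto
    define n where "n = norm_U \<Omega> U"
    note le = norm_le_norm_U[of U, folded n_def]
    have "(vf.qn ?f (R (fst U)))\<^sup>2 = (vf.qn ?f (fst U))\<^sup>2"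
      using vf.qn_sumform_sq[OF e m] reflection[OF mem(1)] mem(1) by simp
    then have "vf.qn ?f (R (fst U)) = vf.qn ?f (fst U)"
      using vf.qn_nonneg[OF vf.psd_add[OF e m]] reflection(1)[OF mem(1)] mem(1) power2_eq_iff_nonneg by blast
    then have "norm_V \<Omega> (R (fst U)) \<le> C * vf.qn ?f (fst U)"
      using C(2)[OF reflection(1)[OF mem(1)]] by simp
    also have "\<dots> \<le> C * (C * norm_V \<Omega> (fst U))"
      by (rule mult_left_mono[OF C(3)[OF mem(1)]]) (use C(1) in simp)
    also have "\<dots> \<le> C * (C * n)" using le(1) C(1) by simp
    finally have 1: "norm_V \<Omega> (R (fst U)) \<le> C * C * n" by (simp add: mult.assoc)
    have "norm_Hdiv \<Omega> (\<lambda>x. (1 + \<i>) *s fst (snd U) x) = cmod (1 + \<i>) * norm_Hdiv \<Omega> (fst (snd U))"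
      using vf.qn_scale[OF psd_Hdiv vf_subspace_Hdiv, of "fst (snd U)" "1 + \<i>"] H0div_Hdiv[OF mem(2)] unfolding qn_Hdiv by simp
    also have "\<dots> \<le> 2 * n" using c2(1) le(2) by (intro mult_mono) (auto simp: norm_Hdiv_def)
    finally have 2: "norm_Hdiv \<Omega> (\<lambda>x. (1 + \<i>) *s fst (snd U) x) \<le> 2 * n" .
    have "norm_L2 \<Omega> (\<lambda>x. (1 - \<i>) * fst (snd (snd U)) x + of_real \<delta> * wdiv \<Omega> (fst (snd U)) x)
       \<le> cmod (1 - \<i>) * norm_L2 \<Omega> (fst (snd (snd U))) + \<delta> * norm_L2 \<Omega> (wdiv \<Omega> (fst (snd U)))"
      using norm_L2_triangle[OF L2_cmult[OF mem(3)] L2_cmult[OF L2_wdiv0[OF mem(2)]], of "1 - \<i>" "of_real \<delta>"]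
        norm_L2_cmult[OF mem(3), of "1 - \<i>"] norm_L2_cmult[OF L2_wdiv0[OF mem(2)], of "of_real \<delta>"] coeff(4) by simp
    also have "\<dots> \<le> 2 * n + \<delta> * n"
      using c2(2) le(3,5) coeff(4) norm_L2_nonneg by (intro add_mono mult_mono) auto
    finally have 3: "norm_L2 \<Omega> (\<lambda>x. (1 - \<i>) * fst (snd (snd U)) x + of_real \<delta> * wdiv \<Omega> (fst (snd U)) x) \<le> 2 * n + \<delta> * n" .
    have "norm_H1 \<Omega> (\<lambda>x. (1 + \<i>) * snd (snd (snd U)) x) = cmod (1 + \<i>) * norm_H1 \<Omega> (snd (snd (snd U)))"
      using fn.qn_scale[OF psd_H1 fn_subspace_H1, of "snd (snd (snd U))" "1 + \<i>"] H10_H1[OF mem(4)] unfolding qn_H1 by simp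
    also have "\<dots> \<le> 2 * n" using c2(1) le(4) by (intro mult_mono) (auto simp: norm_H1_def sum_nonneg)
    finally have 4: "norm_H1 \<Omega> (\<lambda>x. (1 + \<i>) * snd (snd (snd U)) x) \<le> 2 * n" .
    have "norm_U \<Omega> (test_op R \<delta> U) \<le> C * C * n + 2 * n + (2 * n + \<delta> * n) + 2 * n"
      unfolding test_op_def by (rule order_trans[OF norm_U_le]) (intro add_mono 1 2 3 4)
    then show ?thesis unfolding n_def by (simp add: algebra_simps)
  qed
  moreover have "C * C + 6 + \<delta> > 0" using C(1) coeff(4) by (simp add: add_pos_pos)
  ultimately show ?thesis by blast
qed

lemma norm_test_op_defect:
  assumes "A = (0, 0, r, 0)" "L2 \<Omega> r" "AE x in lebesgue_on \<Omega>. r x = 0"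
  shows "norm_U \<Omega> A = 0"
  using assms norm_L2_eq_0_iff[OF assms(2)] by (simp add: norm_U_pressure)

lemma test_op_add:
  assumes "Usp \<Omega> U" "Usp \<Omega> V"
  shows "norm_U \<Omega> (test_op R \<delta> (U + V) - (test_op R \<delta> U + test_op R \<delta> V)) = 0"
proof (rule norm_test_op_defect)
  have mem: "Vsp \<Omega> (fst U)" "H0div \<Omega> (fst (snd U))" "Vsp \<Omega> (fst V)" "H0div \<Omega> (fst (snd V))" using assms unfolding Usp_iff by auto
  let ?h = "\<lambda>U. wdiv \<Omega> (fst (snd U))"
  define r where "r x = of_real \<delta> * (?h (U + V) x - (?h U x + ?h V x))" for x
  have "H0div \<Omega> (fst (snd (U + V)))" using vf.subspace_add[OF vf_subspace_H0div] mem(2,4) by simp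
  then show "L2 \<Omega> r" unfolding r_def[abs_def] by (intro L2_cmult L2_diff L2_add L2_wdiv0 mem)
  show "AE x in lebesgue_on \<Omega>. r x = 0"
    using vf.aelinD(2)[OF LDiv_aelin[of None], of "fst (snd U)" "fst (snd V)"] mem(2,4)[THEN H0div_Hdiv] by (simp add: LDiv_def r_def)
  show "test_op R \<delta> (U + V) - (test_op R \<delta> U + test_op R \<delta> V) = (0, 0, r, 0)"
    by (intro prod_eqI ext)
      (simp_all add: test_op_def reflection(2)[OF mem(1,3)] r_def vec_eq_iff algebra_simps)
qed

lemma test_op_scale:
  assumes "Usp \<Omega> U"
  shows "norm_U \<Omega> (test_op R \<delta> (scale_U a U) - scale_U a (test_op R \<delta> U)) = 0"
proof (rule norm_test_op_defect)
  have mem: "Vsp \<Omega> (fst U)" "H0div \<Omega> (fst (snd U))" using assms unfolding Usp_iff by auto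
  define r where "r x = of_real \<delta> * (wdiv \<Omega> (\<lambda>x. a *s fst (snd U) x) x - a * wdiv \<Omega> (fst (snd U)) x)" for x
  show "L2 \<Omega> r" unfolding r_def[abs_def] by (intro L2_cmult L2_diff L2_wdiv0 mem H0div_scale)
  show "AE x in lebesgue_on \<Omega>. r x = 0"
    using vf.aelinD(3)[OF LDiv_aelin[of None], of "fst (snd U)" a] mem(2)[THEN H0div_Hdiv] by (simp add: LDiv_def r_def)
  show "test_op R \<delta> (scale_U a U) - scale_U a (test_op R \<delta> U) = (0, 0, r, 0)"
    by (intro prod_eqI ext)
      (simp_all add: test_op_def scale_U_components reflection(3)[OF mem(1)] r_def vec_eq_iff algebra_simps)
qed

text \<open>The operator is triangular: the reflection is its own inverse, flux and temperature are
  divided by \<open>1 + i\<close>, and the pressure is found last. The weak divergence is taken of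
  the same function \<open>w\<close> in both directions, so the preimage is exact and not just up to
  a null set.\<close>

lemma test_op_surj:
  assumes "Usp \<Omega> V"
  shows "\<exists>U. Usp \<Omega> U \<and> test_op R \<delta> U = V"
proof -
  obtain v z q s where V: "V = (v, z, q, s)" by (rule prod_cases4)
  have mem: "Vsp \<Omega> v" "H0div \<Omega> z" "L2 \<Omega> q" "H10 \<Omega> s" using assms unfolding Usp_iff V by auto
  have n: "1 + \<i> \<noteq> 0" "1 - \<i> \<noteq> 0" by (simp_all add: complex_eq_iff)
  define w where "w = (\<lambda>x. inverse (1 + \<i>) *s z x)"
  define U where "U = (R v, w, \<lambda>x. inverse (1 - \<i>) * (q x - of_real \<delta> * wdiv \<Omega> w x), \<lambda>x. inverse (1 + \<i>) * s x)"
  have w: "H0div \<Omega> w" unfolding w_def by (rule H0div_scale[OF mem(2)])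
  have "Usp \<Omega> U" unfolding Usp_iff U_def
    using reflection(1)[OF mem(1)] w H10_scale[OF mem(4)] L2_cmult[OF L2_diff[OF mem(3) L2_cmult[OF L2_wdiv0[OF w]]]] by simp
  moreover have "(1 + \<i>) *s w x = z x" for x unfolding w_def vector_smult_assoc using n(1) by simp
  then have "test_op R \<delta> U = V" unfolding test_op_def U_def V
    using n by (simp add: reflection(4)[OF mem(1)] mult.assoc[symmetric])
  ultimately show ?thesis by blast
qed

end

text \<open>The infimum is below each of its terms, the terms being bounded below by 0. Testing the
  eigenvalue equation with the eigenvector gives \<open>0 \<le> \<kappa>\<close>, so
  \<open>1 + \<kappa>\<close> may be cleared.\<close>

lemma gamma_min_gap:
  assumes p: "\<mu> > 0" "lam > 0" "\<rho> > 0" and \<kappa>: "\<kappa> \<in> elast_eigenvalues \<Omega> \<mu> lam \<rho>"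
  shows "gamma_min \<Omega> \<mu> lam \<rho> \<omega> * (1 + \<kappa>) \<le> \<bar>\<omega>\<^sup>2 - \<kappa>\<bar>"
proof -
  obtain \<psi> where \<psi>: "Vsp \<Omega> \<psi>" "vf.qn (mf \<rho>) \<psi> \<noteq> 0" "ef \<mu> lam \<psi> \<psi> = of_real \<kappa> * mf \<rho> \<psi> \<psi>"
    using \<kappa> unfolding elast_eigenvalues_eq[OF p(3)] vf.eigvals_def by blast
  have "(vf.qn (ef \<mu> lam) \<psi>)\<^sup>2 = \<kappa> * (vf.qn (mf \<rho>) \<psi>)\<^sup>2"
    using vf.qn_sq[OF psd_ef, of \<mu> lam \<psi>] vf.qn_sq[OF psd_mf, of \<rho> \<psi>] \<psi> p by simp
  then have "0 \<le> \<kappa> * (vf.qn (mf \<rho>) \<psi>)\<^sup>2" by (metis zero_le_power2)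
  then have k0: "0 \<le> \<kappa>" using \<psi>(2) by (simp add: zero_le_mult_iff)
  have "gamma_min \<Omega> \<mu> lam \<rho> \<omega> \<le> \<bar>(\<omega>\<^sup>2 - \<kappa>) / (1 + \<kappa>)\<bar>"
    unfolding gamma_min_def by (rule cINF_lower[OF bdd_belowI2[of _ 0] \<kappa>]) simp
  also have "\<dots> = \<bar>\<omega>\<^sup>2 - \<kappa>\<bar> / (1 + \<kappa>)" using k0 by (simp add: abs_divide)
  finally show ?thesis using k0 by (simp add: pos_le_divide_eq)
qed

text \<open>The norm is a supremum over the unit ball, so a vector is rescaled to length one.
  Vectors of seminorm zero cannot be rescaled, but boundedness of \<open>F\<close> makes
  \<open>F\<close> vanish on them.\<close>

lemma cmod_antidual_le:
  assumes F: "antidual_U \<Omega> F" and V: "Usp \<Omega> V"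
  shows "cmod (F V) \<le> norm_antidual \<Omega> F * norm_U \<Omega> V" "0 \<le> norm_antidual \<Omega> F"
proof -
  obtain M where M: "\<And>U. Usp \<Omega> U \<Longrightarrow> cmod (F U) \<le> M * norm_U \<Omega> U" using F unfolding antidual_U_def by blast
  have sc: "F (scale_U c U) = cnj c * F U" if "Usp \<Omega> U" for c U using F that unfolding antidual_U_def by blast
  have nn: "0 \<le> norm_U \<Omega> U" for U unfolding norm_U_def by (simp split: prod.split)
  let ?X = "{cmod (F U) |U. Usp \<Omega> U \<and> norm_U \<Omega> U \<le> 1}"
  have bdd: "bdd_above ?X"
  proof (rule bdd_aboveI[of _ "\<bar>M\<bar>"], clarify)
    fix U assume U: "Usp \<Omega> U" "norm_U \<Omega> U \<le> 1"
    have "M * norm_U \<Omega> U \<le> \<bar>M\<bar> * 1" using U(2) nn[of U] by (intro mult_mono) auto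
    then show "cmod (F U) \<le> \<bar>M\<bar>" using M[OF U(1)] by simp
  qed
  have scV: "Usp \<Omega> (scale_U c V)" "norm_U \<Omega> (scale_U c V) = cmod c * norm_U \<Omega> V" for c
    using uf.subspace_scale[OF uf_subspace_U] uf.qn_scale[OF psd_U uf_subspace_U, of V c] V unfolding qn_U by auto
  have up: "cmod (F U) \<le> norm_antidual \<Omega> F" if "Usp \<Omega> U" "norm_U \<Omega> U \<le> 1" for U
    unfolding norm_antidual_def by (rule cSup_upper[OF _ bdd]) (use that in blast)
  have "cmod (F (scale_U 0 V)) \<le> norm_antidual \<Omega> F" by (rule up[OF scV(1)], unfold scV(2)) simp
  then show "0 \<le> norm_antidual \<Omega> F" by (meson norm_ge_zero order_trans)
  show "cmod (F V) \<le> norm_antidual \<Omega> F * norm_U \<Omega> V"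
  proof (cases "norm_U \<Omega> V = 0")
    case True
    then show ?thesis using M[OF V] by simp
  next
    case False
    then have n: "norm_U \<Omega> V > 0" using nn[of V] by simp
    have "cmod (F (scale_U (of_real (1 / norm_U \<Omega> V)) V)) \<le> norm_antidual \<Omega> F"
      by (rule up[OF scV(1)], unfold scV(2)) (use n in \<open>simp add: norm_divide\<close>)
    then show ?thesis unfolding sc[OF V] using n by (simp add: norm_mult norm_divide divide_le_eq)
  qed
qed

end

section \<open>Coercivity against the test operator and solvability\<close>

context domain
begin

lemma form_A_coercive:
  fixes \<rho> \<rho>f \<rho>w \<mu> lam \<alpha> c0 \<beta> b0 a0 \<tau> \<omega> kmax \<theta>min B C \<gamma> :: real
    and K \<Theta> :: "real^'n \<Rightarrow> real^'n^'n"
  assumes pos: "\<rho> > 0" "\<rho>f > 0" "\<mu> > 0" "lam > 0" "\<alpha> > 0" "c0 > 0" "\<beta> > 0" "b0 > 0" "\<omega> > 0" "\<theta>min > 0" "\<gamma> > 0"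
    and K: "tensor_field \<Omega> (\<lambda>x. matrix_inv (K x)) (1 / kmax) B" and Th: "tensor_field \<Omega> \<Theta> \<theta>min C"
    and R: "vf.reflects {u. Vsp \<Omega> u} (ef \<mu> lam) (mf \<rho>) (\<omega>\<^sup>2) \<gamma> R"
    and D: "0 < \<omega> * (1 / kmax - \<omega> * \<rho>w)" and tau: "\<omega> * \<tau> < 1"
    and h2: "2 * (\<omega>\<^sup>2 * \<rho>f)\<^sup>2 < \<gamma> * \<rho> * (\<omega> * (1 / kmax - \<omega> * \<rho>w))" and h4: "a0 > 2 * b0\<^sup>2 / c0"
    and h5: "16 * \<alpha>\<^sup>2 < \<gamma> * lam * c0" "8 * \<beta>\<^sup>2 < \<gamma> * lam * (a0 - 2 * b0\<^sup>2 / c0)"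
  shows "\<exists>\<delta> c. \<delta> > 0 \<and> c > 0 \<and> (\<forall>U. Usp \<Omega> U \<longrightarrow>
    c * (norm_U \<Omega> U)\<^sup>2 \<le> Re (form_A \<Omega> \<rho> \<rho>f \<rho>w \<mu> lam \<alpha> c0 \<beta> b0 a0 \<tau> \<omega> K \<Theta> U (test_op R \<delta> U)))"
proof -
  define \<theta> where "\<theta> = \<theta>min * (1 - \<omega> * \<tau>) / (\<omega> * (1 + \<omega>\<^sup>2 * \<tau>\<^sup>2))"
  define D where "D = \<omega> * (1 / kmax - \<omega> * \<rho>w)"
  define k where "k = \<omega>\<^sup>2 * \<rho>f"
  have "0 < 1 + \<omega>\<^sup>2 * \<tau>\<^sup>2" by (simp add: add_pos_nonneg)
  then have th: "\<theta> > 0" unfolding \<theta>_def using pos tau by simp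
  have k: "k > 0" unfolding k_def using pos by simp
  obtain \<delta> c where dc: "\<delta> > 0" "c > 0" and main: "\<And>E N W P T G d x. 0 \<le> x \<Longrightarrow> 0 \<le> E \<Longrightarrow> 0 \<le> N \<Longrightarrow> 0 \<le> W \<Longrightarrow> 0 \<le> P \<Longrightarrow> 0 \<le> T \<Longrightarrow> 0 \<le> d \<Longrightarrow> lam * x\<^sup>2 \<le> E \<Longrightarrow>
      c * (E + N\<^sup>2 + W\<^sup>2 + P\<^sup>2 + T\<^sup>2 + G\<^sup>2 + d\<^sup>2) \<le>
      \<gamma> * (E + \<rho> * N\<^sup>2) + D * W\<^sup>2 + c0 * P\<^sup>2 + a0 * T\<^sup>2 + \<theta> * G\<^sup>2 + \<delta> * d\<^sup>2
      - 5/2 * k * W * N - 5/2 * \<alpha> * P * x - 2 * b0 * T * P - 5/2 * \<beta> * T * x - \<delta> * d * (\<alpha> * x + c0 * P + b0 * T)"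
    by (rule coercive_quadratic_form[OF pos(11,1) D[folded D_def] pos(6,4) th pos(5,7,8) k h2[folded D_def k_def] h4 h5]) (rule that)
  have est: "c / (1 + 1 / \<mu>) * (norm_U \<Omega> U)\<^sup>2 \<le> Re (form_A \<Omega> \<rho> \<rho>f \<rho>w \<mu> lam \<alpha> c0 \<beta> b0 a0 \<tau> \<omega> K \<Theta> U (test_op R \<delta> U))"
    if U: "Usp \<Omega> U" for U
  proof -
    obtain u w p T where U_eq: "U = (u, w, p, T)" by (rule prod_cases4)
    have mem: "Vsp \<Omega> u" "H0div \<Omega> w" "L2 \<Omega> p" "H10 \<Omega> T" using U unfolding Usp_iff U_eq by simp_all
    note r = reflection[OF R pos(3,4,1) dc(1) mem(1)]
    define E where "E = (vf.qn (ef \<mu> lam) u)\<^sup>2"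
    define N where "N = vnorm_L2 \<Omega> u"
    \<comment> \<open>The energy contains \<open>lam\<close> times the squared divergence, and the
      reflection preserves the energy, so \<open>x\<close> bounds the divergence of \<open>u\<close>
      and of \<open>R u\<close> alike.\<close>
    define x where "x = sqrt (E / lam)"
    define W where "W = vnorm_L2 \<Omega> w"
    define P where "P = norm_L2 \<Omega> p"
    define t where "t = norm_L2 \<Omega> T"
    define d where "d = norm_L2 \<Omega> (wdiv \<Omega> w)"
    define G where "G = vnorm_L2 \<Omega> (wgrad \<Omega> T)"
    have E0: "0 \<le> E" unfolding E_def by simp
    have x0: "0 \<le> x" and xE: "lam * x\<^sup>2 \<le> E" unfolding x_def using E0 pos by simp_all
    have mN: "(vf.qn (mf \<rho>) v)\<^sup>2 = \<rho> * (vnorm_L2 \<Omega> v)\<^sup>2" if "Vsp \<Omega> v" for v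
      using qn_mf_sq[OF that, of \<rho>] pos(1) by (simp add: vnorm_L2_def sum_nonneg)
    have "(vnorm_L2 \<Omega> (R u))\<^sup>2 = N\<^sup>2"
      using mN[OF mem(1)] mN[OF r(1)] r(6) pos(1) unfolding N_def by simp
    then have RN: "vnorm_L2 \<Omega> (R u) \<le> N" unfolding N_def
      using power2_eq_iff_nonneg[OF vnorm_L2_nonneg vnorm_L2_nonneg] by (metis order_refl)
    have dx: "norm_L2 \<Omega> (divV \<Omega> v) \<le> x" if v: "Vsp \<Omega> v" "(vf.qn (ef \<mu> lam) v)\<^sup>2 = E" for v
    proof -
      have "lam * (norm_L2 \<Omega> (divV \<Omega> v))\<^sup>2 \<le> E"
        using qn_ef_sq[OF v(1), of \<mu> lam] v(2) pos by (simp add: sum_nonneg)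
      then show ?thesis unfolding x_def using pos by (intro real_le_rsqrt) (simp add: pos_le_divide_eq mult.commute)
    qed
    have div_le: "norm_L2 \<Omega> (divV \<Omega> u) \<le> x" "norm_L2 \<Omega> (divV \<Omega> (R u)) \<le> x"
      using dx[OF mem(1)] dx[OF r(1)] r(5) unfolding E_def by simp_all
    have nn: "0 \<le> N" "0 \<le> W" "0 \<le> P" "0 \<le> t" "0 \<le> d"
      unfolding N_def W_def P_def t_def d_def by (simp_all add: vnorm_L2_nonneg norm_L2_nonneg)
    have tU: "test_op R \<delta> U = (R u, \<lambda>x. (1 + \<i>) *s w x, \<lambda>x. (1 - \<i>) * p x + of_real \<delta> * wdiv \<Omega> w x, \<lambda>x. (1 + \<i>) * T x)"
      unfolding test_op_def U_eq fst_conv snd_conv ..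
    have "\<gamma> * (E + \<rho> * N\<^sup>2) \<le> Re (ef \<mu> lam u (R u)) - \<omega>\<^sup>2 * Re (mf \<rho> u (R u))"
      using r(7) mN[OF mem(1)] unfolding E_def N_def by simp
    moreover note Re_form_A_test[OF mem r(1) K Th pos(2,5,6,7,8,9) tau dc(1) _ RN div_le, of \<mu> lam \<rho> \<rho>w a0,
        folded N_def W_def P_def t_def d_def G_def, folded \<theta>_def D_def k_def, folded tU U_eq, OF order_refl]
    moreover note main[OF x0 E0 nn xE, of G]
    ultimately have le: "c * (E + N\<^sup>2 + W\<^sup>2 + P\<^sup>2 + t\<^sup>2 + G\<^sup>2 + d\<^sup>2)
        \<le> Re (form_A \<Omega> \<rho> \<rho>f \<rho>w \<mu> lam \<alpha> c0 \<beta> b0 a0 \<tau> \<omega> K \<Theta> U (test_op R \<delta> U))" by linarith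
    \<comment> \<open>The seven quantities control the product norm; the Korn inequality contributes
      the only loss, the factor \<open>1 + 1 / \<mu>\<close>.\<close>
    have "(norm_V \<Omega> u)\<^sup>2 \<le> N\<^sup>2 + E / \<mu>"
      using norm_V_sq_le[OF mem(1) pos(3), of lam] pos(4) unfolding N_def E_def vnorm_L2_def by (simp add: sum_nonneg)
    moreover have "(norm_Hdiv \<Omega> w)\<^sup>2 = W\<^sup>2 + d\<^sup>2" unfolding norm_Hdiv_def W_def d_def by simp
    moreover have "(norm_H1 \<Omega> T)\<^sup>2 = t\<^sup>2 + G\<^sup>2" unfolding norm_H1_def t_def G_def vnorm_L2_def by (simp add: sum_nonneg)
    moreover have "(norm_U \<Omega> U)\<^sup>2 = (norm_V \<Omega> u)\<^sup>2 + (norm_Hdiv \<Omega> w)\<^sup>2 + P\<^sup>2 + (norm_H1 \<Omega> T)\<^sup>2"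
      unfolding norm_U_def U_eq P_def by simp
    moreover have "0 \<le> (N\<^sup>2 + W\<^sup>2 + P\<^sup>2 + t\<^sup>2 + G\<^sup>2 + d\<^sup>2) / \<mu>" using pos(3) by simp
    moreover have "(1 + 1 / \<mu>) * (E + N\<^sup>2 + W\<^sup>2 + P\<^sup>2 + t\<^sup>2 + G\<^sup>2 + d\<^sup>2)
        = E + N\<^sup>2 + W\<^sup>2 + P\<^sup>2 + t\<^sup>2 + G\<^sup>2 + d\<^sup>2 + E / \<mu> + (N\<^sup>2 + W\<^sup>2 + P\<^sup>2 + t\<^sup>2 + G\<^sup>2 + d\<^sup>2) / \<mu>"
      by (simp add: distrib_right add_divide_distrib)
    ultimately have "(norm_U \<Omega> U)\<^sup>2 \<le> (1 + 1 / \<mu>) * (E + N\<^sup>2 + W\<^sup>2 + P\<^sup>2 + t\<^sup>2 + G\<^sup>2 + d\<^sup>2)" using E0 by linarith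
    then have "c * (norm_U \<Omega> U)\<^sup>2 \<le> c * ((1 + 1 / \<mu>) * (E + N\<^sup>2 + W\<^sup>2 + P\<^sup>2 + t\<^sup>2 + G\<^sup>2 + d\<^sup>2))"
      using dc(2) by (intro mult_left_mono) simp_all
    also have "\<dots> = (1 + 1 / \<mu>) * (c * (E + N\<^sup>2 + W\<^sup>2 + P\<^sup>2 + t\<^sup>2 + G\<^sup>2 + d\<^sup>2))" by (rule mult.left_commute)
    finally have "c / (1 + 1 / \<mu>) * (norm_U \<Omega> U)\<^sup>2 \<le> c * (E + N\<^sup>2 + W\<^sup>2 + P\<^sup>2 + t\<^sup>2 + G\<^sup>2 + d\<^sup>2)"
      using pos_divide_le_eq[of "1 + 1 / \<mu>"] pos(3) by (simp add: add_pos_pos mult.commute)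
    then show ?thesis using le by (rule order_trans)
  qed
  have "c / (1 + 1 / \<mu>) > 0" using dc(2) pos(3) by (simp add: add_pos_pos)
  with est dc(1) show ?thesis by blast
qed

end

text \<open>Elements are functions, not classes modulo null sets, which is why uniqueness is
  expressed by the norm of a difference. The stability constant is chosen before the functional and
  the solution.\<close>

theorem mainTheorem5:
  fixes \<Omega> :: "(real^'n::finite) set"
    and \<rho> \<rho>f \<rho>w \<mu> lam \<alpha> c0 \<beta> b0 a0 \<tau> \<omega> kmin kmax \<theta>min \<theta>max :: real
    and K \<Theta> :: "real^'n \<Rightarrow> real^'n^'n"
  assumes dom: "lipschitz_domain \<Omega>"
    and pos: "\<rho> > 0" "\<rho>f > 0" "\<rho>w > 0" "\<mu> > 0" "lam > 0" "\<alpha> > 0" "c0 > 0"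
             "\<beta> > 0" "b0 > 0" "a0 > 0" "\<tau> \<ge> 0" "\<omega> > 0"
    and K: "sym_tensor_field \<Omega> K kmin kmax" "kmin > 0" "kmax > 0"
    and Th: "sym_tensor_field \<Omega> \<Theta> \<theta>min \<theta>max" "\<theta>min > 0" "\<theta>max > 0"
    and nonres: "\<omega>\<^sup>2 \<notin> elast_eigenvalues \<Omega> \<mu> lam \<rho>"
    and crit: "\<omega> < 1 / (\<rho>w * kmax)"
    and h1: "lam > \<alpha>\<^sup>2 / c0 * max (1/2) (8 / gamma_min \<Omega> \<mu> lam \<rho> \<omega>)"
    and h2: "gamma_min \<Omega> \<mu> lam \<rho> \<omega> - 2 * \<omega>^3 * \<rho>f\<^sup>2 / (\<rho> * (1 / kmax - \<omega> * \<rho>w)) > 0"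
    and h3: "\<tau> < 1 / \<omega>"
    and h4: "a0 > 2 * b0\<^sup>2 / c0"
    and h5: "lam > 8 / gamma_min \<Omega> \<mu> lam \<rho> \<omega> * max (2 * \<alpha>\<^sup>2 / c0) (\<beta>\<^sup>2 / (a0 - 2 * b0\<^sup>2 / c0))"
  shows "(\<forall>F. antidual_U \<Omega> F \<longrightarrow>
            (\<exists>U. Usp \<Omega> U \<and> (\<forall>V. Usp \<Omega> V \<longrightarrow>
                   form_A \<Omega> \<rho> \<rho>f \<rho>w \<mu> lam \<alpha> c0 \<beta> b0 a0 \<tau> \<omega> K \<Theta> U V = F V)) \<and>
            (\<forall>U U'. Usp \<Omega> U \<longrightarrow> Usp \<Omega> U' \<longrightarrow>
                (\<forall>V. Usp \<Omega> V \<longrightarrow> form_A \<Omega> \<rho> \<rho>f \<rho>w \<mu> lam \<alpha> c0 \<beta> b0 a0 \<tau> \<omega> K \<Theta> U V = F V) \<longrightarrow>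
                (\<forall>V. Usp \<Omega> V \<longrightarrow> form_A \<Omega> \<rho> \<rho>f \<rho>w \<mu> lam \<alpha> c0 \<beta> b0 a0 \<tau> \<omega> K \<Theta> U' V = F V) \<longrightarrow>
                norm_U \<Omega> (diff_U U U') = 0))
       \<and> (\<exists>C>0. \<forall>F U. antidual_U \<Omega> F \<longrightarrow> Usp \<Omega> U \<longrightarrow>
            (\<forall>V. Usp \<Omega> V \<longrightarrow> form_A \<Omega> \<rho> \<rho>f \<rho>w \<mu> lam \<alpha> c0 \<beta> b0 a0 \<tau> \<omega> K \<Theta> U V = F V) \<longrightarrow>
            norm_U \<Omega> U \<le> C * norm_antidual \<Omega> F)"
proof -
  let ?A = "form_A \<Omega> \<rho> \<rho>f \<rho>w \<mu> lam \<alpha> c0 \<beta> b0 a0 \<tau> \<omega> K \<Theta>"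
  let ?S = "{U. Usp \<Omega> U}"
  interpret domain \<Omega> using dom unfolding lipschitz_domain_def by unfold_locales auto
  let ?f = "uf.coord_ip \<Omega> UNIV LU"
  define \<gamma> where "\<gamma> = gamma_min \<Omega> \<mu> lam \<rho> \<omega>"
  define D where "D = 1 / kmax - \<omega> * \<rho>w"
  \<comment> \<open>The critical frequency is the point where the rotated flux form would lose its
    positive lower bound.\<close>
  have "\<omega> * \<rho>w < 1 / kmax" using crit pos K(3) by (simp add: field_simps)
  then have D: "D > 0" unfolding D_def by simp
  have h2': "2 * \<omega>^3 * \<rho>f\<^sup>2 / (\<rho> * D) < \<gamma>" using h2 unfolding \<gamma>_def D_def by simp
  moreover have "0 \<le> 2 * \<omega>^3 * \<rho>f\<^sup>2 / (\<rho> * D)" using pos D by simp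
  ultimately have \<gamma>: "\<gamma> > 0" by linarith
  have "2 * \<omega>^3 * \<rho>f\<^sup>2 < \<gamma> * (\<rho> * D)" using h2' pos D by (simp add: pos_divide_less_eq)
  then have "\<omega> * (2 * \<omega>^3 * \<rho>f\<^sup>2) < \<omega> * (\<gamma> * (\<rho> * D))" using pos by simp
  \<comment> \<open>The assumption \<open>h2\<close> multiplied by \<open>\<omega>\<close>: with
    coupling constant \<open>\<omega>\<^sup>2 * \<rho>f\<close> and flux coefficient
    \<open>\<omega> * D\<close>, it is the discriminant condition of the quadratic form.\<close>
  then have g2: "2 * (\<omega>\<^sup>2 * \<rho>f)\<^sup>2 < \<gamma> * \<rho> * (\<omega> * D)" by (simp add: power2_eq_square power3_eq_cube mult_ac)
  define a' where "a' = a0 - 2 * b0\<^sup>2 / c0"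
  have a': "a' > 0" unfolding a'_def using h4 by simp
  have h5': "8 / \<gamma> * max (2 * \<alpha>\<^sup>2 / c0) (\<beta>\<^sup>2 / a') < lam" using h5 unfolding \<gamma>_def a'_def .
  have m: "8 / \<gamma> * y < lam" if "y \<le> max (2 * \<alpha>\<^sup>2 / c0) (\<beta>\<^sup>2 / a')" for y
    using mult_left_mono[OF that, of "8 / \<gamma>"] \<gamma> h5' by simp
  \<comment> \<open>The two entries of the maximum in \<open>h5\<close> give the two absorption
    conditions, one for the pressure and one for the temperature.\<close>
  have g5: "16 * \<alpha>\<^sup>2 < \<gamma> * lam * c0" using m[of "2 * \<alpha>\<^sup>2 / c0"] \<gamma> pos by (simp add: field_simps)
  have g5': "8 * \<beta>\<^sup>2 < \<gamma> * lam * a'" using m[of "\<beta>\<^sup>2 / a'"] \<gamma> a' by (simp add: field_simps)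
  have tau: "\<omega> * \<tau> < 1" using h3 pos by (simp add: field_simps)
  have Ki: "tensor_field \<Omega> (\<lambda>x. matrix_inv (K x)) (1 / kmax) (1 / kmin)" by (rule tensor_field_inv[OF K sets_dom])
  have Tf: "tensor_field \<Omega> \<Theta> \<theta>min \<theta>max" by (rule tensor_field_sym[OF Th])
  obtain R where R: "vf.reflects {u. Vsp \<Omega> u} (ef \<mu> lam) (mf \<rho>) (\<omega>\<^sup>2) \<gamma> R"
    using elastic_reflection[OF pos(4,5,1) \<gamma>, of "\<omega>\<^sup>2"] gamma_min_gap[OF pos(4,5,1), of _ \<omega>] unfolding \<gamma>_def by auto
  obtain \<delta> c where dc: "\<delta> > 0" "c > 0" and co: "\<And>U. Usp \<Omega> U \<Longrightarrow> c * (norm_U \<Omega> U)\<^sup>2 \<le> Re (?A U (test_op R \<delta> U))"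
    using form_A_coercive[OF pos(1,2,4,5,6,7,8,9,12) Th(2) \<gamma> Ki Tf R _ tau _ h4 g5 g5'[unfolded a'_def], of \<rho>w] pos(12) D g2
    unfolding D_def by auto
  note t_op = test_op_mem[OF R pos(4,5,1) dc(1)] test_op_add[OF R pos(4,5,1) dc(1)] test_op_scale[OF R pos(4,5,1) dc(1)]
    test_op_surj[OF R pos(4,5,1) dc(1)]
  obtain L where L: "L > 0" "\<And>U. Usp \<Omega> U \<Longrightarrow> norm_U \<Omega> (test_op R \<delta> U) \<le> L * norm_U \<Omega> U"
    using test_op_bounded[OF R pos(4,5,1) dc(1)] by blast
  have "uf.bform ?S ?f ?A" by (rule bform_A[OF Ki _ Tf]) (use K Th in simp_all)
  then obtain M where sA: "uf.sesq ?S ?A" and M: "M \<ge> 0" "\<And>U V. Usp \<Omega> U \<Longrightarrow> Usp \<Omega> V \<Longrightarrow> cmod (?A U V) \<le> M * norm_U \<Omega> U * norm_U \<Omega> V"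
    unfolding uf.bform_def uf.fbounded_def qn_U by blast
  have nn: "0 \<le> norm_U \<Omega> U" for U unfolding norm_U_def by (simp split: prod.split)
  have ex: "\<exists>U. Usp \<Omega> U \<and> (\<forall>V. Usp \<Omega> V \<longrightarrow> ?A U V = F V)" if F: "antidual_U \<Omega> F" for F
  proof -
    have al: "uf.antilinear ?S F" using F unfolding uf.antilinear_def antidual_U_def add_U_eq by simp
    have "\<exists>U\<in>?S. \<forall>V\<in>?S. ?A U V = F V"
    proof (rule uf.T_coercive_solvable[where T = "test_op R \<delta>" and K = L and M = M and c = c and L = "norm_antidual \<Omega> F",
          OF psd_U uf_subspace_U qcomplete_U sA _ M(1) _ _ _ _ _ _ dc(2) al])
    qed (unfold qn_U mem_Collect_eq, (use M(2) t_op L(2) co cmod_antidual_le(1)[OF F] in \<open>blast\<close>)+)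
    then show ?thesis by blast
  qed
  \<comment> \<open>The difference of two solutions is annihilated by every test vector, in
    particular by its own image under the test operator, where the form is coercive.\<close>
  have uniq: "norm_U \<Omega> (diff_U U U') = 0" if mem: "Usp \<Omega> U" "Usp \<Omega> U'"
    and eq: "\<And>V. Usp \<Omega> V \<Longrightarrow> ?A U V = F V" "\<And>V. Usp \<Omega> V \<Longrightarrow> ?A U' V = F V" for F U U'
  proof -
    have d: "Usp \<Omega> (U - U')" using uf.subspace_diff[OF uf_subspace_U] mem by blast
    have t: "Usp \<Omega> (test_op R \<delta> (U - U'))" by (rule t_op(1)[OF d])
    have "?A (U - U') (test_op R \<delta> (U - U')) = 0"
      using uf.sesq_diff(1)[OF sA uf_subspace_U, of U U' "test_op R \<delta> (U - U')"] mem t eq by simp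
    then have "c * (norm_U \<Omega> (U - U'))\<^sup>2 \<le> 0" using co[OF d] by simp
    then show ?thesis unfolding diff_U_eq using dc(2) by (simp add: mult_le_0_iff)
  qed
  \<comment> \<open>Testing with the image of the solution and dividing by its norm gives the
    constant: bound of the test operator over coercivity constant.\<close>
  have bound: "norm_U \<Omega> U \<le> L / c * norm_antidual \<Omega> F" if F: "antidual_U \<Omega> F" and U: "Usp \<Omega> U"
    and eq: "\<And>V. Usp \<Omega> V \<Longrightarrow> ?A U V = F V" for F U
  proof (cases "norm_U \<Omega> U = 0")
    case True
    then show ?thesis using cmod_antidual_le(2)[OF F U] L(1) dc(2) by simp
  next
    case False
    then have n: "norm_U \<Omega> U > 0" using nn[of U] by simp
    have t: "Usp \<Omega> (test_op R \<delta> U)" by (rule t_op(1)[OF U])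
    have "c * (norm_U \<Omega> U)\<^sup>2 \<le> cmod (F (test_op R \<delta> U))"
      using co[OF U] complex_Re_le_cmod[of "F (test_op R \<delta> U)"] eq[OF t] by simp
    also have "\<dots> \<le> norm_antidual \<Omega> F * norm_U \<Omega> (test_op R \<delta> U)" by (rule cmod_antidual_le(1)[OF F t])
    also have "\<dots> \<le> norm_antidual \<Omega> F * (L * norm_U \<Omega> U)" by (rule mult_left_mono[OF L(2)[OF U] cmod_antidual_le(2)[OF F U]])
    finally have "(c * norm_U \<Omega> U) * norm_U \<Omega> U \<le> (L * norm_antidual \<Omega> F) * norm_U \<Omega> U" by (simp add: power2_eq_square mult_ac)
    then have "c * norm_U \<Omega> U \<le> L * norm_antidual \<Omega> F" using n by (rule mult_right_le_imp_le)
    then show ?thesis using dc(2) by (simp add: field_simps)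
  qed
  have "L / c > 0" using L(1) dc(2) by simp
  with ex uniq bound show ?thesis by blast
qed

end
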